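(* Let $G$ be an amenable discrete group and let $G$ act on a discrete group $H$ by automorphisms. Then $H\rtimes G$ has FD if and only if $G$ is RF and every element of $\widehat H$ can be approximated in the Fell topology by (elements of $\widehat H$ given by) representations with finite images whose orbits are finite.
   Context: $\widehat H$ is the set of unitary equivalence classes of irreducible unitary representations of $H$ with the Fell topology. A group has property FD (Lubotzky–Shalom) if the irreducible unitary representations with finite image are dense in its unitary dual. A group is RF (residually finite) if its homomorphisms to finite groups separate its points. The action $\alpha$ of $G$ on $H$ induces the action of $G$ on $\widehat H$ given by $(g\cdot\rho)(h)=\rho(\alpha_{g^{-1}}(h))$, and orbits are taken with respect to this action. *)

theory Defs
  imports
    "HOL-Analysis.Analysis"
    "HOL-Algebra.Bij"
    "HOL-Algebra.Module"
    "HOL-Algebra.Group_Action"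
begin

section \<open>Complex Hilbert spaces\<close>

text \<open>Hilbert spaces are records with an explicit carrier set, so that subspaces, and spaces of
  every dimension, can be quantified over. The multiplication and unit that a module record
  inherits from rings play no role.\<close>

definition complex_ring :: "complex ring"
  where "complex_ring = \<lparr>carrier = UNIV, mult = (*), one = 1, zero = 0, add = (+)\<rparr>"

record 'v inner_space = "(complex, 'v) module" +
  ip :: "'v \<Rightarrow> 'v \<Rightarrow> complex"

text \<open>The library requires a metric to be symmetric and nonnegative on the whole type, so the norm
  distance is extended by 0 outside the carrier.\<close>

definition ip_dist :: "'v inner_space \<Rightarrow> 'v \<Rightarrow> 'v \<Rightarrow> real"
  where "ip_dist V v w = (if v \<in> carrier V \<and> w \<in> carrier V
    then sqrt (Re (ip V (v \<ominus>\<^bsub>V\<^esub> w) (v \<ominus>\<^bsub>V\<^esub> w))) else 0)"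

locale hilbert_space = module complex_ring V for V :: "'v inner_space" +
  assumes ip_cnj: "\<lbrakk>v \<in> carrier V; w \<in> carrier V\<rbrakk> \<Longrightarrow> ip V v w = cnj (ip V w v)"
    and ip_add: "\<lbrakk>u \<in> carrier V; v \<in> carrier V; w \<in> carrier V\<rbrakk>
      \<Longrightarrow> ip V (u \<oplus>\<^bsub>V\<^esub> v) w = ip V u w + ip V v w"
    and ip_smult: "\<lbrakk>v \<in> carrier V; w \<in> carrier V\<rbrakk> \<Longrightarrow> ip V (a \<odot>\<^bsub>V\<^esub> v) w = a * ip V v w"
    and ip_nonneg: "v \<in> carrier V \<Longrightarrow> 0 \<le> Re (ip V v v)"
    and ip_definite: "\<lbrakk>v \<in> carrier V; ip V v v = 0\<rbrakk> \<Longrightarrow> v = \<zero>\<^bsub>V\<^esub>"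
    and complete: "Metric_space.mcomplete (carrier V) (ip_dist V)"

definition closed_subspace :: "'v set \<Rightarrow> 'v inner_space \<Rightarrow> bool"
  where "closed_subspace W V \<longleftrightarrow>
    submodule W complex_ring V \<and> closedin (Metric_space.mtopology (carrier V) (ip_dist V)) W"

definition unitary_maps :: "'v inner_space \<Rightarrow> 'w inner_space \<Rightarrow> ('v \<Rightarrow> 'w) set"
  where "unitary_maps V W = {U. bij_betw U (carrier V) (carrier W) \<and>
    (\<forall>v\<in>carrier V. \<forall>w\<in>carrier V. U (v \<oplus>\<^bsub>V\<^esub> w) = U v \<oplus>\<^bsub>W\<^esub> U w) \<and>
    (\<forall>a. \<forall>v\<in>carrier V. U (a \<odot>\<^bsub>V\<^esub> v) = a \<odot>\<^bsub>W\<^esub> U v) \<and>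
    (\<forall>v\<in>carrier V. \<forall>w\<in>carrier V. ip W (U v) (U w) = ip V v w)}"

text \<open>As in \<^const>\<open>BijGroup\<close>, the elements are extensional, so distinct functions are distinct
  operators; this matters for counting the image of a representation.\<close>

definition unitary_group :: "'v inner_space \<Rightarrow> ('v \<Rightarrow> 'v) monoid"
  where "unitary_group V =
    BijGroup (carrier V) \<lparr>carrier := unitary_maps V V \<inter> Bij (carrier V)\<rparr>"


section \<open>Unitary representations of discrete groups\<close>

type_synonym ('a, 'v) rep = "'v inner_space \<times> ('a \<Rightarrow> 'v \<Rightarrow> 'v)"

definition unitary_rep :: "('a, 'b) monoid_scheme \<Rightarrow> ('a, 'v) rep \<Rightarrow> bool"
  where "unitary_rep G = (\<lambda>(V, \<pi>). hilbert_space V \<and> \<pi> \<in> hom G (unitary_group V))"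

definition irreducible_rep :: "('a, 'b) monoid_scheme \<Rightarrow> ('a, 'v) rep \<Rightarrow> bool"
  where "irreducible_rep G = (\<lambda>(V, \<pi>). unitary_rep G (V, \<pi>) \<and> carrier V \<noteq> {\<zero>\<^bsub>V\<^esub>} \<and>
    (\<forall>W. closed_subspace W V \<and> (\<forall>g\<in>carrier G. \<pi> g ` W \<subseteq> W) \<longrightarrow>
      W = {\<zero>\<^bsub>V\<^esub>} \<or> W = carrier V))"

definition unitarily_equivalent ::
    "('a, 'b) monoid_scheme \<Rightarrow> ('a, 'v) rep \<Rightarrow> ('a, 'w) rep \<Rightarrow> bool"
  where "unitarily_equivalent G = (\<lambda>(V, \<pi>) (W, \<sigma>).
    \<exists>U\<in>unitary_maps V W. \<forall>g\<in>carrier G. \<forall>v\<in>carrier V. U (\<pi> g v) = \<sigma> g (U v))"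

definition finite_image :: "('a, 'b) monoid_scheme \<Rightarrow> ('a, 'v) rep \<Rightarrow> bool"
  where "finite_image G = (\<lambda>(V, \<pi>). finite (\<pi> ` carrier G))"


section \<open>The unitary dual\<close>

text \<open>The equivalence classes have to be formed inside one type of vectors. The type
  \<^typ>\<open>'a \<Rightarrow> complex\<close> is large enough for every irreducible representation of a group with
  elements of type \<^typ>\<open>'a\<close>: a nonzero vector \<open>\<xi>\<close> is cyclic, so mapping \<open>v\<close> to the function
  \<open>g \<mapsto> \<langle>v, \<pi>(g)\<xi>\<rangle>\<close> is injective (see \<open>irreducible_rep_universe\<close> below).\<close>

definition irreps :: "('a, 'b) monoid_scheme \<Rightarrow> ('a, 'a \<Rightarrow> complex) rep set"
  where "irreps G = {\<rho>. irreducible_rep G \<rho>}"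

definition equiv_rel ::
    "('a, 'b) monoid_scheme \<Rightarrow> (('a, 'a \<Rightarrow> complex) rep \<times> ('a, 'a \<Rightarrow> complex) rep) set"
  where "equiv_rel G = {(\<rho>, \<sigma>). \<rho> \<in> irreps G \<and> \<sigma> \<in> irreps G \<and> unitarily_equivalent G \<rho> \<sigma>}"

definition rep_class ::
    "('a, 'b) monoid_scheme \<Rightarrow> ('a, 'a \<Rightarrow> complex) rep \<Rightarrow> ('a, 'a \<Rightarrow> complex) rep set"
  where "rep_class G \<rho> = equiv_rel G `` {\<rho>}"

definition unitary_dual :: "('a, 'b) monoid_scheme \<Rightarrow> ('a, 'a \<Rightarrow> complex) rep set set"
  where "unitary_dual G = irreps G // equiv_rel G"

text \<open>The basic neighbourhood of \<open>(V, \<pi>)\<close> given by the functions of positive type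
  \<open>g \<mapsto> \<langle>\<pi>(g)v, v\<rangle>\<close> for \<open>v\<close> in a finite set \<open>F\<close>, a finite (i.e. compact) subset \<open>Q\<close> of the group
  and \<open>\<epsilon> > 0\<close>: each of them is approximated on \<open>Q\<close> by a finite sum of functions of positive type
  associated with \<open>\<sigma>\<close>. See Bekka, de la Harpe and Valette, Kazhdan's Property (T), Appendix F.2.\<close>

definition fell_nbhd :: "('a, 'b) monoid_scheme \<Rightarrow> ('a, 'a \<Rightarrow> complex) rep \<Rightarrow>
    ('a \<Rightarrow> complex) set \<Rightarrow> 'a set \<Rightarrow> real \<Rightarrow> ('a, 'a \<Rightarrow> complex) rep set set"
  where "fell_nbhd G = (\<lambda>(V, \<pi>) F Q \<epsilon>. {rep_class G (W, \<sigma>) | W \<sigma>. (W, \<sigma>) \<in> irreps G \<and>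
    (\<forall>v\<in>F. \<exists>ws. set ws \<subseteq> carrier W \<and>
      (\<forall>x\<in>Q. cmod (ip V (\<pi> x v) v - (\<Sum>w\<leftarrow>ws. ip W (\<sigma> x w) w)) < \<epsilon>))})"

definition fell_topology ::
    "('a, 'b) monoid_scheme \<Rightarrow> ('a, 'a \<Rightarrow> complex) rep set topology"
  where "fell_topology G = topology_generated_by
    {fell_nbhd G (V, \<pi>) F Q \<epsilon> | V \<pi> F Q \<epsilon>. (V, \<pi>) \<in> irreps G \<and>
      finite F \<and> F \<subseteq> carrier V \<and> finite Q \<and> Q \<subseteq> carrier G \<and> 0 < \<epsilon>}"

definition finite_image_dual :: "('a, 'b) monoid_scheme \<Rightarrow> ('a, 'a \<Rightarrow> complex) rep set set"
  where "finite_image_dual G = {rep_class G \<rho> | \<rho>. \<rho> \<in> irreps G \<and> finite_image G \<rho>}"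

definition property_FD :: "('a, 'b) monoid_scheme \<Rightarrow> bool"
  where "property_FD G \<longleftrightarrow> fell_topology G closure_of finite_image_dual G = unitary_dual G"


section \<open>Residual finiteness and amenability\<close>

text \<open>Every finite group is isomorphic to one whose elements are natural numbers.\<close>

definition residually_finite :: "('a, 'b) monoid_scheme \<Rightarrow> bool"
  where "residually_finite G \<longleftrightarrow> (\<forall>x\<in>carrier G. \<forall>y\<in>carrier G. x \<noteq> y \<longrightarrow>
    (\<exists>(K :: nat monoid) f. group K \<and> finite (carrier K) \<and> f \<in> hom G K \<and> f x \<noteq> f y))"

definition bounded_functions :: "('a, 'b) monoid_scheme \<Rightarrow> ('a \<Rightarrow> real) set"
  where "bounded_functions G = {f. bounded (f ` carrier G)}"

text \<open>Existence of a left-invariant mean on the bounded functions. Positivity and linearity force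
  \<open>m f\<close> to depend only on the values of \<open>f\<close> on the group.\<close>

definition amenable :: "('a, 'b) monoid_scheme \<Rightarrow> bool"
  where "amenable G \<longleftrightarrow> (\<exists>m :: ('a \<Rightarrow> real) \<Rightarrow> real.
    (\<forall>f\<in>bounded_functions G. \<forall>h\<in>bounded_functions G. m (\<lambda>x. f x + h x) = m f + m h) \<and>
    (\<forall>c. \<forall>f\<in>bounded_functions G. m (\<lambda>x. c * f x) = c * m f) \<and>
    (\<forall>f\<in>bounded_functions G. (\<forall>x\<in>carrier G. 0 \<le> f x) \<longrightarrow> 0 \<le> m f) \<and>
    m (\<lambda>x. 1) = 1 \<and>
    (\<forall>g\<in>carrier G. \<forall>f\<in>bounded_functions G. m (\<lambda>x. f (inv\<^bsub>G\<^esub> g \<otimes>\<^bsub>G\<^esub> x)) = m f))"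


section \<open>Actions by automorphisms\<close>

text \<open>An action of \<open>G\<close> on \<open>H\<close> by automorphisms is a homomorphism
  \<open>\<alpha> \<in> hom G (AutoGroup H)\<close>.\<close>

definition semidirect_product ::
    "('h, 'b) monoid_scheme \<Rightarrow> ('g, 'c) monoid_scheme \<Rightarrow> ('g \<Rightarrow> 'h \<Rightarrow> 'h) \<Rightarrow> ('h \<times> 'g) monoid"
  where "semidirect_product H G \<alpha> =
    \<lparr>carrier = carrier H \<times> carrier G,
     mult = (\<lambda>(h, g) (h', g'). (h \<otimes>\<^bsub>H\<^esub> \<alpha> g h', g \<otimes>\<^bsub>G\<^esub> g')),
     one = (\<one>\<^bsub>H\<^esub>, \<one>\<^bsub>G\<^esub>)\<rparr>"

definition rep_action ::
    "('g, 'c) monoid_scheme \<Rightarrow> ('g \<Rightarrow> 'h \<Rightarrow> 'h) \<Rightarrow> 'g \<Rightarrow> ('h, 'v) rep \<Rightarrow> ('h, 'v) rep"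
  where "rep_action G \<alpha> g = (\<lambda>(V, \<pi>). (V, \<lambda>h. \<pi> (\<alpha> (inv\<^bsub>G\<^esub> g) h)))"

definition dual_action :: "('g, 'c) monoid_scheme \<Rightarrow> ('h, 'b) monoid_scheme \<Rightarrow>
    ('g \<Rightarrow> 'h \<Rightarrow> 'h) \<Rightarrow> 'g \<Rightarrow> ('h, 'h \<Rightarrow> complex) rep set \<Rightarrow> ('h, 'h \<Rightarrow> complex) rep set"
  where "dual_action G H \<alpha> g c = (\<Union>\<rho>\<in>c. rep_class H (rep_action G \<alpha> g \<rho>))"


section \<open>Adequacy of the universe of vectors\<close>

text \<open>An irreducible representation on vectors of an arbitrary type is unitarily equivalent to one
  in \<^term>\<open>irreps G\<close>.\<close>

lemma complex_ring_simps [simp]: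
  "carrier complex_ring = UNIV" "a \<otimes>\<^bsub>complex_ring\<^esub> b = a * b" "a \<oplus>\<^bsub>complex_ring\<^esub> b = a + b"
  "\<one>\<^bsub>complex_ring\<^esub> = 1" "\<zero>\<^bsub>complex_ring\<^esub> = 0"
  by (simp_all add: complex_ring_def)

lemma cring_complex_ring: "cring complex_ring"
proof (rule cringI)
  show "abelian_group complex_ring"
    by (rule abelian_groupI) (auto intro: exI[of _ "- x" for x])
  show "comm_monoid complex_ring"
    by (rule comm_monoidI) auto
qed (auto simp: algebra_simps)

context hilbert_space
begin

lemma cr: "x \<in> carrier V \<Longrightarrow> a \<odot>\<^bsub>V\<^esub> x \<in> carrier V"
  using smult_closed[of a x] by simp

lemma ip_add2: "\<lbrakk>u \<in> carrier V; v \<in> carrier V; w \<in> carrier V\<rbrakk>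
      \<Longrightarrow> ip V w (u \<oplus>\<^bsub>V\<^esub> v) = ip V w u + ip V w v"
  by (subst (1 2 3) ip_cnj) (auto simp: ip_add)

lemma ip_smult2: "\<lbrakk>v \<in> carrier V; w \<in> carrier V\<rbrakk> \<Longrightarrow> ip V w (a \<odot>\<^bsub>V\<^esub> v) = cnj a * ip V w v"
  by (subst (1 2) ip_cnj) (auto simp: ip_smult cr)

lemma a_minus_smult: "\<lbrakk>v \<in> carrier V; w \<in> carrier V\<rbrakk> \<Longrightarrow> v \<ominus>\<^bsub>V\<^esub> w = v \<oplus>\<^bsub>V\<^esub> ((-1) \<odot>\<^bsub>V\<^esub> w)"
proof -
  assume vw: "v \<in> carrier V" "w \<in> carrier V"
  have e: "\<ominus>\<^bsub>complex_ring\<^esub> 1 = - 1"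
    using R.minus_equality[of "-1" 1] by simp
  show ?thesis
    using smult_l_minus[of 1 w] vw smult_one[of w] e by (simp add: a_minus_def)
qed

lemma ip_zero: "v \<in> carrier V \<Longrightarrow> ip V \<zero>\<^bsub>V\<^esub> v = 0" "v \<in> carrier V \<Longrightarrow> ip V v \<zero>\<^bsub>V\<^esub> = 0"
  using ip_add[of "\<zero>\<^bsub>V\<^esub>" "\<zero>\<^bsub>V\<^esub>" v] ip_add2[of "\<zero>\<^bsub>V\<^esub>" "\<zero>\<^bsub>V\<^esub>" v] by auto

lemma ip_real: "v \<in> carrier V \<Longrightarrow> ip V v v = of_real (Re (ip V v v))"
  using ip_cnj[of v v] by (metis Reals_cnj_iff of_real_Re)

lemma cauchy_schwarz:
  assumes v: "v \<in> carrier V" and w: "w \<in> carrier V"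
  shows "(cmod (ip V v w))\<^sup>2 \<le> Re (ip V v v) * Re (ip V w w)"
proof (cases "ip V w w = 0")
  case True
  then have "w = \<zero>\<^bsub>V\<^esub>" using ip_definite w by blast
  then show ?thesis using ip_zero v w by simp
next
  case False
  define a where "a = ip V v w"
  define q where "q = Re (ip V w w)"
  have q: "q > 0" using False ip_nonneg[OF w] ip_real[OF w] unfolding q_def
    by (metis less_eq_real_def of_real_0)
  have qq: "ip V w w = of_real q" using ip_real[OF w] by (simp add: q_def)
  have wv: "ip V w v = cnj a" using ip_cnj[OF w v] by (simp add: a_def)
  define z where "z = v \<oplus>\<^bsub>V\<^esub> ((- a / of_real q) \<odot>\<^bsub>V\<^esub> w)"
  have z: "z \<in> carrier V" using v w cr by (simp add: z_def)
  have "ip V z z = ip V v v + cnj (- a / of_real q) * a + (- a / of_real q) * cnj a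
     + (- a / of_real q) * cnj (- a / of_real q) * of_real q"
    unfolding z_def using v w cr by (simp add: ip_add ip_add2 ip_smult ip_smult2 qq wv a_def[symmetric] algebra_simps)
  also have "\<dots> = ip V v v - of_real ((cmod a)\<^sup>2 / q)"
    using q complex_norm_square[of a] by (simp add: field_simps)
  finally have "Re (ip V z z) = Re (ip V v v) - (cmod a)\<^sup>2 / q" by simp
  then have "(cmod a)\<^sup>2 / q \<le> Re (ip V v v)" using ip_nonneg[OF z] by simp
  then show ?thesis using q by (simp add: a_def q_def field_simps)
qed

lemma ip_norm_add:
  assumes v: "v \<in> carrier V" and w: "w \<in> carrier V"
  shows "sqrt (Re (ip V (v \<oplus>\<^bsub>V\<^esub> w) (v \<oplus>\<^bsub>V\<^esub> w))) \<le> sqrt (Re (ip V v v)) + sqrt (Re (ip V w w))"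
proof (rule real_le_lsqrt)
  have "Re (ip V v w) \<le> cmod (ip V v w)" by (rule complex_Re_le_cmod)
  also have "\<dots> \<le> sqrt (Re (ip V v v)) * sqrt (Re (ip V w w))"
    using cauchy_schwarz[OF v w] by (metis real_le_rsqrt real_sqrt_mult)
  finally have *: "Re (ip V v w) \<le> sqrt (Re (ip V v v)) * sqrt (Re (ip V w w))" .
  have "Re (ip V w v) = Re (ip V v w)" using ip_cnj[OF v w] by simp
  then show "Re (ip V (v \<oplus>\<^bsub>V\<^esub> w) (v \<oplus>\<^bsub>V\<^esub> w)) \<le> (sqrt (Re (ip V v v)) + sqrt (Re (ip V w w)))\<^sup>2"
    using v w * ip_nonneg[OF v] ip_nonneg[OF w]
    by (simp add: ip_add ip_add2 power2_sum)
qed (use v w ip_nonneg in \<open>auto intro!: add_nonneg_nonneg\<close>)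

lemma ip_minus_sym:
  assumes v: "v \<in> carrier V" and w: "w \<in> carrier V"
  shows "ip V (v \<ominus>\<^bsub>V\<^esub> w) (v \<ominus>\<^bsub>V\<^esub> w) = ip V (w \<ominus>\<^bsub>V\<^esub> v) (w \<ominus>\<^bsub>V\<^esub> v)"
  using v w cr by (simp add: a_minus_smult ip_add ip_add2 ip_smult ip_smult2)

lemma minus_eq_zeroD:
  assumes "v \<in> carrier V" "w \<in> carrier V" "v \<ominus>\<^bsub>V\<^esub> w = \<zero>\<^bsub>V\<^esub>"
  shows "v = w"
proof -
  have "v = (v \<ominus>\<^bsub>V\<^esub> w) \<oplus>\<^bsub>V\<^esub> w" using assms(1,2) by (simp add: a_minus_def M.a_assoc M.l_neg)
  then show ?thesis using assms by simp
qed

lemma Metric_space: "Metric_space (carrier V) (ip_dist V)"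
proof
  show "0 \<le> ip_dist V x y" for x y by (auto simp: ip_dist_def intro: ip_nonneg)
  show "ip_dist V x y = ip_dist V y x" for x y by (auto simp: ip_dist_def ip_minus_sym)
  show "ip_dist V x y = 0 \<longleftrightarrow> x = y" if "x \<in> carrier V" "y \<in> carrier V" for x y
  proof
    assume "ip_dist V x y = 0"
    then have "x \<ominus>\<^bsub>V\<^esub> y = \<zero>\<^bsub>V\<^esub>" using that ip_real[of "x \<ominus>\<^bsub>V\<^esub> y"]
      by (auto simp: ip_dist_def intro!: ip_definite)
    then show "x = y" using that minus_eq_zeroD by blast
  qed (use that ip_zero in \<open>auto simp: ip_dist_def M.r_neg a_minus_def\<close>)
  fix x y z assume c: "x \<in> carrier V" "y \<in> carrier V" "z \<in> carrier V"
  have "x \<ominus>\<^bsub>V\<^esub> z = (x \<ominus>\<^bsub>V\<^esub> y) \<oplus>\<^bsub>V\<^esub> (y \<ominus>\<^bsub>V\<^esub> z)"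
    using c by (simp add: a_minus_def M.a_ac) (metis M.a_assoc M.a_inv_closed M.l_neg M.r_neg M.r_zero M.l_zero M.a_lcomm M.a_comm)
  then show "ip_dist V x z \<le> ip_dist V x y + ip_dist V y z"
    using ip_norm_add[of "x \<ominus>\<^bsub>V\<^esub> y" "y \<ominus>\<^bsub>V\<^esub> z"] c by (simp add: ip_dist_def)
qed

lemma closed_subspace_orth:
  assumes X: "X \<subseteq> carrier V"
  shows "closed_subspace {v \<in> carrier V. \<forall>x\<in>X. ip V v x = 0} V" (is "closed_subspace ?K V")
proof -
  interpret Ms: Metric_space "carrier V" "ip_dist V" by (rule Metric_space)
  have "submodule ?K complex_ring V"
  proof (rule submoduleI)
    show "\<ominus>\<^bsub>V\<^esub> a \<in> ?K" if "a \<in> ?K" for a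
      using that X cr a_minus_smult[of "\<zero>\<^bsub>V\<^esub>" a] ip_smult[of a _ "-1"] by (auto simp: a_minus_def)
  qed (use X cr in \<open>auto simp: ip_zero ip_add ip_smult subset_iff\<close>)
  moreover have "closedin Ms.mtopology ?K"
    unfolding Ms.metric_closedin_iff_sequentially_closed
  proof (intro conjI allI impI)
    fix s l assume a: "range s \<subseteq> ?K \<and> limitin Ms.mtopology s l sequentially"
    then have l: "l \<in> carrier V" by (auto simp: Ms.limitin_metric)
    have "ip V l x = 0" if x: "x \<in> X" for x
    proof (rule ccontr)
      assume ne: "ip V l x \<noteq> 0"
      have xV: "x \<in> carrier V" using x X by blast
      define n where "n = sqrt (Re (ip V x x))"
      have n0: "n \<ge> 0" using ip_nonneg[OF xV] by (simp add: n_def)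
      have "cmod (ip V l x) / (n + 1) > 0" using ne n0 by simp
      then obtain k where k: "ip_dist V (s k) l < cmod (ip V l x) / (n + 1)" and sk: "s k \<in> carrier V"
        using a unfolding Ms.limitin_metric eventually_sequentially by (meson order_refl)
      have skK: "ip V (s k) x = 0" using a x by auto
      have "ip V (s k \<ominus>\<^bsub>V\<^esub> l) x = - ip V l x"
        using sk l xV cr skK by (simp add: a_minus_smult ip_add ip_smult)
      then have "cmod (ip V l x) \<le> sqrt (Re (ip V (s k \<ominus>\<^bsub>V\<^esub> l) (s k \<ominus>\<^bsub>V\<^esub> l))) * n"
        using cauchy_schwarz[of "s k \<ominus>\<^bsub>V\<^esub> l" x] sk l xV unfolding n_def
        by (metis M.minus_closed norm_minus_cancel real_le_rsqrt real_sqrt_mult)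
      also have "\<dots> = ip_dist V (s k) l * n" using sk l by (simp add: ip_dist_def)
      also have "\<dots> \<le> cmod (ip V l x) / (n + 1) * n" using k n0 by (intro mult_right_mono) auto
      also have "\<dots> < cmod (ip V l x)" using n0 ne by (simp add: field_simps)
      finally show False by simp
    qed
    then show "l \<in> ?K" using l by simp
  qed auto
  ultimately show ?thesis by (simp add: closed_subspace_def)
qed

end

text \<open>Transport of structure along a map that is injective on the carrier.\<close>

definition transport :: "('v \<Rightarrow> 'w) \<Rightarrow> 'v inner_space \<Rightarrow> 'w inner_space"
  where "transport f V = (let g = inv_into (carrier V) f in
    \<lparr>carrier = f ` carrier V, mult = undefined, one = undefined, zero = f \<zero>\<^bsub>V\<^esub>,
     add = \<lambda>x y. f (g x \<oplus>\<^bsub>V\<^esub> g y), smult = \<lambda>a x. f (a \<odot>\<^bsub>V\<^esub> g x),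
     ip = \<lambda>x y. ip V (g x) (g y)\<rparr>)"

context hilbert_space
begin

lemma transport:
  assumes f: "inj_on f (carrier V)"
  shows "hilbert_space (transport f V)" "f \<in> unitary_maps V (transport f V)"
    "closed_subspace X (transport f V) \<Longrightarrow> closed_subspace {v \<in> carrier V. f v \<in> X} V"
proof -
  define W where "W = transport f V"
  have inv: "inv_into (carrier V) f (f x) = x" if "x \<in> carrier V" for x
    using f that by simp
  have W [simp]: "carrier W = f ` carrier V" "\<zero>\<^bsub>W\<^esub> = f \<zero>\<^bsub>V\<^esub>"
    "\<lbrakk>x \<in> carrier V; y \<in> carrier V\<rbrakk> \<Longrightarrow> f x \<oplus>\<^bsub>W\<^esub> f y = f (x \<oplus>\<^bsub>V\<^esub> y)"
    "x \<in> carrier V \<Longrightarrow> a \<odot>\<^bsub>W\<^esub> f x = f (a \<odot>\<^bsub>V\<^esub> x)"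
    "\<lbrakk>x \<in> carrier V; y \<in> carrier V\<rbrakk> \<Longrightarrow> ip W (f x) (f y) = ip V x y" for x y a
    unfolding W_def transport_def Let_def by (simp_all add: inv)
  have ab: "abelian_group W"
  proof (rule abelian_groupI)
    show "\<exists>y\<in>carrier W. y \<oplus>\<^bsub>W\<^esub> x = \<zero>\<^bsub>W\<^esub>" if x: "x \<in> carrier W" for x
    proof -
      obtain x' where x': "x = f x'" "x' \<in> carrier V" using x by auto
      show ?thesis by (rule bexI[of _ "f (\<ominus>\<^bsub>V\<^esub> x')"]) (auto simp: x' M.l_neg)
    qed
  qed (auto simp: M.a_ac)
  interpret WM: abelian_group W by (rule ab)
  have minus: "f x \<ominus>\<^bsub>W\<^esub> f y = f (x \<ominus>\<^bsub>V\<^esub> y)" if "x \<in> carrier V" "y \<in> carrier V" for x y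
  proof -
    have "\<ominus>\<^bsub>W\<^esub> f y = f (\<ominus>\<^bsub>V\<^esub> y)"
      using that by (intro WM.minus_equality) (auto simp: M.l_neg)
    then show ?thesis using that by (simp add: a_minus_def)
  qed
  have d: "ip_dist W (f x) (f y) = ip_dist V x y" if "x \<in> carrier V" "y \<in> carrier V" for x y
    using that minus by (simp add: ip_dist_def)
  have out: "ip_dist W x y = 0" if "\<not> (x \<in> carrier W \<and> y \<in> carrier W)" for x y
    using that by (auto simp: ip_dist_def)
  interpret Ms: Metric_space "carrier V" "ip_dist V" by (rule Metric_space)
  have mod: "module complex_ring W"
    by (rule moduleI[OF cring_complex_ring ab])
       (use cr smult_l_distr smult_r_distr smult_assoc1 smult_one in auto)
  have "Metric_space (carrier W) (ip_dist W)"
  proof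
    show nn: "0 \<le> ip_dist W x y" for x y
      by (cases "x \<in> carrier W \<and> y \<in> carrier W") (auto simp: out d)
    show "ip_dist W x y = ip_dist W y x" for x y
      using Ms.commute by (cases "x \<in> carrier W \<and> y \<in> carrier W") (auto simp: out d)
    show "(ip_dist W x y = 0) = (x = y)" if "x \<in> carrier W" "y \<in> carrier W" for x y
      using that d by auto
    show "ip_dist W x z \<le> ip_dist W x y + ip_dist W y z"
      if "x \<in> carrier W" "y \<in> carrier W" "z \<in> carrier W" for x y z
      using that d Ms.triangle by auto
  qed
  then interpret Mw: Metric_space "carrier W" "ip_dist W" .
  have lim: "limitin Mw.mtopology (f \<circ> s) (f l) sequentially"
    if "limitin Ms.mtopology s l sequentially" "range s \<subseteq> carrier V" for s l
    using that d unfolding Mw.limitin_metric Ms.limitin_metric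
    by (force simp: range_subsetD elim!: eventually_mono)
  have complete': "Mw.mcomplete"
    unfolding Mw.mcomplete_def
  proof (intro allI impI)
    fix s assume s: "Mw.MCauchy s"
    define t where "t = inv_into (carrier V) f \<circ> s"
    have "range s \<subseteq> carrier W" using s by (simp only: Mw.MCauchy_def)
    then have sr: "s n \<in> f ` carrier V" for n by (simp only: W(1)) blast
    have t: "range t \<subseteq> carrier V" "s = f \<circ> t" using sr
      by (auto simp: t_def inv_into_into f_inv_into_f)
    have "Ms.MCauchy t"
      using s t d unfolding Mw.MCauchy_def Ms.MCauchy_def by (simp add: range_subsetD)
    then obtain l where "limitin Ms.mtopology t l sequentially"
      using complete Ms.mcomplete_def by blast
    then show "\<exists>x. limitin Mw.mtopology s x sequentially" using lim t by blast
  qed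
  show "hilbert_space (transport f V)"
    unfolding W_def[symmetric]
  proof (intro hilbert_space.intro mod hilbert_space_axioms.intro complete')
    show "ip W v w = cnj (ip W w v)" if "v \<in> carrier W" "w \<in> carrier W" for v w
      using that by (auto intro: ip_cnj)
    show "v = \<zero>\<^bsub>W\<^esub>" if "v \<in> carrier W" "ip W v v = 0" for v
      using that ip_definite by auto
  qed (auto simp: ip_add ip_smult cr ip_nonneg)
  show "f \<in> unitary_maps V (transport f V)"
    unfolding W_def[symmetric] unitary_maps_def using f by (auto simp: bij_betw_def)
  show "closed_subspace {v \<in> carrier V. f v \<in> X} V" if X: "closed_subspace X (transport f V)"
  proof -
    interpret WMo: module complex_ring W by (rule mod)
    have X1: "submodule X complex_ring W" and X2: "closedin Mw.mtopology X"
      using X by (auto simp: closed_subspace_def W_def)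
    note E = WMo.submoduleE[OF X1]
    have Xz: "f \<zero>\<^bsub>V\<^esub> \<in> X"
      using submodule.axioms(1)[OF X1] subgroup.one_closed by fastforce
    have "submodule {v \<in> carrier V. f v \<in> X} complex_ring V"
    proof (rule submoduleI)
      show "\<ominus>\<^bsub>V\<^esub> a \<in> {v \<in> carrier V. f v \<in> X}" if "a \<in> {v \<in> carrier V. f v \<in> X}" for a
        using that E(4)[of "-1" "f a"] a_minus_smult[of "\<zero>\<^bsub>V\<^esub>" a] cr[of a "-1"] by (auto simp: a_minus_def)
      show "a \<oplus>\<^bsub>V\<^esub> b \<in> {v \<in> carrier V. f v \<in> X}"
        if "a \<in> {v \<in> carrier V. f v \<in> X}" "b \<in> {v \<in> carrier V. f v \<in> X}" for a b
        using that E(5)[of "f a" "f b"] by auto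
      show "a \<odot>\<^bsub>V\<^esub> x \<in> {v \<in> carrier V. f v \<in> X}"
        if "a \<in> carrier complex_ring" "x \<in> {v \<in> carrier V. f v \<in> X}" for a x
        using that E(4)[of a "f x"] cr by auto
    qed (use Xz in auto)
    moreover have "closedin Ms.mtopology {v \<in> carrier V. f v \<in> X}"
      unfolding Ms.metric_closedin_iff_sequentially_closed
    proof (intro conjI allI impI)
      fix s l
      assume a: "range s \<subseteq> {v \<in> carrier V. f v \<in> X} \<and> limitin Ms.mtopology s l sequentially"
      then have "limitin Mw.mtopology (f \<circ> s) (f l) sequentially" by (intro lim) auto
      moreover have "range (f \<circ> s) \<subseteq> X" using a by auto
      ultimately have "f l \<in> X"
        using X2 unfolding Mw.metric_closedin_iff_sequentially_closed by blast
      moreover have "l \<in> carrier V" using a by (auto simp: Ms.limitin_metric)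
      ultimately show "l \<in> {v \<in> carrier V. f v \<in> X}" by simp
    qed auto
    ultimately show ?thesis by (simp add: closed_subspace_def)
  qed
qed

end

lemma unitary_groupD:
  assumes "\<pi> \<in> hom G (unitary_group V)" "g \<in> carrier G"
  shows "\<pi> g \<in> unitary_maps V V" "\<pi> g \<in> Bij (carrier V)"
    "h \<in> carrier G \<Longrightarrow> v \<in> carrier V \<Longrightarrow> \<pi> (g \<otimes>\<^bsub>G\<^esub> h) v = \<pi> g (\<pi> h v)"
  using assms by (auto simp: hom_def unitary_group_def BijGroup_def Pi_def compose_def)

lemma unitary_mapsD:
  assumes "U \<in> unitary_maps V W" "v \<in> carrier V" "w \<in> carrier V"
  shows "U v \<in> carrier W" "U (v \<oplus>\<^bsub>V\<^esub> w) = U v \<oplus>\<^bsub>W\<^esub> U w" "U (a \<odot>\<^bsub>V\<^esub> v) = a \<odot>\<^bsub>W\<^esub> U v"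
    "ip W (U v) (U w) = ip V v w"
  using assms by (auto simp: unitary_maps_def bij_betw_def)

lemma irreducible_rep_universe:
  fixes G :: "('a, 'b) monoid_scheme" and \<rho> :: "('a, 'v) rep"
  assumes G: "group G" and irr: "irreducible_rep G \<rho>"
  shows "\<exists>\<sigma>\<in>irreps G. unitarily_equivalent G \<rho> \<sigma>"
proof -
  obtain V \<pi> where \<rho>: "\<rho> = (V, \<pi>)" by fastforce
  interpret Gp: group G by (rule G)
  interpret hilbert_space V using irr by (auto simp: \<rho> irreducible_rep_def unitary_rep_def)
  have \<pi>: "\<pi> \<in> hom G (unitary_group V)" and ne: "carrier V \<noteq> {\<zero>\<^bsub>V\<^esub>}"
    using irr by (auto simp: \<rho> irreducible_rep_def unitary_rep_def)
  have I: "W = {\<zero>\<^bsub>V\<^esub>} \<or> W = carrier V"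
    if "closed_subspace W V" "\<forall>g\<in>carrier G. \<pi> g ` W \<subseteq> W" for W
    using irr that by (auto simp: \<rho> irreducible_rep_def)
  note P = unitary_groupD[OF \<pi>]
  note Q = unitary_mapsD[OF P(1)]
  have Qc: "\<pi> g v \<in> carrier V" if "g \<in> carrier G" "v \<in> carrier V" for g v
    using Q(1)[OF that that(2)] .
  obtain \<xi> where xi: "\<xi> \<in> carrier V" "\<xi> \<noteq> \<zero>\<^bsub>V\<^esub>" using ne by blast
  define X where "X = (\<lambda>g. \<pi> g \<xi>) ` carrier G"
  have X: "X \<subseteq> carrier V" using Q(1) xi by (auto simp: X_def)
  define K where "K = {v \<in> carrier V. \<forall>x\<in>X. ip V v x = 0}"
  have one: "\<pi> \<one>\<^bsub>G\<^esub> v = v" if v: "v \<in> carrier V" for v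
  proof -
    have "\<pi> \<one>\<^bsub>G\<^esub> (\<pi> \<one>\<^bsub>G\<^esub> v) = \<pi> \<one>\<^bsub>G\<^esub> v" using P(3)[of "\<one>\<^bsub>G\<^esub>" "\<one>\<^bsub>G\<^esub>" v] v by simp
    moreover have "inj_on (\<pi> \<one>\<^bsub>G\<^esub>) (carrier V)" using P(2)[of "\<one>\<^bsub>G\<^esub>"] by (auto simp: Bij_def bij_betw_def)
    ultimately show ?thesis using Q(1)[of "\<one>\<^bsub>G\<^esub>" v v] v by (auto dest: inj_onD)
  qed
  have inv: "\<pi> g ` K \<subseteq> K" if g: "g \<in> carrier G" for g
  proof
    fix w assume "w \<in> \<pi> g ` K"
    then obtain v where v: "w = \<pi> g v" "v \<in> K" by blast
    then have vV: "v \<in> carrier V" by (simp add: K_def)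
    have "ip V w (\<pi> h \<xi>) = 0" if h: "h \<in> carrier G" for h
    proof -
      have "\<pi> h \<xi> = \<pi> g (\<pi> (inv\<^bsub>G\<^esub> g \<otimes>\<^bsub>G\<^esub> h) \<xi>)"
        using P(3)[of g "inv\<^bsub>G\<^esub> g \<otimes>\<^bsub>G\<^esub> h" \<xi>] g h xi by (simp add: Gp.m_assoc[symmetric])
      then have "ip V w (\<pi> h \<xi>) = ip V v (\<pi> (inv\<^bsub>G\<^esub> g \<otimes>\<^bsub>G\<^esub> h) \<xi>)"
        using Q(4)[of g v "\<pi> (inv\<^bsub>G\<^esub> g \<otimes>\<^bsub>G\<^esub> h) \<xi>"] Q(1)[of "inv\<^bsub>G\<^esub> g \<otimes>\<^bsub>G\<^esub> h" \<xi> \<xi>] g h xi vV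
        by (simp add: v)
      then show ?thesis using v g h by (simp add: K_def X_def)
    qed
    then show "w \<in> K" using Q(1)[OF g vV vV] by (auto simp: K_def X_def v(1))
  qed
  have "\<xi> \<notin> K"
  proof
    assume "\<xi> \<in> K"
    then have "ip V \<xi> (\<pi> \<one>\<^bsub>G\<^esub> \<xi>) = 0" by (auto simp: K_def X_def)
    then show False using one xi ip_definite by simp
  qed
  then have K0: "K = {\<zero>\<^bsub>V\<^esub>}"
    using I[of K] closed_subspace_orth[OF X] inv xi by (auto simp: K_def)
  define f where "f v = (\<lambda>g. if g \<in> carrier G then ip V v (\<pi> g \<xi>) else 0)" for v
  have f: "inj_on f (carrier V)"
  proof
    fix v w assume vw: "v \<in> carrier V" "w \<in> carrier V" "f v = f w"
    have "ip V v (\<pi> g \<xi>) = ip V w (\<pi> g \<xi>)" if "g \<in> carrier G" for g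
      using fun_cong[OF vw(3), of g] that by (simp add: f_def)
    then have "v \<ominus>\<^bsub>V\<^esub> w \<in> K"
      using vw Q(1) xi cr by (auto simp: K_def X_def a_minus_smult ip_add ip_smult)
    then have "v \<ominus>\<^bsub>V\<^esub> w = \<zero>\<^bsub>V\<^esub>" using K0 by simp
    then show "v = w" using vw minus_eq_zeroD by blast
  qed
  define W where "W = transport f V"
  interpret W: hilbert_space W unfolding W_def by (rule transport(1)[OF f])
  have fU: "f \<in> unitary_maps V W" unfolding W_def by (rule transport(2)[OF f])
  note F = unitary_mapsD[OF fU]
  have cW: "carrier W = f ` carrier V" using fU by (auto simp: unitary_maps_def bij_betw_def)
  have zW: "\<zero>\<^bsub>W\<^esub> = f \<zero>\<^bsub>V\<^esub>" by (simp add: W_def transport_def Let_def)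
  define \<sigma> where "\<sigma> g = (\<lambda>x\<in>carrier W. f (\<pi> g (inv_into (carrier V) f x)))" for g
  have \<sigma>: "\<sigma> g (f v) = f (\<pi> g v)" if "v \<in> carrier V" for g v
    using that f by (simp add: \<sigma>_def cW)
  have bij: "bij_betw (\<sigma> g) (carrier W) (carrier W)" if g: "g \<in> carrier G" for g
  proof -
    have b: "bij_betw (\<pi> g) (carrier V) (carrier V)" using P(2)[OF g] by (simp add: Bij_def)
    have fb: "bij_betw f (carrier V) (carrier W)" using f cW by (simp add: bij_betw_def)
    have "bij_betw (f \<circ> \<pi> g \<circ> inv_into (carrier V) f) (carrier W) (carrier W)"
      by (intro bij_betw_trans[OF bij_betw_inv_into[OF fb]] bij_betw_trans[OF b fb])
    then show ?thesis by (rule bij_betw_cong[THEN iffD1, rotated]) (simp add: \<sigma>_def)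
  qed
  have uni: "\<sigma> g \<in> unitary_maps W W \<inter> Bij (carrier W)" if g: "g \<in> carrier G" for g
  proof
    show "\<sigma> g \<in> Bij (carrier W)" using bij[OF g] by (simp add: Bij_def \<sigma>_def)
    have 1: "\<sigma> g (f v \<oplus>\<^bsub>W\<^esub> f w) = \<sigma> g (f v) \<oplus>\<^bsub>W\<^esub> \<sigma> g (f w)"
      if "v \<in> carrier V" "w \<in> carrier V" for v w
      using that g by (simp add: F(2)[symmetric] \<sigma> Q(2) Qc)
    have 2: "\<sigma> g (a \<odot>\<^bsub>W\<^esub> f v) = a \<odot>\<^bsub>W\<^esub> \<sigma> g (f v)" if "v \<in> carrier V" for a v
      using that g cr by (simp add: F(3)[OF that that, symmetric] F(3)[OF Qc Qc, symmetric] \<sigma> Q(3)[OF g that that])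
    have 3: "ip W (\<sigma> g (f v)) (\<sigma> g (f w)) = ip W (f v) (f w)"
      if "v \<in> carrier V" "w \<in> carrier V" for v w
      using that g by (simp add: \<sigma> F(4) Q(4) Qc)
    show "\<sigma> g \<in> unitary_maps W W"
      unfolding unitary_maps_def using bij[OF g] 1 2 3 by (auto simp: cW)
  qed
  have hom: "\<sigma> \<in> hom G (unitary_group W)"
    unfolding hom_def
  proof (intro CollectI conjI ballI)
    show "\<sigma> \<in> carrier G \<rightarrow> carrier (unitary_group W)" using uni by (auto simp: unitary_group_def)
    fix g h assume gh: "g \<in> carrier G" "h \<in> carrier G"
    have "\<sigma> (g \<otimes>\<^bsub>G\<^esub> h) = compose (carrier W) (\<sigma> g) (\<sigma> h)"
    proof
      fix x
      show "\<sigma> (g \<otimes>\<^bsub>G\<^esub> h) x = compose (carrier W) (\<sigma> g) (\<sigma> h) x"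
      proof (cases "x \<in> carrier W")
        case True
        then obtain v where v: "x = f v" "v \<in> carrier V" using cW by auto
        then show ?thesis using True \<sigma> P(3)[OF gh v(2)] Q(1)[OF gh(2) v(2) v(2)] by (simp add: compose_def)
      qed (auto simp: \<sigma>_def compose_def)
    qed
    then show "\<sigma> (g \<otimes>\<^bsub>G\<^esub> h) = \<sigma> g \<otimes>\<^bsub>unitary_group W\<^esub> \<sigma> h"
      using uni gh by (simp add: unitary_group_def BijGroup_def)
  qed
  have "(W, \<sigma>) \<in> irreps G"
    unfolding irreps_def irreducible_rep_def unitary_rep_def
  proof (simp add: hom W.hilbert_space_axioms, intro conjI allI impI)
    show "carrier W \<noteq> {\<zero>\<^bsub>W\<^esub>}"
    proof
      assume "carrier W = {\<zero>\<^bsub>W\<^esub>}"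
      then have "f \<xi> = f \<zero>\<^bsub>V\<^esub>" using xi unfolding cW zW by blast
      then show False using f xi M.zero_closed by (auto dest: inj_onD)
    qed
    fix Y assume Y: "closed_subspace Y W \<and> (\<forall>g\<in>carrier G. \<sigma> g ` Y \<subseteq> Y)"
    have Ys: "Y \<subseteq> carrier W" using Y W.submoduleE(1) by (auto simp: closed_subspace_def)
    let ?Z = "{v \<in> carrier V. f v \<in> Y}"
    have YZ: "Y = f ` ?Z" using Ys cW by auto
    have "closed_subspace ?Z V" using transport(3)[OF f] Y by (simp add: W_def)
    moreover have "\<pi> g ` ?Z \<subseteq> ?Z" if "g \<in> carrier G" for g
    proof
      fix y assume "y \<in> \<pi> g ` ?Z"
      then obtain v where v: "y = \<pi> g v" "v \<in> carrier V" "f v \<in> Y" by blast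
      then have "\<sigma> g (f v) \<in> Y" using Y that by blast
      then show "y \<in> ?Z" using v that \<sigma> Qc by simp
    qed
    ultimately have "?Z = {\<zero>\<^bsub>V\<^esub>} \<or> ?Z = carrier V" by (intro I) auto
    then show "Y = {\<zero>\<^bsub>W\<^esub>} \<or> Y = carrier W"
    proof
      assume Z: "?Z = {\<zero>\<^bsub>V\<^esub>}"
      have "Y = {\<zero>\<^bsub>W\<^esub>}" using YZ unfolding Z zW by simp
      then show ?thesis ..
    next
      assume Z: "?Z = carrier V"
      have "Y = carrier W" using YZ unfolding Z cW .
      then show ?thesis ..
    qed
  qed
  moreover have "unitarily_equivalent G \<rho> (W, \<sigma>)"
    unfolding \<rho> unitarily_equivalent_def using \<sigma>
    by (auto intro!: bexI[OF _ fU])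
  ultimately show ?thesis by blast
qed

end

theory Submission
  imports Defs "HOL-Algebra.Weak_Morphisms"
begin

text \<open>
  The proof works with functions of positive type instead of representations. A state is a
  function of positive type with value 1 at the identity. Coefficients of unit vectors are states,
  and every state comes from a cyclic vector by the GNS construction; irreducible representations
  correspond to the extreme points of the compact convex set of states, by Schur's lemma.

  \<^emph>\<open>Density.\<close> Let \<open>N\<close> range over a family of normal subgroups that is closed under intersection.
  The irreducible representations that are trivial on some \<open>N\<close> are dense in the dual exactly if
  every state is a pointwise limit of states that are 1 on some \<open>N\<close>
  (\<open>dual_dense_if_states_dense\<close>, \<open>states_dense_if_dual_dense\<close>). One direction approximates
  a pure state by pure states, which is Milman's theorem; the other recovers all states from the
  pure ones, which is the Krein-Milman theorem. For the normal subgroups of finite index this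
  describes property FD (\<open>property_FD_iff\<close>). For those of them in \<open>H\<close> that the action of \<open>G\<close>
  preserves it describes the density of the representations with finite image and finite orbit
  (\<open>finite_orbit_dual_eq\<close>): the kernels along a finite orbit intersect in an invariant subgroup of
  finite index, and conversely \<open>G\<close> acts on a finite quotient of \<open>H\<close> through a finite group.

  \<^emph>\<open>From the semidirect product to the factors.\<close> A state of \<open>H\<close> extended by 0 is a state of the
  semidirect product; approximating the extension and restricting to \<open>H\<close> gives the density over
  \<open>H\<close> (\<open>FD_dual_dense\<close>). The indicator function of \<open>H\<close>, approximated by states that are 1 on
  subgroups of finite index, separates the elements of \<open>G\<close> from the identity
  (\<open>FD_residually_finite\<close>).

  \<^emph>\<open>From the factors to the semidirect product.\<close> Let \<open>\<phi>\<close> be a state of the semidirect product, the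
  coefficient of \<open>\<zeta>\<close> in a representation \<open>\<pi>\<close>. Amenability provides a unit vector \<open>\<xi>\<close> with finite
  support \<open>T\<close> in the regular representation of \<open>G\<close> that finitely many given \<open>g\<close> almost fix
  (\<open>almost_invariant_vector\<close>). So \<open>\<phi>(h, g)\<close> is close to the sum over \<open>t\<close> of
  \<open>\<xi>(g t) \<xi>(t) \<phi>(h, g)\<close>, and \<open>\<phi>(h, g)\<close> can be written here as an inner product of
  \<open>\<pi>(\<alpha>(s\<^sup>-\<^sup>1) h) v t\<close> and \<open>v s\<close> for \<open>s = g t\<close> and the vectors \<open>v t = \<pi>(t\<^sup>-\<^sup>1) \<zeta>\<close>: only the
  restriction of \<open>\<pi>\<close> to \<open>H\<close> and finitely many vectors enter. The matrix of these coefficients is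
  approximated by a matrix of positive type that is periodic modulo an invariant \<open>M\<close> of
  finite index (\<open>matrix_approx\<close>). By residual finiteness the condition \<open>s = g t\<close> may be replaced by
  a congruence modulo a subgroup \<open>L\<close> of finite index that acts trivially on \<open>H / M\<close>. The result is of
  positive type and periodic modulo \<open>M \<times> L\<close> (\<open>folded_positive_type\<close>, \<open>folded_periodic\<close>).
\<close>

section \<open>Positive semidefinite kernels\<close>

text \<open>A list of pairs of a coefficient and an index stands for a formal linear combination, and
  \<open>bil K\<close> is the sesquilinear form on formal combinations that the kernel defines. Lists make sums
  concatenations and need neither a quotient nor a normal form.\<close>
definition bil :: "('x \<Rightarrow> 'x \<Rightarrow> complex) \<Rightarrow> (complex \<times> 'x) list \<Rightarrow> (complex \<times> 'x) list \<Rightarrow> complex"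
  where "bil K l m = (\<Sum>p\<leftarrow>l. \<Sum>q\<leftarrow>m. fst p * cnj (fst q) * K (snd p) (snd q))"

abbreviation scale :: "complex \<Rightarrow> (complex \<times> 'x) list \<Rightarrow> (complex \<times> 'x) list"
  where "scale a \<equiv> map (apfst ((*) a))"

abbreviation push :: "('x \<Rightarrow> 'y) \<Rightarrow> (complex \<times> 'x) list \<Rightarrow> (complex \<times> 'y) list"
  where "push f \<equiv> map (apsnd f)"

definition pd :: "('x \<Rightarrow> 'x \<Rightarrow> complex) \<Rightarrow> bool"
  where "pd K \<longleftrightarrow> (\<forall>x y. K y x = cnj (K x y)) \<and> (\<forall>l. 0 \<le> Re (bil K l l))"

lemma bil_Nil [simp]: "bil K [] m = 0" "bil K l [] = 0"
  by (simp_all add: bil_def)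

lemma bil_append [simp]:
  "bil K (l @ l') m = bil K l m + bil K l' m" "bil K l (m @ m') = bil K l m + bil K l m'"
  by (simp_all add: bil_def sum_list_addf)

lemma bil_Cons: "bil K (p # l) m = bil K [p] m + bil K l m" "bil K l (q # m) = bil K l [q] + bil K l m"
  using bil_append(1)[of K "[p]" l m] bil_append(2)[of K l "[q]" m] by simp_all

lemma bil_single: "bil K [(a, x)] [(b, y)] = a * cnj b * K x y"
  by (simp add: bil_def)

lemma bil_scale [simp]:
  "bil K (scale a l) m = a * bil K l m" "bil K l (scale a m) = cnj a * bil K l m"
  by (simp_all add: bil_def o_def sum_list_const_mult[symmetric] mult_ac)

lemma bil_push: "bil K (push f l) (push g m) = bil (\<lambda>x y. K (f x) (g y)) l m"
  by (simp add: bil_def o_def)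

lemma bil_cong:
  "(\<And>x y. x \<in> snd ` set l \<Longrightarrow> y \<in> snd ` set m \<Longrightarrow> K x y = K' x y) \<Longrightarrow> bil K l m = bil K' l m"
  unfolding bil_def by (intro arg_cong[where f = sum_list] map_cong) auto

lemma bil_add_kernel: "bil (\<lambda>x y. K x y + K' x y) l m = bil K l m + bil K' l m"
  by (simp add: bil_def sum_list_addf algebra_simps)

lemma bil_mult_kernel: "bil (\<lambda>x y. a * K x y) l m = a * bil K l m"
  by (simp add: bil_def sum_list_const_mult[symmetric] mult_ac)

lemma bil_tendsto:
  assumes "\<And>x y. ((\<lambda>n. K n x y) \<longlongrightarrow> L x y) F"
  shows "((\<lambda>n. bil (K n) l m) \<longlongrightarrow> bil L l m) F"
proof -
  have s: "((\<lambda>n. \<Sum>p\<leftarrow>l. f n p) \<longlongrightarrow> (\<Sum>p\<leftarrow>l. g p)) F"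
    if "\<And>p. ((\<lambda>n. f n p) \<longlongrightarrow> g p) F" for f :: "_ \<Rightarrow> _ \<Rightarrow> complex" and g and l :: "(complex \<times> 'a) list"
    using that by (induction l) (auto intro!: tendsto_intros)
  show ?thesis unfolding bil_def by (intro s tendsto_intros assms)
qed

context
  fixes K :: "'x \<Rightarrow> 'x \<Rightarrow> complex"
  assumes K: "pd K"
begin

lemma pd_sym: "K y x = cnj (K x y)"
  using K unfolding pd_def by blast

lemma pd_nonneg: "0 \<le> Re (bil K l l)"
  using K unfolding pd_def by blast

lemma bil_cnj: "bil K m l = cnj (bil K l m)"
proof (induction m)
  case (Cons q m)
  have "bil K [q] l = cnj (bil K l [q])"
  proof (induction l)
    case (Cons p l)
    have "bil K [q] [p] = cnj (bil K [p] [q])"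
      using pd_sym[of "snd q" "snd p"] by (simp add: bil_def mult.commute)
    then show ?case using Cons by (simp add: bil_Cons(1)[of K p l] bil_Cons(2)[of K "[q]" p l])
  qed simp
  then show ?case using Cons by (simp add: bil_Cons(1)[of K q m] bil_Cons(2)[of K l q m])
qed simp

lemma bil_real: "bil K l l = of_real (Re (bil K l l))"
  using arg_cong[OF bil_cnj[of l l], of Im] by (simp add: complex_eq_iff)

lemma bil_cs: "(cmod (bil K l m))\<^sup>2 \<le> Re (bil K l l) * Re (bil K m m)"
proof -
  define a where "a = bil K l m"
  define p where "p = Re (bil K l l)"
  define q where "q = Re (bil K m m)"
  have pq: "p \<ge> 0" "q \<ge> 0" by (simp_all add: p_def q_def pd_nonneg)
  have ml: "bil K m l = cnj a" by (simp add: a_def bil_cnj[of m l])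
  have e: "bil K l l = of_real p" "bil K m m = of_real q"
    using bil_real[of l] bil_real[of m] by (simp_all add: p_def q_def)
  have *: "0 \<le> p - 2 * t * (cmod a)\<^sup>2 + t\<^sup>2 * (cmod a)\<^sup>2 * q" for t :: real
  proof -
    let ?d = "l @ scale (- of_real t * a) m"
    have "bil K ?d ?d = of_real p - 2 * of_real t * (a * cnj a) + of_real (t\<^sup>2) * (a * cnj a) * of_real q"
      by (simp add: a_def[symmetric] ml e algebra_simps power2_eq_square)
    also have "\<dots> = of_real (p - 2 * t * (cmod a)\<^sup>2 + t\<^sup>2 * (cmod a)\<^sup>2 * q)"
      by (simp add: complex_norm_square[symmetric])
    finally show ?thesis using pd_nonneg[of ?d] by simp
  qed
  show ?thesis
  proof (cases "q = 0")
    case True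
    have "cmod a = 0"
    proof (rule ccontr)
      assume "cmod a \<noteq> 0"
      then have "2 * ((p + 1) / (cmod a)\<^sup>2) * (cmod a)\<^sup>2 = 2 * (p + 1)" by simp
      then show False using *[of "(p + 1) / (cmod a)\<^sup>2"] True pq by simp
    qed
    then show ?thesis using pq by (simp add: a_def[symmetric] p_def[symmetric] q_def[symmetric])
  next
    case False
    then have "q > 0" using pq by simp
    then have "0 \<le> p - (cmod a)\<^sup>2 / q" using *[of "1 / q"] by (simp add: power2_eq_square)
    then show ?thesis using \<open>q > 0\<close>
      by (simp add: a_def[symmetric] p_def[symmetric] q_def[symmetric] field_simps)
  qed
qed

definition knorm :: "(complex \<times> 'x) list \<Rightarrow> real"
  where "knorm l = sqrt (Re (bil K l l))"

lemma knorm_nonneg: "0 \<le> knorm l"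
  by (simp add: knorm_def pd_nonneg)

lemma knorm_cs: "cmod (bil K l m) \<le> knorm l * knorm m"
  using bil_cs[of l m] unfolding knorm_def by (metis real_le_rsqrt real_sqrt_mult)

lemma knorm_add: "knorm (l @ m) \<le> knorm l + knorm m"
proof -
  have "Re (bil K (l @ m) (l @ m)) = Re (bil K l l) + Re (bil K m m) + 2 * Re (bil K l m)"
    using arg_cong[OF bil_cnj[of m l], of Re] by simp
  also have "\<dots> \<le> Re (bil K l l) + Re (bil K m m) + 2 * (knorm l * knorm m)"
    using knorm_cs[of l m] complex_Re_le_cmod[of "bil K l m"] by simp
  also have "\<dots> = (knorm l + knorm m)\<^sup>2"
    by (simp add: knorm_def power2_sum pd_nonneg)
  finally have "sqrt (Re (bil K (l @ m) (l @ m))) \<le> knorm l + knorm m"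
    using knorm_nonneg by (intro real_le_lsqrt) (auto intro: add_nonneg_nonneg pd_nonneg)
  then show ?thesis by (simp add: knorm_def)
qed

lemma knorm_scale: "knorm (scale a l) = cmod a * knorm l"
proof -
  have "bil K (scale a l) (scale a l) = (a * cnj a) * bil K l l"
    by simp
  also have "\<dots> = of_real ((cmod a)\<^sup>2) * bil K l l"
    by (simp only: complex_norm_square)
  finally have "Re (bil K (scale a l) (scale a l)) = (cmod a)\<^sup>2 * Re (bil K l l)"
    by (metis Re_complex_of_real bil_real of_real_mult)
  then show ?thesis by (simp add: knorm_def real_sqrt_mult)
qed

end

lemma pdI: "(\<And>x y. K y x = cnj (K x y)) \<Longrightarrow> (\<And>l. 0 \<le> Re (bil K l l)) \<Longrightarrow> pd K"
  unfolding pd_def by blast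

lemma pd_pullback: "pd K \<Longrightarrow> pd (\<lambda>x y. K (f x) (f y))"
  by (rule pdI, rule pd_sym) (simp_all add: bil_push[symmetric] pd_nonneg)

lemma pd_add: "pd K \<Longrightarrow> pd K' \<Longrightarrow> pd (\<lambda>x y. K x y + K' x y)"
proof (rule pdI)
  assume K: "pd K" and K': "pd K'"
  show "K y x + K' y x = cnj (K x y + K' x y)" for x y
    using pd_sym[OF K, of y x] pd_sym[OF K', of y x] by simp
  show "0 \<le> Re (bil (\<lambda>x y. K x y + K' x y) l l)" for l
    using pd_nonneg[OF K, of l] pd_nonneg[OF K', of l] by (simp add: bil_add_kernel)
qed

lemma pd_zero: "pd (\<lambda>x y. 0)"
  by (rule pdI) (simp_all add: bil_def)

lemma pd_one: "pd (\<lambda>x y :: 'x. 1)"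
proof (rule pdI)
  fix l :: "(complex \<times> 'x) list"
  have "bil (\<lambda>x y. 1) l l = (\<Sum>p\<leftarrow>l. fst p) * cnj (\<Sum>p\<leftarrow>l. fst p)"
  proof -
    have "(\<Sum>q\<leftarrow>l. cnj (fst q)) = cnj (\<Sum>q\<leftarrow>l. fst q)" for l :: "(complex \<times> 'x) list" by (induction l) auto
    then show ?thesis by (simp add: bil_def sum_list_const_mult sum_list_mult_const)
  qed
  also have "\<dots> = of_real ((cmod (\<Sum>p\<leftarrow>l. fst p))\<^sup>2)" by (simp only: complex_norm_square)
  finally show "0 \<le> Re (bil (\<lambda>x y. 1) l l)" by simp
qed simp

lemma pd_sum: "finite A \<Longrightarrow> (\<And>i. i \<in> A \<Longrightarrow> pd (K i)) \<Longrightarrow> pd (\<lambda>x y. \<Sum>i\<in>A. K i x y)"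
  by (induction A rule: finite_induct) (auto intro: pd_add pd_zero)

lemma pd_mult: "0 \<le> r \<Longrightarrow> pd K \<Longrightarrow> pd (\<lambda>x y. of_real r * K x y)"
proof (rule pdI)
  assume r: "0 \<le> r" and K: "pd K"
  show "of_real r * K y x = cnj (of_real r * K x y)" for x y
    using pd_sym[OF K, of y x] by simp
  show "0 \<le> Re (bil (\<lambda>x y. of_real r * K x y) l l)" for l
    using pd_nonneg[OF K, of l] r by (simp add: bil_mult_kernel)
qed

lemma bil_concat: "bil K (concat (map (\<lambda>(c, x). scale c (f x)) l)) (concat (map (\<lambda>(c, x). scale c (f x)) m))
  = bil (\<lambda>x y. bil K (f x) (f y)) l m" (is "bil K (?F l) (?F m) = _")
proof -
  have 1: "bil K (scale (fst p) (f (snd p))) (?F m) = bil (\<lambda>x y. bil K (f x) (f y)) [p] m" for p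
  proof (induction m)
    case (Cons q m)
    obtain d y where q: "q = (d, y)" by fastforce
    show ?case
      using Cons bil_Cons(2)[of "\<lambda>x y. bil K (f x) (f y)" "[p]" q m]
      by (simp add: q bil_def[of _ "[p]" "[(d, y)]"])
  qed simp
  show ?thesis
  proof (induction l)
    case (Cons p l)
    then show ?case
      using 1[of p] bil_Cons(1)[of "\<lambda>x y. bil K (f x) (f y)" p l m] by (cases p) simp
  qed simp
qed

text \<open>\<open>K\<close> is a matrix of inner products of vectors; so is the kernel on the right, with
  combinations of these vectors in their place.\<close>
lemma pd_combination: "pd K \<Longrightarrow> pd (\<lambda>x y. bil K (f x) (f y))"
  by (rule pdI, rule bil_cnj) (simp_all add: bil_concat[symmetric] pd_nonneg)

lemma pd_restrict: "pd K \<Longrightarrow> pd (\<lambda>x y. if P x \<and> P y then K x y else 0)"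
proof -
  assume K: "pd K"
  define f where "f x = (if P x then [(1 :: complex, x)] else [])" for x
  have "(\<lambda>x y. if P x \<and> P y then K x y else 0) = (\<lambda>x y. bil K (f x) (f y))"
    by (auto simp: f_def bil_single fun_eq_iff)
  then show ?thesis using pd_combination[OF K, of f] by simp
qed

text \<open>On a given list the kernel is the sum, over the finitely many values of \<open>\<kappa>\<close>, of the kernel
  \<open>K\<close> cut down to one block.\<close>
lemma pd_block:
  fixes K :: "'x \<Rightarrow> 'x \<Rightarrow> complex"
  assumes K: "pd K"
  shows "pd (\<lambda>x y. if \<kappa> x = \<kappa> y then K x y else 0)" (is "pd ?K")
proof (rule pdI)
  show "?K y x = cnj (?K x y)" for x y using pd_sym[OF K, of y x] by auto
  fix l :: "(complex \<times> 'x) list"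
  define P where "P = \<kappa> ` snd ` set l"
  define f where "f i x = (if \<kappa> x = i then [(1 :: complex, x)] else [])" for i x
  have "pd (\<lambda>x y. \<Sum>i\<in>P. bil K (f i x) (f i y))"
    by (intro pd_sum pd_combination K) (simp add: P_def)
  then have "0 \<le> Re (bil (\<lambda>x y. \<Sum>i\<in>P. bil K (f i x) (f i y)) l l)" by (rule pd_nonneg)
  also have "bil (\<lambda>x y. \<Sum>i\<in>P. bil K (f i x) (f i y)) l l = bil ?K l l"
  proof (rule bil_cong)
    fix x y assume xy: "x \<in> snd ` set l" "y \<in> snd ` set l"
    have "(\<Sum>i\<in>P. bil K (f i x) (f i y)) = (\<Sum>i\<in>P. if i = \<kappa> x then ?K x y else 0)"
      by (intro sum.cong) (auto simp: f_def bil_single)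
    also have "\<dots> = ?K x y" using xy by (simp add: P_def)
    finally show "(\<Sum>i\<in>P. bil K (f i x) (f i y)) = ?K x y" .
  qed
  finally show "0 \<le> Re (bil ?K l l)" .
qed

section \<open>Convergence, orthogonal projection and closed spans in Hilbert spaces\<close>

context hilbert_space
begin

definition nrm :: "'v \<Rightarrow> real"
  where "nrm v = sqrt (Re (ip V v v))"

lemma nrm_nonneg [simp]: "v \<in> carrier V \<Longrightarrow> 0 \<le> nrm v"
  by (simp add: nrm_def ip_nonneg)

lemma nrm_sq: "v \<in> carrier V \<Longrightarrow> ip V v v = of_real ((nrm v)\<^sup>2)"
  using ip_real[of v] ip_nonneg[of v] by (simp add: nrm_def)

lemma Re_nrm_sq: "v \<in> carrier V \<Longrightarrow> Re (ip V v v) = (nrm v)\<^sup>2"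
  by (simp add: nrm_sq)

lemma nrm_cs: "v \<in> carrier V \<Longrightarrow> w \<in> carrier V \<Longrightarrow> cmod (ip V v w) \<le> nrm v * nrm w"
  using cauchy_schwarz[of v w] unfolding nrm_def by (metis real_le_rsqrt real_sqrt_mult)

lemma nrm_add: "v \<in> carrier V \<Longrightarrow> w \<in> carrier V \<Longrightarrow> nrm (v \<oplus>\<^bsub>V\<^esub> w) \<le> nrm v + nrm w"
  unfolding nrm_def by (rule ip_norm_add)

lemma nrm_smult: "v \<in> carrier V \<Longrightarrow> nrm (a \<odot>\<^bsub>V\<^esub> v) = cmod a * nrm v"
proof -
  assume v: "v \<in> carrier V"
  have "ip V (a \<odot>\<^bsub>V\<^esub> v) (a \<odot>\<^bsub>V\<^esub> v) = (a * cnj a) * ip V v v"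
    using v by (simp add: ip_smult ip_smult2 cr)
  also have "\<dots> = of_real ((cmod a)\<^sup>2 * (nrm v)\<^sup>2)"
    using v by (simp only: complex_norm_square nrm_sq of_real_mult)
  finally show ?thesis using v
    by (simp add: nrm_def[of "a \<odot>\<^bsub>V\<^esub> v"] power_mult_distrib[symmetric])
qed

lemma nrm_zero [simp]: "nrm \<zero>\<^bsub>V\<^esub> = 0"
  by (simp add: nrm_def ip_zero)

lemma nrm_eq_zero: "v \<in> carrier V \<Longrightarrow> nrm v = 0 \<Longrightarrow> v = \<zero>\<^bsub>V\<^esub>"
  using nrm_sq[of v] ip_definite[of v] by simp

lemma ip_minus: "\<lbrakk>u \<in> carrier V; v \<in> carrier V; w \<in> carrier V\<rbrakk>
    \<Longrightarrow> ip V (u \<ominus>\<^bsub>V\<^esub> v) w = ip V u w - ip V v w"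
  "\<lbrakk>u \<in> carrier V; v \<in> carrier V; w \<in> carrier V\<rbrakk>
    \<Longrightarrow> ip V w (u \<ominus>\<^bsub>V\<^esub> v) = ip V w u - ip V w v"
  by (simp_all add: a_minus_smult ip_add ip_add2 ip_smult ip_smult2 cr)

lemmas ip_simps = ip_add ip_add2 ip_smult ip_smult2 ip_minus ip_zero cr

lemma minus_zeroI: "v \<in> carrier V \<Longrightarrow> v \<ominus>\<^bsub>V\<^esub> v = \<zero>\<^bsub>V\<^esub>"
  by (simp add: a_minus_def M.r_neg)

lemma ip_eqI:
  assumes "u \<in> carrier V" "w \<in> carrier V" "\<And>z. z \<in> carrier V \<Longrightarrow> ip V u z = ip V w z"
  shows "u = w"
proof -
  have "ip V (u \<ominus>\<^bsub>V\<^esub> w) (u \<ominus>\<^bsub>V\<^esub> w) = 0" using assms by (simp add: ip_minus(1))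
  then have "u \<ominus>\<^bsub>V\<^esub> w = \<zero>\<^bsub>V\<^esub>" using assms by (intro ip_definite) auto
  then show ?thesis using assms minus_eq_zeroD by blast
qed

lemma nrm_minus_sym: "v \<in> carrier V \<Longrightarrow> w \<in> carrier V \<Longrightarrow> nrm (v \<ominus>\<^bsub>V\<^esub> w) = nrm (w \<ominus>\<^bsub>V\<^esub> v)"
  by (simp add: nrm_def ip_minus_sym)

lemma nrm_triangle:
  assumes "u \<in> carrier V" "v \<in> carrier V" "w \<in> carrier V"
  shows "nrm (u \<ominus>\<^bsub>V\<^esub> w) \<le> nrm (u \<ominus>\<^bsub>V\<^esub> v) + nrm (v \<ominus>\<^bsub>V\<^esub> w)"
proof -
  have "u \<ominus>\<^bsub>V\<^esub> w = (u \<ominus>\<^bsub>V\<^esub> v) \<oplus>\<^bsub>V\<^esub> (v \<ominus>\<^bsub>V\<^esub> w)"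
    by (rule ip_eqI) (use assms in \<open>auto simp: ip_simps\<close>)
  then show ?thesis using assms nrm_add by simp
qed

lemma nrm_diff: "u \<in> carrier V \<Longrightarrow> v \<in> carrier V \<Longrightarrow> \<bar>nrm u - nrm v\<bar> \<le> nrm (u \<ominus>\<^bsub>V\<^esub> v)"
proof -
  assume uv: "u \<in> carrier V" "v \<in> carrier V"
  have "u = (u \<ominus>\<^bsub>V\<^esub> v) \<oplus>\<^bsub>V\<^esub> v" "v = (v \<ominus>\<^bsub>V\<^esub> u) \<oplus>\<^bsub>V\<^esub> u"
    by (rule ip_eqI; use uv in \<open>simp add: ip_simps\<close>)+
  then have "nrm u \<le> nrm (u \<ominus>\<^bsub>V\<^esub> v) + nrm v" "nrm v \<le> nrm (v \<ominus>\<^bsub>V\<^esub> u) + nrm u"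
    using nrm_add uv by (metis M.minus_closed)+
  then show ?thesis using nrm_minus_sym uv by auto
qed

definition conv :: "(nat \<Rightarrow> 'v) \<Rightarrow> 'v \<Rightarrow> bool"
  where "conv s l \<longleftrightarrow> (\<forall>n. s n \<in> carrier V) \<and> l \<in> carrier V \<and> (\<lambda>n. nrm (s n \<ominus>\<^bsub>V\<^esub> l)) \<longlonglongrightarrow> 0"

lemma conv_ip:
  assumes "conv s l" "w \<in> carrier V"
  shows "(\<lambda>n. ip V (s n) w) \<longlonglongrightarrow> ip V l w" "(\<lambda>n. ip V w (s n)) \<longlonglongrightarrow> ip V w l"
proof -
  have c: "s n \<in> carrier V" "l \<in> carrier V" for n using assms by (auto simp: conv_def)
  have 0: "(\<lambda>n. nrm (s n \<ominus>\<^bsub>V\<^esub> l) * nrm w) \<longlonglongrightarrow> 0"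
    using assms by (auto simp: conv_def intro: tendsto_mult_left_zero)
  have "(\<lambda>n. ip V (s n) w - ip V l w) \<longlonglongrightarrow> 0"
    by (rule Lim_null_comparison[OF _ 0])
       (use nrm_cs[of "s _ \<ominus>\<^bsub>V\<^esub> l" w] c assms in \<open>simp add: ip_minus\<close>)
  then show 1: "(\<lambda>n. ip V (s n) w) \<longlonglongrightarrow> ip V l w" by (simp add: LIM_zero_iff)
  have "ip V w (s n) = cnj (ip V (s n) w)" "ip V w l = cnj (ip V l w)" for n
    using ip_cnj[of w "s n"] ip_cnj[of w l] c assms by auto
  then show "(\<lambda>n. ip V w (s n)) \<longlonglongrightarrow> ip V w l" using tendsto_cnj[OF 1] by simp
qed

lemma conv_nrm:
  assumes "conv s l"
  shows "(\<lambda>n. nrm (s n)) \<longlonglongrightarrow> nrm l"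
proof -
  have c: "s n \<in> carrier V" "l \<in> carrier V" for n using assms by (auto simp: conv_def)
  have 0: "(\<lambda>n. nrm (s n \<ominus>\<^bsub>V\<^esub> l)) \<longlonglongrightarrow> 0" using assms by (simp add: conv_def)
  have "(\<lambda>n. nrm (s n) - nrm l) \<longlonglongrightarrow> 0"
    by (rule Lim_null_comparison[OF _ 0]) (use nrm_diff c in simp)
  then show ?thesis by (simp add: LIM_zero_iff)
qed

lemma conv_unique: "conv s l \<Longrightarrow> conv s l' \<Longrightarrow> l = l'"
  using LIMSEQ_unique[OF conv_ip(1) conv_ip(1)] by (intro ip_eqI) (auto simp: conv_def)

lemma limitin_iff_conv:
  assumes "range s \<subseteq> carrier V"
  shows "limitin (Metric_space.mtopology (carrier V) (ip_dist V)) s l sequentially \<longleftrightarrow> conv s l"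
proof -
  interpret Ms: Metric_space "carrier V" "ip_dist V" by (rule Metric_space)
  have sr: "s n \<in> carrier V" for n using assms by auto
  have "(\<lambda>n. nrm (s n \<ominus>\<^bsub>V\<^esub> l)) \<longlonglongrightarrow> 0 \<longleftrightarrow> (\<forall>\<epsilon>>0. \<forall>\<^sub>F n in sequentially. nrm (s n \<ominus>\<^bsub>V\<^esub> l) < \<epsilon>)"
    if "l \<in> carrier V" using that sr by (simp add: tendsto_iff)
  then show ?thesis using sr
    by (auto simp: Ms.limitin_metric conv_def ip_dist_def nrm_def)
qed

lemma cauchy_conv:
  assumes s: "\<And>n. s n \<in> carrier V"
    and c: "\<And>\<epsilon>. \<epsilon> > 0 \<Longrightarrow> \<exists>N. \<forall>m\<ge>N. \<forall>n\<ge>N. nrm (s m \<ominus>\<^bsub>V\<^esub> s n) < \<epsilon>"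
  shows "\<exists>l. conv s l"
proof -
  interpret Ms: Metric_space "carrier V" "ip_dist V" by (rule Metric_space)
  have "Ms.MCauchy s"
    using s c by (auto simp: Ms.MCauchy_def ip_dist_def nrm_def)
  then obtain l where "limitin Ms.mtopology s l sequentially"
    using complete unfolding Ms.mcomplete_def by blast
  then show ?thesis using limitin_iff_conv[of s l] s by (auto simp: image_subset_iff)
qed

lemma closed_subspace_conv: "closed_subspace W V \<Longrightarrow> (\<And>n. s n \<in> W) \<Longrightarrow> conv s l \<Longrightarrow> l \<in> W"
proof -
  interpret Ms: Metric_space "carrier V" "ip_dist V" by (rule Metric_space)
  assume W: "closed_subspace W V" and s: "\<And>n. s n \<in> W" and l: "conv s l"
  have "range s \<subseteq> carrier V" using l by (auto simp: conv_def)
  then have "limitin Ms.mtopology s l sequentially" using limitin_iff_conv l by blast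
  moreover have "range s \<subseteq> W" using s by blast
  ultimately show "l \<in> W"
    using W unfolding closed_subspace_def Ms.metric_closedin_iff_sequentially_closed by blast
qed

lemma closed_subspaceD:
  assumes "closed_subspace W V"
  shows "W \<subseteq> carrier V" "\<zero>\<^bsub>V\<^esub> \<in> W" "\<lbrakk>u \<in> W; v \<in> W\<rbrakk> \<Longrightarrow> u \<oplus>\<^bsub>V\<^esub> v \<in> W" "u \<in> W \<Longrightarrow> a \<odot>\<^bsub>V\<^esub> u \<in> W"
    "\<lbrakk>u \<in> W; v \<in> W\<rbrakk> \<Longrightarrow> u \<ominus>\<^bsub>V\<^esub> v \<in> W"
proof -
  have W: "submodule W complex_ring V" using assms by (simp add: closed_subspace_def)
  note E = submoduleE[OF W]
  show 1: "W \<subseteq> carrier V" by (rule E)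
  show "\<zero>\<^bsub>V\<^esub> \<in> W" using submodule.axioms(1)[OF W] subgroup.one_closed by fastforce
  show 2: "\<lbrakk>u \<in> W; v \<in> W\<rbrakk> \<Longrightarrow> u \<oplus>\<^bsub>V\<^esub> v \<in> W" for u v by (rule E(5))
  show 3: "u \<in> W \<Longrightarrow> a \<odot>\<^bsub>V\<^esub> u \<in> W" for a u using E(4)[of a u] by simp
  show "\<lbrakk>u \<in> W; v \<in> W\<rbrakk> \<Longrightarrow> u \<ominus>\<^bsub>V\<^esub> v \<in> W" using 1 2 3 by (simp add: a_minus_smult subset_iff)
qed

lemma closed_subspaceI:
  assumes "W \<subseteq> carrier V" "\<zero>\<^bsub>V\<^esub> \<in> W" "\<And>u v. \<lbrakk>u \<in> W; v \<in> W\<rbrakk> \<Longrightarrow> u \<oplus>\<^bsub>V\<^esub> v \<in> W"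
    "\<And>a u. u \<in> W \<Longrightarrow> a \<odot>\<^bsub>V\<^esub> u \<in> W" "\<And>s l. (\<And>n. s n \<in> W) \<Longrightarrow> conv s l \<Longrightarrow> l \<in> W"
  shows "closed_subspace W V"
proof -
  interpret Ms: Metric_space "carrier V" "ip_dist V" by (rule Metric_space)
  have "\<ominus>\<^bsub>V\<^esub> a \<in> W" if "a \<in> W" for a
    using that assms(1) assms(4)[of a "-1"] a_minus_smult[of "\<zero>\<^bsub>V\<^esub>" a] cr[of a "-1"]
    by (auto simp: a_minus_def)
  then have "submodule W complex_ring V" using assms by (intro submoduleI) auto
  moreover have "closedin Ms.mtopology W"
    unfolding Ms.metric_closedin_iff_sequentially_closed
  proof (intro conjI allI impI)
    fix s l assume a: "range s \<subseteq> W \<and> limitin Ms.mtopology s l sequentially"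
    then have "range s \<subseteq> carrier V" using assms(1) by blast
    then have "conv s l" using a limitin_iff_conv by blast
    then show "l \<in> W" using a assms(5)[of s l] by auto
  qed (rule assms(1))
  ultimately show ?thesis by (simp add: closed_subspace_def)
qed

primrec comb :: "('i \<Rightarrow> 'v) \<Rightarrow> (complex \<times> 'i) list \<Rightarrow> 'v"
  where "comb x [] = \<zero>\<^bsub>V\<^esub>"
  | "comb x (p # l) = (fst p \<odot>\<^bsub>V\<^esub> x (snd p)) \<oplus>\<^bsub>V\<^esub> comb x l"

definition total :: "('i \<Rightarrow> 'v) \<Rightarrow> bool"
  where "total x \<longleftrightarrow> (\<forall>u\<in>carrier V. \<forall>\<epsilon>>0. \<exists>l. nrm (u \<ominus>\<^bsub>V\<^esub> comb x l) < \<epsilon>)"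

lemma comb_in: "closed_subspace W V \<Longrightarrow> (\<And>i. x i \<in> W) \<Longrightarrow> comb x l \<in> W"
  by (induction l) (auto intro: closed_subspaceD)

context
  fixes x :: "'i \<Rightarrow> 'v"
  assumes x: "\<And>i. x i \<in> carrier V"
begin

lemma comb_closed [simp]: "comb x l \<in> carrier V"
  by (induction l) (auto simp: x cr)

lemma ip_comb: "w \<in> carrier V \<Longrightarrow> ip V (comb x l) w = (\<Sum>p\<leftarrow>l. fst p * ip V (x (snd p)) w)"
  by (induction l) (auto simp: ip_simps x)

lemma comb_append: "comb x (l @ m) = comb x l \<oplus>\<^bsub>V\<^esub> comb x m"
  by (rule ip_eqI) (auto simp: ip_comb ip_add x)

lemma comb_scale: "comb x (scale a l) = a \<odot>\<^bsub>V\<^esub> comb x l"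
  by (rule ip_eqI) (auto simp: ip_comb ip_smult cr x o_def sum_list_const_mult[symmetric] mult.assoc)

lemma comb_minus: "comb x (l @ scale (-1) m) = comb x l \<ominus>\<^bsub>V\<^esub> comb x m"
  by (simp add: comb_append comb_scale a_minus_smult)

end

lemma ip_comb_comb:
  assumes x: "\<And>i. x i \<in> carrier V" and y: "\<And>i. y i \<in> carrier V"
  shows "ip V (comb x l) (comb y m) = bil (\<lambda>i j. ip V (x i) (y j)) l m"
proof -
  have "ip V (x i) (comb y m) = (\<Sum>q\<leftarrow>m. cnj (fst q) * ip V (x i) (y (snd q)))" for i
    by (induction m) (auto simp: ip_simps x y comb_closed)
  then show ?thesis
    by (simp add: ip_comb x y comb_closed bil_def sum_list_const_mult[symmetric] mult.assoc)
qed

lemma pd_gram: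
  assumes "\<And>i. x i \<in> carrier V"
  shows "pd (\<lambda>i j. ip V (x i) (x j))"
proof (rule pdI)
  show "ip V (x j) (x i) = cnj (ip V (x i) (x j))" for i j by (rule ip_cnj) (rule assms)+
qed (simp add: ip_comb_comb[symmetric] assms ip_nonneg comb_closed)

lemma quadratic_nonneg_imp_zero:
  fixes A N :: real
  assumes "\<And>t. 0 \<le> 2 * t * A + t\<^sup>2 * N" "0 \<le> N"
  shows "A = 0"
proof (rule ccontr)
  assume A: "A \<noteq> 0"
  define s where "s = - A / (N + 1)"
  have s: "A = - s * (N + 1)" "s \<noteq> 0" using A assms(2) by (simp_all add: s_def)
  have "0 \<le> - (s\<^sup>2 * (N + 2))"
    using assms(1)[of s] unfolding s(1) by (simp add: algebra_simps power2_eq_square)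
  moreover have "0 < s\<^sup>2 * (N + 2)" using s(2) assms(2) by simp
  ultimately show False by simp
qed

text \<open>The Riesz representation theorem as a moment problem: the vector is the limit of a minimizing
  sequence for \<open>|u|\<^sup>2 - 2 Re L(u)\<close> over the combinations \<open>u\<close> of the \<open>x i\<close>, where \<open>L\<close> is the functional
  with the values \<open>f i\<close>. The parallelogram law makes the sequence Cauchy, and the vanishing first
  variation at the limit is the assertion.\<close>
lemma moment_riesz:
  fixes x :: "'i \<Rightarrow> 'v"
  assumes W: "closed_subspace W V" and xW: "\<And>i. x i \<in> W" and B: "0 \<le> B"
    and bound: "\<And>l. cmod (\<Sum>p\<leftarrow>l. fst p * f (snd p)) \<le> B * nrm (comb x l)"
  shows "\<exists>w\<in>W. \<forall>i. ip V (x i) w = f i"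
proof -
  have x: "x i \<in> carrier V" for i using xW closed_subspaceD(1)[OF W] by blast
  define L where "L l = (\<Sum>p\<leftarrow>l. fst p * f (snd p))" for l
  have L: "L (l @ m) = L l + L m" "L (scale a l) = a * L l" for a l m
    by (simp_all add: L_def o_def sum_list_const_mult[symmetric] mult.assoc)
  define K where "K i j = ip V (x i) (x j)" for i j
  have K: "pd K" unfolding K_def by (rule pd_gram) (rule x)
  have bK: "bil K l m = ip V (comb x l) (comb x m)" for l m
    unfolding K_def by (simp add: ip_comb_comb x)
  define q where "q l = Re (bil K l l) - 2 * Re (L l)" for l
  have qlow: "- B\<^sup>2 \<le> q l" for l
  proof -
    have "Re (L l) \<le> B * nrm (comb x l)"
      using bound[of l] complex_Re_le_cmod[of "L l"] by (simp add: L_def)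
    moreover have "Re (bil K l l) = (nrm (comb x l))\<^sup>2" by (simp add: bK Re_nrm_sq x)
    moreover have "0 \<le> (nrm (comb x l) - B)\<^sup>2" by simp
    ultimately show ?thesis unfolding q_def power2_diff by (simp add: mult_ac)
  qed
  define d where "d = Inf (range q)"
  have bdd: "bdd_below (range q)" using qlow by (intro bdd_belowI[of _ "- B\<^sup>2"]) auto
  have dq: "d \<le> q l" for l unfolding d_def by (rule cInf_lower[OF _ bdd]) auto
  have "\<exists>l. q l < d + 1 / Suc n" for n
    using cInf_lessD[of "range q" "d + 1 / Suc n"] by (auto simp: d_def)
  then obtain l where l: "q (l n) < d + 1 / Suc n" for n by metis
  define s where "s n = comb x (l n)" for n
  have sc: "s n \<in> carrier V" for n by (simp add: s_def x)
  have par: "(nrm (s m \<ominus>\<^bsub>V\<^esub> s n))\<^sup>2 \<le> 2 / Suc m + 2 / Suc n" for m n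
  proof -
    have "(nrm (s m \<ominus>\<^bsub>V\<^esub> s n))\<^sup>2 = Re (bil K (l m @ scale (-1) (l n)) (l m @ scale (-1) (l n)))"
      by (simp only: bK s_def comb_minus x Re_nrm_sq comb_closed M.minus_closed)
    also have "\<dots> = 2 * q (l m) + 2 * q (l n) - 4 * q (scale (1/2) (l m @ l n))"
      by (simp add: q_def L algebra_simps)
    finally show ?thesis using l[of m] l[of n] dq[of "scale (1/2) (l m @ l n)"] by simp
  qed
  have "\<exists>w. conv s w"
  proof (rule cauchy_conv[OF sc])
    fix e :: real assume e: "e > 0"
    have "\<exists>N. 4 / e\<^sup>2 < Suc N" by (meson lessI less_trans of_nat_less_iff reals_Archimedean2)
    then obtain N where N: "4 / e\<^sup>2 < Suc N" ..
    have "nrm (s m \<ominus>\<^bsub>V\<^esub> s n) < e" if "m \<ge> N" "n \<ge> N" for m n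
    proof -
      have "2 / Suc m + 2 / Suc n \<le> 2 / Suc N + 2 / Suc N"
        using that by (intro add_mono divide_left_mono) auto
      also have "\<dots> = 4 / Suc N" by simp
      also have "\<dots> < e\<^sup>2"
        using N e by (simp add: pos_divide_less_eq pos_less_divide_eq mult.commute del: of_nat_Suc)
      finally show ?thesis using par[of m n] e by (intro power2_less_imp_less[of _ e]) auto
    qed
    then show "\<exists>N. \<forall>m\<ge>N. \<forall>n\<ge>N. nrm (s m \<ominus>\<^bsub>V\<^esub> s n) < e" by blast
  qed
  then obtain w where w: "conv s w" ..
  have "w \<in> W"
    by (rule closed_subspace_conv[OF W _ w]) (simp add: s_def comb_in[OF W xW])
  have wc: "w \<in> carrier V" using w by (simp add: conv_def)
  have qlim: "(\<lambda>n. q (l n)) \<longlonglongrightarrow> d"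
  proof (rule tendsto_sandwich[of "\<lambda>_. d" _ _ "\<lambda>n. d + 1 / Suc n"])
    show "(\<lambda>n. d + 1 / Suc n) \<longlonglongrightarrow> d"
      using tendsto_add[OF tendsto_const[of d] lim_1_over_n[THEN LIMSEQ_Suc]] by simp
  qed (use dq l in \<open>auto intro!: always_eventually less_imp_le\<close>)
  have key: "Re (ip V w (comb x m)) = Re (L m)" for m
  proof -
    have "0 \<le> 2 * t * (Re (ip V w (comb x m)) - Re (L m)) + t\<^sup>2 * (nrm (comb x m))\<^sup>2" for t
    proof -
      have "d \<le> q (l n) + 2 * t * (Re (ip V (s n) (comb x m)) - Re (L m)) + t\<^sup>2 * (nrm (comb x m))\<^sup>2" for n
      proof -
        have "Re (bil K m (l n)) = Re (bil K (l n) m)"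
          using arg_cong[OF bil_cnj[OF K, of m "l n"], of Re] by simp
        then have "q (l n @ scale (of_real t) m) = q (l n) + 2 * t * (Re (bil K (l n) m) - Re (L m)) + t\<^sup>2 * Re (bil K m m)"
          by (simp add: q_def L algebra_simps power2_eq_square)
        moreover have "Re (bil K m m) = (nrm (comb x m))\<^sup>2" by (simp add: bK Re_nrm_sq x)
        ultimately show ?thesis
          using dq[of "l n @ scale (of_real t) m"] by (simp add: bK s_def)
      qed
      moreover have "(\<lambda>n. q (l n) + 2 * t * (Re (ip V (s n) (comb x m)) - Re (L m)) + t\<^sup>2 * (nrm (comb x m))\<^sup>2)
        \<longlonglongrightarrow> d + 2 * t * (Re (ip V w (comb x m)) - Re (L m)) + t\<^sup>2 * (nrm (comb x m))\<^sup>2"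
        by (intro tendsto_intros qlim conv_ip w) (simp add: x)
      ultimately have "d \<le> d + 2 * t * (Re (ip V w (comb x m)) - Re (L m)) + t\<^sup>2 * (nrm (comb x m))\<^sup>2"
        by (intro LIMSEQ_le_const) auto
      then show ?thesis by simp
    qed
    then show ?thesis using quadratic_nonneg_imp_zero[of "Re (ip V w (comb x m)) - Re (L m)"] by force
  qed
  have "ip V (x i) w = f i" for i
  proof -
    have "Re (ip V w (x i)) = Re (f i)"
      using key[of "[(1, i)]"] by (simp add: L_def ip_simps x wc)
    moreover have "Im (ip V w (x i)) = - Im (f i)"
      using key[of "[(\<i>, i)]"] by (simp add: L_def ip_simps x wc)
    ultimately show ?thesis using ip_cnj[OF x wc, of i] by (simp add: complex_eq_iff)
  qed
  then show ?thesis using \<open>w \<in> W\<close> by blast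
qed

text \<open>The moment problem for all vectors of \<open>W\<close>, with the inner products against \<open>v\<close> as moments.\<close>
lemma projection:
  assumes W: "closed_subspace W V" and v: "v \<in> carrier V"
  shows "\<exists>w\<in>W. \<forall>u\<in>W. ip V u (v \<ominus>\<^bsub>V\<^esub> w) = 0"
proof -
  define x where "x i = (if i \<in> W then i else \<zero>\<^bsub>V\<^esub>)" for i
  have xW: "x i \<in> W" for i using closed_subspaceD(2)[OF W] by (simp add: x_def)
  have x: "x i \<in> carrier V" for i using xW closed_subspaceD(1)[OF W] by blast
  have "\<exists>w\<in>W. \<forall>i. ip V (x i) w = ip V (x i) v"
  proof (rule moment_riesz[OF W xW])
    show "cmod (\<Sum>p\<leftarrow>l. fst p * ip V (x (snd p)) v) \<le> nrm v * nrm (comb x l)" for l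
      using nrm_cs[of "comb x l" v] x v by (simp add: ip_comb mult.commute)
  qed (use v in auto)
  then obtain w where w: "w \<in> W" "\<And>i. ip V (x i) w = ip V (x i) v" by blast
  have "ip V u (v \<ominus>\<^bsub>V\<^esub> w) = 0" if "u \<in> W" for u
    using w(2)[of u] subsetD[OF closed_subspaceD(1)[OF W] w(1)]
      subsetD[OF closed_subspaceD(1)[OF W] that] that v by (simp add: ip_minus(2) x_def)
  then show ?thesis using w(1) by blast
qed

definition cspan :: "('i \<Rightarrow> 'v) \<Rightarrow> 'v set"
  where "cspan x = {u \<in> carrier V. \<forall>\<epsilon>>0. \<exists>l. nrm (u \<ominus>\<^bsub>V\<^esub> comb x l) < \<epsilon>}"

lemma total_iff: "total x \<longleftrightarrow> cspan x = carrier V"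
  by (auto simp: total_def cspan_def)

lemma cspan_base:
  assumes "\<And>i. x i \<in> carrier V"
  shows "x i \<in> cspan x"
proof -
  have "comb x [(1, i)] = x i" using assms smult_one[of "x i"] by simp
  then have "nrm (x i \<ominus>\<^bsub>V\<^esub> comb x [(1, i)]) = 0" using assms minus_zeroI by simp
  then show ?thesis unfolding cspan_def using assms[of i]
    by (intro CollectI conjI allI impI exI[of _ "[(1, i)]"]) simp_all
qed

lemma closed_subspace_cspan:
  assumes x: "\<And>i. x i \<in> carrier V"
  shows "closed_subspace (cspan x) V"
proof (rule closed_subspaceI)
  have xc: "comb x l \<in> carrier V" for l by (rule comb_closed) (rule x)
  show "\<zero>\<^bsub>V\<^esub> \<in> cspan x"
    using minus_zeroI[of "\<zero>\<^bsub>V\<^esub>"] by (auto simp: cspan_def intro!: exI[of _ "[]"])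
  show "u \<oplus>\<^bsub>V\<^esub> v \<in> cspan x" if uvs: "u \<in> cspan x" "v \<in> cspan x" for u v
    unfolding cspan_def
  proof (intro CollectI conjI allI impI)
    fix e :: real assume e: "e > 0"
    have uv: "u \<in> carrier V" "v \<in> carrier V" using uvs by (auto simp: cspan_def)
    have "e / 2 > 0" using e by simp
    then obtain l m where lm: "nrm (u \<ominus>\<^bsub>V\<^esub> comb x l) < e / 2" "nrm (v \<ominus>\<^bsub>V\<^esub> comb x m) < e / 2"
      using uvs unfolding cspan_def by blast
    have "(u \<oplus>\<^bsub>V\<^esub> v) \<ominus>\<^bsub>V\<^esub> comb x (l @ m) = (u \<ominus>\<^bsub>V\<^esub> comb x l) \<oplus>\<^bsub>V\<^esub> (v \<ominus>\<^bsub>V\<^esub> comb x m)"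
      by (rule ip_eqI) (use uv xc x in \<open>auto simp: ip_simps comb_append\<close>)
    then have "nrm ((u \<oplus>\<^bsub>V\<^esub> v) \<ominus>\<^bsub>V\<^esub> comb x (l @ m)) < e"
      using nrm_add[of "u \<ominus>\<^bsub>V\<^esub> comb x l" "v \<ominus>\<^bsub>V\<^esub> comb x m"] uv xc lm by simp
    then show "\<exists>l. nrm ((u \<oplus>\<^bsub>V\<^esub> v) \<ominus>\<^bsub>V\<^esub> comb x l) < e" ..
  qed (use uvs in \<open>auto simp: cspan_def\<close>)
  show "a \<odot>\<^bsub>V\<^esub> u \<in> cspan x" if us: "u \<in> cspan x" for a u
    unfolding cspan_def
  proof (intro CollectI conjI allI impI)
    fix e :: real assume e: "e > 0"
    have u: "u \<in> carrier V" using us by (auto simp: cspan_def)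
    have "e / (cmod a + 1) > 0" using e by (simp add: add_nonneg_pos)
    then obtain l where l: "nrm (u \<ominus>\<^bsub>V\<^esub> comb x l) < e / (cmod a + 1)"
      using us unfolding cspan_def by blast
    have "(a \<odot>\<^bsub>V\<^esub> u) \<ominus>\<^bsub>V\<^esub> comb x (scale a l) = a \<odot>\<^bsub>V\<^esub> (u \<ominus>\<^bsub>V\<^esub> comb x l)"
      by (rule ip_eqI) (use u xc x in \<open>auto simp: ip_simps comb_scale algebra_simps\<close>)
    then have "nrm ((a \<odot>\<^bsub>V\<^esub> u) \<ominus>\<^bsub>V\<^esub> comb x (scale a l)) = cmod a * nrm (u \<ominus>\<^bsub>V\<^esub> comb x l)"
      using nrm_smult u xc by simp
    also have "\<dots> \<le> (cmod a + 1) * nrm (u \<ominus>\<^bsub>V\<^esub> comb x l)"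
      using u xc by (intro mult_right_mono) auto
    also have "\<dots> < e" using l by (simp add: pos_less_divide_eq add_nonneg_pos mult.commute)
    finally show "\<exists>l. nrm ((a \<odot>\<^bsub>V\<^esub> u) \<ominus>\<^bsub>V\<^esub> comb x l) < e" ..
  qed (use us cr in \<open>auto simp: cspan_def\<close>)
  show "u \<in> cspan x" if s: "\<And>n. s n \<in> cspan x" and u: "conv s u" for s u
    unfolding cspan_def
  proof (intro CollectI conjI allI impI)
    show uc: "u \<in> carrier V" using u by (simp add: conv_def)
    fix e :: real assume e: "e > 0"
    have "\<forall>\<^sub>F n in sequentially. nrm (s n \<ominus>\<^bsub>V\<^esub> u) < e / 2"
      using u e by (intro order_tendstoD(2)[of _ 0]) (auto simp: conv_def)
    then obtain n where n: "nrm (s n \<ominus>\<^bsub>V\<^esub> u) < e / 2" by (auto simp: eventually_sequentially)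
    have sc: "s n \<in> carrier V" using s by (simp add: cspan_def)
    have "e / 2 > 0" using e by simp
    then obtain l where l: "nrm (s n \<ominus>\<^bsub>V\<^esub> comb x l) < e / 2"
      using s[of n] unfolding cspan_def by blast
    have "nrm (u \<ominus>\<^bsub>V\<^esub> comb x l) < e"
      using nrm_triangle[OF uc sc xc[of l]] nrm_minus_sym[OF uc sc] n l by simp
    then show "\<exists>l. nrm (u \<ominus>\<^bsub>V\<^esub> comb x l) < e" ..
  qed
qed (auto simp: cspan_def)

lemma cspan_seq:
  assumes x: "\<And>i. x i \<in> carrier V" and u: "u \<in> cspan x"
  obtains l where "conv (\<lambda>n. comb x (l n)) u"
proof -
  have uc: "u \<in> carrier V" using u by (simp add: cspan_def)
  have "\<exists>l. nrm (u \<ominus>\<^bsub>V\<^esub> comb x l) < 1 / Suc n" for n using u by (simp add: cspan_def)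
  then obtain l where l: "nrm (u \<ominus>\<^bsub>V\<^esub> comb x (l n)) < 1 / Suc n" for n by metis
  have "(\<lambda>n. nrm (comb x (l n) \<ominus>\<^bsub>V\<^esub> u)) \<longlonglongrightarrow> 0"
  proof (rule Lim_null_comparison[OF _ lim_1_over_n[THEN LIMSEQ_Suc]])
    show "\<forall>\<^sub>F n in sequentially. norm (nrm (comb x (l n) \<ominus>\<^bsub>V\<^esub> u)) \<le> 1 / of_nat (Suc n)"
      using l uc x less_imp_le[OF l] by (simp add: nrm_minus_sym comb_closed)
  qed
  then show ?thesis using uc x by (intro that[of l]) (simp add: conv_def comb_closed)
qed

lemma cspan_ip_eq:
  assumes x: "\<And>i. x i \<in> carrier V" and "u \<in> cspan x" "w \<in> carrier V" "w' \<in> carrier V"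
    and eq: "\<And>i. ip V (x i) w = ip V (x i) w'"
  shows "ip V u w = ip V u w'"
proof -
  obtain l where l: "conv (\<lambda>n. comb x (l n)) u" using cspan_seq[of x u] x assms(2) by blast
  have "ip V (comb x (l n)) w = ip V (comb x (l n)) w'" for n
    by (simp add: ip_comb x assms eq)
  then show ?thesis
    using LIMSEQ_unique[OF conv_ip(1)[OF l assms(3)]] conv_ip(1)[OF l assms(4)] by simp
qed

lemma total_eqI:
  assumes "\<And>i. x i \<in> carrier V" "total x" "w \<in> carrier V" "w' \<in> carrier V"
    and eq: "\<And>i. ip V (x i) w = ip V (x i) w'"
  shows "w = w'"
proof (rule ip_eqI)
  fix z assume z: "z \<in> carrier V"
  have "ip V z w = ip V z w'" using cspan_ip_eq[of x z w w'] assms z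
    by (simp add: total_iff)
  then show "ip V w z = ip V w' z" using ip_cnj[of w z] ip_cnj[of w' z] assms z by simp
qed (use assms in auto)

lemma total_nrm_le:
  assumes x: "\<And>i. x i \<in> carrier V" and "total x" and z: "z \<in> carrier V"
    and B: "0 \<le> B" and b: "\<And>l. cmod (ip V (comb x l) z) \<le> B * nrm (comb x l)"
  shows "nrm z \<le> B"
proof -
  obtain l where l: "conv (\<lambda>n. comb x (l n)) z"
    using cspan_seq[of x z] x z assms(2) by (auto simp: total_iff)
  have "cmod (ip V z z) \<le> B * nrm z"
    by (rule LIMSEQ_le[OF tendsto_norm[OF conv_ip(1)[OF l z]] tendsto_mult_left[OF conv_nrm[OF l]]])
       (use b in auto)
  then have "nrm z * nrm z \<le> B * nrm z" using z by (simp add: nrm_sq power2_eq_square norm_mult)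
  then show ?thesis using z B
    by (cases "nrm z = 0") (auto simp: mult_le_cancel_right less_le)
qed

end

section \<open>Schur's lemma for bounded symmetric operators\<close>

context hilbert_space
begin

lemma nrm_minus_le: "u \<in> carrier V \<Longrightarrow> w \<in> carrier V \<Longrightarrow> nrm (u \<ominus>\<^bsub>V\<^esub> w) \<le> nrm u + nrm w"
  using nrm_add[of u "(-1) \<odot>\<^bsub>V\<^esub> w"] by (simp add: a_minus_smult nrm_smult cr)

text \<open>Symmetry implies linearity (\<open>symop_bddlin\<close>).\<close>
definition symop :: "real \<Rightarrow> ('v \<Rightarrow> 'v) \<Rightarrow> bool"
  where "symop C T \<longleftrightarrow> (\<forall>u\<in>carrier V. T u \<in> carrier V \<and> nrm (T u) \<le> C * nrm u) \<and>
    (\<forall>u\<in>carrier V. \<forall>w\<in>carrier V. ip V (T u) w = ip V u (T w))"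

definition bddlin :: "('v \<Rightarrow> 'v) \<Rightarrow> bool"
  where "bddlin T \<longleftrightarrow> (\<forall>u\<in>carrier V. T u \<in> carrier V) \<and>
    (\<forall>u\<in>carrier V. \<forall>w\<in>carrier V. T (u \<oplus>\<^bsub>V\<^esub> w) = T u \<oplus>\<^bsub>V\<^esub> T w) \<and>
    (\<forall>a. \<forall>u\<in>carrier V. T (a \<odot>\<^bsub>V\<^esub> u) = a \<odot>\<^bsub>V\<^esub> T u) \<and>
    (\<exists>C. \<forall>u\<in>carrier V. nrm (T u) \<le> C * nrm u)"

lemma symopD:
  assumes "symop C T" "u \<in> carrier V"
  shows "T u \<in> carrier V" "nrm (T u) \<le> C * nrm u" "w \<in> carrier V \<Longrightarrow> ip V (T u) w = ip V u (T w)"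
  using assms by (auto simp: symop_def)

lemma bddlinD:
  assumes "bddlin T" "u \<in> carrier V"
  shows "T u \<in> carrier V" "T (a \<odot>\<^bsub>V\<^esub> u) = a \<odot>\<^bsub>V\<^esub> T u"
    "w \<in> carrier V \<Longrightarrow> T (u \<oplus>\<^bsub>V\<^esub> w) = T u \<oplus>\<^bsub>V\<^esub> T w"
    "w \<in> carrier V \<Longrightarrow> T (u \<ominus>\<^bsub>V\<^esub> w) = T u \<ominus>\<^bsub>V\<^esub> T w"
  using assms by (auto simp: bddlin_def a_minus_smult cr)

lemma symop_bddlin:
  assumes T: "symop C T"
  shows "bddlin T"
  unfolding bddlin_def
proof (intro conjI ballI allI)
  note D = symopD[OF T]
  show "T (u \<oplus>\<^bsub>V\<^esub> w) = T u \<oplus>\<^bsub>V\<^esub> T w" if "u \<in> carrier V" "w \<in> carrier V" for u w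
    by (rule ip_eqI) (use that D(1) in \<open>simp_all add: ip_simps D(3)\<close>)
  show "T (a \<odot>\<^bsub>V\<^esub> u) = a \<odot>\<^bsub>V\<^esub> T u" if "u \<in> carrier V" for a u
    by (rule ip_eqI) (use that D(1) in \<open>simp_all add: ip_simps D(3)\<close>)
qed (use T in \<open>auto simp: symop_def\<close>)

lemma unitary_nrm: "U \<in> unitary_maps V V \<Longrightarrow> u \<in> carrier V \<Longrightarrow> nrm (U u) = nrm u"
  by (simp add: nrm_def unitary_mapsD(4))

lemma unitary_bddlin: "U \<in> unitary_maps V V \<Longrightarrow> bddlin U"
  unfolding bddlin_def
  by (intro conjI exI[of _ 1]) (auto simp: unitary_nrm unitary_mapsD(1,2) intro: unitary_mapsD(3))

lemma bddlin_conv: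
  assumes T: "bddlin T" and c: "conv s l"
  shows "conv (\<lambda>n. T (s n)) (T l)"
proof -
  have sl: "s n \<in> carrier V" "l \<in> carrier V" for n using c by (auto simp: conv_def)
  obtain C where C: "\<And>u. u \<in> carrier V \<Longrightarrow> nrm (T u) \<le> C * nrm u"
    using T unfolding bddlin_def by blast
  have 0: "(\<lambda>n. C * nrm (s n \<ominus>\<^bsub>V\<^esub> l)) \<longlonglongrightarrow> 0"
    using c by (auto simp: conv_def intro: tendsto_mult_right_zero)
  have "(\<lambda>n. nrm (T (s n) \<ominus>\<^bsub>V\<^esub> T l)) \<longlonglongrightarrow> 0"
  proof (rule Lim_null_comparison[OF always_eventually 0], rule allI)
    fix n
    show "norm (nrm (T (s n) \<ominus>\<^bsub>V\<^esub> T l)) \<le> C * nrm (s n \<ominus>\<^bsub>V\<^esub> l)"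
      using C[of "s n \<ominus>\<^bsub>V\<^esub> l"] sl bddlinD(1,4)[OF T] by simp
  qed
  then show ?thesis using sl bddlinD(1)[OF T] by (simp add: conv_def)
qed

text \<open>The absolute value of \<open>X\<close>, without spectral theory. Put \<open>B = 1 - X\<^sup>2\<close>. The iteration
  \<open>Y (n + 1) = (B + (Y n)\<^sup>2) / 2\<close> converges strongly to some \<open>Z\<close> with \<open>2 Z = B + Z\<^sup>2\<close>, and then
  \<open>S = 1 - Z\<close> satisfies \<open>S\<^sup>2 = X\<^sup>2\<close>. The same iteration with 1 in place of \<open>B\<close> gives the numbers \<open>y n\<close>,
  and their increments bound those of \<open>Y n\<close>. Every \<open>Y n\<close> commutes with whatever commutes with \<open>X\<close>,
  hence so does \<open>S\<close>.\<close>
lemma abs_operator: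
  assumes X: "symop 1 X"
  shows "\<exists>S. symop 2 S \<and> (\<forall>u\<in>carrier V. 0 \<le> Re (ip V (S u) u) \<and> S (S u) = X (X u)) \<and>
    (\<forall>A. bddlin A \<and> (\<forall>u\<in>carrier V. X (A u) = A (X u)) \<longrightarrow> (\<forall>u\<in>carrier V. S (A u) = A (S u)))"
proof -
  note XD = symopD[OF X]
  define B where "B u = u \<ominus>\<^bsub>V\<^esub> X (X u)" for u
  have Bc: "B u \<in> carrier V" if "u \<in> carrier V" for u using that XD(1) by (simp add: B_def)
  have Bsym: "ip V (B u) w = ip V u (B w)" if "u \<in> carrier V" "w \<in> carrier V" for u w
    using that XD(1) by (simp add: B_def ip_minus XD(3))
  have Bn: "nrm (B u) \<le> nrm u" if u: "u \<in> carrier V" for u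
  proof (rule power2_le_imp_le)
    have "ip V (X (X u)) u = ip V (X u) (X u)" "ip V u (X (X u)) = ip V (X u) (X u)"
      using u XD(1) XD(3)[of "X u" u] XD(3)[of u "X u"] by auto
    then have "ip V (B u) (B u) = ip V u u - 2 * ip V (X u) (X u) + ip V (X (X u)) (X (X u))"
      using u XD(1) by (simp add: B_def ip_minus algebra_simps)
    then have "(nrm (B u))\<^sup>2 = (nrm u)\<^sup>2 - 2 * (nrm (X u))\<^sup>2 + (nrm (X (X u)))\<^sup>2"
      using u XD(1) Bc by (simp add: Re_nrm_sq[symmetric])
    moreover have "(nrm (X (X u)))\<^sup>2 \<le> (nrm (X u))\<^sup>2"
      using XD(2)[of "X u"] u XD(1) by (intro power_mono) auto
    ultimately show "(nrm (B u))\<^sup>2 \<le> (nrm u)\<^sup>2"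
      using zero_le_power2[of "nrm (X u)"] by linarith
  qed (use u in simp)
  define Y where "Y = rec_nat (\<lambda>u. \<zero>\<^bsub>V\<^esub>) (\<lambda>_ f u. (1/2) \<odot>\<^bsub>V\<^esub> (B u \<oplus>\<^bsub>V\<^esub> f (f u)))"
  define y :: "nat \<Rightarrow> real" where "y = rec_nat 0 (\<lambda>_ r. (1 + r\<^sup>2) / 2)"
  have Y0 [simp]: "Y 0 u = \<zero>\<^bsub>V\<^esub>" and YS [simp]: "Y (Suc n) u = (1/2) \<odot>\<^bsub>V\<^esub> (B u \<oplus>\<^bsub>V\<^esub> Y n (Y n u))" for n u
    by (simp_all add: Y_def)
  have y0 [simp]: "y 0 = 0" and yS: "y (Suc n) = (1 + (y n)\<^sup>2) / 2" for n
    by (simp_all add: y_def)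
  have yb: "0 \<le> y n \<and> y n \<le> 1" for n
    by (induction n) (auto simp: yS power_le_one)
  have yinc: "y n \<le> y (Suc n)" for n
    using zero_le_power2[of "1 - y n"] by (simp add: yS power2_diff)
  have Ysym: "symop (y n) (Y n)" for n
  proof (induction n)
    case (Suc n)
    note D = symopD[OF Suc]
    have "nrm ((1/2) \<odot>\<^bsub>V\<^esub> (B u \<oplus>\<^bsub>V\<^esub> Y n (Y n u))) \<le> (1 + (y n)\<^sup>2) / 2 * nrm u" if u: "u \<in> carrier V" for u
    proof -
      have "nrm (Y n (Y n u)) \<le> y n * (y n * nrm u)"
        using D(2)[OF D(1)[OF u]] mult_left_mono[OF D(2)[OF u], of "y n"] yb[of n] by simp
      then have "nrm (B u \<oplus>\<^bsub>V\<^esub> Y n (Y n u)) \<le> nrm u + y n * (y n * nrm u)"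
        using nrm_add[of "B u" "Y n (Y n u)"] Bn[OF u] u D(1) Bc by simp
      then show ?thesis using u D(1) Bc by (simp add: nrm_smult algebra_simps power2_eq_square)
    qed
    then show ?case unfolding symop_def
      using D(1) Bc by (auto simp: ip_simps Bsym D(3) yS)
  qed (auto simp: symop_def ip_zero)
  note YD = symopD[OF Ysym]
  note YL = bddlinD[OF symop_bddlin[OF Ysym]]
  have diff1: "nrm (Y (Suc n) u \<ominus>\<^bsub>V\<^esub> Y n u) \<le> (y (Suc n) - y n) * nrm u" if "u \<in> carrier V" for n u
    using that
  proof (induction n arbitrary: u)
    case 0
    have "(1/2) \<odot>\<^bsub>V\<^esub> (B u \<oplus>\<^bsub>V\<^esub> \<zero>\<^bsub>V\<^esub>) \<ominus>\<^bsub>V\<^esub> \<zero>\<^bsub>V\<^esub> = (1/2) \<odot>\<^bsub>V\<^esub> B u"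
      by (rule ip_eqI) (use 0 Bc in \<open>auto simp: ip_simps\<close>)
    then show ?case using 0 Bn[OF 0] Bc by (simp add: nrm_smult yS)
  next
    case (Suc n)
    let ?d = "Y (Suc n) u \<ominus>\<^bsub>V\<^esub> Y n u"
    let ?e = "Y (Suc n) (Y n u) \<ominus>\<^bsub>V\<^esub> Y n (Y n u)"
    note c = YD(1)[OF Suc.prems, of "Suc n"] YD(1)[OF Suc.prems, of n] Suc.prems
    have dc: "?d \<in> carrier V" "?e \<in> carrier V" using YD(1) Suc.prems by (simp_all del: YS)
    have *: "Y (Suc (Suc n)) u \<ominus>\<^bsub>V\<^esub> Y (Suc n) u = (1/2) \<odot>\<^bsub>V\<^esub> (Y (Suc n) ?d \<oplus>\<^bsub>V\<^esub> ?e)"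
    proof (rule ip_eqI)
      fix z assume z: "z \<in> carrier V"
      have A: "Y (Suc (Suc n)) u = (1/2) \<odot>\<^bsub>V\<^esub> (B u \<oplus>\<^bsub>V\<^esub> Y (Suc n) (Y (Suc n) u))"
        "Y (Suc n) u = (1/2) \<odot>\<^bsub>V\<^esub> (B u \<oplus>\<^bsub>V\<^esub> Y n (Y n u))" by (rule YS)+
      have E: "Y (Suc n) ?d = Y (Suc n) (Y (Suc n) u) \<ominus>\<^bsub>V\<^esub> Y (Suc n) (Y n u)"
        using c YD(1) by (intro YL(4)) auto
      have "ip V (Y (Suc (Suc n)) u \<ominus>\<^bsub>V\<^esub> Y (Suc n) u) z = ip V (Y (Suc (Suc n)) u) z - ip V (Y (Suc n) u) z"
        using c z YD(1) by (intro ip_minus) (auto simp del: YS)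
      also have "ip V (Y (Suc (Suc n)) u) z = (1/2) * (ip V (B u) z + ip V (Y (Suc n) (Y (Suc n) u)) z)"
        unfolding A(1) using c z Bc YD(1) by (simp add: ip_simps del: YS)
      also have "ip V (Y (Suc n) u) z = (1/2) * (ip V (B u) z + ip V (Y n (Y n u)) z)"
        unfolding A(2) using c z Bc YD(1) by (simp add: ip_simps del: YS)
      finally show "ip V (Y (Suc (Suc n)) u \<ominus>\<^bsub>V\<^esub> Y (Suc n) u) z = ip V ((1/2) \<odot>\<^bsub>V\<^esub> (Y (Suc n) ?d \<oplus>\<^bsub>V\<^esub> ?e)) z"
        unfolding E using c z YD(1)
        by (simp add: ip_simps add_divide_distrib diff_divide_distrib del: YS)
    qed (use YD(1) dc Suc.prems cr in \<open>auto simp del: YS\<close>)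
    have d: "0 \<le> y (Suc n) - y n" using yinc[of n] by linarith
    have "nrm (Y (Suc n) ?d) \<le> y (Suc n) * ((y (Suc n) - y n) * nrm u)"
      using YD(2)[OF dc(1), of "Suc n"] mult_left_mono[OF Suc.IH[OF Suc.prems], of "y (Suc n)"] yb[of "Suc n"]
      by (simp del: YS)
    moreover have "nrm ?e \<le> (y (Suc n) - y n) * (y n * nrm u)"
      using Suc.IH[OF c(2)] mult_left_mono[OF YD(2)[OF Suc.prems, of n] d] by (simp del: YS)
    ultimately have "nrm (Y (Suc n) ?d \<oplus>\<^bsub>V\<^esub> ?e) \<le> ((y (Suc n))\<^sup>2 - (y n)\<^sup>2) * nrm u"
      using nrm_add[OF YD(1)[OF dc(1), of "Suc n"] dc(2)]
      by (simp add: algebra_simps power2_eq_square del: YS)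
    moreover have "y (Suc (Suc n)) - y (Suc n) = (1/2) * ((y (Suc n))\<^sup>2 - (y n)\<^sup>2)"
    proof -
      have "2 * y (Suc m) = 1 + (y m)\<^sup>2" for m by (simp add: yS)
      moreover have "2 * b = 1 + A \<Longrightarrow> 2 * c = 1 + B \<Longrightarrow> c - b = (1/2) * (B - A)" for A B b c :: real
        by argo
      ultimately show ?thesis by blast
    qed
    moreover have "nrm (Y (Suc (Suc n)) u \<ominus>\<^bsub>V\<^esub> Y (Suc n) u) = (1/2) * nrm (Y (Suc n) ?d \<oplus>\<^bsub>V\<^esub> ?e)"
      unfolding * using dc YD(1) by (subst nrm_smult) (auto simp del: YS)
    moreover have "b \<le> e * N" if "a \<le> D * N" "e = (1/2) * D" "b = (1/2) * a" for a b D N e :: real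
      unfolding that(2,3) mult.assoc using that(1) by linarith
    ultimately show ?case by blast
  qed
  have diff: "nrm (Y m u \<ominus>\<^bsub>V\<^esub> Y n u) \<le> (y m - y n) * nrm u" if u: "u \<in> carrier V" and mn: "n \<le> m" for m n u
    using mn
  proof (induction m rule: dec_induct)
    case base
    then show ?case using u YD(1) by (simp add: minus_zeroI)
  next
    case (step m)
    then show ?case
      using nrm_triangle[OF YD(1)[OF u, of "Suc m"] YD(1)[OF u, of m] YD(1)[OF u, of n]] diff1[OF u, of m]
      by (simp add: algebra_simps del: YS)
  qed
  have "convergent y"
    by (intro Bseq_monoseq_convergent BseqI'[of _ 1] incseq_imp_monoseq incseq_SucI yinc) (simp add: yb)
  then have yC: "Cauchy y" by (rule convergent_Cauchy)
  have "\<exists>l. conv (\<lambda>n. Y n u) l" if u: "u \<in> carrier V" for u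
  proof (rule cauchy_conv)
    fix e :: real assume e: "e > 0"
    have "e / (nrm u + 1) > 0" using e u by (simp add: add_nonneg_pos)
    then obtain N where N: "\<And>m n. m \<ge> N \<Longrightarrow> n \<ge> N \<Longrightarrow> \<bar>y m - y n\<bar> < e / (nrm u + 1)"
      using yC unfolding Cauchy_def dist_real_def by blast
    have *: "nrm (Y m u \<ominus>\<^bsub>V\<^esub> Y n u) < e" if "m \<ge> n" "n \<ge> N" for m n
    proof -
      have "nrm (Y m u \<ominus>\<^bsub>V\<^esub> Y n u) \<le> \<bar>y m - y n\<bar> * (nrm u + 1)"
        using diff[OF u that(1)] u by (smt (verit) mult_mono nrm_nonneg)
      also have "\<dots> < e" using N[of m n] that u by (simp add: pos_less_divide_eq add_nonneg_pos)
      finally show ?thesis .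
    qed
    show "\<exists>N. \<forall>m\<ge>N. \<forall>n\<ge>N. nrm (Y m u \<ominus>\<^bsub>V\<^esub> Y n u) < e"
    proof (intro exI allI impI)
      fix m n assume "m \<ge> N" "n \<ge> N"
      then show "nrm (Y m u \<ominus>\<^bsub>V\<^esub> Y n u) < e"
        using *[of m n] *[of n m] nrm_minus_sym[OF YD(1)[OF u, of m] YD(1)[OF u, of n]]
        by (metis nle_le)
    qed
  qed (rule YD(1)[OF u])
  then have "\<exists>Z. \<forall>u\<in>carrier V. conv (\<lambda>n. Y n u) (Z u)" by metis
  then obtain Z where Z: "\<And>u. u \<in> carrier V \<Longrightarrow> conv (\<lambda>n. Y n u) (Z u)" by blast
  have Zc: "Z u \<in> carrier V" if "u \<in> carrier V" for u using Z[OF that] by (simp add: conv_def)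
  have Zsym: "symop 1 Z"
    unfolding symop_def
  proof (intro conjI ballI)
    fix u assume u: "u \<in> carrier V"
    show "Z u \<in> carrier V" by (rule Zc[OF u])
    have "nrm (Y n u) \<le> 1 * nrm u" for n
      using YD(2)[OF u, of n] mult_right_mono[of "y n" 1 "nrm u"] yb[of n] u by simp
    then show "nrm (Z u) \<le> 1 * nrm u"
      by (intro LIMSEQ_le_const2[OF conv_nrm[OF Z[OF u]]]) auto
    fix w assume w: "w \<in> carrier V"
    show "ip V (Z u) w = ip V u (Z w)"
      using LIMSEQ_unique[OF conv_ip(1)[OF Z[OF u] w]] conv_ip(2)[OF Z[OF w] u] YD(3)[OF u w] by simp
  qed
  note ZL = bddlinD[OF symop_bddlin[OF Zsym]]
  have ZZ: "conv (\<lambda>n. Y n (Y n u)) (Z (Z u))" if u: "u \<in> carrier V" for u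
  proof -
    have 0: "(\<lambda>n. nrm (Y n u \<ominus>\<^bsub>V\<^esub> Z u) + nrm (Y n (Z u) \<ominus>\<^bsub>V\<^esub> Z (Z u))) \<longlonglongrightarrow> 0"
      using Z[OF u] Z[OF Zc[OF u]] unfolding conv_def by (intro tendsto_add_zero) auto
    have "(\<lambda>n. nrm (Y n (Y n u) \<ominus>\<^bsub>V\<^esub> Z (Z u))) \<longlonglongrightarrow> 0"
    proof (rule Lim_null_comparison[OF always_eventually 0], rule allI)
      fix n
      have "nrm (Y n (Y n u) \<ominus>\<^bsub>V\<^esub> Y n (Z u)) = nrm (Y n (Y n u \<ominus>\<^bsub>V\<^esub> Z u))"
        using u Zc YD(1) by (simp add: YL(4))
      also have "\<dots> \<le> y n * nrm (Y n u \<ominus>\<^bsub>V\<^esub> Z u)" using u Zc YD(1) by (intro YD(2)) auto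
      also have "\<dots> \<le> 1 * nrm (Y n u \<ominus>\<^bsub>V\<^esub> Z u)" using u Zc YD(1) yb by (intro mult_right_mono) auto
      finally show "norm (nrm (Y n (Y n u) \<ominus>\<^bsub>V\<^esub> Z (Z u))) \<le> nrm (Y n u \<ominus>\<^bsub>V\<^esub> Z u) + nrm (Y n (Z u) \<ominus>\<^bsub>V\<^esub> Z (Z u))"
        using nrm_triangle[of "Y n (Y n u)" "Y n (Z u)" "Z (Z u)"] u Zc YD(1) by simp
    qed
    then show ?thesis using u Zc YD(1) by (simp add: conv_def)
  qed
  have fixp: "2 * ip V (Z u) z = ip V (B u) z + ip V (Z (Z u)) z" if u: "u \<in> carrier V" and z: "z \<in> carrier V" for u z
  proof (rule LIMSEQ_unique)
    have "(\<lambda>n. 2 * ip V (Y (Suc n) u) z) \<longlonglongrightarrow> 2 * ip V (Z u) z"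
      by (intro tendsto_intros LIMSEQ_Suc[OF conv_ip(1)[OF Z[OF u] z]])
    moreover have "2 * ip V (Y (Suc n) u) z = ip V (B u) z + ip V (Y n (Y n u)) z" for n
      using u z YD(1) Bc by (simp add: ip_simps)
    ultimately show "(\<lambda>n. ip V (B u) z + ip V (Y n (Y n u)) z) \<longlonglongrightarrow> 2 * ip V (Z u) z"
      by (simp only:)
    show "(\<lambda>n. ip V (B u) z + ip V (Y n (Y n u)) z) \<longlonglongrightarrow> ip V (B u) z + ip V (Z (Z u)) z"
      by (intro tendsto_intros conv_ip(1)[OF ZZ[OF u] z])
  qed
  define S where "S u = u \<ominus>\<^bsub>V\<^esub> Z u" for u
  have Sc: "S u \<in> carrier V" if "u \<in> carrier V" for u using that Zc by (simp add: S_def)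
  have "symop 2 S"
    unfolding symop_def
  proof (intro conjI ballI)
    fix u assume u: "u \<in> carrier V"
    show "S u \<in> carrier V" by (rule Sc[OF u])
    show "nrm (S u) \<le> 2 * nrm u"
      using nrm_minus_le[OF u Zc[OF u]] symopD(2)[OF Zsym u] by (simp add: S_def)
    show "ip V (S u) w = ip V u (S w)" if "w \<in> carrier V" for w
      using that u Zc symopD(3)[OF Zsym] by (simp add: S_def ip_minus)
  qed
  moreover have "0 \<le> Re (ip V (S u) u)" if u: "u \<in> carrier V" for u
  proof -
    have "Re (ip V (Z u) u) \<le> nrm (Z u) * nrm u"
      using nrm_cs[OF Zc[OF u] u] complex_Re_le_cmod[of "ip V (Z u) u"] by linarith
    also have "\<dots> \<le> nrm u * nrm u"
      using symopD(2)[OF Zsym u] u by (intro mult_right_mono) auto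
    finally show ?thesis using u Zc by (simp add: S_def ip_minus Re_nrm_sq power2_eq_square)
  qed
  moreover have "S (S u) = X (X u)" if u: "u \<in> carrier V" for u
  proof (rule ip_eqI)
    fix z assume z: "z \<in> carrier V"
    have "S (S u) = (u \<ominus>\<^bsub>V\<^esub> Z u) \<ominus>\<^bsub>V\<^esub> (Z u \<ominus>\<^bsub>V\<^esub> Z (Z u))"
      using u Zc by (simp add: S_def ZL(4))
    then have "ip V (S (S u)) z = ip V u z - 2 * ip V (Z u) z + ip V (Z (Z u)) z"
      using u z Zc by (simp add: ip_minus)
    then show "ip V (S (S u)) z = ip V (X (X u)) z"
      unfolding fixp[OF u z] using u z XD(1) by (simp add: B_def ip_minus)
  qed (use u Sc XD(1) in auto)
  moreover have "S (A u) = A (S u)"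
    if A: "bddlin A" and XA: "\<forall>u\<in>carrier V. X (A u) = A (X u)" and u: "u \<in> carrier V" for A u
  proof -
    note AD = bddlinD[OF A]
    have YA: "Y n (A u) = A (Y n u)" if "u \<in> carrier V" for n u
      using that
    proof (induction n arbitrary: u)
      case 0
      have "A \<zero>\<^bsub>V\<^esub> = \<zero>\<^bsub>V\<^esub>" using AD(4)[of "\<zero>\<^bsub>V\<^esub>" "\<zero>\<^bsub>V\<^esub>"] AD(1) by (simp add: minus_zeroI)
      then show ?case by simp
    next
      case (Suc n)
      have "B (A u) = A (B u)" using Suc.prems XA XD(1) AD by (simp add: B_def)
      then show ?case using Suc YD(1) Bc AD(1) by (simp add: AD(2,3))
    qed
    have "conv (\<lambda>n. Y n (A u)) (A (Z u))"
      using bddlin_conv[OF A Z[OF u]] YA[OF u] by simp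
    then have "Z (A u) = A (Z u)" using conv_unique Z AD(1) u by blast
    then show ?thesis using u Zc AD by (simp add: S_def)
  qed
  ultimately show ?thesis by blast
qed

text \<open>With the absolute value \<open>S\<close> of \<open>X\<close>, the set of all \<open>v\<close> with \<open>S v = X v\<close> is closed and invariant. If it
  is everything, \<open>X = S\<close> is nonnegative. If it is 0, then \<open>S + X\<close>, whose values lie in it,
  vanishes, and \<open>X = - S\<close> is nonpositive.\<close>
lemma schur_sign:
  assumes \<A>: "\<A> \<subseteq> unitary_maps V V"
    and irr: "\<And>W. closed_subspace W V \<Longrightarrow> (\<And>A. A \<in> \<A> \<Longrightarrow> A ` W \<subseteq> W) \<Longrightarrow> W = {\<zero>\<^bsub>V\<^esub>} \<or> W = carrier V"
    and X: "symop 1 X" and XA: "\<And>A u. A \<in> \<A> \<Longrightarrow> u \<in> carrier V \<Longrightarrow> X (A u) = A (X u)"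
  shows "(\<forall>u\<in>carrier V. 0 \<le> Re (ip V (X u) u)) \<or> (\<forall>u\<in>carrier V. Re (ip V (X u) u) \<le> 0)"
proof -
  obtain S where S: "symop 2 S" and S0: "\<And>u. u \<in> carrier V \<Longrightarrow> 0 \<le> Re (ip V (S u) u)"
    and SS: "\<And>u. u \<in> carrier V \<Longrightarrow> S (S u) = X (X u)"
    and SA: "\<And>A u. bddlin A \<Longrightarrow> (\<forall>u\<in>carrier V. X (A u) = A (X u)) \<Longrightarrow> u \<in> carrier V \<Longrightarrow> S (A u) = A (S u)"
    using abs_operator[OF X] by blast
  note SD = symopD[OF S] and XD = symopD[OF X]
  have SX: "S (X u) = X (S u)" if "u \<in> carrier V" for u
    using SA[OF symop_bddlin[OF X]] that by blast
  define W where "W = {v \<in> carrier V. \<forall>x \<in> (\<lambda>w. S w \<ominus>\<^bsub>V\<^esub> X w) ` carrier V. ip V v x = 0}"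
  have W: "v \<in> W \<longleftrightarrow> v \<in> carrier V \<and> S v = X v" for v
  proof (cases "v \<in> carrier V")
    case True
    have "ip V v (S w \<ominus>\<^bsub>V\<^esub> X w) = ip V (S v) w - ip V (X v) w" if "w \<in> carrier V" for w
      using that True SD XD by (simp add: ip_minus)
    then have "v \<in> W \<longleftrightarrow> (\<forall>w\<in>carrier V. ip V (S v) w = ip V (X v) w)"
      using True by (auto simp: W_def)
    then show ?thesis using True ip_eqI[OF SD(1)[OF True] XD(1)[OF True]] by auto
  qed (simp add: W_def)
  have "W = {\<zero>\<^bsub>V\<^esub>} \<or> W = carrier V"
  proof (rule irr)
    show "closed_subspace W V"
      unfolding W_def by (rule closed_subspace_orth) (use SD(1) XD(1) in auto)
    show "A ` W \<subseteq> W" if A: "A \<in> \<A>" for A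
    proof
      fix y assume "y \<in> A ` W"
      then obtain v where v: "y = A v" "v \<in> carrier V" "S v = X v" using W by auto
      have b: "bddlin A" using A \<A> unitary_bddlin by blast
      have "S (A v) = A (S v)" using SA[OF b] XA[OF A] v by blast
      then show "y \<in> W" using v XA[OF A, of v] bddlinD(1)[OF b] by (simp add: W)
    qed
  qed
  then show ?thesis
  proof
    assume W0: "W = {\<zero>\<^bsub>V\<^esub>}"
    have "Re (ip V (X u) u) \<le> 0" if u: "u \<in> carrier V" for u
    proof -
      have "S (S u \<oplus>\<^bsub>V\<^esub> X u) = X (S u \<oplus>\<^bsub>V\<^esub> X u)"
        using u SD(1) XD(1) SS SX bddlinD(3)[OF symop_bddlin[OF S]] bddlinD(3)[OF symop_bddlin[OF X]]
        by (simp add: M.a_comm)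
      then have "S u \<oplus>\<^bsub>V\<^esub> X u \<in> W" using u SD(1) XD(1) by (simp add: W)
      then have "ip V (S u \<oplus>\<^bsub>V\<^esub> X u) u = 0" using W0 u by (simp add: ip_zero)
      then have "Re (ip V (S u) u) + Re (ip V (X u) u) = 0"
        using u SD(1) XD(1) by (simp add: ip_add flip: plus_complex.simps(1))
      then show ?thesis using S0[OF u] by simp
    qed
    then show ?thesis by blast
  next
    assume "W = carrier V"
    then show ?thesis using S0 W by metis
  qed
qed

lemma symop_zeroI:
  assumes X: "symop C X" and z: "\<And>u. u \<in> carrier V \<Longrightarrow> Re (ip V (X u) u) = 0" and u: "u \<in> carrier V"
  shows "X u = \<zero>\<^bsub>V\<^esub>"
proof -
  note XD = symopD[OF X]
  have w: "X u \<in> carrier V" by (rule XD(1)[OF u])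
  have "Re (ip V (X (u \<oplus>\<^bsub>V\<^esub> X u)) (u \<oplus>\<^bsub>V\<^esub> X u)) = 0" using u w by (intro z) auto
  moreover have "X (u \<oplus>\<^bsub>V\<^esub> X u) = X u \<oplus>\<^bsub>V\<^esub> X (X u)"
    using bddlinD(3)[OF symop_bddlin[OF X]] u w by simp
  moreover have "ip V (X (X u)) u = ip V (X u) (X u)" using XD(3)[OF w u] by simp
  ultimately have "2 * Re (ip V (X u) (X u)) = 0"
    using z[OF u] z[OF w] u w XD(1) by (simp add: ip_simps)
  then have "nrm (X u) = 0" by (simp add: nrm_def)
  then show ?thesis using nrm_eq_zero w by blast
qed

text \<open>For every real \<open>c\<close> the operator \<open>T - c\<close> has a sign by \<open>schur_sign\<close>. At the supremum of those \<open>c\<close>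
  for which it is nonnegative it has both signs, so it is 0.\<close>
theorem schur:
  assumes \<A>: "\<A> \<subseteq> unitary_maps V V"
    and irr: "\<And>W. closed_subspace W V \<Longrightarrow> (\<And>A. A \<in> \<A> \<Longrightarrow> A ` W \<subseteq> W) \<Longrightarrow> W = {\<zero>\<^bsub>V\<^esub>} \<or> W = carrier V"
    and T: "symop C T" and TA: "\<And>A u. A \<in> \<A> \<Longrightarrow> u \<in> carrier V \<Longrightarrow> T (A u) = A (T u)"
  shows "\<exists>c. \<forall>u\<in>carrier V. T u = of_real c \<odot>\<^bsub>V\<^esub> u"
proof -
  note TD = symopD[OF T]
  define X where "X c u = T u \<ominus>\<^bsub>V\<^esub> of_real c \<odot>\<^bsub>V\<^esub> u" for c :: real and u
  have Xsym: "symop (C + \<bar>c\<bar>) (X c)" for c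
    unfolding symop_def
  proof (intro conjI ballI)
    fix u assume u: "u \<in> carrier V"
    show "X c u \<in> carrier V" using u TD(1) cr by (simp add: X_def)
    have "nrm (X c u) \<le> nrm (T u) + nrm (of_real c \<odot>\<^bsub>V\<^esub> u)"
      unfolding X_def using u TD(1) cr by (intro nrm_minus_le) auto
    then show "nrm (X c u) \<le> (C + \<bar>c\<bar>) * nrm u"
      using TD(2)[OF u] u by (simp add: nrm_smult algebra_simps)
    show "ip V (X c u) w = ip V u (X c w)" if "w \<in> carrier V" for w
      using that u TD by (simp add: X_def ip_simps)
  qed
  have rX: "Re (ip V (X c u) u) = Re (ip V (T u) u) - c * (nrm u)\<^sup>2" if "u \<in> carrier V" for c u
    using that TD(1) by (simp add: X_def ip_simps Re_nrm_sq)
  have sign: "(\<forall>u\<in>carrier V. c * (nrm u)\<^sup>2 \<le> Re (ip V (T u) u)) \<or> (\<forall>u\<in>carrier V. Re (ip V (T u) u) \<le> c * (nrm u)\<^sup>2)" for c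
  proof -
    define r where "r = \<bar>C\<bar> + \<bar>c\<bar> + 1"
    have r: "r > 0" by (simp add: r_def)
    define Y where "Y u = of_real (1 / r) \<odot>\<^bsub>V\<^esub> X c u" for u
    note XD = symopD[OF Xsym[of c]]
    have "symop 1 Y"
      unfolding symop_def
    proof (intro conjI ballI)
      fix u assume u: "u \<in> carrier V"
      have "0 \<le> nrm u" using u by simp
      then have "nrm (X c u) \<le> r * nrm u"
        using XD(2)[OF u] mult_right_mono[of "C + \<bar>c\<bar>" r "nrm u"] u abs_ge_self[of C]
        unfolding r_def by linarith
      then show "nrm (Y u) \<le> 1 * nrm u"
        using u XD(1) r by (simp add: Y_def nrm_smult norm_divide divide_le_eq mult.commute)
    qed (use XD cr in \<open>auto simp: Y_def ip_simps\<close>)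
    moreover have "Y (A u) = A (Y u)" if A: "A \<in> \<A>" and u: "u \<in> carrier V" for A u
    proof -
      have b: "bddlin A" using A \<A> unitary_bddlin by blast
      show ?thesis using u TD(1) cr by (simp add: Y_def X_def TA[OF A u] bddlinD[OF b])
    qed
    ultimately have "(\<forall>u\<in>carrier V. 0 \<le> Re (ip V (Y u) u)) \<or> (\<forall>u\<in>carrier V. Re (ip V (Y u) u) \<le> 0)"
      by (intro schur_sign[OF \<A> irr])
    moreover have "Re (ip V (Y u) u) = (1 / r) * (Re (ip V (T u) u) - c * (nrm u)\<^sup>2)" if "u \<in> carrier V" for u
      using that XD(1) by (simp add: Y_def ip_smult rX)
    ultimately show ?thesis using r by (auto simp: zero_le_divide_iff divide_le_0_iff)
  qed
  show ?thesis
  proof (cases "carrier V = {\<zero>\<^bsub>V\<^esub>}")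
    case True
    then show ?thesis using TD(1) cr by (metis M.zero_closed singletonD)
  next
    case False
    then obtain v where v: "v \<in> carrier V" "nrm v \<noteq> 0" using nrm_eq_zero M.zero_closed by blast
    define P where "P = {c. \<forall>u\<in>carrier V. c * (nrm u)\<^sup>2 \<le> Re (ip V (T u) u)}"
    have Tb: "\<bar>Re (ip V (T u) u)\<bar> \<le> C * (nrm u)\<^sup>2" if u: "u \<in> carrier V" for u
    proof -
      have "\<bar>Re (ip V (T u) u)\<bar> \<le> nrm (T u) * nrm u"
        using nrm_cs[OF TD(1)[OF u] u] abs_Re_le_cmod[of "ip V (T u) u"] by linarith
      also have "\<dots> \<le> C * nrm u * nrm u" using TD(2)[OF u] u by (intro mult_right_mono) auto
      finally show ?thesis by (simp add: power2_eq_square mult.assoc)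
    qed
    have ne: "- C \<in> P" unfolding P_def using Tb by force
    have ub: "c \<le> C" if "c \<in> P" for c
    proof -
      have "c * (nrm v)\<^sup>2 \<le> Re (ip V (T v) v)" using that v(1) unfolding P_def by blast
      then have "c * (nrm v)\<^sup>2 \<le> C * (nrm v)\<^sup>2" using Tb[OF v(1)] by linarith
      then show ?thesis using v by (simp add: mult_le_cancel_right)
    qed
    have bdd: "bdd_above P" using ub by (rule bdd_aboveI)
    define s where "s = Sup P"
    have lo: "s * (nrm u)\<^sup>2 \<le> Re (ip V (T u) u)" if u: "u \<in> carrier V" for u
    proof (cases "nrm u = 0")
      case True
      then show ?thesis using nrm_eq_zero[OF u] TD(1) by (simp add: ip_zero)
    next
      case False
      then have p: "(nrm u)\<^sup>2 > 0" by simp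
      have "s \<le> Re (ip V (T u) u) / (nrm u)\<^sup>2"
        unfolding s_def
      proof (rule cSup_least)
        show "P \<noteq> {}" using ne by blast
      qed (use p u in \<open>simp add: P_def pos_le_divide_eq\<close>)
      then show ?thesis using p by (simp add: pos_le_divide_eq)
    qed
    have hi: "Re (ip V (T u) u) \<le> s * (nrm u)\<^sup>2" if u: "u \<in> carrier V" for u
    proof -
      have "Re (ip V (T u) u) \<le> (s + e) * (nrm u)\<^sup>2" if "e > 0" for e
      proof -
        have "s + e \<notin> P" using cSup_upper[OF _ bdd, of "s + e"] that by (auto simp: s_def)
        then show ?thesis using sign[of "s + e"] u by (auto simp: P_def)
      qed
      then have "Re (ip V (T u) u) \<le> s * (nrm u)\<^sup>2 + e" if "e > 0" for e
      proof -
        have "0 < e / ((nrm u)\<^sup>2 + 1)" using that by (simp add: add_nonneg_pos)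
        then have "Re (ip V (T u) u) \<le> (s + e / ((nrm u)\<^sup>2 + 1)) * (nrm u)\<^sup>2"
          using \<open>\<And>e. 0 < e \<Longrightarrow> Re (ip V (T u) u) \<le> (s + e) * (nrm u)\<^sup>2\<close> by blast
        also have "\<dots> \<le> s * (nrm u)\<^sup>2 + e"
          using that by (simp add: distrib_right divide_le_eq add_nonneg_pos mult_left_mono)
        finally show ?thesis .
      qed
      then show ?thesis by (rule field_le_epsilon)
    qed
    have "X s u = \<zero>\<^bsub>V\<^esub>" if u: "u \<in> carrier V" for u
      by (rule symop_zeroI[OF Xsym _ u]) (use lo hi rX in force)
    then have "T u = of_real s \<odot>\<^bsub>V\<^esub> u" if "u \<in> carrier V" for u
      using minus_eq_zeroD[of "T u" "of_real s \<odot>\<^bsub>V\<^esub> u"] that TD(1) cr unfolding X_def by blast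
    then show ?thesis by blast
  qed
qed

end

section \<open>The Hilbert space of a positive semidefinite kernel\<close>

definition kdist :: "('x \<Rightarrow> 'x \<Rightarrow> complex) \<Rightarrow> (complex \<times> 'x) list \<Rightarrow> (complex \<times> 'x) list \<Rightarrow> real"
  where "kdist K l m = knorm K (l @ scale (-1) m)"

definition kcauchy :: "('x \<Rightarrow> 'x \<Rightarrow> complex) \<Rightarrow> (nat \<Rightarrow> (complex \<times> 'x) list) \<Rightarrow> bool"
  where "kcauchy K L \<longleftrightarrow> (\<forall>\<epsilon>>0. \<exists>N. \<forall>m\<ge>N. \<forall>n\<ge>N. kdist K (L m) (L n) < \<epsilon>)"

text \<open>The point of the completion that a Cauchy sequence \<open>L\<close> defines is encoded as a function, namely
  as its inner products with the kernel vectors.\<close>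
definition klim :: "('x \<Rightarrow> 'x \<Rightarrow> complex) \<Rightarrow> (nat \<Rightarrow> (complex \<times> 'x) list) \<Rightarrow> 'x \<Rightarrow> complex"
  where "klim K L = (\<lambda>y. lim (\<lambda>n. bil K (L n) [(1, y)]))"

definition krep :: "('x \<Rightarrow> 'x \<Rightarrow> complex) \<Rightarrow> ('x \<Rightarrow> complex) \<Rightarrow> nat \<Rightarrow> (complex \<times> 'x) list"
  where "krep K f = (SOME L. kcauchy K L \<and> klim K L = f)"

text \<open>The inner product is read off from representing sequences chosen by \<open>krep\<close>; it does not depend on
  the choice (\<open>ip_tendsto\<close>).\<close>
definition rkhs :: "('x \<Rightarrow> 'x \<Rightarrow> complex) \<Rightarrow> ('x \<Rightarrow> complex) inner_space"
  where "rkhs K = \<lparr>carrier = klim K ` Collect (kcauchy K), mult = undefined, one = undefined,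
    zero = \<lambda>x. 0, add = \<lambda>f g x. f x + g x, smult = \<lambda>a f x. a * f x,
    ip = \<lambda>f g. lim (\<lambda>n. bil K (krep K f n) (krep K g n))\<rparr>"

context
  fixes K :: "'x \<Rightarrow> 'x \<Rightarrow> complex"
  assumes K: "pd K"
begin

lemma kdist_nonneg: "0 \<le> kdist K l m"
  by (simp add: kdist_def knorm_nonneg[OF K])

lemma kdist_sym: "kdist K l m = kdist K m l"
  by (simp add: kdist_def knorm_def[OF K] algebra_simps)

lemma kdist_triangle: "kdist K l m \<le> kdist K l k + kdist K k m"
proof -
  have "kdist K l m = knorm K ((l @ scale (-1) k) @ (k @ scale (-1) m))"
    by (simp add: kdist_def knorm_def[OF K] algebra_simps)
  then show ?thesis using knorm_add[OF K] by (simp only: kdist_def)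
qed

lemma kdist_knorm: "\<bar>knorm K l - knorm K m\<bar> \<le> kdist K l m"
proof -
  have "knorm K l \<le> kdist K l m + knorm K m" for l m
  proof -
    have "knorm K l = knorm K ((l @ scale (-1) m) @ m)"
      by (simp add: knorm_def[OF K] algebra_simps)
    also have "\<dots> \<le> kdist K l m + knorm K m" unfolding kdist_def by (rule knorm_add[OF K])
    finally show ?thesis .
  qed
  from this[of l m] this[of m l] show ?thesis using kdist_sym[of l m] by simp
qed

lemma kcauchy_const: "kcauchy K (\<lambda>_. l)"
  by (simp add: kcauchy_def kdist_def knorm_def[OF K])

lemma kcauchy_append:
  assumes L: "kcauchy K L" and M: "kcauchy K M"
  shows "kcauchy K (\<lambda>n. L n @ M n)"
  unfolding kcauchy_def
proof (intro allI impI)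
  fix e :: real assume "e > 0"
  then have "e / 2 > 0" by simp
  then obtain N1 N2 where N: "\<And>m n. m \<ge> N1 \<Longrightarrow> n \<ge> N1 \<Longrightarrow> kdist K (L m) (L n) < e / 2"
    "\<And>m n. m \<ge> N2 \<Longrightarrow> n \<ge> N2 \<Longrightarrow> kdist K (M m) (M n) < e / 2"
    using L M unfolding kcauchy_def by meson
  have "kdist K (L m @ M m) (L n @ M n) < e" if "m \<ge> max N1 N2" "n \<ge> max N1 N2" for m n
  proof -
    have "kdist K (L m @ M m) (L n @ M n) = knorm K ((L m @ scale (-1) (L n)) @ (M m @ scale (-1) (M n)))"
      by (simp add: kdist_def knorm_def[OF K] algebra_simps)
    also have "\<dots> \<le> kdist K (L m) (L n) + kdist K (M m) (M n)"
      unfolding kdist_def by (rule knorm_add[OF K])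
    finally show ?thesis using N(1)[of m n] N(2)[of m n] that by simp
  qed
  then show "\<exists>N. \<forall>m\<ge>N. \<forall>n\<ge>N. kdist K (L m @ M m) (L n @ M n) < e" by blast
qed

lemma kcauchy_scale:
  assumes L: "kcauchy K L"
  shows "kcauchy K (\<lambda>n. scale a (L n))"
  unfolding kcauchy_def
proof (intro allI impI)
  fix e :: real assume e: "e > 0"
  then have "e / (cmod a + 1) > 0" by (simp add: add_nonneg_pos)
  then obtain N where N: "\<And>m n. m \<ge> N \<Longrightarrow> n \<ge> N \<Longrightarrow> kdist K (L m) (L n) < e / (cmod a + 1)"
    using L unfolding kcauchy_def by meson
  have "kdist K (scale a (L m)) (scale a (L n)) < e" if "m \<ge> N" "n \<ge> N" for m n
  proof -
    have "kdist K (scale a (L m)) (scale a (L n)) = knorm K (scale a (L m @ scale (-1) (L n)))"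
      by (simp add: kdist_def knorm_def[OF K] algebra_simps del: map_map)
    also have "\<dots> \<le> (cmod a + 1) * kdist K (L m) (L n)"
      unfolding knorm_scale[OF K] kdist_def by (intro mult_right_mono knorm_nonneg[OF K]) simp
    also have "\<dots> < e" using N[OF that] by (simp add: pos_less_divide_eq add_nonneg_pos mult.commute)
    finally show ?thesis .
  qed
  then show "\<exists>N. \<forall>m\<ge>N. \<forall>n\<ge>N. kdist K (scale a (L m)) (scale a (L n)) < e" by blast
qed

lemma kcauchy_bounded:
  assumes L: "kcauchy K L"
  shows "\<exists>B>0. \<forall>n. knorm K (L n) \<le> B"
proof -
  have "Cauchy (\<lambda>n. knorm K (L n))"
    unfolding Cauchy_def dist_real_def using L kdist_knorm unfolding kcauchy_def
    by (meson le_less_trans)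
  then have "Bseq (\<lambda>n. knorm K (L n))" by (rule Cauchy_Bseq)
  then obtain B where "B > 0" "\<And>n. norm (knorm K (L n)) \<le> B" by (auto simp: Bseq_def)
  then show ?thesis using knorm_nonneg[OF K] by auto
qed

lemma bil_diff: "cmod (bil K l m - bil K l' m') \<le> kdist K l l' * knorm K m + knorm K l' * kdist K m m'"
proof -
  have "bil K l m - bil K l' m' = bil K (l @ scale (-1) l') m + bil K l' (m @ scale (-1) m')"
    by simp
  also have "cmod \<dots> \<le> cmod (bil K (l @ scale (-1) l') m) + cmod (bil K l' (m @ scale (-1) m'))"
    by (rule norm_triangle_ineq)
  also have "\<dots> \<le> kdist K l l' * knorm K m + knorm K l' * kdist K m m'"
    unfolding kdist_def by (intro add_mono knorm_cs[OF K])
  finally show ?thesis .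
qed

lemma bil_convergent:
  assumes L: "kcauchy K L" and M: "kcauchy K M"
  shows "convergent (\<lambda>n. bil K (L n) (M n))"
proof (rule Cauchy_convergent)
  obtain A where A: "A > 0" "\<And>n. knorm K (L n) \<le> A" using kcauchy_bounded[OF L] by blast
  obtain B where B: "B > 0" "\<And>n. knorm K (M n) \<le> B" using kcauchy_bounded[OF M] by blast
  show "Cauchy (\<lambda>n. bil K (L n) (M n))"
    unfolding Cauchy_def dist_norm
  proof (intro allI impI)
    fix e :: real assume e: "e > 0"
    have "e / (2 * B) > 0" "e / (2 * A) > 0" using e A B by auto
    then obtain N1 N2 where N: "\<And>m n. m \<ge> N1 \<Longrightarrow> n \<ge> N1 \<Longrightarrow> kdist K (L m) (L n) < e / (2 * B)"
      "\<And>m n. m \<ge> N2 \<Longrightarrow> n \<ge> N2 \<Longrightarrow> kdist K (M m) (M n) < e / (2 * A)"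
      using L M unfolding kcauchy_def by meson
    have "cmod (bil K (L m) (M m) - bil K (L n) (M n)) < e" if "m \<ge> max N1 N2" "n \<ge> max N1 N2" for m n
    proof -
      have "kdist K (L m) (L n) * knorm K (M m) \<le> kdist K (L m) (L n) * B"
        by (intro mult_left_mono B kdist_nonneg)
      also have "\<dots> < e / 2" using N(1)[of m n] that B by (simp add: pos_less_divide_eq mult.commute mult.left_commute)
      finally have 1: "kdist K (L m) (L n) * knorm K (M m) < e / 2" .
      have "knorm K (L n) * kdist K (M m) (M n) \<le> A * kdist K (M m) (M n)"
        by (intro mult_right_mono A kdist_nonneg)
      also have "\<dots> < e / 2" using N(2)[of m n] that A by (simp add: pos_less_divide_eq mult.commute mult.left_commute)
      finally show ?thesis using 1 bil_diff[of "L m" "M m" "L n" "M n"] by linarith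
    qed
    then show "\<exists>N. \<forall>m\<ge>N. \<forall>n\<ge>N. cmod (bil K (L m) (M m) - bil K (L n) (M n)) < e" by blast
  qed
qed

lemma klim_tendsto: "kcauchy K L \<Longrightarrow> (\<lambda>n. bil K (L n) [(1, y)]) \<longlonglongrightarrow> klim K L y"
  using bil_convergent[OF _ kcauchy_const] by (simp add: klim_def convergent_LIMSEQ_iff)

lemma bil_single_right: "bil K l ((b, y) # m) = cnj b * bil K l [(1, y)] + bil K l m"
proof -
  have "bil K l [(b, y)] = cnj b * bil K l [(1, y)]"
    using bil_scale(2)[of K l b "[(1, y)]"] by simp
  then show ?thesis using bil_Cons(2)[of K l "(b, y)" m] by simp
qed

text \<open>A Cauchy sequence whose inner products with all kernel vectors tend to 0 tends to 0 in norm: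
  the square of the norm of a late term is nearly its inner product with any later one, and
  these inner products tend to 0, as the term is a finite combination of kernel vectors.\<close>
lemma klim_eqD:
  assumes L: "kcauchy K L" and L': "kcauchy K L'" and eq: "klim K L = klim K L'"
  shows "(\<lambda>n. kdist K (L n) (L' n)) \<longlonglongrightarrow> 0"
proof -
  define D where "D n = L n @ scale (-1) (L' n)" for n
  have D: "kcauchy K D" unfolding D_def by (intro kcauchy_append kcauchy_scale L L')
  have z: "(\<lambda>m. bil K (D m) l) \<longlonglongrightarrow> 0" for l
  proof (induction l)
    case (Cons p l)
    obtain b y where p: "p = (b, y)" by fastforce
    have "(\<lambda>m. bil K (D m) [(1, y)]) \<longlonglongrightarrow> klim K L y - klim K L' y"
      unfolding D_def using tendsto_diff[OF klim_tendsto[OF L] klim_tendsto[OF L']] by simp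
    then have "(\<lambda>m. cnj b * bil K (D m) [(1, y)] + bil K (D m) l) \<longlonglongrightarrow> cnj b * 0 + 0"
      unfolding eq by (intro tendsto_intros Cons) simp
    then show ?case by (simp add: p bil_single_right[of _ b y l])
  qed simp
  have "(\<lambda>n. knorm K (D n)) \<longlonglongrightarrow> 0"
  proof (rule LIMSEQ_I)
    fix e :: real assume e: "e > 0"
    obtain B where B: "B > 0" "\<And>n. knorm K (D n) \<le> B" using kcauchy_bounded[OF D] by blast
    have "e\<^sup>2 / (2 * B) > 0" using e B by simp
    then obtain N where N: "\<And>m n. m \<ge> N \<Longrightarrow> n \<ge> N \<Longrightarrow> kdist K (D m) (D n) < e\<^sup>2 / (2 * B)"
      using D unfolding kcauchy_def by meson
    have "knorm K (D n) < e" if n: "n \<ge> N" for n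
    proof -
      obtain M where M: "\<And>m. m \<ge> M \<Longrightarrow> cmod (bil K (D m) (D n)) < e\<^sup>2 / 2"
        using LIMSEQ_D[OF z[of "D n"], of "e\<^sup>2 / 2"] e by auto
      define m where "m = max M N"
      have "(knorm K (D n))\<^sup>2 = Re (bil K (D n) (D n))"
        by (simp add: knorm_def[OF K] pd_nonneg[OF K])
      also have "\<dots> = Re (bil K (D m) (D n)) + Re (bil K (D n @ scale (-1) (D m)) (D n))" by simp
      also have "\<dots> \<le> cmod (bil K (D m) (D n)) + cmod (bil K (D n @ scale (-1) (D m)) (D n))"
        by (intro add_mono complex_Re_le_cmod)
      also have "cmod (bil K (D n @ scale (-1) (D m)) (D n)) \<le> kdist K (D n) (D m) * B"
        using knorm_cs[OF K, of "D n @ scale (-1) (D m)" "D n"]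
          mult_left_mono[OF B(2)[of n] kdist_nonneg[of "D n" "D m"]] by (simp add: kdist_def)
      also have "kdist K (D n) (D m) * B < e\<^sup>2 / 2"
        using N[of n m] n B by (simp add: m_def pos_less_divide_eq mult.commute mult.left_commute)
      finally have "(knorm K (D n))\<^sup>2 < e\<^sup>2" using M[of m] by (simp add: m_def)
      then show ?thesis by (rule power2_less_imp_less) (use e in simp)
    qed
    then have "norm (knorm K (D n) - 0) < e" if "n \<ge> N" for n
      using that knorm_nonneg[OF K, of "D n"] by simp
    then show "\<exists>N. \<forall>n\<ge>N. norm (knorm K (D n) - 0) < e" by blast
  qed
  then show ?thesis by (simp add: D_def kdist_def)
qed

lemma klim_eqI:
  assumes L: "kcauchy K L" and L': "kcauchy K L'" and d: "(\<lambda>n. kdist K (L n) (L' n)) \<longlonglongrightarrow> 0"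
  shows "klim K L = klim K L'"
proof
  fix y
  have "(\<lambda>n. bil K (L n) [(1, y)] - bil K (L' n) [(1, y)]) \<longlonglongrightarrow> 0"
  proof (rule Lim_null_comparison[OF always_eventually])
    show "\<forall>n. norm (bil K (L n) [(1, y)] - bil K (L' n) [(1, y)]) \<le> kdist K (L n) (L' n) * knorm K [(1, y)]"
      using bil_diff[of "L _" "[(1, y)]" "L' _" "[(1, y)]"] kcauchy_const[of "[(1, y)]"]
      by (simp add: kdist_def[of _ "[(1, y)]"] knorm_def[OF K, of "[(1, y), (-1, y)]"] bil_def)
    show "(\<lambda>n. kdist K (L n) (L' n) * knorm K [(1, y)]) \<longlonglongrightarrow> 0"
      using tendsto_mult_left_zero[OF d] .
  qed
  moreover have "(\<lambda>n. bil K (L n) [(1, y)] - bil K (L' n) [(1, y)]) \<longlonglongrightarrow> klim K L y - klim K L' y"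
    by (intro tendsto_diff klim_tendsto L L')
  ultimately show "klim K L y = klim K L' y" using LIMSEQ_unique by fastforce
qed

lemma rkhs_carrier: "f \<in> carrier (rkhs K) \<longleftrightarrow> (\<exists>L. kcauchy K L \<and> f = klim K L)"
  by (auto simp: rkhs_def)

lemma rkhs_simps [simp]: "\<zero>\<^bsub>rkhs K\<^esub> = (\<lambda>x. 0)" "f \<oplus>\<^bsub>rkhs K\<^esub> g = (\<lambda>x. f x + g x)"
  "a \<odot>\<^bsub>rkhs K\<^esub> f = (\<lambda>x. a * f x)"
  by (simp_all add: rkhs_def)

lemma ip_tendsto:
  assumes L: "kcauchy K L" and M: "kcauchy K M"
  shows "(\<lambda>n. bil K (L n) (M n)) \<longlonglongrightarrow> ip (rkhs K) (klim K L) (klim K M)"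
proof -
  define L' where "L' = krep K (klim K L)"
  define M' where "M' = krep K (klim K M)"
  have L': "kcauchy K L'" "klim K L' = klim K L"
    unfolding L'_def krep_def by (rule someI2[of _ L]; use L in simp)+
  have M': "kcauchy K M'" "klim K M' = klim K M"
    unfolding M'_def krep_def by (rule someI2[of _ M]; use M in simp)+
  obtain A where A: "A > 0" "\<And>n. knorm K (M n) \<le> A" using kcauchy_bounded[OF M] by blast
  obtain B where B: "B > 0" "\<And>n. knorm K (L' n) \<le> B" using kcauchy_bounded[OF L'(1)] by blast
  have "(\<lambda>n. bil K (L n) (M n) - bil K (L' n) (M' n)) \<longlonglongrightarrow> 0"
  proof (rule Lim_null_comparison[OF always_eventually])
    show "\<forall>n. norm (bil K (L n) (M n) - bil K (L' n) (M' n)) \<le> kdist K (L n) (L' n) * A + B * kdist K (M n) (M' n)"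
    proof
      fix n
      show "norm (bil K (L n) (M n) - bil K (L' n) (M' n)) \<le> kdist K (L n) (L' n) * A + B * kdist K (M n) (M' n)"
        by (rule order_trans[OF bil_diff])
           (intro add_mono mult_left_mono mult_right_mono A(2) B(2) kdist_nonneg)
    qed
    have "(\<lambda>n. kdist K (L n) (L' n) * A + B * kdist K (M n) (M' n)) \<longlonglongrightarrow> 0 * A + B * 0"
      by (intro tendsto_intros klim_eqD L M L' M') (simp_all add: L' M')
    then show "(\<lambda>n. kdist K (L n) (L' n) * A + B * kdist K (M n) (M' n)) \<longlonglongrightarrow> 0" by simp
  qed
  moreover have "(\<lambda>n. bil K (L' n) (M' n)) \<longlonglongrightarrow> ip (rkhs K) (klim K L) (klim K M)"
    using bil_convergent[OF L'(1) M'(1)]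
    by (simp add: rkhs_def L'_def M'_def convergent_LIMSEQ_iff)
  ultimately have "(\<lambda>n. (bil K (L n) (M n) - bil K (L' n) (M' n)) + bil K (L' n) (M' n))
      \<longlonglongrightarrow> 0 + ip (rkhs K) (klim K L) (klim K M)" by (rule tendsto_add)
  then show ?thesis by simp
qed

lemma klim_append:
  assumes L: "kcauchy K L" and M: "kcauchy K M"
  shows "klim K (\<lambda>n. L n @ M n) = (\<lambda>x. klim K L x + klim K M x)"
proof
  fix x
  have "(\<lambda>n. bil K (L n @ M n) [(1, x)]) \<longlonglongrightarrow> klim K L x + klim K M x"
    using tendsto_add[OF klim_tendsto[OF L] klim_tendsto[OF M]] by simp
  then show "klim K (\<lambda>n. L n @ M n) x = klim K L x + klim K M x"
    using LIMSEQ_unique[OF klim_tendsto[OF kcauchy_append[OF L M]]] by blast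
qed

lemma klim_scale:
  assumes L: "kcauchy K L"
  shows "klim K (\<lambda>n. scale a (L n)) = (\<lambda>x. a * klim K L x)"
proof
  fix x
  have "(\<lambda>n. bil K (scale a (L n)) [(1, x)]) \<longlonglongrightarrow> a * klim K L x"
    using tendsto_mult_left[OF klim_tendsto[OF L]] by simp
  then show "klim K (\<lambda>n. scale a (L n)) x = a * klim K L x"
    using LIMSEQ_unique[OF klim_tendsto[OF kcauchy_scale[OF L]]] by blast
qed

lemma klim_const: "klim K (\<lambda>_. l) = (\<lambda>y. bil K l [(1, y)])"
  by (simp add: klim_def)

lemma rkhs_closed:
  assumes "f \<in> carrier (rkhs K)" "g \<in> carrier (rkhs K)"
  shows "(\<lambda>x. f x + g x) \<in> carrier (rkhs K)" "(\<lambda>x. a * f x) \<in> carrier (rkhs K)"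
proof -
  obtain L M where L: "kcauchy K L" "f = klim K L" and M: "kcauchy K M" "g = klim K M"
    using assms by (auto simp: rkhs_carrier)
  show "(\<lambda>x. f x + g x) \<in> carrier (rkhs K)"
    using klim_append[OF L(1) M(1)] kcauchy_append[OF L(1) M(1)] unfolding rkhs_carrier L M by metis
  show "(\<lambda>x. a * f x) \<in> carrier (rkhs K)"
    using klim_scale[OF L(1)] kcauchy_scale[OF L(1)] unfolding rkhs_carrier L by metis
qed

lemma rkhs_zero_closed: "(\<lambda>x. 0) \<in> carrier (rkhs K)"
  using klim_const[of "[]"] kcauchy_const[of "[]"] unfolding rkhs_carrier by auto

lemma abelian_group_rkhs: "abelian_group (rkhs K)"
proof (rule abelian_groupI)
  fix f assume "f \<in> carrier (rkhs K)"
  then have "(\<lambda>x. (-1) * f x) \<in> carrier (rkhs K)" by (rule rkhs_closed(2)) (rule rkhs_zero_closed)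
  then show "\<exists>g\<in>carrier (rkhs K). g \<oplus>\<^bsub>rkhs K\<^esub> f = \<zero>\<^bsub>rkhs K\<^esub>" by (rule bexI[rotated]) simp
qed (simp_all add: rkhs_closed rkhs_zero_closed add_ac)

lemma rkhs_minus:
  assumes "f \<in> carrier (rkhs K)" "g \<in> carrier (rkhs K)"
  shows "f \<ominus>\<^bsub>rkhs K\<^esub> g = (\<lambda>x. f x - g x)"
proof -
  interpret abelian_group "rkhs K" by (rule abelian_group_rkhs)
  have "(\<lambda>x. (-1) * g x) \<in> carrier (rkhs K)" using assms(2) rkhs_closed(2) by blast
  then have "\<ominus>\<^bsub>rkhs K\<^esub> g = (\<lambda>x. (-1) * g x)" using assms(2) by (intro minus_equality) simp_all
  then show ?thesis by (simp add: a_minus_def)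
qed

lemma dist_tendsto:
  assumes L: "kcauchy K L" and M: "kcauchy K M"
  shows "(\<lambda>n. kdist K (L n) (M n)) \<longlonglongrightarrow> ip_dist (rkhs K) (klim K L) (klim K M)"
proof -
  have c: "klim K L \<in> carrier (rkhs K)" "klim K M \<in> carrier (rkhs K)" using L M rkhs_carrier by auto
  define D where "D n = L n @ scale (-1) (M n)" for n
  have D: "kcauchy K D" unfolding D_def by (intro kcauchy_append kcauchy_scale L M)
  have "klim K D = klim K L \<ominus>\<^bsub>rkhs K\<^esub> klim K M"
    unfolding rkhs_minus[OF c] D_def klim_append[OF L kcauchy_scale[OF M]] klim_scale[OF M] by simp
  then have "(\<lambda>n. sqrt (Re (bil K (D n) (D n)))) \<longlonglongrightarrow> ip_dist (rkhs K) (klim K L) (klim K M)"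
    using tendsto_real_sqrt[OF tendsto_Re[OF ip_tendsto[OF D D]]] c by (simp add: ip_dist_def)
  then show ?thesis by (simp add: D_def kdist_def knorm_def[OF K])
qed

lemma Metric_space_rkhs: "Metric_space (carrier (rkhs K)) (ip_dist (rkhs K))"
proof
  show nn: "0 \<le> ip_dist (rkhs K) f g" for f g
  proof (cases "f \<in> carrier (rkhs K) \<and> g \<in> carrier (rkhs K)")
    case True
    then obtain L M where L: "kcauchy K L" "f = klim K L" and M: "kcauchy K M" "g = klim K M"
      by (auto simp: rkhs_carrier)
    show ?thesis unfolding L(2) M(2)
      by (rule LIMSEQ_le_const[OF dist_tendsto[OF L(1) M(1)]]) (simp add: kdist_nonneg)
  qed (auto simp: ip_dist_def)
  show "ip_dist (rkhs K) f g = ip_dist (rkhs K) g f" for f g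
  proof (cases "f \<in> carrier (rkhs K) \<and> g \<in> carrier (rkhs K)")
    case True
    then obtain L M where L: "kcauchy K L" "f = klim K L" and M: "kcauchy K M" "g = klim K M"
      by (auto simp: rkhs_carrier)
    show ?thesis using LIMSEQ_unique[OF dist_tendsto[OF L(1) M(1)]] dist_tendsto[OF M(1) L(1)] L M
      by (simp add: kdist_sym)
  qed (auto simp: ip_dist_def)
  show "ip_dist (rkhs K) f g = 0 \<longleftrightarrow> f = g" if as: "f \<in> carrier (rkhs K)" "g \<in> carrier (rkhs K)" for f g
  proof -
    obtain L M where L: "kcauchy K L" "f = klim K L" and M: "kcauchy K M" "g = klim K M"
      using as by (auto simp: rkhs_carrier)
    show ?thesis
      using klim_eqI[OF L(1) M(1)] klim_eqD[OF L(1) M(1)] dist_tendsto[OF L(1) M(1)] LIMSEQ_unique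
      unfolding L M by metis
  qed
  show "ip_dist (rkhs K) f h \<le> ip_dist (rkhs K) f g + ip_dist (rkhs K) g h"
    if as: "f \<in> carrier (rkhs K)" "g \<in> carrier (rkhs K)" "h \<in> carrier (rkhs K)" for f g h
  proof -
    obtain L M P where L: "kcauchy K L" "f = klim K L" and M: "kcauchy K M" "g = klim K M"
      and P: "kcauchy K P" "h = klim K P"
      using as by (auto simp: rkhs_carrier)
    show ?thesis unfolding L M P
      by (rule LIMSEQ_le[OF dist_tendsto[OF L(1) P(1)]
            tendsto_add[OF dist_tendsto[OF L(1) M(1)] dist_tendsto[OF M(1) P(1)]]])
         (use kdist_triangle in blast)
  qed
qed

lemma mcomplete_rkhs: "Metric_space.mcomplete (carrier (rkhs K)) (ip_dist (rkhs K))"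
proof -
  interpret M: Metric_space "carrier (rkhs K)" "ip_dist (rkhs K)" by (rule Metric_space_rkhs)
  let ?d = "ip_dist (rkhs K)"
  show ?thesis
    unfolding M.mcomplete_def
  proof (intro allI impI)
    fix s assume s: "M.MCauchy s"
    then have "s k \<in> carrier (rkhs K)" for k by (auto simp: M.MCauchy_def)
    then obtain L where L: "\<And>k. kcauchy K (L k)" "\<And>k. s k = klim K (L k)"
      unfolding rkhs_carrier by metis
    have "\<exists>n. \<forall>m\<ge>n. kdist K (L k m) (L k n) < 1 / Suc k" for k
      using L(1)[of k, unfolded kcauchy_def, rule_format, of "1 / Suc k"] by auto
    then obtain \<nu> where \<nu>: "\<And>k m. m \<ge> \<nu> k \<Longrightarrow> kdist K (L k m) (L k (\<nu> k)) < 1 / Suc k" by metis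
    define l where "l k = L k (\<nu> k)" for k
    define c where "c l = klim K (\<lambda>_. l)" for l
    have cc: "c l \<in> carrier (rkhs K)" for l unfolding rkhs_carrier c_def using kcauchy_const by blast
    have sl: "?d (s k) (c (l k)) \<le> 1 / Suc k" for k
      unfolding L(2) c_def
      by (rule LIMSEQ_le_const2[OF dist_tendsto[OF L(1) kcauchy_const]])
         (use \<nu> in \<open>auto simp: l_def intro!: exI[of _ "\<nu> k"] less_imp_le\<close>)
    have cd: "?d (c l) (c m) = kdist K l m" for l m
      using LIMSEQ_unique[OF dist_tendsto[OF kcauchy_const kcauchy_const]] unfolding c_def by fastforce
    have sc: "s k \<in> carrier (rkhs K)" for k using s by (auto simp: M.MCauchy_def)
    have l: "kcauchy K l"
      unfolding kcauchy_def
    proof (intro allI impI)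
      fix e :: real assume e: "e > 0"
      obtain N1 where N1: "\<And>m n. m \<ge> N1 \<Longrightarrow> n \<ge> N1 \<Longrightarrow> ?d (s m) (s n) < e / 3"
        using s e unfolding M.MCauchy_def by (metis divide_pos_pos zero_less_numeral)
      obtain N2 where N2: "1 / real (Suc N2) < e / 3" using e nat_approx_posE[of "e / 3"] by auto
      have "kdist K (l m) (l n) < e" if mn: "m \<ge> max N1 N2" "n \<ge> max N1 N2" for m n
      proof -
        have "1 / real (Suc m) \<le> 1 / real (Suc N2)" "1 / real (Suc n) \<le> 1 / real (Suc N2)"
          using mn by (auto intro!: divide_left_mono)
        moreover have "?d (c (l m)) (c (l n)) \<le> ?d (c (l m)) (s m) + (?d (s m) (s n) + ?d (s n) (c (l n)))"
          using M.triangle[OF cc[of "l m"] sc[of m] cc[of "l n"]] M.triangle[OF sc[of m] sc[of n] cc[of "l n"]] by linarith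
        ultimately show ?thesis
          using sl[of m] sl[of n] N1[of m n] N2 mn by (simp add: cd M.commute[of "c (l m)"])
      qed
      then show "\<exists>N. \<forall>m\<ge>N. \<forall>n\<ge>N. kdist K (l m) (l n) < e" by blast
    qed
    define f where "f = klim K l"
    have fc: "f \<in> carrier (rkhs K)" using l by (auto simp: f_def rkhs_carrier)
    have "\<exists>N. \<forall>k\<ge>N. ?d (s k) f < e" if e: "e > 0" for e
    proof -
      obtain N1 where N1: "\<And>m n. m \<ge> N1 \<Longrightarrow> n \<ge> N1 \<Longrightarrow> kdist K (l m) (l n) < e / 3"
        using l e unfolding kcauchy_def by (metis divide_pos_pos zero_less_numeral)
      obtain N2 where N2: "1 / real (Suc N2) < e / 3" using e nat_approx_posE[of "e / 3"] by auto
      have "?d (s k) f < e" if k: "k \<ge> max N1 N2" for k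
      proof -
        have "?d (c (l k)) f \<le> e / 3"
          unfolding c_def f_def
          by (rule LIMSEQ_le_const2[OF dist_tendsto[OF kcauchy_const l]])
             (use N1[of k] k in \<open>auto intro!: exI[of _ N1] less_imp_le\<close>)
        moreover have "1 / real (Suc k) \<le> 1 / real (Suc N2)" using k by (auto intro!: divide_left_mono)
        ultimately show ?thesis using M.triangle[OF sc[of k] cc[of "l k"] fc] sl[of k] N2 e by linarith
      qed
      then show ?thesis by blast
    qed
    then have "limitin M.mtopology s f sequentially"
      unfolding M.limitin_metric eventually_sequentially using sc fc by blast
    then show "\<exists>x. limitin M.mtopology s x sequentially" by blast
  qed
qed

theorem hilbert_space_rkhs: "hilbert_space (rkhs K)"
proof (intro hilbert_space.intro hilbert_space_axioms.intro mcomplete_rkhs)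
  show "module complex_ring (rkhs K)"
    by (rule moduleI[OF cring_complex_ring abelian_group_rkhs])
       (simp_all add: rkhs_closed algebra_simps)
  show "ip (rkhs K) f g = cnj (ip (rkhs K) g f)" if fg: "f \<in> carrier (rkhs K)" "g \<in> carrier (rkhs K)" for f g
  proof -
    obtain L M where L: "kcauchy K L" "f = klim K L" and M: "kcauchy K M" "g = klim K M"
      using fg by (auto simp: rkhs_carrier)
    have "(\<lambda>n. bil K (L n) (M n)) \<longlonglongrightarrow> cnj (ip (rkhs K) g f)"
      using tendsto_cnj[OF ip_tendsto[OF M(1) L(1)]] unfolding L M bil_cnj[OF K, symmetric] .
    then show ?thesis using LIMSEQ_unique[OF ip_tendsto[OF L(1) M(1)]] unfolding L M by blast
  qed
  show "ip (rkhs K) (f \<oplus>\<^bsub>rkhs K\<^esub> g) h = ip (rkhs K) f h + ip (rkhs K) g h"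
    if as: "f \<in> carrier (rkhs K)" "g \<in> carrier (rkhs K)" "h \<in> carrier (rkhs K)" for f g h
  proof -
    obtain L M P where L: "kcauchy K L" "f = klim K L" and M: "kcauchy K M" "g = klim K M"
      and P: "kcauchy K P" "h = klim K P"
      using as by (auto simp: rkhs_carrier)
    have "(\<lambda>n. bil K (L n @ M n) (P n)) \<longlonglongrightarrow> ip (rkhs K) f h + ip (rkhs K) g h"
      using tendsto_add[OF ip_tendsto[OF L(1) P(1)] ip_tendsto[OF M(1) P(1)]] unfolding L M P by simp
    then show ?thesis
      using LIMSEQ_unique[OF ip_tendsto[OF kcauchy_append[OF L(1) M(1)] P(1)]]
      unfolding rkhs_simps L M P klim_append[OF L(1) M(1)] by blast
  qed
  show "ip (rkhs K) (a \<odot>\<^bsub>rkhs K\<^esub> f) g = a * ip (rkhs K) f g"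
    if as: "f \<in> carrier (rkhs K)" "g \<in> carrier (rkhs K)" for a f g
  proof -
    obtain L M where L: "kcauchy K L" "f = klim K L" and M: "kcauchy K M" "g = klim K M"
      using as by (auto simp: rkhs_carrier)
    have "(\<lambda>n. bil K (scale a (L n)) (M n)) \<longlonglongrightarrow> a * ip (rkhs K) f g"
      using tendsto_mult_left[OF ip_tendsto[OF L(1) M(1)]] unfolding L M by simp
    then show ?thesis
      using LIMSEQ_unique[OF ip_tendsto[OF kcauchy_scale[OF L(1)] M(1)]]
      unfolding rkhs_simps L M klim_scale[OF L(1)] by blast
  qed
  show "0 \<le> Re (ip (rkhs K) f f)" if as: "f \<in> carrier (rkhs K)" for f
  proof -
    obtain L where L: "kcauchy K L" "f = klim K L" using as by (auto simp: rkhs_carrier)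
    show ?thesis unfolding L
      by (rule LIMSEQ_le_const[OF tendsto_Re[OF ip_tendsto[OF L(1) L(1)]]]) (auto intro: pd_nonneg[OF K])
  qed
  show "f = \<zero>\<^bsub>rkhs K\<^esub>" if f: "f \<in> carrier (rkhs K)" "ip (rkhs K) f f = 0" for f
  proof -
    obtain L where L: "kcauchy K L" "f = klim K L" using f by (auto simp: rkhs_carrier)
    have "(\<lambda>n. sqrt (Re (bil K (L n) (L n)))) \<longlonglongrightarrow> sqrt (Re 0)"
      using tendsto_real_sqrt[OF tendsto_Re[OF ip_tendsto[OF L(1) L(1)]]] f(2) unfolding L by simp
    then have "(\<lambda>n. kdist K (L n) []) \<longlonglongrightarrow> 0" by (simp add: kdist_def knorm_def[OF K])
    then have "klim K L = klim K (\<lambda>_. [])" by (rule klim_eqI[OF L(1) kcauchy_const])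
    then show ?thesis by (simp add: L klim_const)
  qed
qed

lemma rkhs_kernel: "K x \<in> carrier (rkhs K)"
proof -
  have "K x = klim K (\<lambda>_. [(1, x)])" by (simp add: klim_const bil_single)
  then show ?thesis using kcauchy_const rkhs_carrier by blast
qed

lemma rkhs_reproducing: "f \<in> carrier (rkhs K) \<Longrightarrow> ip (rkhs K) f (K x) = f x"
proof -
  assume "f \<in> carrier (rkhs K)"
  then obtain L where L: "kcauchy K L" "f = klim K L" by (auto simp: rkhs_carrier)
  have "K x = klim K (\<lambda>_. [(1, x)])" by (simp add: klim_const bil_single)
  then show ?thesis
    using LIMSEQ_unique[OF ip_tendsto[OF L(1) kcauchy_const] klim_tendsto[OF L(1)]] L(2) by metis
qed

lemma rkhs_total: "hilbert_space.total (rkhs K) K"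
proof -
  interpret hilbert_space "rkhs K" by (rule hilbert_space_rkhs)
  have comb: "comb K l = klim K (\<lambda>_. l)" for l
  proof (induction l)
    case (Cons p l)
    show ?case using bil_Cons(1)[of K p l] by (cases p) (simp add: Cons klim_const bil_def fun_eq_iff)
  qed (simp add: klim_const)
  show ?thesis
    unfolding total_def
  proof (intro ballI allI impI)
    fix f and e :: real assume f: "f \<in> carrier (rkhs K)" and e: "e > 0"
    obtain L where L: "kcauchy K L" "f = klim K L" using f by (auto simp: rkhs_carrier)
    have "e / 2 > 0" using e by simp
    then obtain N where N: "\<And>m n. m \<ge> N \<Longrightarrow> n \<ge> N \<Longrightarrow> kdist K (L m) (L n) < e / 2"
      using L(1) unfolding kcauchy_def by meson
    have "ip_dist (rkhs K) f (klim K (\<lambda>_. L N)) \<le> e / 2"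
      unfolding L(2)
      by (rule LIMSEQ_le_const2[OF dist_tendsto[OF L(1) kcauchy_const]])
         (use N in \<open>auto intro!: exI[of _ N] less_imp_le\<close>)
    moreover have "klim K (\<lambda>_. L N) \<in> carrier (rkhs K)" using kcauchy_const rkhs_carrier by blast
    ultimately have "nrm (f \<ominus>\<^bsub>rkhs K\<^esub> comb K (L N)) < e"
      using f e by (simp add: nrm_def ip_dist_def comb)
    then show "\<exists>l. nrm (f \<ominus>\<^bsub>rkhs K\<^esub> comb K l) < e" ..
  qed
qed

text \<open>A symmetry \<open>\<sigma>\<close> of the kernel acts unitarily by composition with its inverse. The GNS
  representation consists of such operators.\<close>
lemma rkhs_permute:
  assumes inv: "\<And>x. \<sigma> (\<tau> x) = x" and K\<sigma>: "\<And>x y. K (\<sigma> x) (\<sigma> y) = K x y"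
  shows "f \<in> carrier (rkhs K) \<Longrightarrow> f \<circ> \<tau> \<in> carrier (rkhs K)"
    "f \<in> carrier (rkhs K) \<Longrightarrow> g \<in> carrier (rkhs K) \<Longrightarrow> ip (rkhs K) (f \<circ> \<tau>) (g \<circ> \<tau>) = ip (rkhs K) f g"
proof -
  have c: "kcauchy K (\<lambda>n. push \<sigma> (L n))" if "kcauchy K L" for L
  proof -
    have "scale (-1) (push \<sigma> m) = push \<sigma> (scale (-1) m)" for m
      by (induction m) auto
    then have "push \<sigma> l @ scale (-1) (push \<sigma> m) = push \<sigma> (l @ scale (-1) m)" for l m
      by (simp only: map_append)
    then have "kdist K (push \<sigma> l) (push \<sigma> m) = kdist K l m" for l m
      unfolding kdist_def knorm_def[OF K] by (simp only: bil_push K\<sigma>)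
    then show ?thesis using that by (simp add: kcauchy_def)
  qed
  have e: "klim K (\<lambda>n. push \<sigma> (L n)) = klim K L \<circ> \<tau>" for L
  proof
    fix y
    have "bil K (push \<sigma> (L n)) [(1, y)] = bil K (L n) [(1, \<tau> y)]" for n
      using bil_push[of K \<sigma> "L n" \<sigma> "[(1, \<tau> y)]"] by (simp add: K\<sigma> inv)
    then show "klim K (\<lambda>n. push \<sigma> (L n)) y = (klim K L \<circ> \<tau>) y" by (simp add: klim_def)
  qed
  show "f \<in> carrier (rkhs K) \<Longrightarrow> f \<circ> \<tau> \<in> carrier (rkhs K)"
    using c e[symmetric] unfolding rkhs_carrier by blast
  show "f \<in> carrier (rkhs K) \<Longrightarrow> g \<in> carrier (rkhs K) \<Longrightarrow> ip (rkhs K) (f \<circ> \<tau>) (g \<circ> \<tau>) = ip (rkhs K) f g"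
  proof -
    assume "f \<in> carrier (rkhs K)" "g \<in> carrier (rkhs K)"
    then obtain L M where L: "kcauchy K L" "f = klim K L" and M: "kcauchy K M" "g = klim K M"
      by (auto simp: rkhs_carrier)
    have "(\<lambda>n. bil K (L n) (M n)) \<longlonglongrightarrow> ip (rkhs K) (f \<circ> \<tau>) (g \<circ> \<tau>)"
      using ip_tendsto[OF c[OF L(1)] c[OF M(1)]] unfolding e L M bil_push K\<sigma> .
    then show ?thesis
      unfolding L(2) M(2) by (rule LIMSEQ_unique[OF _ ip_tendsto[OF L(1) M(1)]])
  qed
qed

end

section \<open>Functions of positive type, the GNS construction and purity\<close>

definition kernel_of :: "('a, 'b) monoid_scheme \<Rightarrow> ('a \<Rightarrow> complex) \<Rightarrow> 'a \<Rightarrow> 'a \<Rightarrow> complex"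
  where "kernel_of G \<phi> x y =
    (if x \<in> carrier G \<and> y \<in> carrier G then \<phi> (inv\<^bsub>G\<^esub> y \<otimes>\<^bsub>G\<^esub> x) else 0)"

definition positive_type :: "('a, 'b) monoid_scheme \<Rightarrow> ('a \<Rightarrow> complex) \<Rightarrow> bool"
  where "positive_type G \<phi> \<longleftrightarrow> pd (kernel_of G \<phi>) \<and> (\<forall>x. x \<notin> carrier G \<longrightarrow> \<phi> x = 0)"

definition states :: "('a, 'b) monoid_scheme \<Rightarrow> ('a \<Rightarrow> complex) set"
  where "states G = {\<phi>. positive_type G \<phi> \<and> \<phi> \<one>\<^bsub>G\<^esub> = 1}"

definition pure :: "('a, 'b) monoid_scheme \<Rightarrow> ('a \<Rightarrow> complex) \<Rightarrow> bool"
  where "pure G \<phi> \<longleftrightarrow> \<phi> \<in> states G \<and> (\<forall>a\<in>states G. \<forall>b\<in>states G. \<forall>t. 0 < t \<and> t < 1 \<and>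
    (\<forall>x. \<phi> x = of_real (1 - t) * a x + of_real t * b x) \<longrightarrow> a = \<phi>)"

text \<open>Left translation, extended by the identity so that it permutes the whole type.\<close>
definition shift :: "('a, 'b) monoid_scheme \<Rightarrow> 'a \<Rightarrow> 'a \<Rightarrow> 'a"
  where "shift G g x = (if x \<in> carrier G then g \<otimes>\<^bsub>G\<^esub> x else x)"

definition gns :: "('a, 'b) monoid_scheme \<Rightarrow> ('a \<Rightarrow> complex) \<Rightarrow> ('a, 'a \<Rightarrow> complex) rep"
  where "gns G \<phi> = (rkhs (kernel_of G \<phi>),
    \<lambda>g. \<lambda>f\<in>carrier (rkhs (kernel_of G \<phi>)). f \<circ> shift G (inv\<^bsub>G\<^esub> g))"

context group
begin

lemma shift_closed [simp]: "g \<in> carrier G \<Longrightarrow> shift G g x \<in> carrier G \<longleftrightarrow> x \<in> carrier G"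
  by (simp add: shift_def)

lemma shift_inv: "g \<in> carrier G \<Longrightarrow> shift G g (shift G (inv g) x) = x"
  "g \<in> carrier G \<Longrightarrow> shift G (inv g) (shift G g x) = x"
  by (simp_all add: shift_def m_assoc[symmetric])

lemma shift_mult: "g \<in> carrier G \<Longrightarrow> h \<in> carrier G \<Longrightarrow> shift G (g \<otimes> h) x = shift G g (shift G h x)"
  by (simp add: shift_def m_assoc)

lemma shift_one: "shift G \<one> x = x"
  by (simp add: shift_def)

lemma kernel_shift: "g \<in> carrier G \<Longrightarrow> kernel_of G \<phi> (shift G g x) (shift G g y) = kernel_of G \<phi> x y"
  by (auto simp: kernel_of_def shift_def inv_mult_group m_assoc inv_solve_left)
     (metis inv_closed l_inv l_one m_assoc m_closed)

context
  fixes \<phi> :: "'a \<Rightarrow> complex"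
  assumes pt: "positive_type G \<phi>"
begin

lemma pt_pd: "pd (kernel_of G \<phi>)"
  using pt by (simp add: positive_type_def)

lemma pt_outside: "x \<notin> carrier G \<Longrightarrow> \<phi> x = 0"
  using pt by (simp add: positive_type_def)

lemma pt_one: "\<phi> \<one> = of_real (Re (\<phi> \<one>))" "0 \<le> Re (\<phi> \<one>)"
  using bil_real[OF pt_pd, of "[(1, \<one>)]"] pd_nonneg[OF pt_pd, of "[(1, \<one>)]"]
  by (simp_all add: bil_single kernel_of_def)

lemma pt_bound: "cmod (\<phi> x) \<le> Re (\<phi> \<one>)"
proof (cases "x \<in> carrier G")
  case True
  have "(cmod (\<phi> x))\<^sup>2 \<le> (Re (\<phi> \<one>))\<^sup>2"
    using bil_cs[OF pt_pd, of "[(1, x)]" "[(1, \<one>)]"] True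
    by (simp add: bil_single kernel_of_def power2_eq_square)
  then show ?thesis using pt_one(2) by (rule power2_le_imp_le)
qed (simp add: pt_outside pt_one(2))

text \<open>The difference of the kernel vectors at \<open>n\<close> and at the identity has norm 0.\<close>
lemma pt_periodic:
  assumes n: "n \<in> carrier G" "\<phi> n = \<phi> \<one>" and x: "x \<in> carrier G"
  shows "\<phi> (x \<otimes> n) = \<phi> x"
proof -
  let ?l = "[(1, n), (-1, \<one>)]"
  have "kernel_of G \<phi> \<one> n = cnj (kernel_of G \<phi> n \<one>)" by (rule pd_sym[OF pt_pd])
  moreover have "kernel_of G \<phi> n \<one> = \<phi> \<one>" "kernel_of G \<phi> \<one> \<one> = \<phi> \<one>" "kernel_of G \<phi> n n = \<phi> \<one>"
    using n by (simp_all add: kernel_of_def)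
  ultimately have "Re (bil (kernel_of G \<phi>) ?l ?l) = 0" by (simp add: bil_def)
  then have "bil (kernel_of G \<phi>) ?l [(1, inv x)] = 0"
    using bil_cs[OF pt_pd, of ?l "[(1, inv x)]"] by simp
  then show ?thesis using n x by (simp add: bil_def kernel_of_def)
qed

end

end

locale group_rep = group G + hilbert_space V
  for G :: "('a, 'b) monoid_scheme" (structure) and V :: "'v inner_space" and \<pi> :: "'a \<Rightarrow> 'v \<Rightarrow> 'v" +
  assumes hom: "\<pi> \<in> hom G (unitary_group V)"
begin

lemma unitary: "g \<in> carrier G \<Longrightarrow> \<pi> g \<in> unitary_maps V V"
  by (rule unitary_groupD(1)[OF hom])

lemma rep_closed [simp]: "g \<in> carrier G \<Longrightarrow> v \<in> carrier V \<Longrightarrow> \<pi> g v \<in> carrier V"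
  using unitary_mapsD(1)[OF unitary] by blast

lemma rep_mult: "g \<in> carrier G \<Longrightarrow> h \<in> carrier G \<Longrightarrow> v \<in> carrier V \<Longrightarrow> \<pi> (g \<otimes>\<^bsub>G\<^esub> h) v = \<pi> g (\<pi> h v)"
  by (rule unitary_groupD(3)[OF hom])

lemma rep_extensional: "g \<in> carrier G \<Longrightarrow> \<pi> g \<in> extensional (carrier V)"
  using unitary_groupD(2)[OF hom] by (auto simp: Bij_def)

lemma rep_one: "v \<in> carrier V \<Longrightarrow> \<pi> \<one>\<^bsub>G\<^esub> v = v"
proof -
  assume v: "v \<in> carrier V"
  have "\<pi> \<one>\<^bsub>G\<^esub> (\<pi> \<one>\<^bsub>G\<^esub> v) = \<pi> \<one>\<^bsub>G\<^esub> v" using rep_mult[of "\<one>\<^bsub>G\<^esub>" "\<one>\<^bsub>G\<^esub>" v] v by simp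
  moreover have "inj_on (\<pi> \<one>\<^bsub>G\<^esub>) (carrier V)"
    using unitary_groupD(2)[OF hom, of "\<one>\<^bsub>G\<^esub>"] by (auto simp: Bij_def bij_betw_def)
  ultimately show ?thesis using v by (auto dest: inj_onD)
qed

lemma rep_ip: "g \<in> carrier G \<Longrightarrow> v \<in> carrier V \<Longrightarrow> w \<in> carrier V \<Longrightarrow> ip V (\<pi> g v) (\<pi> g w) = ip V v w"
  using unitary_mapsD(4)[OF unitary] by blast

lemma rep_adj:
  assumes "g \<in> carrier G" "v \<in> carrier V" "w \<in> carrier V"
  shows "ip V (\<pi> g v) w = ip V v (\<pi> (inv\<^bsub>G\<^esub> g) w)"
  using rep_ip[of g v "\<pi> (inv\<^bsub>G\<^esub> g) w"] rep_mult[of g "inv\<^bsub>G\<^esub> g" w] assms by (simp add: rep_one)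

lemma rep_linear: "g \<in> carrier G \<Longrightarrow> bddlin (\<pi> g)"
  by (rule unitary_bddlin[OF unitary])

lemma rep_nrm: "g \<in> carrier G \<Longrightarrow> v \<in> carrier V \<Longrightarrow> nrm (\<pi> g v) = nrm v"
  by (rule unitary_nrm[OF unitary])

lemma rep_zero: "g \<in> carrier G \<Longrightarrow> \<pi> g \<zero>\<^bsub>V\<^esub> = \<zero>\<^bsub>V\<^esub>"
  using rep_nrm[of g "\<zero>\<^bsub>V\<^esub>"] nrm_eq_zero[of "\<pi> g \<zero>\<^bsub>V\<^esub>"] by simp

definition coef :: "'v \<Rightarrow> 'a \<Rightarrow> complex"
  where "coef v x = (if x \<in> carrier G then ip V (\<pi> x v) v else 0)"

definition orb :: "'v \<Rightarrow> 'a \<Rightarrow> 'v"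
  where "orb v x = (if x \<in> carrier G then \<pi> x v else \<zero>\<^bsub>V\<^esub>)"

lemma orb_closed [simp]: "v \<in> carrier V \<Longrightarrow> orb v x \<in> carrier V"
  by (simp add: orb_def)

lemma orb_one: "v \<in> carrier V \<Longrightarrow> orb v \<one>\<^bsub>G\<^esub> = v"
  by (simp add: orb_def rep_one)

lemma rep_orb: "g \<in> carrier G \<Longrightarrow> v \<in> carrier V \<Longrightarrow> \<pi> g (orb v x) = orb v (shift G g x)"
  by (simp add: orb_def shift_def rep_mult rep_zero)

lemma kernel_coef: "v \<in> carrier V \<Longrightarrow> kernel_of G (coef v) x y = ip V (orb v x) (orb v y)"
proof (cases "x \<in> carrier G \<and> y \<in> carrier G")
  case True
  assume v: "v \<in> carrier V"
  have "ip V (\<pi> y v) (\<pi> x v) = ip V v (\<pi> (inv\<^bsub>G\<^esub> y) (\<pi> x v))"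
    using True v by (simp add: rep_adj)
  then have "ip V (\<pi> x v) (\<pi> y v) = ip V (\<pi> (inv\<^bsub>G\<^esub> y) (\<pi> x v)) v"
    using True v ip_cnj[of "\<pi> x v" "\<pi> y v"] ip_cnj[of v "\<pi> (inv\<^bsub>G\<^esub> y) (\<pi> x v)"] by simp
  then show ?thesis using True v by (simp add: kernel_of_def coef_def orb_def rep_mult)
qed (auto simp: kernel_of_def orb_def ip_zero)

lemma kernel_coef_fun: "v \<in> carrier V \<Longrightarrow> kernel_of G (coef v) = (\<lambda>x y. ip V (orb v x) (orb v y))"
  by (simp add: kernel_coef fun_eq_iff)

lemma coef_positive_type: "v \<in> carrier V \<Longrightarrow> positive_type G (coef v)"
  using pd_gram[of "orb v"] unfolding positive_type_def by (simp add: kernel_coef_fun coef_def)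

lemma coef_one: "v \<in> carrier V \<Longrightarrow> coef v \<one>\<^bsub>G\<^esub> = of_real ((nrm v)\<^sup>2)"
  by (simp add: coef_def rep_one nrm_sq)

lemma coef_states: "v \<in> carrier V \<Longrightarrow> nrm v = 1 \<Longrightarrow> coef v \<in> states G"
  by (simp add: states_def coef_positive_type coef_one)

lemma coef_normalized:
  assumes v: "v \<in> carrier V" "nrm v \<noteq> 0"
  shows "(\<lambda>x. coef v x / of_real ((nrm v)\<^sup>2)) \<in> states G"
proof -
  define u where "u = of_real (1 / nrm v) \<odot>\<^bsub>V\<^esub> v"
  have u: "u \<in> carrier V" "nrm u = 1" using v by (simp_all add: u_def cr nrm_smult norm_divide)
  have "coef u x = coef v x / of_real ((nrm v)\<^sup>2)" for x
    using v by (simp add: coef_def u_def bddlinD[OF rep_linear] ip_smult ip_smult2 cr power2_eq_square)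
  then have "coef u = (\<lambda>x. coef v x / of_real ((nrm v)\<^sup>2))" by (rule ext)
  then show ?thesis using coef_states[OF u] by simp
qed

lemma ip_rep_comb:
  assumes v: "v \<in> carrier V" and x: "x \<in> carrier G"
  shows "ip V (\<pi> x (comb (orb v) l)) (comb (orb v) m) =
    bil (\<lambda>z y. kernel_of G (coef v) (shift G x z) y) l m"
proof -
  have e: "\<pi> x (comb (orb v) l) = comb (\<lambda>z. orb v (shift G x z)) l" for l
  proof (induction l)
    case (Cons p l)
    have "comb (orb v) l \<in> carrier V" by (rule comb_closed) (simp add: v)
    then show ?case using x v Cons by (simp add: bddlinD[OF rep_linear] rep_orb cr)
  qed (simp add: rep_zero x)
  show ?thesis unfolding e using v by (simp add: ip_comb_comb kernel_coef)
qed

lemma coef_comb: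
  assumes v: "v \<in> carrier V" and x: "x \<in> carrier G"
  shows "coef (comb (orb v) l) x = bil (\<lambda>z y. kernel_of G (coef v) (shift G x z) y) l l"
  using x by (simp add: coef_def ip_rep_comb[OF v])

lemma irreducible_iff:
  "irreducible_rep G (V, \<pi>) \<longleftrightarrow> carrier V \<noteq> {\<zero>\<^bsub>V\<^esub>} \<and>
    (\<forall>W. closed_subspace W V \<and> (\<forall>g\<in>carrier G. \<pi> g ` W \<subseteq> W) \<longrightarrow> W = {\<zero>\<^bsub>V\<^esub>} \<or> W = carrier V)"
  using hom hilbert_space_axioms by (simp add: irreducible_rep_def unitary_rep_def)

lemma cspan_invariant:
  assumes v: "v \<in> carrier V" and g: "g \<in> carrier G"
  shows "\<pi> g ` cspan (orb v) \<subseteq> cspan (orb v)"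
proof
  fix y assume "y \<in> \<pi> g ` cspan (orb v)"
  then obtain u where u: "y = \<pi> g u" "u \<in> carrier V" "u \<in> cspan (orb v)" by (auto simp: cspan_def)
  have W: "closed_subspace (cspan (orb v)) V" by (rule closed_subspace_cspan) (simp add: v)
  obtain l where l: "conv (\<lambda>n. comb (orb v) (l n)) u"
    using cspan_seq[of "orb v" u] u v by auto
  have "\<pi> g (comb (orb v) l) \<in> cspan (orb v)" for l
  proof (induction l)
    case Nil
    then show ?case using g closed_subspaceD(2)[OF W] by (simp add: rep_zero)
  next
    case (Cons p l)
    have "comb (orb v) l \<in> carrier V" by (rule comb_closed) (simp add: v)
    moreover have "orb v x \<in> cspan (orb v)" for x by (rule cspan_base) (simp add: v)
    ultimately show ?case using g v Cons closed_subspaceD[OF W]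
      by (simp add: bddlinD[OF rep_linear] rep_orb cr)
  qed
  then show "y \<in> cspan (orb v)"
    using closed_subspace_conv[OF W _ bddlin_conv[OF rep_linear[OF g] l]] u(1) by simp
qed

lemma irreducible_total:
  assumes irr: "irreducible_rep G (V, \<pi>)" and v: "v \<in> carrier V" "nrm v \<noteq> 0"
  shows "total (orb v)"
proof -
  have "closed_subspace (cspan (orb v)) V" by (rule closed_subspace_cspan) (simp add: v)
  then have "cspan (orb v) = {\<zero>\<^bsub>V\<^esub>} \<or> cspan (orb v) = carrier V"
    using irr cspan_invariant[OF v(1)] by (simp add: irreducible_iff)
  moreover have "v \<in> cspan (orb v)" using cspan_base[of "orb v" "\<one>\<^bsub>G\<^esub>"] v by (simp add: orb_one)
  moreover have "v \<noteq> \<zero>\<^bsub>V\<^esub>" using v(2) by auto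
  ultimately show ?thesis unfolding total_iff by blast
qed

text \<open>An invariant closed subspace \<open>W\<close> splits \<open>\<zeta>\<close> into orthogonal components \<open>w\<close> and \<open>w'\<close>, and the
  coefficient of \<open>\<zeta>\<close> into the sum of theirs. Purity makes the coefficient of \<open>w\<close> a multiple of that of
  \<open>\<zeta>\<close>, whence \<open>w = |w|\<^sup>2 \<zeta>\<close> because the orbit of \<open>\<zeta>\<close> is total. So either \<open>w = 0\<close>, and \<open>W\<close> is orthogonal
  to the orbit, or \<open>W\<close> contains \<open>\<zeta>\<close>.\<close>
lemma pure_cyclic_irreducible:
  assumes z: "\<zeta> \<in> carrier V" "nrm \<zeta> = 1" and tot: "total (orb \<zeta>)" and pure: "pure G (coef \<zeta>)"
  shows "irreducible_rep G (V, \<pi>)"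
  unfolding irreducible_iff
proof (intro conjI allI impI)
  show "carrier V \<noteq> {\<zero>\<^bsub>V\<^esub>}" using z by auto
  fix W assume W0: "closed_subspace W V \<and> (\<forall>g\<in>carrier G. \<pi> g ` W \<subseteq> W)"
  then have W: "closed_subspace W V" and inv: "\<And>g u. g \<in> carrier G \<Longrightarrow> u \<in> W \<Longrightarrow> \<pi> g u \<in> W" by auto
  note WD = closed_subspaceD[OF W]
  have full: "W = carrier V" if zW: "\<zeta> \<in> W"
  proof -
    have o: "orb \<zeta> x \<in> W" for x using inv zW WD(2) by (simp add: orb_def)
    have "u \<in> W" if u: "u \<in> carrier V" for u
    proof -
      obtain l where l: "conv (\<lambda>n. comb (orb \<zeta>) (l n)) u"
        using cspan_seq[of "orb \<zeta>" u] z u tot by (auto simp: total_iff)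
      show ?thesis using closed_subspace_conv[OF W comb_in[OF W o] l] .
    qed
    then show ?thesis using WD(1) by blast
  qed
  obtain w where w: "w \<in> W" "\<And>u. u \<in> W \<Longrightarrow> ip V u (\<zeta> \<ominus>\<^bsub>V\<^esub> w) = 0"
    using projection[OF W z(1)] by blast
  define w' where "w' = \<zeta> \<ominus>\<^bsub>V\<^esub> w"
  have wc: "w \<in> carrier V" "w' \<in> carrier V" using w(1) WD(1) z by (auto simp: w'_def)
  have zw: "\<zeta> = w \<oplus>\<^bsub>V\<^esub> w'" unfolding w'_def by (rule ip_eqI) (use wc z in \<open>auto simp: ip_simps\<close>)
  have o1: "ip V (\<pi> x w) w' = 0" if "x \<in> carrier G" for x
    using w(2) inv w(1) that by (simp add: w'_def)
  have o2: "ip V (\<pi> x w') w = 0" if "x \<in> carrier G" for x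
    using o1[of "inv\<^bsub>G\<^esub> x"] rep_adj[OF that wc(2,1)] ip_cnj[of w' "\<pi> (inv\<^bsub>G\<^esub> x) w"] that wc by simp
  have split: "coef \<zeta> x = coef w x + coef w' x" for x
    using wc o1[of x] o2[of x] unfolding zw coef_def by (simp add: bddlinD[OF rep_linear] ip_add ip_add2)
  have "(nrm \<zeta>)\<^sup>2 = (nrm w)\<^sup>2 + (nrm w')\<^sup>2"
  proof -
    have "complex_of_real ((nrm \<zeta>)\<^sup>2) = of_real ((nrm w)\<^sup>2 + (nrm w')\<^sup>2)"
      using split[of "\<one>\<^bsub>G\<^esub>"] coef_one z(1) wc by simp
    then show ?thesis by (simp only: of_real_eq_iff)
  qed
  then have n: "1 - (nrm w')\<^sup>2 = (nrm w)\<^sup>2" using z by simp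
  show "W = {\<zero>\<^bsub>V\<^esub>} \<or> W = carrier V"
  proof (cases "nrm w = 0")
    case True
    then have "w = \<zero>\<^bsub>V\<^esub>" using wc nrm_eq_zero by blast
    then have zz: "\<zeta> = w'" using zw wc by simp
    have "u = \<zero>\<^bsub>V\<^esub>" if u: "u \<in> W" for u
    proof (rule total_eqI[of "orb \<zeta>"])
      have uc: "u \<in> carrier V" using u WD(1) by blast
      show "ip V (orb \<zeta> i) u = ip V (orb \<zeta> i) \<zero>\<^bsub>V\<^esub>" for i
      proof (cases "i \<in> carrier G")
        case True
        have "ip V (\<pi> (inv\<^bsub>G\<^esub> i) u) \<zeta> = 0"
          using w(2)[OF inv[OF _ u], of "inv\<^bsub>G\<^esub> i"] True unfolding w'_def[symmetric] zz[symmetric] by simp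
        then show ?thesis
          using True uc z rep_adj[of i \<zeta> u] ip_cnj[of \<zeta> "\<pi> (inv\<^bsub>G\<^esub> i) u"] by (simp add: orb_def ip_zero)
      qed (use uc in \<open>simp add: orb_def ip_zero\<close>)
    qed (use z tot u WD(1) in auto)
    then show ?thesis using WD(2) by blast
  next
    case False
    have "\<zeta> \<in> W"
    proof (cases "nrm w' = 0")
      case True
      then have "w' = \<zero>\<^bsub>V\<^esub>" using wc nrm_eq_zero by blast
      then show ?thesis using zw wc w by simp
    next
      case w'0: False
      define a where "a x = coef w x / of_real ((nrm w)\<^sup>2)" for x
      define b where "b x = coef w' x / of_real ((nrm w')\<^sup>2)" for x
      have ab: "a \<in> states G" "b \<in> states G"
        unfolding a_def b_def using coef_normalized wc False w'0 by auto
      have lt: "0 < (nrm w')\<^sup>2" "(nrm w')\<^sup>2 < 1" using False w'0 n by (auto simp: zero_less_power2)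
        (metis diff_gt_0_iff_gt zero_less_power2)
      have "coef \<zeta> x = of_real (1 - (nrm w')\<^sup>2) * a x + of_real ((nrm w')\<^sup>2) * b x" for x
        unfolding n split using False w'0 by (simp add: a_def b_def)
      then have "a = coef \<zeta>" using pure ab lt unfolding pure_def by blast
      then have key: "coef w x = of_real ((nrm w)\<^sup>2) * coef \<zeta> x" for x
        using False by (simp add: a_def fun_eq_iff field_simps)
      have "w = of_real ((nrm w)\<^sup>2) \<odot>\<^bsub>V\<^esub> \<zeta>"
      proof (rule total_eqI[of "orb \<zeta>"])
        show "ip V (orb \<zeta> i) w = ip V (orb \<zeta> i) (of_real ((nrm w)\<^sup>2) \<odot>\<^bsub>V\<^esub> \<zeta>)" for i
        proof (cases "i \<in> carrier G")
          case True
          have "ip V (\<pi> i \<zeta>) w = ip V (\<pi> i w) w + ip V (\<pi> i w') w"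
            using True wc unfolding zw by (simp add: bddlinD[OF rep_linear] ip_add)
          also have "\<dots> = of_real ((nrm w)\<^sup>2) * ip V (\<pi> i \<zeta>) \<zeta>"
            using key[of i] True o2[OF True] by (simp add: coef_def)
          finally show ?thesis using True z by (simp add: orb_def ip_smult2)
        qed (use wc z in \<open>simp add: orb_def ip_zero cr\<close>)
      qed (use z tot wc cr in auto)
      moreover have "of_real (1 / (nrm w)\<^sup>2) \<odot>\<^bsub>V\<^esub> (of_real ((nrm w)\<^sup>2) \<odot>\<^bsub>V\<^esub> \<zeta>) = \<zeta>"
        by (rule ip_eqI) (use z False in \<open>auto simp: ip_simps\<close>)
      ultimately show ?thesis using WD(4)[OF w(1), of "of_real (1 / (nrm w)\<^sup>2)"] by simp
    qed
    then show ?thesis using full by blast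
  qed
qed

lemma closed_subspace_carrier: "closed_subspace (carrier V) V"
  by (rule closed_subspaceI) (auto simp: cr conv_def)

text \<open>If the coefficient of \<open>v\<close> is a mixture that contains the state \<open>a\<close>, then the kernel of \<open>a\<close> is
  dominated by a multiple of the inner products of the orbit of \<open>v\<close>. By \<open>moment_riesz\<close> it is given by a
  bounded symmetric operator \<open>T\<close>, which commutes with the representation. By Schur's lemma \<open>T\<close> is a
  scalar.\<close>
theorem irreducible_coef_pure:
  assumes irr: "irreducible_rep G (V, \<pi>)" and v: "v \<in> carrier V" "nrm v = 1"
  shows "pure G (coef v)"
  unfolding pure_def
proof (intro conjI ballI allI impI)
  show "coef v \<in> states G" using coef_states v by blast
  fix a b t
  assume a: "a \<in> states G" and b: "b \<in> states G"
    and t: "0 < t \<and> t < 1 \<and> (\<forall>x. coef v x = of_real (1 - t) * a x + of_real t * b x)"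
  define x where "x = orb v"
  have xc: "x i \<in> carrier V" for i by (simp add: x_def v)
  have tot: "total x" unfolding x_def using irreducible_total[OF irr v(1)] v(2) by simp
  have pa: "positive_type G a" and pb: "positive_type G b" and a1: "a \<one>\<^bsub>G\<^esub> = 1"
    using a b by (auto simp: states_def)
  define K where "K = kernel_of G a"
  have K: "pd K" unfolding K_def by (rule pt_pd[OF pa])
  define C where "C = 1 / (1 - t)"
  have C: "C > 0" using t by (simp add: C_def)
  have dom: "Re (bil K l l) \<le> C * (nrm (comb x l))\<^sup>2" for l
  proof -
    have "kernel_of G (coef v) = (\<lambda>i j. of_real (1 - t) * K i j + of_real t * kernel_of G b i j)"
      using t by (auto simp: K_def kernel_of_def fun_eq_iff)
    then have "bil (kernel_of G (coef v)) l l = of_real (1 - t) * bil K l l + of_real t * bil (kernel_of G b) l l"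
      by (simp only: bil_add_kernel bil_mult_kernel)
    moreover have "bil (kernel_of G (coef v)) l l = ip V (comb x l) (comb x l)"
      unfolding x_def kernel_coef_fun[OF v(1)] by (subst ip_comb_comb) (simp_all add: v)
    ultimately have "(nrm (comb x l))\<^sup>2 = (1 - t) * Re (bil K l l) + t * Re (bil (kernel_of G b) l l)"
      by (simp add: Re_nrm_sq[symmetric] comb_closed xc)
    moreover have "0 \<le> t * Re (bil (kernel_of G b) l l)"
      using t pd_nonneg[OF pt_pd[OF pb]] by simp
    ultimately have "(1 - t) * Re (bil K l l) \<le> (nrm (comb x l))\<^sup>2" by linarith
    then show ?thesis using t by (simp add: C_def field_simps)
  qed
  have kdom: "knorm K l \<le> sqrt C * nrm (comb x l)" for l
  proof -
    have "knorm K l \<le> sqrt (C * (nrm (comb x l))\<^sup>2)"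
      unfolding knorm_def[OF K] by (intro real_sqrt_le_mono dom)
    then show ?thesis by (simp add: real_sqrt_mult comb_closed xc)
  qed
  have "\<exists>w\<in>carrier V. \<forall>i. ip V (x i) w = K i j" for j
  proof (rule moment_riesz[OF closed_subspace_carrier xc])
    show "0 \<le> sqrt C * knorm K [(1, j)]" using C knorm_nonneg[OF K] by simp
    show "cmod (\<Sum>p\<leftarrow>l. fst p * K (snd p) j) \<le> sqrt C * knorm K [(1, j)] * nrm (comb x l)" for l
    proof -
      have "(\<Sum>p\<leftarrow>l. fst p * K (snd p) j) = bil K l [(1, j)]" by (simp add: bil_def)
      then show ?thesis
        using knorm_cs[OF K, of l "[(1, j)]"] mult_right_mono[OF kdom[of l] knorm_nonneg[OF K, of "[(1, j)]"]]
        by (simp add: mult_ac)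
    qed
  qed
  \<comment> \<open>\<open>\<tau> j\<close> is the image of \<open>x j\<close> under the operator to be constructed.\<close>
  then obtain \<tau> where \<tau>c: "\<And>j. \<tau> j \<in> carrier V" and \<tau>: "\<And>i j. ip V (x i) (\<tau> j) = K i j" by metis
  have \<tau>comb: "nrm (comb \<tau> d) \<le> C * nrm (comb x d)" for d
  proof (rule total_nrm_le[OF xc tot])
    show "0 \<le> C * nrm (comb x d)" using C by (simp add: comb_closed xc)
    show "cmod (ip V (comb x l) (comb \<tau> d)) \<le> C * nrm (comb x d) * nrm (comb x l)" for l
    proof -
      have "ip V (comb x l) (comb \<tau> d) = bil K l d" by (simp add: ip_comb_comb xc \<tau>c \<tau>)
      also have "cmod \<dots> \<le> knorm K l * knorm K d" by (rule knorm_cs[OF K])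
      also have "\<dots> \<le> (sqrt C * nrm (comb x l)) * (sqrt C * nrm (comb x d))"
        using C by (intro mult_mono kdom) (simp_all add: knorm_nonneg[OF K] comb_closed xc)
      also have "\<dots> = C * nrm (comb x d) * nrm (comb x l)" using C by simp
      finally show ?thesis .
    qed
  qed (rule comb_closed[OF \<tau>c])
  have \<tau>bound: "cmod (ip V (comb \<tau> l) u) \<le> C * nrm u * nrm (comb x l)" if u: "u \<in> carrier V" for l u
    using nrm_cs[OF comb_closed u, of \<tau> l] \<tau>c mult_right_mono[OF \<tau>comb[of l], of "nrm u"] u
    by (simp add: mult_ac)
  have "\<exists>w\<in>carrier V. \<forall>i. ip V (x i) w = ip V (\<tau> i) u" if u: "u \<in> carrier V" for u
  proof (rule moment_riesz[OF closed_subspace_carrier xc])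
    show "0 \<le> C * nrm u" using C u by simp
    show "cmod (\<Sum>p\<leftarrow>l. fst p * ip V (\<tau> (snd p)) u) \<le> C * nrm u * nrm (comb x l)" for l
      using \<tau>bound[OF u, of l] by (simp add: ip_comb \<tau>c u)
  qed
  then obtain T where Tc: "\<And>u. u \<in> carrier V \<Longrightarrow> T u \<in> carrier V"
    and T: "\<And>u i. u \<in> carrier V \<Longrightarrow> ip V (x i) (T u) = ip V (\<tau> i) u" by metis
  note teq = total_eqI[of x, OF xc tot]
  have Tx: "T (x i) = \<tau> i" for i
  proof (rule teq)
    have "ip V (x j) (T (x i)) = cnj (K i j)" for j
      using T[OF xc, of j i] ip_cnj[OF \<tau>c xc, of j i] by (simp add: \<tau>)
    then show "ip V (x j) (T (x i)) = ip V (x j) (\<tau> i)" for j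
      using pd_sym[OF K, of j i] by (simp add: \<tau>)
  qed (simp_all add: Tc xc \<tau>c)
  have Tn: "nrm (T u) \<le> C * nrm u" if u: "u \<in> carrier V" for u
  proof (rule total_nrm_le[OF xc tot])
    show "cmod (ip V (comb x l) (T u)) \<le> C * nrm u * nrm (comb x l)" for l
      using \<tau>bound[OF u, of l] u by (simp add: ip_comb xc \<tau>c Tc T)
  qed (use C u Tc in auto)
  have Tlin: "bddlin T"
    unfolding bddlin_def
  proof (intro conjI ballI allI)
    show "T (u \<oplus>\<^bsub>V\<^esub> w) = T u \<oplus>\<^bsub>V\<^esub> T w" if "u \<in> carrier V" "w \<in> carrier V" for u w
      by (rule teq) (use that Tc in \<open>simp_all add: T ip_add2 \<tau>c xc\<close>)
    show "T (c \<odot>\<^bsub>V\<^esub> u) = c \<odot>\<^bsub>V\<^esub> T u" if "u \<in> carrier V" for c u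
      by (rule teq) (use that Tc in \<open>simp_all add: T ip_smult2 \<tau>c xc cr\<close>)
  qed (use Tc Tn in auto)
  have Tcomb: "T (comb x l) = comb \<tau> l" for l
  proof (induction l)
    case Nil
    then show ?case using bddlinD(4)[OF Tlin, of "\<zero>\<^bsub>V\<^esub>" "\<zero>\<^bsub>V\<^esub>"] Tc by (simp add: minus_zeroI)
  next
    case (Cons p l)
    then show ?case by (simp add: bddlinD[OF Tlin] xc cr comb_closed Tx)
  qed
  have Tsym: "symop C T"
    unfolding symop_def
  proof (intro conjI ballI)
    fix u w assume u: "u \<in> carrier V" and w: "w \<in> carrier V"
    obtain l where l: "conv (\<lambda>n. comb x (l n)) u"
      using cspan_seq[of x u] xc u tot by (auto simp: total_iff)
    have "ip V (comb x (l n)) (T w) = ip V (T (comb x (l n))) w" for n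
      unfolding Tcomb using w Tc by (simp add: ip_comb xc \<tau>c T)
    then show "ip V (T u) w = ip V u (T w)"
      using LIMSEQ_unique[OF conv_ip(1)[OF l Tc[OF w]]] conv_ip(1)[OF bddlin_conv[OF Tlin l] w] by simp
  qed (use Tc Tn in auto)
  have Kshift: "K (shift G g i) j = K i (shift G (inv\<^bsub>G\<^esub> g) j)" if g: "g \<in> carrier G" for g i j
    using kernel_shift[OF g, of a i "shift G (inv\<^bsub>G\<^esub> g) j"] g by (simp add: K_def shift_inv)
  have xshift: "ip V (x i) (\<pi> g u) = ip V (x (shift G (inv\<^bsub>G\<^esub> g) i)) u" if g: "g \<in> carrier G" and u: "u \<in> carrier V" for g i u
    using rep_adj[of "inv\<^bsub>G\<^esub> g" "x i" u] g u xc rep_orb[of "inv\<^bsub>G\<^esub> g" v i] v by (simp add: x_def)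
  have \<tau>shift: "\<tau> (shift G g j) = \<pi> g (\<tau> j)" if g: "g \<in> carrier G" for g j
  proof (rule teq)
    show "ip V (x i) (\<tau> (shift G g j)) = ip V (x i) (\<pi> g (\<tau> j))" for i
      using Kshift[of "inv\<^bsub>G\<^esub> g" i j] g by (simp add: \<tau> xshift \<tau>c)
  qed (use g \<tau>c in auto)
  have comm: "T (\<pi> g u) = \<pi> g (T u)" if g: "g \<in> carrier G" and u: "u \<in> carrier V" for g u
  proof (rule teq)
    fix i
    have "ip V (x i) (T (\<pi> g u)) = ip V (\<tau> i) (\<pi> g u)" using g u by (simp add: T)
    also have "\<dots> = ip V (\<tau> (shift G (inv\<^bsub>G\<^esub> g) i)) u"
      using rep_adj[of "inv\<^bsub>G\<^esub> g" "\<tau> i" u] g u \<tau>c by (simp add: \<tau>shift)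
    also have "\<dots> = ip V (x i) (\<pi> g (T u))" using g u Tc by (simp add: T xshift)
    finally show "ip V (x i) (T (\<pi> g u)) = ip V (x i) (\<pi> g (T u))" .
  qed (use g u Tc in auto)
  have "\<exists>c. \<forall>u\<in>carrier V. T u = of_real c \<odot>\<^bsub>V\<^esub> u"
  proof (rule schur[of "\<pi> ` carrier G"])
    show "\<pi> ` carrier G \<subseteq> unitary_maps V V" using unitary by blast
    show "W = {\<zero>\<^bsub>V\<^esub>} \<or> W = carrier V"
      if "closed_subspace W V" "\<And>A. A \<in> \<pi> ` carrier G \<Longrightarrow> A ` W \<subseteq> W" for W
      using irr that unfolding irreducible_iff by simp
    show "symop C T" by (rule Tsym)
    show "T (A u) = A (T u)" if "A \<in> \<pi> ` carrier G" "u \<in> carrier V" for A u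
      using that comm by auto
  qed
  then obtain c where c: "\<And>u. u \<in> carrier V \<Longrightarrow> T u = of_real c \<odot>\<^bsub>V\<^esub> u" by blast
  have ac: "a g = of_real c * coef v g" if g: "g \<in> carrier G" for g
  proof -
    have "a g = K g \<one>\<^bsub>G\<^esub>" using g by (simp add: K_def kernel_of_def)
    also have "\<dots> = ip V (x g) (of_real c \<odot>\<^bsub>V\<^esub> x \<one>\<^bsub>G\<^esub>)" using \<tau>[of g "\<one>\<^bsub>G\<^esub>"] Tx[of "\<one>\<^bsub>G\<^esub>"] c[OF xc] by simp
    also have "\<dots> = of_real c * coef v g" using g v by (simp add: x_def orb_one ip_smult2 coef_def orb_def rep_one)
    finally show ?thesis .
  qed
  have "of_real c = (1 :: complex)" using ac[of "\<one>\<^bsub>G\<^esub>"] a1 coef_one[OF v(1)] v(2) by simp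
  show "a = coef v"
  proof
    fix g
    show "a g = coef v g"
    proof (cases "g \<in> carrier G")
      case True
      then show ?thesis using ac[of g] \<open>of_real c = 1\<close> by simp
    qed (simp add: coef_def pt_outside[OF pa])
  qed
qed

end

context group
begin

lemma gns_rep:
  assumes pt: "positive_type G \<phi>"
  shows "group_rep G (fst (gns G \<phi>)) (snd (gns G \<phi>))"
proof -
  define K where "K = kernel_of G \<phi>"
  have K: "pd K" unfolding K_def by (rule pt_pd[OF pt])
  define V where "V = rkhs K"
  interpret hilbert_space V unfolding V_def by (rule hilbert_space_rkhs[OF K])
  define L where "L g = (\<lambda>f\<in>carrier V. f \<circ> shift G (inv g))" for g
  have L: "L g f = f \<circ> shift G (inv g)" if "f \<in> carrier V" for g f using that by (simp add: L_def)
  have Lc: "L g f \<in> carrier V" if "f \<in> carrier V" "g \<in> carrier G" for g f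
    using that rkhs_permute(1)[OF K, of "shift G g" "shift G (inv g)" f]
    by (simp add: L V_def K_def shift_inv kernel_shift)
  have Lip: "ip V (L g f) (L g h) = ip V f h" if "f \<in> carrier V" "h \<in> carrier V" "g \<in> carrier G" for g f h
    using that rkhs_permute(2)[OF K, of "shift G g" "shift G (inv g)" f h]
    by (simp add: L V_def K_def shift_inv kernel_shift)
  have Lm: "L (g \<otimes> h) f = L g (L h f)" if "f \<in> carrier V" "g \<in> carrier G" "h \<in> carrier G" for g h f
  proof -
    have "L g (L h f) = (f \<circ> shift G (inv h)) \<circ> shift G (inv g)"
      using L[OF Lc[OF that(1,3)], of g] L[OF that(1), of h] by simp
    then show ?thesis
      using that unfolding L[OF that(1), of "g \<otimes> h"] by (simp add: fun_eq_iff inv_mult_group shift_mult)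
  qed
  have L1: "L \<one> f = f" if "f \<in> carrier V" for f using that by (simp add: L fun_eq_iff shift_one)
  have bij: "bij_betw (L g) (carrier V) (carrier V)" if g: "g \<in> carrier G" for g
    by (rule bij_betw_byWitness[of _ "L (inv g)"])
       (use g Lc Lm[symmetric] L1 in auto)
  have L_Bij: "L g \<in> Bij (carrier V)" if "g \<in> carrier G" for g
    using bij[OF that] by (simp add: Bij_def L_def)
  have L_uni: "L g \<in> unitary_maps V V" if g: "g \<in> carrier G" for g
    unfolding unitary_maps_def
  proof (intro CollectI conjI ballI allI bij[OF g])
    show "L g (f \<oplus>\<^bsub>V\<^esub> h) = L g f \<oplus>\<^bsub>V\<^esub> L g h" if fh: "f \<in> carrier V" "h \<in> carrier V" for f h
    proof -
      have "f \<oplus>\<^bsub>V\<^esub> h \<in> carrier V" using fh by simp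
      then show ?thesis using fh by (simp add: L) (simp add: V_def rkhs_simps[OF K] o_def)
    qed
    show "L g (a \<odot>\<^bsub>V\<^esub> f) = a \<odot>\<^bsub>V\<^esub> L g f" if f: "f \<in> carrier V" for a f
    proof -
      have "a \<odot>\<^bsub>V\<^esub> f \<in> carrier V" using f cr by simp
      then show ?thesis using f by (simp add: L) (simp add: V_def rkhs_simps[OF K] o_def)
    qed
  qed (use g Lip in auto)
  have "L \<in> hom G (unitary_group V)"
    unfolding hom_def
  proof (intro CollectI conjI ballI)
    show "L \<in> carrier G \<rightarrow> carrier (unitary_group V)" using L_uni L_Bij by (auto simp: unitary_group_def)
    fix g h assume gh: "g \<in> carrier G" "h \<in> carrier G"
    have "L (g \<otimes> h) = compose (carrier V) (L g) (L h)"
    proof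
      fix f
      show "L (g \<otimes> h) f = compose (carrier V) (L g) (L h) f"
        using Lm[of f g h] gh by (cases "f \<in> carrier V") (auto simp: compose_def L_def)
    qed
    then show "L (g \<otimes> h) = L g \<otimes>\<^bsub>unitary_group V\<^esub> L h"
      using L_uni L_Bij gh by (simp add: unitary_group_def BijGroup_def)
  qed
  moreover have "L = (\<lambda>g. \<lambda>f\<in>carrier V. f \<circ> shift G (inv g))" by (rule ext) (simp add: L_def)
  then have "gns G \<phi> = (V, L)" by (simp add: gns_def V_def K_def)
  ultimately show ?thesis
    using hilbert_space_axioms group_axioms by (simp add: group_rep_def group_rep_axioms_def)
qed

lemma gns_props:
  assumes pt: "positive_type G \<phi>" and V: "gns G \<phi> = (V, \<pi>)"
  shows "\<exists>\<zeta>\<in>carrier V. hilbert_space.total V (group_rep.orb G V \<pi> \<zeta>) \<and> group_rep.coef G V \<pi> \<zeta> = \<phi>"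
    and "\<forall>f\<in>carrier V. \<forall>g. \<pi> g f = f \<circ> shift G (inv g)"
    and "\<forall>f\<in>carrier V. \<forall>x. f x = ip V f (kernel_of G \<phi> x)"
    and "\<forall>f\<in>carrier V. \<forall>x. x \<notin> carrier G \<longrightarrow> f x = 0"
proof -
  define K where "K = kernel_of G \<phi>"
  have K: "pd K" unfolding K_def by (rule pt_pd[OF pt])
  have Veq: "V = rkhs K" and \<pi>eq: "\<pi> = (\<lambda>g. \<lambda>f\<in>carrier V. f \<circ> shift G (inv g))"
    using V by (auto simp: gns_def K_def)
  interpret group_rep G V \<pi> using gns_rep[OF pt] V by simp
  have Kc: "K x \<in> carrier V" for x unfolding Veq by (rule rkhs_kernel[OF K])
  show 2: "\<forall>f\<in>carrier V. \<forall>g. \<pi> g f = f \<circ> shift G (inv g)" by (simp add: \<pi>eq)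
  show rep: "\<forall>f\<in>carrier V. \<forall>x. f x = ip V f (kernel_of G \<phi> x)"
    using rkhs_reproducing[OF K] by (simp add: Veq K_def)
  have K0: "K x = \<zero>\<^bsub>V\<^esub>" if "x \<notin> carrier G" for x
    using that by (auto simp: K_def Veq rkhs_simps[OF K, unfolded K_def] kernel_of_def)
  show "\<forall>f\<in>carrier V. \<forall>x. x \<notin> carrier G \<longrightarrow> f x = 0"
    using rep K0 by (auto simp: K_def[symmetric] ip_zero)
  have \<pi>K: "\<pi> g (K x) = K (shift G g x)" if "g \<in> carrier G" for g x
  proof -
    have "\<pi> g (K x) = K x \<circ> shift G (inv g)" using 2 Kc by blast
    also have "\<dots> = K (shift G g x)"
      using kernel_shift[OF that, of \<phi> x "shift G (inv g) _"] that by (auto simp: K_def shift_inv fun_eq_iff)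
    finally show ?thesis .
  qed
  have orb: "orb (K \<one>) = K"
    using \<pi>K K0 by (auto simp: orb_def fun_eq_iff shift_def)
  show "\<exists>\<zeta>\<in>carrier V. total (orb \<zeta>) \<and> coef \<zeta> = \<phi>"
  proof (intro bexI conjI)
    have "hilbert_space.total V K" using rkhs_total[OF K] unfolding Veq[symmetric] .
    then show "total (orb (K \<one>))" unfolding orb .
    have "coef (K \<one>) x = \<phi> x" for x
    proof (cases "x \<in> carrier G")
      case True
      have "coef (K \<one>) x = ip V (K x) (K \<one>)" using True \<pi>K[of x "\<one>"] by (simp add: coef_def shift_def)
      also have "\<dots> = K x \<one>" using rep Kc by (simp add: K_def)
      finally show ?thesis using True by (simp add: K_def kernel_of_def)
    qed (simp add: coef_def pt_outside[OF pt])
    then show "coef (K \<one>) = \<phi>" by (rule ext)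
  qed (rule Kc)
qed

text \<open>The condition on the conjugates of \<open>n\<close> makes the kernel invariant under translation by \<open>n\<close>.\<close>
lemma gns_trivial:
  assumes st: "positive_type G \<phi>" and V: "gns G \<phi> = (V, \<pi>)"
    and n: "n \<in> carrier G" and triv: "\<And>x. x \<in> carrier G \<Longrightarrow> \<phi> (inv x \<otimes> n \<otimes> x) = \<phi> \<one>"
    and f: "f \<in> carrier V"
  shows "\<pi> n f = f"
proof -
  have "kernel_of G \<phi> (shift G (inv n) y) z = kernel_of G \<phi> y z" for y z
  proof (cases "y \<in> carrier G \<and> z \<in> carrier G")
    case True
    let ?m = "inv y \<otimes> n \<otimes> y"
    have m: "?m \<in> carrier G" "\<phi> ?m = \<phi> \<one>" using True n triv by auto
    have "inv z \<otimes> y = (inv z \<otimes> (inv n \<otimes> y)) \<otimes> ?m"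
    proof -
      have "y \<otimes> (inv y \<otimes> (n \<otimes> y)) = n \<otimes> y" "inv n \<otimes> (n \<otimes> y) = y"
        using m_assoc[of y "inv y" "n \<otimes> y"] m_assoc[of "inv n" n y] True n by simp_all
      then show ?thesis using True n by (simp add: m_assoc)
    qed
    then show ?thesis
      using pt_periodic[OF st m, of "inv z \<otimes> (inv n \<otimes> y)"] True n by (simp add: kernel_of_def shift_def)
  qed (use n in \<open>auto simp: kernel_of_def\<close>)
  then have "kernel_of G \<phi> (shift G (inv n) y) = kernel_of G \<phi> y" for y by (rule ext)
  then have "f (shift G (inv n) y) = f y" for y using gns_props(3)[OF st V] f by metis
  then show ?thesis using gns_props(2)[OF st V] f by (simp add: fun_eq_iff)
qed

theorem pure_gns_irreducible:
  assumes pure: "pure G \<phi>" and V: "gns G \<phi> = (V, \<pi>)"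
  shows "(V, \<pi>) \<in> irreps G"
proof -
  have st: "positive_type G \<phi>" "\<phi> \<one> = 1" using pure by (auto simp: pure_def states_def)
  interpret group_rep G V \<pi> using gns_rep[OF st(1)] V by simp
  obtain \<zeta> where z: "\<zeta> \<in> carrier V" "total (orb \<zeta>)" "coef \<zeta> = \<phi>"
    using gns_props(1)[OF st(1) V] by blast
  have "complex_of_real ((nrm \<zeta>)\<^sup>2) = of_real 1" using coef_one[OF z(1)] z(3) st(2) by simp
  then have "(nrm \<zeta>)\<^sup>2 = 1" by (simp only: of_real_eq_iff)
  then have "nrm \<zeta> = 1" using power2_eq_imp_eq[of "nrm \<zeta>" 1] z(1) by simp
  then show ?thesis
    using pure_cyclic_irreducible[of \<zeta>] z pure by (simp add: irreps_def)
qed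

end

section \<open>Extreme points of compact convex sets of functions\<close>

definition mix :: "real \<Rightarrow> ('x \<Rightarrow> complex) \<Rightarrow> ('x \<Rightarrow> complex) \<Rightarrow> 'x \<Rightarrow> complex"
  where "mix t a b = (\<lambda>x. of_real (1 - t) * a x + of_real t * b x)"

definition convexf :: "('x \<Rightarrow> complex) set \<Rightarrow> bool"
  where "convexf K \<longleftrightarrow> (\<forall>a\<in>K. \<forall>b\<in>K. \<forall>t. 0 \<le> t \<and> t \<le> 1 \<longrightarrow> mix t a b \<in> K)"

definition chull :: "('x \<Rightarrow> complex) set \<Rightarrow> ('x \<Rightarrow> complex) set"
  where "chull X = \<Inter>{C. convexf C \<and> X \<subseteq> C}"

definition near :: "'x set \<Rightarrow> real \<Rightarrow> ('x \<Rightarrow> complex) \<Rightarrow> ('x \<Rightarrow> complex) \<Rightarrow> bool"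
  where "near Q \<epsilon> a b \<longleftrightarrow> (\<forall>x\<in>Q. cmod (a x - b x) < \<epsilon>)"

text \<open>The closure in the topology of pointwise convergence.\<close>
definition adh :: "('x \<Rightarrow> complex) set \<Rightarrow> ('x \<Rightarrow> complex) set"
  where "adh X = {a. \<forall>Q \<epsilon>. finite Q \<and> 0 < \<epsilon> \<longrightarrow> (\<exists>b\<in>X. near Q \<epsilon> a b)}"

definition extreme :: "('x \<Rightarrow> complex) set \<Rightarrow> ('x \<Rightarrow> complex) \<Rightarrow> bool"
  where "extreme K e \<longleftrightarrow> e \<in> K \<and> (\<forall>a\<in>K. \<forall>b\<in>K. \<forall>t. 0 < t \<and> t < 1 \<and> e = mix t a b \<longrightarrow> a = e)"

lemma mix_0 [simp]: "mix 0 a b = a" and mix_1 [simp]: "mix 1 a b = b"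
  by (simp_all add: mix_def)

lemma convexfD: "convexf K \<Longrightarrow> a \<in> K \<Longrightarrow> b \<in> K \<Longrightarrow> 0 \<le> t \<Longrightarrow> t \<le> 1 \<Longrightarrow> mix t a b \<in> K"
  by (simp add: convexf_def)

lemma convexf_chull: "convexf (chull X)"
  unfolding convexf_def chull_def by blast

lemma chull_superset: "X \<subseteq> chull X"
  unfolding chull_def by blast

lemma chull_least: "convexf C \<Longrightarrow> X \<subseteq> C \<Longrightarrow> chull X \<subseteq> C"
  unfolding chull_def by blast

lemma chull_mono: "X \<subseteq> Y \<Longrightarrow> chull X \<subseteq> chull Y"
  unfolding chull_def by blast

lemma chull_empty: "chull {} = {}"
  using chull_least[of "{}" "{}"] by (simp add: convexf_def)

lemma adhI: "(\<And>Q \<epsilon>. finite Q \<Longrightarrow> 0 < \<epsilon> \<Longrightarrow> \<exists>b\<in>X. near Q \<epsilon> a b) \<Longrightarrow> a \<in> adh X"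
  unfolding adh_def by blast

lemma adhD: "a \<in> adh X \<Longrightarrow> finite Q \<Longrightarrow> 0 < \<epsilon> \<Longrightarrow> \<exists>b\<in>X. near Q \<epsilon> a b"
  unfolding adh_def by blast

lemma near_refl: "0 < \<epsilon> \<Longrightarrow> near Q \<epsilon> a a"
  by (simp add: near_def)

lemma adh_superset: "X \<subseteq> adh X"
  using near_refl by (blast intro: adhI)

lemma adh_mono: "X \<subseteq> Y \<Longrightarrow> adh X \<subseteq> adh Y"
  unfolding adh_def by blast

lemma near_trans: "near Q d a b \<Longrightarrow> near Q e b c \<Longrightarrow> near Q (d + e) a c"
  unfolding near_def by (metis norm_diff_triangle_less)

lemma near_sym: "near Q d a b \<Longrightarrow> near Q d b a"
  unfolding near_def by (simp add: norm_minus_commute)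

lemma adh_adh:
  fixes X :: "('x \<Rightarrow> complex) set"
  shows "adh (adh X) \<subseteq> adh X"
proof
  fix a assume a: "a \<in> adh (adh X)"
  show "a \<in> adh X"
  proof (rule adhI)
    fix Q :: "'x set" and e :: real assume Q: "finite Q" and e: "0 < e"
    obtain b where b: "b \<in> adh X" "near Q (e / 2) a b" using adhD[OF a Q, of "e / 2"] e by auto
    obtain c where c: "c \<in> X" "near Q (e / 2) b c" using adhD[OF b(1) Q, of "e / 2"] e by auto
    have "near Q e a c" using near_trans[OF b(2) c(2)] by simp
    then show "\<exists>b\<in>X. near Q e a b" using c(1) by blast
  qed
qed

lemma convexf_adh:
  fixes K :: "('x \<Rightarrow> complex) set"
  assumes K: "convexf K"
  shows "convexf (adh K)"
  unfolding convexf_def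
proof (intro ballI allI impI)
  fix a b t assume a: "a \<in> adh K" and b: "b \<in> adh K" and t: "0 \<le> t \<and> t \<le> (1 :: real)"
  show "mix t a b \<in> adh K"
  proof (rule adhI)
    fix Q :: "'x set" and e :: real assume Q: "finite Q" and e: "0 < e"
    obtain a' where a': "a' \<in> K" "near Q e a a'" using adhD[OF a Q e] by blast
    obtain b' where b': "b' \<in> K" "near Q e b b'" using adhD[OF b Q e] by blast
    have "near Q e (mix t a b) (mix t a' b')"
      unfolding near_def
    proof
      fix x assume x: "x \<in> Q"
      have "mix t a b x - mix t a' b' x = of_real (1 - t) * (a x - a' x) + of_real t * (b x - b' x)"
        by (simp add: mix_def algebra_simps)
      also have "cmod \<dots> \<le> cmod (of_real (1 - t) * (a x - a' x)) + cmod (of_real t * (b x - b' x))"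
        by (rule norm_triangle_ineq)
      also have "\<dots> = (1 - t) * cmod (a x - a' x) + t * cmod (b x - b' x)"
        using t unfolding norm_mult norm_of_real by simp
      also have "\<dots> < e"
        using t a' b' x by (intro convex_bound_lt) (auto simp: near_def)
      finally show "cmod (mix t a b x - mix t a' b' x) < e" .
    qed
    then show "\<exists>c\<in>K. near Q e (mix t a b) c" using convexfD[OF K a'(1) b'(1)] t by blast
  qed
qed

lemma continuous_coordinate: "continuous_on S (\<lambda>a :: 'x \<Rightarrow> complex. a x)"
  by (rule continuous_on_subset[OF continuous_on_product_coordinates]) simp

lemma open_near:
  assumes "finite Q"
  shows "open {b. near Q e a b}"
proof -
  have "open {b :: 'a \<Rightarrow> complex. cmod (a x - b x) < e}" for x
    by (intro open_Collect_less continuous_intros continuous_coordinate)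
  then have "open (\<Inter>x\<in>Q. {b :: 'a \<Rightarrow> complex. cmod (a x - b x) < e})"
    using assms by (intro open_INT) auto
  also have "(\<Inter>x\<in>Q. {b. cmod (a x - b x) < e}) = {b. near Q e a b}" by (auto simp: near_def)
  finally show ?thesis .
qed

lemma closed_adh: "closed (adh X)"
  unfolding closed_def
proof (subst open_subopen, intro ballI)
  fix a assume "a \<in> - adh X"
  then obtain Q e where Q: "finite Q" "e > 0" "\<And>b. b \<in> X \<Longrightarrow> \<not> near Q e a b"
    unfolding adh_def by auto
  have "b \<notin> adh X" if b: "near Q (e / 2) a b" for b
  proof
    assume "b \<in> adh X"
    then obtain c where "c \<in> X" "near Q (e / 2) b c" using adhD[OF _ Q(1), of b X "e / 2"] Q(2) by auto
    then show False using near_trans[OF b] Q(3)[of c] by force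
  qed
  moreover have "near Q (e / 2) a a" using Q(2) by (simp add: near_def)
  ultimately show "\<exists>T. open T \<and> a \<in> T \<and> T \<subseteq> - adh X"
    using open_near[OF Q(1)] by (intro exI[of _ "{b. near Q (e / 2) a b}"]) auto
qed

lemma adh_compact:
  assumes K: "compact K"
  shows "adh K \<subseteq> K"
proof
  fix a assume a: "a \<in> adh K"
  define I :: "('a set \<times> real) set" where "I = {(Q, e). finite Q \<and> 0 < e}"
  define f where "f = (\<lambda>(Q, e). {b :: 'a \<Rightarrow> complex. \<forall>x\<in>Q. cmod (a x - b x) \<le> e})"
  have "K \<inter> (\<Inter>i\<in>I. f i) \<noteq> {}"
  proof (rule compact_imp_fip_image[OF K])
    fix i assume "i \<in> I"
    obtain Q e where i: "i = (Q, e)" by fastforce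
    have "closed {b :: 'a \<Rightarrow> complex. cmod (a x - b x) \<le> e}" for x
      by (intro closed_Collect_le continuous_intros continuous_coordinate)
    then have "closed (\<Inter>x\<in>Q. {b :: 'a \<Rightarrow> complex. cmod (a x - b x) \<le> e})" by (intro closed_INT) auto
    also have "(\<Inter>x\<in>Q. {b. cmod (a x - b x) \<le> e}) = f i" by (auto simp: f_def i)
    finally show "closed (f i)" .
  next
    fix J assume J: "finite J" "J \<subseteq> I"
    define Q where "Q = (\<Union>i\<in>J. fst i)"
    define e where "e = Min (insert 1 (snd ` J))"
    have "finite Q" using J by (auto simp: Q_def I_def)
    moreover have "e > 0" using J by (auto simp: e_def I_def)
    ultimately obtain b where b: "b \<in> K" "near Q e a b" using adhD[OF a] by blast
    have "b \<in> f i" if i: "i \<in> J" for i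
    proof -
      have "e \<le> snd i" using i J by (simp add: e_def)
      moreover have "fst i \<subseteq> Q" using i by (auto simp: Q_def)
      ultimately show ?thesis using b(2) by (fastforce simp: f_def near_def split: prod.split)
    qed
    then show "K \<inter> (\<Inter>i\<in>J. f i) \<noteq> {}" using b(1) by blast
  qed
  then obtain b where b: "b \<in> K" "\<And>i. i \<in> I \<Longrightarrow> b \<in> f i" by blast
  have "a x = b x" for x
  proof -
    have "cmod (a x - b x) \<le> 0 + e" if "e > 0" for e
      using b(2)[of "({x}, e)"] that by (simp add: I_def f_def)
    then have "cmod (a x - b x) \<le> 0" by (rule field_le_epsilon)
    then show ?thesis by simp
  qed
  then have "a = b" by (rule ext)
  then show "a \<in> K" using b(1) by simp
qed

definition functional :: "'x set \<Rightarrow> ('x \<Rightarrow> complex) \<Rightarrow> ('x \<Rightarrow> complex) \<Rightarrow> real"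
  where "functional Q c a = (\<Sum>x\<in>Q. Re (c x * a x))"

lemma functional_mix: "functional Q c (mix t a b) = (1 - t) * functional Q c a + t * functional Q c b"
  by (simp add: functional_def mix_def sum_distrib_left sum.distrib[symmetric] algebra_simps)

lemma continuous_functional: "continuous_on S (functional Q c)"
  unfolding functional_def by (intro continuous_intros continuous_coordinate)

definition face :: "('x \<Rightarrow> complex) set \<Rightarrow> ('x \<Rightarrow> complex) set \<Rightarrow> bool"
  where "face K E \<longleftrightarrow> closed E \<and> E \<subseteq> K \<and> E \<noteq> {} \<and>
    (\<forall>a\<in>K. \<forall>b\<in>K. \<forall>t. 0 < t \<and> t < 1 \<and> mix t a b \<in> E \<longrightarrow> a \<in> E \<and> b \<in> E)"

lemma faceD:
  assumes "face K E"
  shows "closed E" "E \<subseteq> K" "E \<noteq> {}"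
    "\<lbrakk>mix t a b \<in> E; a \<in> K; b \<in> K; 0 < t; t < 1\<rbrakk> \<Longrightarrow> a \<in> E \<and> b \<in> E"
  using assms unfolding face_def by blast+

lemma faceI:
  assumes "closed E" "E \<subseteq> K" "E \<noteq> {}"
    "\<And>a b t. \<lbrakk>a \<in> K; b \<in> K; 0 < t; t < 1; mix t a b \<in> E\<rbrakk> \<Longrightarrow> a \<in> E \<and> b \<in> E"
  shows "face K E"
  using assms unfolding face_def by blast

lemma face_maximizers:
  assumes K: "compact K" and E: "face K E"
  shows "face K {e \<in> E. \<forall>k\<in>E. functional Q c k \<le> functional Q c e}"
proof -
  let ?F = "functional Q c"
  have "compact E" using compact_Int_closed[OF K, of E] faceD(1,2)[OF E] by (simp add: Int_absorb1)
  then have "\<exists>x\<in>E. \<forall>y\<in>E. ?F y \<le> ?F x"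
    using faceD(3)[OF E] by (intro continuous_attains_sup continuous_functional)
  then obtain e0 where e0: "e0 \<in> E" "\<And>k. k \<in> E \<Longrightarrow> ?F k \<le> ?F e0" by blast
  have eq: "{e \<in> E. \<forall>k\<in>E. ?F k \<le> ?F e} = E \<inter> {e. ?F e0 \<le> ?F e}"
    using e0 by (auto intro: order_trans)
  have "closed {e. ?F e0 \<le> ?F e}"
    by (intro closed_Collect_le continuous_on_const continuous_functional)
  then have cl: "closed (E \<inter> {e. ?F e0 \<le> ?F e})" using faceD(1)[OF E] by (intro closed_Int)
  show ?thesis
    unfolding eq
  proof (intro faceI cl)
    show "E \<inter> {e. ?F e0 \<le> ?F e} \<subseteq> K" using faceD(2)[OF E] by blast
    show "E \<inter> {e. ?F e0 \<le> ?F e} \<noteq> {}" using e0 by auto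
    fix a b t assume a: "a \<in> K" and b: "b \<in> K" and t: "0 < t" "t < 1"
      and m: "mix t a b \<in> E \<inter> {e. ?F e0 \<le> ?F e}"
    then have ab: "a \<in> E" "b \<in> E" using faceD(4)[OF E, of t a b] by blast+
    have le: "?F a \<le> ?F e0" "?F b \<le> ?F e0" using e0(2) ab by auto
    have ge: "?F e0 \<le> (1 - t) * ?F a + t * ?F b" using m by (simp add: functional_mix)
    have "?F e0 \<le> ?F a"
    proof (rule ccontr)
      assume "\<not> ?F e0 \<le> ?F a"
      then have "(1 - t) * ?F a < (1 - t) * ?F e0" using t by simp
      moreover have "t * ?F b \<le> t * ?F e0" using t le by simp
      ultimately show False using ge by (simp add: algebra_simps)
    qed
    moreover have "?F e0 \<le> ?F b"
    proof (rule ccontr)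
      assume "\<not> ?F e0 \<le> ?F b"
      then have "t * ?F b < t * ?F e0" using t by simp
      moreover have "(1 - t) * ?F a \<le> (1 - t) * ?F e0" using t le by simp
      ultimately show False using ge by (simp add: algebra_simps)
    qed
    ultimately show "a \<in> E \<inter> {e. ?F e0 \<le> ?F e} \<and> b \<in> E \<inter> {e. ?F e0 \<le> ?F e}" using ab by blast
  qed
qed

lemma Inter_finite_chain:
  assumes "finite F" "F \<noteq> {}" "\<And>A B. A \<in> F \<Longrightarrow> B \<in> F \<Longrightarrow> A \<subseteq> B \<or> B \<subseteq> A"
  shows "\<Inter>F \<in> F"
  using assms
proof (induction F rule: finite_ne_induct)
  case (insert A F)
  then have I: "\<Inter>F \<in> F" by auto
  then have "A \<subseteq> \<Inter>F \<or> \<Inter>F \<subseteq> A" using insert.prems by blast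
  then have "\<Inter>(insert A F) = A \<or> \<Inter>(insert A F) = \<Inter>F" by auto
  then show ?case using I by auto
qed simp

text \<open>Zorn's lemma for the complements of faces; compactness keeps the intersection of a chain of
  faces nonempty.\<close>
lemma minimal_face:
  assumes K: "compact K" and E0: "face K E0"
  shows "\<exists>M. face K M \<and> M \<subseteq> E0 \<and> (\<forall>E. face K E \<and> E \<subseteq> M \<longrightarrow> E = M)"
proof -
  define A where "A = {K - E | E. face K E \<and> E \<subseteq> E0}"
  have "\<exists>D\<in>A. \<forall>X\<in>A. D \<subseteq> X \<longrightarrow> X = D"
  proof (rule subset_Zorn_nonempty)
    show "A \<noteq> {}" using E0 by (auto simp: A_def)
    fix C assume C0: "C \<noteq> {}" and C: "subset.chain A C"
    define F where "F = (\<lambda>D. K - D) ` C"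
    have F: "face K E \<and> E \<subseteq> E0" if EF: "E \<in> F" for E
    proof -
      obtain D where D: "D \<in> C" "E = K - D" using EF by (auto simp: F_def)
      then obtain E' where E': "D = K - E'" "face K E'" "E' \<subseteq> E0"
        using C by (auto simp: A_def subset.chain_def)
      then have "E = E'" using D faceD(2)[OF E'(2)] by blast
      then show ?thesis using E' by simp
    qed
    have chain: "E \<subseteq> E' \<or> E' \<subseteq> E" if "E \<in> F" "E' \<in> F" for E E'
      using that C unfolding F_def subset_chain_def by blast
    have ne: "F \<noteq> {}" using C0 by (simp add: F_def)
    have "K \<inter> \<Inter>F \<noteq> {}"
    proof (rule compact_imp_fip[OF K])
      show "closed T" if "T \<in> F" for T using F[OF that] faceD(1) by blast
      fix F' assume F': "finite F'" "F' \<subseteq> F"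
      show "K \<inter> \<Inter>F' \<noteq> {}"
      proof (cases "F' = {}")
        case True
        then show ?thesis using faceD(2,3)[OF E0] by auto
      next
        case False
        have "\<Inter>F' \<in> F'" by (rule Inter_finite_chain[OF F'(1) False]) (use chain F'(2) in blast)
        then have "face K (\<Inter>F')" using F F'(2) by blast
        from faceD(2,3)[OF this] show ?thesis by blast
      qed
    qed
    then have fne: "\<Inter>F \<noteq> {}" by blast
    have fcl: "closed (\<Inter>F)" using F faceD(1) by (intro closed_Inter) blast
    obtain E1 where E1: "E1 \<in> F" using ne by blast
    then have fsub: "\<Inter>F \<subseteq> E0" "\<Inter>F \<subseteq> K" using F[OF E1] faceD(2) by blast+
    have fmix: "a \<in> \<Inter>F \<and> b \<in> \<Inter>F"
      if "a \<in> K" "b \<in> K" "0 < t" "t < 1" "mix t a b \<in> \<Inter>F" for a b t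
    proof -
      have "a \<in> E \<and> b \<in> E" if "E \<in> F" for E
        by (rule faceD(4)[of K E t]) (use F[OF that] that \<open>mix t a b \<in> \<Inter>F\<close> \<open>a \<in> K\<close> \<open>b \<in> K\<close> \<open>0 < t\<close> \<open>t < 1\<close> in auto)
      then show ?thesis by blast
    qed
    have "face K (\<Inter>F)" by (rule faceI[OF fcl fsub(2) fne fmix])
    moreover have "\<Union>C = K - \<Inter>F"
    proof -
      have "D \<subseteq> K" if "D \<in> C" for D using that C by (auto simp: A_def subset.chain_def)
      then show ?thesis by (auto simp: F_def)
    qed
    ultimately show "\<Union>C \<in> A" using fsub(1) unfolding A_def by blast
  qed
  then obtain M where M: "face K M" "M \<subseteq> E0" "\<And>X. X \<in> A \<Longrightarrow> K - M \<subseteq> X \<Longrightarrow> X = K - M"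
    by (auto simp: A_def)
  have "E = M" if E: "face K E" "E \<subseteq> M" for E
  proof -
    have "K - E \<in> A" using E M(2) by (auto simp: A_def)
    then have "K - E = K - M" using M(3)[of "K - E"] E by blast
    then show ?thesis using faceD(2)[OF E(1)] faceD(2)[OF M(1)] by blast
  qed
  then show ?thesis using M by blast
qed

text \<open>A minimal face among the maximizers is a point, because a functional that is not constant on it
  would cut out a smaller face.\<close>
lemma extreme_maximizer:
  assumes K: "compact K" "convexf K" "K \<noteq> {}" "closed K"
  shows "\<exists>e. extreme K e \<and> (\<forall>k\<in>K. functional Q c k \<le> functional Q c e)"
proof -
  have "face K K" using K by (intro faceI) auto
  then have mf: "face K {e \<in> K. \<forall>k\<in>K. functional Q c k \<le> functional Q c e}"
    by (rule face_maximizers[OF K(1)])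
  obtain M where M0: "face K M \<and> M \<subseteq> {e \<in> K. \<forall>k\<in>K. functional Q c k \<le> functional Q c e} \<and>
      (\<forall>E. face K E \<and> E \<subseteq> M \<longrightarrow> E = M)"
    using minimal_face[OF K(1) mf] by (rule exE)
  have M: "face K M" "M \<subseteq> {e \<in> K. \<forall>k\<in>K. functional Q c k \<le> functional Q c e}"
    by (rule conjunct1[OF M0], rule conjunct1[OF conjunct2[OF M0]])
  have min: "E = M" if "face K E" "E \<subseteq> M" for E
    using conjunct2[OF conjunct2[OF M0], rule_format, of E] that by simp
  have eqF: "functional R d a = functional R d b" if "a \<in> M" "b \<in> M" for R d a b
  proof -
    have "{e \<in> M. \<forall>k\<in>M. functional R d k \<le> functional R d e} = M"
      by (rule min[OF face_maximizers[OF K(1) M(1)]]) blast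
    then have "functional R d a \<le> functional R d b" "functional R d b \<le> functional R d a" using that by blast+
    then show ?thesis by simp
  qed
  have single: "a = b" if "a \<in> M" "b \<in> M" for a b
  proof
    fix x
    show "a x = b x"
      using eqF[OF that, of "{x}" "\<lambda>_. 1"] eqF[OF that, of "{x}" "\<lambda>_. - \<i>"]
      by (simp add: functional_def complex_eq_iff)
  qed
  obtain e where e: "e \<in> M" using faceD(3)[OF M(1)] by blast
  have "extreme K e"
    unfolding extreme_def
  proof (intro conjI ballI allI impI)
    show "e \<in> K" using e faceD(2)[OF M(1)] by blast
    fix a b t assume "a \<in> K" "b \<in> K" "0 < t \<and> t < 1 \<and> e = mix t a b"
    then have "a \<in> M" using e faceD(4)[OF M(1), of t a b] by blast
    then show "a = e" using single e by blast
  qed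
  then show ?thesis using e M(2) by blast
qed

lemma cmod_diff_scaled_sq:
  "(cmod (d - of_real t * e))\<^sup>2 = (cmod d)\<^sup>2 - 2 * t * Re (cnj d * e) + t\<^sup>2 * (cmod e)\<^sup>2"
  unfolding cmod_power2 by (simp add: algebra_simps power2_eq_square)

text \<open>Only finitely many coordinates \<open>Q\<close> count for an approximation of \<open>k\<close>. Let \<open>c\<close> be the point of the
  closed convex hull of \<open>X\<close> that is nearest to \<open>k\<close> in these coordinates. The functional in the
  direction from \<open>c\<close> to \<open>k\<close> is maximal at \<open>c\<close> on the hull. Its maximum on \<open>K\<close> is attained at an extreme
  point, which lies in the hull; so \<open>k\<close> is not beyond \<open>c\<close>, and the distance is 0.\<close>
theorem krein_milman:
  assumes K: "compact K" "convexf K" "closed K" and X: "X \<subseteq> K" "\<And>e. extreme K e \<Longrightarrow> e \<in> X"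
  shows "K \<subseteq> adh (chull X)"
proof
  fix k assume k: "k \<in> K"
  define C where "C = adh (chull X)"
  have XC: "X \<subseteq> C" using chull_superset adh_superset unfolding C_def by blast
  have CK: "C \<subseteq> K"
    using adh_mono[OF chull_least[OF K(2) X(1)]] adh_compact[OF K(1)] unfolding C_def by blast
  have Cconv: "convexf C" unfolding C_def by (intro convexf_adh convexf_chull)
  have "compact C"
    using compact_Int_closed[OF K(1) closed_adh[of "chull X"]] CK by (simp add: C_def Int_absorb1)
  moreover have "C \<noteq> {}" using extreme_maximizer[OF K(1,2) _ K(3)] k X(2) XC by blast
  ultimately have att: "\<exists>c\<in>C. \<forall>b\<in>C. J c \<le> J b" if "continuous_on C J" for J :: "_ \<Rightarrow> real"
    using that by (intro continuous_attains_inf)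
  show "k \<in> adh (chull X)"
  proof (rule adhI)
    fix Q :: "'a set" and e :: real assume Q: "finite Q" and e: "0 < e"
    define J where "J b = (\<Sum>x\<in>Q. (cmod (k x - b x))\<^sup>2)" for b
    have "continuous_on C J" unfolding J_def by (intro continuous_intros continuous_coordinate)
    then obtain c where c: "c \<in> C" "\<And>b. b \<in> C \<Longrightarrow> J c \<le> J b" using att by blast
    define d where "d x = cnj (k x - c x)" for x
    let ?F = "functional Q d"
    have sep: "?F b \<le> ?F c" if b: "b \<in> C" for b
    proof (rule ccontr)
      assume "\<not> ?F b \<le> ?F c"
      define A where "A = ?F b - ?F c"
      have A: "A > 0" using \<open>\<not> ?F b \<le> ?F c\<close> by (simp add: A_def)
      define N where "N = (\<Sum>x\<in>Q. (cmod (b x - c x))\<^sup>2)"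
      have N: "N \<ge> 0" by (simp add: N_def sum_nonneg)
      define t where "t = min 1 (A / (N + 1))"
      have "t \<le> A / (N + 1)" by (simp add: t_def)
      then have "t * (N + 1) \<le> A" using N by (simp add: pos_le_divide_eq add_nonneg_pos)
      moreover have "0 < t" "t \<le> 1" using A N by (simp_all add: t_def)
      ultimately have t: "0 < t" "t \<le> 1" "t * (N + 1) \<le> A" by simp_all
      have "J (mix t c b) = (\<Sum>x\<in>Q. (cmod (k x - c x))\<^sup>2 - 2 * t * Re (d x * (b x - c x)) + t\<^sup>2 * (cmod (b x - c x))\<^sup>2)"
        unfolding J_def
      proof (rule sum.cong[OF refl])
        fix x
        have "k x - mix t c b x = (k x - c x) - of_real t * (b x - c x)"
          by (simp add: mix_def algebra_simps)
        then show "(cmod (k x - mix t c b x))\<^sup>2 =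
          (cmod (k x - c x))\<^sup>2 - 2 * t * Re (d x * (b x - c x)) + t\<^sup>2 * (cmod (b x - c x))\<^sup>2"
          by (simp only: cmod_diff_scaled_sq d_def)
      qed
      also have "\<dots> = J c - 2 * t * A + t\<^sup>2 * N"
        by (simp add: J_def A_def N_def functional_def sum.distrib sum_subtractf sum_distrib_left
            algebra_simps)
      finally have "2 * t * A \<le> t\<^sup>2 * N"
        using c(2)[OF convexfD[OF Cconv c(1) b, of t]] t by simp
      then have "2 * A \<le> t * N" using t by (simp add: power2_eq_square)
      moreover have "t * N \<le> t * (N + 1)" using t by simp
      ultimately show False using t(3) A by linarith
    qed
    obtain x where x: "extreme K x" "\<And>b. b \<in> K \<Longrightarrow> ?F b \<le> ?F x"
      using extreme_maximizer[OF K(1,2) _ K(3), of Q d] k by blast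
    have "?F k \<le> ?F c" using x(2)[OF k] sep[of x] X(2)[OF x(1)] XC by fastforce
    moreover have "?F k - ?F c = J c"
      unfolding functional_def J_def sum_subtractf[symmetric] cmod_power2
      by (simp add: d_def algebra_simps power2_eq_square)
    ultimately have "J c \<le> 0" by simp
    then have "J c = 0" using sum_nonneg[of Q "\<lambda>x. (cmod (k x - c x))\<^sup>2"] by (simp add: J_def)
    then have kc: "k x = c x" if "x \<in> Q" for x
      using that Q by (simp add: J_def sum_nonneg_eq_0_iff)
    obtain b where "b \<in> chull X" "near Q e c b" using adhD[OF _ Q e, of c] c(1) by (auto simp: C_def)
    then show "\<exists>b\<in>chull X. near Q e k b" using kc by (auto simp: near_def)
  qed
qed

text \<open>The mixtures of a point of the closed convex hull of \<open>A\<close> and one of that of \<open>B\<close> form a compact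
  convex set. So \<open>e\<close> is such a mixture, and since it is extreme, the mixture is trivial.\<close>
lemma extreme_adh_union:
  assumes K: "compact K" "convexf K" and AB: "A \<subseteq> K" "B \<subseteq> K" and e: "extreme K e"
    and adh: "e \<in> adh (chull (A \<union> B))"
  shows "e \<in> adh (chull A) \<or> e \<in> adh (chull B)"
proof (cases "A = {} \<or> B = {}")
  case True
  then show ?thesis using adh by auto
next
  case False
  define CA where "CA = adh (chull A)"
  define CB where "CB = adh (chull B)"
  have sub: "A \<subseteq> CA" "B \<subseteq> CB" using chull_superset adh_superset unfolding CA_def CB_def by blast+
  have cK: "CA \<subseteq> K" "CB \<subseteq> K"
    using adh_mono[OF chull_least[OF K(2) AB(1)]] adh_mono[OF chull_least[OF K(2) AB(2)]] adh_compact[OF K(1)]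
    unfolding CA_def CB_def by blast+
  have cc: "compact CA" "compact CB"
    using compact_Int_closed[OF K(1) closed_adh[of "chull A"]] compact_Int_closed[OF K(1) closed_adh[of "chull B"]] cK
    by (simp_all add: CA_def CB_def Int_absorb1)
  have cv: "convexf CA" "convexf CB" unfolding CA_def CB_def by (intro convexf_adh convexf_chull)+
  define M where "M = (\<lambda>(t, a, b). mix t a b) ` ({0..1} \<times> CA \<times> CB)"
  have "compact M"
    unfolding M_def
  proof (rule compact_continuous_image)
    have 1: "continuous_on S (\<lambda>p :: real \<times> ('a \<Rightarrow> complex) \<times> ('a \<Rightarrow> complex). fst (snd p) x)" for S x
      by (rule continuous_on_compose2[OF continuous_coordinate[of UNIV x]])
         (intro continuous_on_fst continuous_on_snd continuous_on_id, simp)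
    have 2: "continuous_on S (\<lambda>p :: real \<times> ('a \<Rightarrow> complex) \<times> ('a \<Rightarrow> complex). snd (snd p) x)" for S x
      by (rule continuous_on_compose2[OF continuous_coordinate[of UNIV x]])
         (intro continuous_on_snd continuous_on_id, simp)
    have "continuous_on S (\<lambda>p :: real \<times> ('a \<Rightarrow> complex) \<times> ('a \<Rightarrow> complex). mix (fst p) (fst (snd p)) (snd (snd p)))" for S
      unfolding mix_def
      by (rule continuous_on_coordinatewise_then_product)
         (intro continuous_on_add continuous_on_mult continuous_on_of_real continuous_on_diff continuous_on_const
            continuous_on_fst continuous_on_id 1 2)
    then show "continuous_on ({0..1} \<times> CA \<times> CB) (\<lambda>(t, a, b). mix t a b)"
      by (simp add: case_prod_unfold)
  qed (intro compact_Times cc compact_Icc)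
  have MI: "mix t a b \<in> M" if "0 \<le> t" "t \<le> 1" "a \<in> CA" "b \<in> CB" for t a b
    unfolding M_def by (rule image_eqI[of _ _ "(t, a, b)"]) (use that in auto)
  have "A \<union> B \<subseteq> M"
  proof
    fix x assume "x \<in> A \<union> B"
    obtain a b where "a \<in> CA" "b \<in> CB" using False sub by blast
    then show "x \<in> M" using MI[of 0 x b] MI[of 1 a x] sub \<open>x \<in> A \<union> B\<close> by auto
  qed
  moreover have "convexf M"
    unfolding convexf_def
  proof (intro ballI allI impI)
    fix m m' s assume m: "m \<in> M" "m' \<in> M" and s: "0 \<le> s \<and> s \<le> (1 :: real)"
    obtain t a b where 1: "m = mix t a b" "0 \<le> t" "t \<le> 1" "a \<in> CA" "b \<in> CB" using m(1) by (auto simp: M_def)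
    obtain t' a' b' where 2: "m' = mix t' a' b'" "0 \<le> t'" "t' \<le> 1" "a' \<in> CA" "b' \<in> CB" using m(2) by (auto simp: M_def)
    define u where "u = (1 - s) * t + s * t'"
    define p where "p = (1 - s) * (1 - t)"
    define q where "q = s * (1 - t')"
    define p' where "p' = (1 - s) * t"
    define q' where "q' = s * t'"
    have nn: "0 \<le> p" "0 \<le> q" "0 \<le> p'" "0 \<le> q'" using 1 2 s by (simp_all add: p_def q_def p'_def q'_def)
    have pq: "p + q = 1 - u" "p' + q' = u" by (simp_all add: p_def q_def p'_def q'_def u_def algebra_simps)
    have *: "\<exists>c\<in>C. \<forall>x. of_real p * f x + of_real q * g x = of_real (p + q) * c x"
      if "convexf C" "f \<in> C" "g \<in> C" "0 \<le> p" "0 \<le> q" for C p q and f g :: "'a \<Rightarrow> complex"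
    proof (cases "p + q = 0")
      case True
      then have "p = 0" "q = 0" using that by auto
      then show ?thesis using that by auto
    next
      case False
      then have pos: "p + q > 0" using that by simp
      have "mix (q / (p + q)) f g \<in> C" using that pos by (intro convexfD) auto
      moreover have "of_real p * f x + of_real q * g x = of_real (p + q) * mix (q / (p + q)) f g x" for x
      proof -
        have "of_real (p + q) * mix (q / (p + q)) f g x =
          of_real ((p + q) * (1 - q / (p + q))) * f x + of_real ((p + q) * (q / (p + q))) * g x"
          by (simp add: mix_def algebra_simps)
        moreover have "(p + q) * (1 - q / (p + q)) = p" "(p + q) * (q / (p + q)) = q"
          using False by (simp_all add: field_simps)
        ultimately show ?thesis by simp
      qed
      ultimately show ?thesis by blast
    qed
    obtain c where c: "c \<in> CA" "\<And>x. of_real p * a x + of_real q * a' x = of_real (1 - u) * c x"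
      using *[OF cv(1) 1(4) 2(4) nn(1,2)] unfolding pq by blast
    obtain c' where c': "c' \<in> CB" "\<And>x. of_real p' * b x + of_real q' * b' x = of_real u * c' x"
      using *[OF cv(2) 1(5) 2(5) nn(3,4)] unfolding pq by blast
    have "mix s m m' = mix u c c'"
    proof
      fix x
      have "mix s m m' x = (of_real p * a x + of_real q * a' x) + (of_real p' * b x + of_real q' * b' x)"
        by (simp add: mix_def 1 2 p_def q_def p'_def q'_def algebra_simps)
      then show "mix s m m' x = mix u c c' x" unfolding c(2) c'(2) by (simp add: mix_def)
    qed
    moreover have "0 \<le> u" "u \<le> 1" using nn pq by linarith+
    ultimately show "mix s m m' \<in> M" using MI c(1) c'(1) by simp
  qed
  ultimately have "chull (A \<union> B) \<subseteq> M" by (intro chull_least)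
  then have "e \<in> M" using adh adh_mono adh_compact[OF \<open>compact M\<close>] by blast
  then obtain t a b where t: "e = mix t a b" "0 \<le> t" "t \<le> 1" "a \<in> CA" "b \<in> CB" by (auto simp: M_def)
  consider "t = 0" | "t = 1" | "0 < t" "t < 1" using t by linarith
  then show ?thesis
  proof cases
    case 3
    then have "a = e" using e t cK unfolding extreme_def by blast
    then show ?thesis using t by (simp add: CA_def)
  qed (use t in \<open>auto simp: CA_def CB_def\<close>)
qed

text \<open>Cover \<open>K\<close> by finitely many small neighbourhoods. By \<open>extreme_adh_union\<close> the point \<open>e\<close> lies in the
  closed convex hull of one of the pieces of \<open>X\<close>, all of whose points are close together.\<close>
theorem milman:
  assumes K: "compact K" "convexf K" and X: "X \<subseteq> K" and e: "extreme K e" and adh: "e \<in> adh (chull X)"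
  shows "e \<in> adh X"
proof (rule adhI)
  fix Q :: "'a set" and \<epsilon> :: real assume Q: "finite Q" and \<epsilon>: "0 < \<epsilon>"
  define r where "r = \<epsilon> / 4"
  have r: "r > 0" using \<epsilon> by (simp add: r_def)
  define U where "U k = {b. near Q r k b}" for k
  have kU: "k \<in> U k" for k using r by (simp add: U_def near_def)
  obtain P where P: "P \<subseteq> K" "finite P" "K \<subseteq> (\<Union>k\<in>P. U k)"
  proof (rule compactE_image[OF K(1), of K U])
    show "open (U k)" for k unfolding U_def by (rule open_near[OF Q])
    show "K \<subseteq> (\<Union>k\<in>K. U k)" using kU by blast
  qed
  have "\<exists>k\<in>P'. e \<in> adh (chull (X \<inter> U k))" if "finite P'" "e \<in> adh (chull (\<Union>k\<in>P'. X \<inter> U k))" for P'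
    using that
  proof (induction P' rule: finite_induct)
    case empty
    then have "e \<in> adh {}" by (simp add: chull_empty)
    then show ?case using adhD[of e "{}" "{}" 1] by auto
  next
    case (insert k P')
    have "e \<in> adh (chull ((X \<inter> U k) \<union> (\<Union>k\<in>P'. X \<inter> U k)))" using insert.prems by simp
    then have "e \<in> adh (chull (X \<inter> U k)) \<or> e \<in> adh (chull (\<Union>k\<in>P'. X \<inter> U k))"
      using X by (intro extreme_adh_union[OF K _ _ e]) auto
    then show ?case using insert.IH by auto
  qed
  moreover have "X = (\<Union>k\<in>P. X \<inter> U k)" using X P(3) by blast
  ultimately obtain k where k: "k \<in> P" "e \<in> adh (chull (X \<inter> U k))" using P(2) adh by metis
  obtain b where b: "b \<in> chull (X \<inter> U k)" "near Q r e b" using adhD[OF k(2) Q r] by blast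
  have ne: "X \<inter> U k \<noteq> {}" using b chull_empty by auto
  then obtain x where x: "x \<in> X" "near Q r k x" by (auto simp: U_def)
  have "convexf (U k)"
    unfolding convexf_def
  proof (intro ballI allI impI)
    fix f g t assume f: "f \<in> U k" and g: "g \<in> U k" and t: "0 \<le> t \<and> t \<le> (1 :: real)"
    show "mix t f g \<in> U k"
      unfolding U_def near_def
    proof (intro CollectI ballI)
      fix z assume z: "z \<in> Q"
      have "k z - mix t f g z = of_real (1 - t) * (k z - f z) + of_real t * (k z - g z)"
        by (simp add: mix_def algebra_simps)
      also have "cmod \<dots> \<le> cmod (of_real (1 - t) * (k z - f z)) + cmod (of_real t * (k z - g z))"
        by (rule norm_triangle_ineq)
      also have "\<dots> = (1 - t) * cmod (k z - f z) + t * cmod (k z - g z)"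
        using t unfolding norm_mult norm_of_real by simp
      also have "\<dots> < r" using t f g z by (intro convex_bound_lt) (auto simp: U_def near_def)
      finally show "cmod (k z - mix t f g z) < r" .
    qed
  qed
  then have "b \<in> U k" using b(1) chull_least[of "U k" "X \<inter> U k"] by blast
  then have "near Q r b k" by (simp add: U_def near_sym)
  then have "near Q (r + (r + r)) e x" using b(2) x(2) near_trans by blast
  moreover have "r + (r + r) \<le> \<epsilon>" using \<epsilon> by (simp add: r_def)
  ultimately have "near Q \<epsilon> e x" by (fastforce simp: near_def)
  then show "\<exists>b\<in>X. near Q \<epsilon> e b" using x(1) by blast
qed

lemma compact_disc: "compact {a :: 'x \<Rightarrow> complex. \<forall>x. cmod (a x) \<le> r}"
proof -
  have "compactin (product_topology (\<lambda>i. euclidean) UNIV) (\<Pi>\<^sub>E x\<in>(UNIV :: 'x set). cball (0 :: complex) r)"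
    by (subst compactin_PiE) (auto simp: compactin_euclidean_iff)
  then have "compact (\<Pi>\<^sub>E x\<in>(UNIV :: 'x set). cball (0 :: complex) r)"
    unfolding euclidean_product_topology by (simp add: compactin_euclidean_iff)
  also have "(\<Pi>\<^sub>E x\<in>(UNIV :: 'x set). cball (0 :: complex) r) = {a. \<forall>x. cmod (a x) \<le> r}"
    by (auto simp: PiE_def Pi_def)
  finally show ?thesis .
qed

section \<open>States that are 1 on a subgroup\<close>

definition states_on :: "('a, 'b) monoid_scheme \<Rightarrow> 'a set \<Rightarrow> ('a \<Rightarrow> complex) set"
  where "states_on G N = {\<phi> \<in> states G. \<forall>n\<in>N. \<phi> n = 1}"

definition irrep_on :: "('a, 'b) monoid_scheme \<Rightarrow> 'a set \<Rightarrow> ('a, 'a \<Rightarrow> complex) rep \<Rightarrow> bool"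
  where "irrep_on G N = (\<lambda>(V, \<pi>). (V, \<pi>) \<in> irreps G \<and> (\<forall>n\<in>N. \<forall>v\<in>carrier V. \<pi> n v = v))"

definition dual_on :: "('a, 'b) monoid_scheme \<Rightarrow> 'a set set \<Rightarrow> ('a, 'a \<Rightarrow> complex) rep set set"
  where "dual_on G \<N> = {rep_class G \<rho> | \<rho> N. N \<in> \<N> \<and> irrep_on G N \<rho>}"

lemma continuous_kernel_of: "continuous_on S (\<lambda>\<phi>. kernel_of G \<phi> x y)"
  unfolding kernel_of_def
  by (cases "x \<in> carrier G"; cases "y \<in> carrier G") (simp_all add: continuous_coordinate)

lemma continuous_bil_kernel_of: "continuous_on UNIV (\<lambda>\<phi>. bil (kernel_of G \<phi>) l l)"
  unfolding continuous_on_def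
proof
  fix \<phi> :: "'a \<Rightarrow> complex"
  show "((\<lambda>\<phi>. bil (kernel_of G \<phi>) l l) \<longlongrightarrow> bil (kernel_of G \<phi>) l l) (at \<phi> within UNIV)"
    by (rule bil_tendsto) (use continuous_kernel_of[of UNIV G] in \<open>simp add: continuous_on_def\<close>)
qed

lemma closed_states_on: "closed (states_on G N)"
proof -
  have 1: "closed {\<phi>. kernel_of G \<phi> y x = cnj (kernel_of G \<phi> x y)}" for x y
    by (intro closed_Collect_eq continuous_on_cnj continuous_kernel_of)
  have 2: "closed {\<phi>. 0 \<le> Re (bil (kernel_of G \<phi>) l l)}" for l
    by (intro closed_Collect_le continuous_on_const continuous_on_Re continuous_bil_kernel_of)
  have 3: "closed {\<phi> :: 'a \<Rightarrow> complex. \<phi> x = c}" for x c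
    by (intro closed_Collect_eq continuous_on_const continuous_coordinate)
  have "states_on G N = (\<Inter>x. \<Inter>y. {\<phi>. kernel_of G \<phi> y x = cnj (kernel_of G \<phi> x y)}) \<inter>
    (\<Inter>l. {\<phi>. 0 \<le> Re (bil (kernel_of G \<phi>) l l)}) \<inter> (\<Inter>x\<in>- carrier G. {\<phi>. \<phi> x = 0}) \<inter>
    {\<phi>. \<phi> \<one>\<^bsub>G\<^esub> = 1} \<inter> (\<Inter>n\<in>N. {\<phi>. \<phi> n = 1})"
    unfolding states_on_def states_def positive_type_def pd_def by blast
  moreover have "closed \<dots>"
    by (intro closed_Int closed_INT ballI 1 2 3)
  ultimately show ?thesis by simp
qed

lemma kernel_of_mix:
  "kernel_of G (mix t a b) = (\<lambda>x y. of_real (1 - t) * kernel_of G a x y + of_real t * kernel_of G b x y)"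
  by (auto simp: kernel_of_def mix_def fun_eq_iff)

lemma states_on_empty: "states_on G {} = states G"
  by (simp add: states_on_def)

lemma states_on_mono: "N \<subseteq> M \<Longrightarrow> states_on G M \<subseteq> states_on G N"
  by (auto simp: states_on_def)

lemma convexf_states_on: "convexf (states_on G N)"
  unfolding convexf_def
proof (intro ballI allI impI)
  fix a b t assume a: "a \<in> states_on G N" and b: "b \<in> states_on G N" and t: "0 \<le> t \<and> t \<le> (1 :: real)"
  have "pd (kernel_of G (mix t a b))"
    unfolding kernel_of_mix
    using a b t by (intro pd_add pd_mult) (auto simp: states_on_def states_def positive_type_def)
  then show "mix t a b \<in> states_on G N"
    using a b by (auto simp: states_on_def states_def positive_type_def mix_def)
qed

lemma positive_type_sum:
  assumes "\<And>w. w \<in> set ws \<Longrightarrow> positive_type G (f w)"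
  shows "positive_type G (\<lambda>x. \<Sum>w\<leftarrow>ws. f w x)"
  using assms
proof (induction ws)
  case Nil
  have "kernel_of G (\<lambda>x. 0) = (\<lambda>x y. 0)" by (simp add: kernel_of_def fun_eq_iff)
  then show ?case by (simp add: positive_type_def pd_zero)
next
  case (Cons w ws)
  have "kernel_of G (\<lambda>x. \<Sum>w\<leftarrow>w # ws. f w x) =
    (\<lambda>x y. kernel_of G (f w) x y + kernel_of G (\<lambda>x. \<Sum>w\<leftarrow>ws. f w x) x y)"
    by (simp add: kernel_of_def fun_eq_iff)
  then show ?case using Cons by (auto simp: positive_type_def intro: pd_add)
qed

text \<open>The coefficient of a combination of orbit vectors depends continuously on the function of
  positive type at the cyclic vector.\<close>
lemma bil_kernel_diff:
  assumes "\<And>x y. x \<in> snd ` set l \<Longrightarrow> y \<in> snd ` set m \<Longrightarrow> cmod (K x y - K' x y) \<le> d" "0 \<le> d"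
  shows "cmod (bil K l m - bil K' l m) \<le> d * ((\<Sum>p\<leftarrow>l. cmod (fst p)) * (\<Sum>p\<leftarrow>m. cmod (fst p)))"
proof -
  have n: "cmod (\<Sum>p\<leftarrow>l. f p) \<le> (\<Sum>p\<leftarrow>l. g p)" if "\<And>p. p \<in> set l \<Longrightarrow> cmod (f p) \<le> g p" for f g and l :: "'b list"
    using that
  proof (induction l)
    case (Cons p l)
    have "cmod (f p + (\<Sum>p\<leftarrow>l. f p)) \<le> cmod (f p) + cmod (\<Sum>p\<leftarrow>l. f p)" by (rule norm_triangle_ineq)
    also have "\<dots> \<le> g p + (\<Sum>p\<leftarrow>l. g p)" using Cons by (intro add_mono) auto
    finally show ?case by simp
  qed simp
  have "bil K l m - bil K' l m = (\<Sum>p\<leftarrow>l. \<Sum>q\<leftarrow>m. fst p * cnj (fst q) * (K (snd p) (snd q) - K' (snd p) (snd q)))"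
    by (simp add: bil_def sum_list_subtractf[symmetric] algebra_simps)
  also have "cmod \<dots> \<le> (\<Sum>p\<leftarrow>l. \<Sum>q\<leftarrow>m. cmod (fst p) * cmod (fst q) * d)"
    using assms by (intro n) (auto simp: norm_mult intro!: mult_left_mono)
  also have "\<dots> = d * ((\<Sum>p\<leftarrow>l. cmod (fst p)) * (\<Sum>p\<leftarrow>m. cmod (fst p)))"
    by (simp add: sum_list_const_mult sum_list_mult_const mult_ac)
  finally show ?thesis .
qed

lemma finite_slack:
  fixes f :: "'i \<Rightarrow> real"
  assumes "finite A" "\<And>a. a \<in> A \<Longrightarrow> f a < e"
  shows "\<exists>d>0. \<forall>a\<in>A. f a + d \<le> e"
  using assms
proof (induction A rule: finite_induct)
  case (insert a A)
  then obtain d where d: "d > 0" "\<forall>a\<in>A. f a + d \<le> e" by auto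
  have "f a < e" using insert.prems by simp
  then show ?case using d by (intro exI[of _ "min d (e - f a)"]) (auto simp: min_def intro: order_trans)
qed (auto intro: exI[of _ 1])

section \<open>Neighbourhoods in the Fell topology\<close>

lemma unitarily_equivalent_refl:
  "unitary_rep G (V, \<pi>) \<Longrightarrow> unitarily_equivalent G (V, \<pi>) (V, \<pi>)"
proof -
  have "(\<lambda>v. v) \<in> unitary_maps V V" by (simp add: unitary_maps_def bij_betw_def)
  then show ?thesis unfolding unitarily_equivalent_def by (auto intro!: bexI[of _ "\<lambda>v. v"])
qed

lemma irreps_group_rep: "group G \<Longrightarrow> (V, \<pi>) \<in> irreps G \<Longrightarrow> group_rep G V \<pi>"
  by (simp add: irreps_def irreducible_rep_def unitary_rep_def group_rep_def group_rep_axioms_def)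

lemma rep_class_self: "\<rho> \<in> irreps G \<Longrightarrow> \<rho> \<in> rep_class G \<rho>"
  using unitarily_equivalent_refl[of G "fst \<rho>" "snd \<rho>"]
  by (simp add: rep_class_def equiv_rel_def irreps_def irreducible_rep_def case_prod_unfold)

lemma rep_class_eqD:
  assumes "(V, \<pi>) \<in> irreps G" "rep_class G (W, \<sigma>) = rep_class G (V, \<pi>)"
  shows "\<exists>U\<in>unitary_maps W V. \<forall>g\<in>carrier G. \<forall>w\<in>carrier W. U (\<sigma> g w) = \<pi> g (U w)"
proof -
  have "(V, \<pi>) \<in> rep_class G (W, \<sigma>)" using rep_class_self[OF assms(1)] assms(2) by simp
  then have "unitarily_equivalent G (W, \<sigma>) (V, \<pi>)" by (simp add: rep_class_def equiv_rel_def)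
  then show ?thesis by (simp add: unitarily_equivalent_def)
qed

lemma unitary_dual_iff: "c \<in> unitary_dual G \<longleftrightarrow> (\<exists>\<rho>\<in>irreps G. c = rep_class G \<rho>)"
  by (auto simp: unitary_dual_def quotient_def rep_class_def)

lemma fell_nbhd_mono:
  assumes "F \<subseteq> F'" "Q \<subseteq> Q'" "\<epsilon>' \<le> \<epsilon>"
  shows "fell_nbhd G (V, \<pi>) F' Q' \<epsilon>' \<subseteq> fell_nbhd G (V, \<pi>) F Q \<epsilon>"
proof
  fix c assume "c \<in> fell_nbhd G (V, \<pi>) F' Q' \<epsilon>'"
  then obtain W \<sigma> where c: "c = rep_class G (W, \<sigma>)" "(W, \<sigma>) \<in> irreps G"
    and a: "\<forall>v\<in>F'. \<exists>ws. set ws \<subseteq> carrier W \<and>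
      (\<forall>x\<in>Q'. cmod (ip V (\<pi> x v) v - (\<Sum>w\<leftarrow>ws. ip W (\<sigma> x w) w)) < \<epsilon>')"
    by (auto simp: fell_nbhd_def)
  have "\<forall>v\<in>F. \<exists>ws. set ws \<subseteq> carrier W \<and>
      (\<forall>x\<in>Q. cmod (ip V (\<pi> x v) v - (\<Sum>w\<leftarrow>ws. ip W (\<sigma> x w) w)) < \<epsilon>)"
  proof
    fix v assume "v \<in> F"
    then obtain ws where "set ws \<subseteq> carrier W"
      "\<forall>x\<in>Q'. cmod (ip V (\<pi> x v) v - (\<Sum>w\<leftarrow>ws. ip W (\<sigma> x w) w)) < \<epsilon>'" using a assms(1) by blast
    then show "\<exists>ws. set ws \<subseteq> carrier W \<and>
      (\<forall>x\<in>Q. cmod (ip V (\<pi> x v) v - (\<Sum>w\<leftarrow>ws. ip W (\<sigma> x w) w)) < \<epsilon>)"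
      using assms(2,3) by (intro exI[of _ ws]) (auto intro: less_le_trans)
  qed
  then show "c \<in> fell_nbhd G (V, \<pi>) F Q \<epsilon>" using c by (auto simp: fell_nbhd_def)
qed

definition fell_data :: "('a, 'b) monoid_scheme \<Rightarrow> 'v inner_space \<Rightarrow> 'v set \<Rightarrow> 'a set \<Rightarrow> real \<Rightarrow> bool"
  where "fell_data G V F Q \<epsilon> \<longleftrightarrow> finite F \<and> F \<subseteq> carrier V \<and> finite Q \<and> Q \<subseteq> carrier G \<and> 0 < \<epsilon>"

lemma fell_nbhd_self:
  assumes "(V, \<pi>) \<in> irreps G" "fell_data G V F Q \<epsilon>"
  shows "rep_class G (V, \<pi>) \<in> fell_nbhd G (V, \<pi>) F Q \<epsilon>"
proof -
  have "\<exists>ws. set ws \<subseteq> carrier V \<and> (\<forall>x\<in>Q. cmod (ip V (\<pi> x v) v - (\<Sum>w\<leftarrow>ws. ip V (\<pi> x w) w)) < \<epsilon>)"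
    if "v \<in> F" for v
    using that assms(2) by (intro exI[of _ "[v]"]) (auto simp: fell_data_def)
  then show ?thesis using assms(1) by (auto simp: fell_nbhd_def)
qed

text \<open>The basic neighbourhoods are centred at representations and not at classes. A point of one is the
  centre of a smaller one: the vectors \<open>w\<close> that approximate at the point become the test
  vectors, and the slack in the finitely many strict inequalities is the new tolerance.\<close>
lemma fell_nbhd_recenter:
  assumes G: "group G" and \<rho>: "(V, \<pi>) \<in> irreps G" and d: "fell_data G V' F' Q' \<epsilon>'"
    and mem: "rep_class G (V, \<pi>) \<in> fell_nbhd G (V', \<pi>') F' Q' \<epsilon>'"
  shows "\<exists>F Q \<epsilon>. fell_data G V F Q \<epsilon> \<and> fell_nbhd G (V, \<pi>) F Q \<epsilon> \<subseteq> fell_nbhd G (V', \<pi>') F' Q' \<epsilon>'"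
proof -
  obtain W \<sigma> where c: "rep_class G (V, \<pi>) = rep_class G (W, \<sigma>)"
    and a: "\<forall>v\<in>F'. \<exists>ws. set ws \<subseteq> carrier W \<and>
      (\<forall>x\<in>Q'. cmod (ip V' (\<pi>' x v) v - (\<Sum>w\<leftarrow>ws. ip W (\<sigma> x w) w)) < \<epsilon>')"
    and W: "(W, \<sigma>) \<in> irreps G"
    using mem by (auto simp: fell_nbhd_def)
  interpret W: group_rep G W \<sigma> by (rule irreps_group_rep[OF G W])
  obtain U where U: "U \<in> unitary_maps W V" and UI: "\<And>g w. g \<in> carrier G \<Longrightarrow> w \<in> carrier W \<Longrightarrow> U (\<sigma> g w) = \<pi> g (U w)"
    using rep_class_eqD[OF \<rho> c[symmetric]] by blast
  have Uip: "ip V (\<pi> x (U w)) (U w) = ip W (\<sigma> x w) w" if "x \<in> carrier G" "w \<in> carrier W" for x w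
    using that unitary_mapsD(4)[OF U, of "\<sigma> x w" w] UI[OF that] by simp
  have Q': "Q' \<subseteq> carrier G" "finite Q'" and F': "finite F'" and e': "0 < \<epsilon>'" using d by (auto simp: fell_data_def)
  obtain ws where ws: "\<And>v. v \<in> F' \<Longrightarrow> set (ws v) \<subseteq> carrier W"
    "\<And>v x. v \<in> F' \<Longrightarrow> x \<in> Q' \<Longrightarrow> cmod (ip V' (\<pi>' x v) v - (\<Sum>w\<leftarrow>ws v. ip W (\<sigma> x w) w)) < \<epsilon>'"
    using bchoice[OF a] by blast
  have "\<exists>\<delta>>0. \<forall>p\<in>F' \<times> Q'. cmod (ip V' (\<pi>' (snd p) (fst p)) (fst p) - (\<Sum>w\<leftarrow>ws (fst p). ip W (\<sigma> (snd p) w) w)) + \<delta> \<le> \<epsilon>'"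
    by (rule finite_slack) (use F' Q' ws(2) in auto)
  then obtain \<delta> where \<delta>: "\<delta> > 0" "\<And>v x. v \<in> F' \<Longrightarrow> x \<in> Q' \<Longrightarrow>
      cmod (ip V' (\<pi>' x v) v - (\<Sum>w\<leftarrow>ws v. ip W (\<sigma> x w) w)) + \<delta> \<le> \<epsilon>'" by fastforce
  define n where "n = (\<Sum>v\<in>F'. length (ws v))"
  define \<epsilon> where "\<epsilon> = \<delta> / (real n + 1)"
  have \<epsilon>: "\<epsilon> > 0" using \<delta> by (simp add: \<epsilon>_def add_nonneg_pos)
  define F where "F = (\<Union>v\<in>F'. U ` set (ws v))"
  have F: "F \<subseteq> carrier V" using ws(1) unitary_mapsD(1)[OF U] unfolding F_def by blast
  have "fell_data G V F Q' \<epsilon>" using F F' Q' \<epsilon> by (simp add: fell_data_def F_def)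
  moreover have "fell_nbhd G (V, \<pi>) F Q' \<epsilon> \<subseteq> fell_nbhd G (V', \<pi>') F' Q' \<epsilon>'"
  proof
    fix c assume "c \<in> fell_nbhd G (V, \<pi>) F Q' \<epsilon>"
    then obtain X \<tau> where X: "c = rep_class G (X, \<tau>)" "(X, \<tau>) \<in> irreps G"
      and b: "\<forall>v\<in>F. \<exists>ws. set ws \<subseteq> carrier X \<and>
        (\<forall>x\<in>Q'. cmod (ip V (\<pi> x v) v - (\<Sum>w\<leftarrow>ws. ip X (\<tau> x w) w)) < \<epsilon>)"
      by (auto simp: fell_nbhd_def)
    obtain m where m: "\<And>v. v \<in> F \<Longrightarrow> set (m v) \<subseteq> carrier X"
      "\<And>v x. v \<in> F \<Longrightarrow> x \<in> Q' \<Longrightarrow> cmod (ip V (\<pi> x v) v - (\<Sum>w\<leftarrow>m v. ip X (\<tau> x w) w)) < \<epsilon>"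
      using bchoice[OF b] by blast
    have "\<exists>us. set us \<subseteq> carrier X \<and> (\<forall>x\<in>Q'. cmod (ip V' (\<pi>' x v) v - (\<Sum>w\<leftarrow>us. ip X (\<tau> x w) w)) < \<epsilon>')"
      if v: "v \<in> F'" for v
    proof (intro exI conjI ballI)
      define us where "us = concat (map (\<lambda>w. m (U w)) (ws v))"
      have UF: "U w \<in> F" if "w \<in> set (ws v)" for w using that v by (auto simp: F_def)
      show "set us \<subseteq> carrier X" using m(1)[OF UF] by (auto simp: us_def)
      fix x assume x: "x \<in> Q'"
      have xG: "x \<in> carrier G" using x Q' by blast
      have "cmod ((\<Sum>w\<leftarrow>l. ip W (\<sigma> x w) w) - (\<Sum>w\<leftarrow>concat (map (\<lambda>w. m (U w)) l). ip X (\<tau> x w) w)) \<le> length l * \<epsilon>"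
        if "set l \<subseteq> set (ws v)" for l
        using that
      proof (induction l)
        case (Cons w l)
        have w: "w \<in> set (ws v)" "w \<in> carrier W" using Cons.prems ws(1)[OF v] by auto
        have "cmod (ip W (\<sigma> x w) w - (\<Sum>w\<leftarrow>m (U w). ip X (\<tau> x w) w)) \<le> \<epsilon>"
          using m(2)[OF UF[OF w(1)] x] Uip[OF xG w(2)] by simp
        moreover have "cmod ((\<Sum>w\<leftarrow>l. ip W (\<sigma> x w) w) - (\<Sum>w\<leftarrow>concat (map (\<lambda>w. m (U w)) l). ip X (\<tau> x w) w)) \<le> length l * \<epsilon>"
          using Cons by simp
        moreover have "cmod ((a + b) - (a' + b')) \<le> cmod (a - a') + cmod (b - b')" for a b a' b'
          using norm_triangle_ineq[of "a - a'" "b - b'"] by (simp add: algebra_simps)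
        ultimately have "cmod ((ip W (\<sigma> x w) w + (\<Sum>w\<leftarrow>l. ip W (\<sigma> x w) w)) -
            ((\<Sum>w\<leftarrow>m (U w). ip X (\<tau> x w) w) + (\<Sum>w\<leftarrow>concat (map (\<lambda>w. m (U w)) l). ip X (\<tau> x w) w))) \<le> \<epsilon> + length l * \<epsilon>"
          by (meson add_mono order_trans)
        then show ?case by (simp add: algebra_simps)
      qed simp
      then have "cmod ((\<Sum>w\<leftarrow>ws v. ip W (\<sigma> x w) w) - (\<Sum>w\<leftarrow>us. ip X (\<tau> x w) w)) \<le> length (ws v) * \<epsilon>"
        unfolding us_def by blast
      also have "length (ws v) \<le> n" unfolding n_def by (rule member_le_sum[OF v]) (use F' in auto)
      then have "length (ws v) * \<epsilon> \<le> n * \<epsilon>" using \<epsilon> by (intro mult_right_mono) auto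
      also have "n * \<epsilon> < \<delta>" using \<delta>(1) by (simp add: \<epsilon>_def field_simps)
      finally have "cmod ((\<Sum>w\<leftarrow>ws v. ip W (\<sigma> x w) w) - (\<Sum>w\<leftarrow>us. ip X (\<tau> x w) w)) < \<delta>" .
      moreover have "cmod (a - c) \<le> cmod (a - b) + cmod (b - c)" for a b c :: complex
        using norm_triangle_ineq[of "a - b" "b - c"] by simp
      ultimately show "cmod (ip V' (\<pi>' x v) v - (\<Sum>w\<leftarrow>us. ip X (\<tau> x w) w)) < \<epsilon>'"
        using \<delta>(2)[OF v x] by (meson add_strict_left_mono less_le_trans le_less_trans)
    qed
    then show "c \<in> fell_nbhd G (V', \<pi>') F' Q' \<epsilon>'" using X by (auto simp: fell_nbhd_def)
  qed
  ultimately show ?thesis by blast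
qed

lemma fell_basis:
  assumes G: "group G" and \<rho>: "(V, \<pi>) \<in> irreps G"
    and U: "openin (fell_topology G) U" "rep_class G (V, \<pi>) \<in> U"
  shows "\<exists>F Q \<epsilon>. fell_data G V F Q \<epsilon> \<and> fell_nbhd G (V, \<pi>) F Q \<epsilon> \<subseteq> U"
proof -
  have "generate_topology_on {fell_nbhd G (V, \<pi>) F Q \<epsilon> | V \<pi> F Q \<epsilon>. (V, \<pi>) \<in> irreps G \<and>
      finite F \<and> F \<subseteq> carrier V \<and> finite Q \<and> Q \<subseteq> carrier G \<and> 0 < \<epsilon>} U"
    using U(1) by (simp add: fell_topology_def openin_topology_generated_by_iff)
  then show ?thesis using U(2)
  proof (induction rule: generate_topology_on.induct)
    case Empty
    then show ?case by simp
  next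
    case (Int A B)
    obtain F1 Q1 e1 where 1: "fell_data G V F1 Q1 e1" "fell_nbhd G (V, \<pi>) F1 Q1 e1 \<subseteq> A" using Int by blast
    obtain F2 Q2 e2 where 2: "fell_data G V F2 Q2 e2" "fell_nbhd G (V, \<pi>) F2 Q2 e2 \<subseteq> B" using Int by blast
    have "fell_data G V (F1 \<union> F2) (Q1 \<union> Q2) (min e1 e2)" using 1(1) 2(1) by (auto simp: fell_data_def)
    moreover have "fell_nbhd G (V, \<pi>) (F1 \<union> F2) (Q1 \<union> Q2) (min e1 e2) \<subseteq> fell_nbhd G (V, \<pi>) F1 Q1 e1"
      by (rule fell_nbhd_mono) auto
    moreover have "fell_nbhd G (V, \<pi>) (F1 \<union> F2) (Q1 \<union> Q2) (min e1 e2) \<subseteq> fell_nbhd G (V, \<pi>) F2 Q2 e2"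
      by (rule fell_nbhd_mono) auto
    ultimately show ?case using 1(2) 2(2) by (meson Int_greatest order_trans)
  next
    case (UN \<K>)
    then obtain k where k: "k \<in> \<K>" "rep_class G (V, \<pi>) \<in> k" by blast
    then obtain F Q e where "fell_data G V F Q e" "fell_nbhd G (V, \<pi>) F Q e \<subseteq> k" using UN.IH by blast
    then show ?case using k(1) by blast
  next
    case (Basis s)
    then obtain V' \<pi>' F' Q' e' where s: "s = fell_nbhd G (V', \<pi>') F' Q' e'" "fell_data G V' F' Q' e'"
      by (auto simp: fell_data_def)
    show ?case using fell_nbhd_recenter[OF G \<rho> s(2)] Basis.prems unfolding s(1) by blast
  qed
qed

lemma fell_nbhd_open:
  assumes "(V, \<pi>) \<in> irreps G" "fell_data G V F Q \<epsilon>"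
  shows "openin (fell_topology G) (fell_nbhd G (V, \<pi>) F Q \<epsilon>)"
proof -
  have "fell_nbhd G (V, \<pi>) F Q \<epsilon> \<in> {fell_nbhd G (V, \<pi>) F Q \<epsilon> | V \<pi> F Q \<epsilon>. (V, \<pi>) \<in> irreps G \<and>
      finite F \<and> F \<subseteq> carrier V \<and> finite Q \<and> Q \<subseteq> carrier G \<and> 0 < \<epsilon>}"
    using assms unfolding fell_data_def by blast
  then show ?thesis unfolding fell_topology_def by (rule topology_generated_by_Basis)
qed

lemma fell_closure_iff:
  assumes G: "group G" and \<rho>: "(V, \<pi>) \<in> irreps G"
  shows "rep_class G (V, \<pi>) \<in> fell_topology G closure_of S \<longleftrightarrow>
    (\<forall>F Q \<epsilon>. fell_data G V F Q \<epsilon> \<longrightarrow> S \<inter> fell_nbhd G (V, \<pi>) F Q \<epsilon> \<noteq> {})"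
proof
  assume c: "rep_class G (V, \<pi>) \<in> fell_topology G closure_of S"
  show "\<forall>F Q \<epsilon>. fell_data G V F Q \<epsilon> \<longrightarrow> S \<inter> fell_nbhd G (V, \<pi>) F Q \<epsilon> \<noteq> {}"
  proof (intro allI impI)
    fix F Q \<epsilon> assume d: "fell_data G V F Q \<epsilon>"
    show "S \<inter> fell_nbhd G (V, \<pi>) F Q \<epsilon> \<noteq> {}"
      using c fell_nbhd_self[OF \<rho> d] fell_nbhd_open[OF \<rho> d] unfolding in_closure_of by blast
  qed
next
  assume a: "\<forall>F Q \<epsilon>. fell_data G V F Q \<epsilon> \<longrightarrow> S \<inter> fell_nbhd G (V, \<pi>) F Q \<epsilon> \<noteq> {}"
  have "fell_data G V {} {} 1" by (simp add: fell_data_def)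
  then have "rep_class G (V, \<pi>) \<in> topspace (fell_topology G)"
    using fell_nbhd_self[OF \<rho>] fell_nbhd_open[OF \<rho>] openin_subset by blast
  moreover have "\<exists>y\<in>S. y \<in> T" if T: "rep_class G (V, \<pi>) \<in> T" "openin (fell_topology G) T" for T
  proof -
    have "\<exists>F Q \<epsilon>. fell_data G V F Q \<epsilon> \<and> fell_nbhd G (V, \<pi>) F Q \<epsilon> \<subseteq> T"
      by (rule fell_basis[OF G \<rho> T(2,1)])
    then show ?thesis using a by blast
  qed
  ultimately show "rep_class G (V, \<pi>) \<in> fell_topology G closure_of S" unfolding in_closure_of by blast
qed

lemma fell_closure_subset: "fell_topology G closure_of S \<subseteq> unitary_dual G"
proof -
  have "topspace (fell_topology G) \<subseteq> unitary_dual G"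
  proof
    fix c assume "c \<in> topspace (fell_topology G)"
    then obtain V \<pi> F Q \<epsilon> where "c \<in> fell_nbhd G (V, \<pi>) F Q \<epsilon>"
      by (auto simp: fell_topology_def topology_generated_by_topspace)
    then obtain W \<sigma> where "c = rep_class G (W, \<sigma>)" "(W, \<sigma>) \<in> irreps G"
      by (auto simp: fell_nbhd_def)
    then show "c \<in> unitary_dual G" by (auto simp: unitary_dual_iff)
  qed
  then show ?thesis by (rule order_trans[OF closure_of_subset_topspace])
qed

section \<open>Density in the dual and density of states\<close>

context group
begin

lemma compact_states_on: "compact (states_on G N)"
proof -
  have "states_on G N \<subseteq> {a. \<forall>x. cmod (a x) \<le> 1}"
  proof
    fix \<phi> assume "\<phi> \<in> states_on G N"
    then have "positive_type G \<phi>" "\<phi> \<one> = 1" by (auto simp: states_on_def states_def)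
    then show "\<phi> \<in> {a. \<forall>x. cmod (a x) \<le> 1}" using pt_bound[of \<phi>] by simp
  qed
  then show ?thesis
    using compact_Int_closed[OF compact_disc[of 1] closed_states_on[of G N]] by (simp add: Int_absorb1)
qed

lemma pure_iff_extreme: "pure G \<phi> \<longleftrightarrow> extreme (states G) \<phi>"
  by (simp add: pure_def extreme_def mix_def fun_eq_iff)

text \<open>1 is an extreme point of the unit disc, so both parts of a mixture that is 1 on \<open>N\<close> are 1 on \<open>N\<close>.\<close>
lemma extreme_states_on_pure:
  assumes e: "extreme (states_on G N) e"
  shows "pure G e"
  unfolding pure_iff_extreme extreme_def
proof (intro conjI ballI allI impI)
  have eN: "e \<in> states_on G N" using e by (simp add: extreme_def)
  then show "e \<in> states G" by (simp add: states_on_def)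
  fix a b t assume a: "a \<in> states G" and b: "b \<in> states G" and t: "0 < t \<and> t < 1 \<and> e = mix t a b"
  have le: "cmod (c x) \<le> 1" if "c \<in> states G" for c x
    using pt_bound[of c x] that by (simp add: states_def)
  have "a n = 1 \<and> b n = 1" if n: "n \<in> N" for n
  proof -
    have "mix t a b n = 1" using eN n t by (auto simp: states_on_def)
    then have s: "(1 - t) * Re (a n) + t * Re (b n) = 1"
    proof -
      have "Re (mix t a b n) = (1 - t) * Re (a n) + t * Re (b n)" by (simp add: mix_def)
      then show ?thesis using \<open>mix t a b n = 1\<close> by simp
    qed
    have r: "Re (a n) \<le> 1" "Re (b n) \<le> 1"
      using le[OF a, of n] le[OF b, of n] complex_Re_le_cmod order_trans by blast+
    have "(1 - t) * (1 - Re (a n)) + t * (1 - Re (b n)) = 0" using s by (simp add: algebra_simps)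
    moreover have "0 \<le> (1 - t) * (1 - Re (a n))" "0 \<le> t * (1 - Re (b n))" using r t by simp_all
    ultimately have "(1 - t) * (1 - Re (a n)) = 0" "t * (1 - Re (b n)) = 0" by linarith+
    then have R: "Re (a n) = 1" "Re (b n) = 1" using t by simp_all
    have "z = 1" if "Re z = 1" "cmod z \<le> 1" for z
    proof -
      have "(cmod z)\<^sup>2 \<le> 1" using that(2) by (simp add: power_le_one)
      then have "Im z = 0" using that(1) by (simp add: cmod_power2)
      then show ?thesis using that(1) by (simp add: complex_eq_iff)
    qed
    then show ?thesis using R le[OF a, of n] le[OF b, of n] by blast
  qed
  then have "a \<in> states_on G N" "b \<in> states_on G N" using a b by (auto simp: states_on_def)
  then show "a = e" using e t unfolding extreme_def by blast
qed

lemma states_on_approx_pure: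
  "states_on G N \<subseteq> adh (chull {e \<in> states_on G N. pure G e})"
  using extreme_states_on_pure
  by (intro krein_milman compact_states_on convexf_states_on closed_states_on) (auto simp: extreme_def)

lemma pure_adh:
  assumes pure: "pure G \<phi>" and d: "\<phi> \<in> adh (\<Union>N\<in>\<N>. states_on G N)"
  shows "\<phi> \<in> adh (\<Union>N\<in>\<N>. {e \<in> states_on G N. pure G e})" (is "_ \<in> adh ?X")
proof (rule milman)
  show "compact (states G)" "convexf (states G)"
    using compact_states_on[of "{}"] convexf_states_on[of G "{}"] by (simp_all add: states_on_empty)
  show "?X \<subseteq> states G" by (auto simp: states_on_def)
  show "extreme (states G) \<phi>" using pure by (simp add: pure_iff_extreme)
  have "states_on G N \<subseteq> adh (chull ?X)" if "N \<in> \<N>" for N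
  proof -
    have "{e \<in> states_on G N. pure G e} \<subseteq> ?X" using that by blast
    from adh_mono[OF chull_mono[OF this]] show ?thesis using states_on_approx_pure[of N] by blast
  qed
  then have "(\<Union>N\<in>\<N>. states_on G N) \<subseteq> adh (chull ?X)" by blast
  from adh_mono[OF this] show "\<phi> \<in> adh (chull ?X)" using d adh_adh[of "chull ?X"] by blast
qed

end

context group_rep
begin

lemma coef_approx:
  assumes v: "v \<in> carrier V" and tot: "total (orb v)" and u: "u \<in> carrier V" and e: "e > 0"
  shows "\<exists>l. \<forall>x. cmod (coef u x - coef (comb (orb v) l) x) < e"
proof -
  define d where "d = min 1 (e / (2 * nrm u + 2))"
  have n: "0 \<le> nrm u" using u by simp
  have d: "d > 0" using e n by (simp add: d_def)
  then obtain l where l: "nrm (u \<ominus>\<^bsub>V\<^esub> comb (orb v) l) < d" using tot u unfolding total_def by blast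
  define w where "w = comb (orb v) l"
  have w: "w \<in> carrier V" unfolding w_def by (rule comb_closed) (simp add: v)
  have "cmod (coef u x - coef w x) < e" if x: "x \<in> carrier G" for x
  proof -
    have "coef u x - coef w x = ip V (\<pi> x (u \<ominus>\<^bsub>V\<^esub> w)) u + ip V (\<pi> x w) (u \<ominus>\<^bsub>V\<^esub> w)"
      using x u w by (simp add: coef_def bddlinD[OF rep_linear] ip_minus)
    also have "cmod \<dots> \<le> cmod (ip V (\<pi> x (u \<ominus>\<^bsub>V\<^esub> w)) u) + cmod (ip V (\<pi> x w) (u \<ominus>\<^bsub>V\<^esub> w))"
      by (rule norm_triangle_ineq)
    also have "\<dots> \<le> nrm (u \<ominus>\<^bsub>V\<^esub> w) * nrm u + nrm w * nrm (u \<ominus>\<^bsub>V\<^esub> w)"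
      using x u w nrm_cs[of "\<pi> x (u \<ominus>\<^bsub>V\<^esub> w)" u] nrm_cs[of "\<pi> x w" "u \<ominus>\<^bsub>V\<^esub> w"] by (simp add: rep_nrm)
    also have "\<dots> = nrm (u \<ominus>\<^bsub>V\<^esub> w) * (nrm u + nrm w)" by (simp add: algebra_simps)
    also have "\<dots> \<le> d * (2 * nrm u + 1)"
    proof (rule mult_mono)
      have "nrm w \<le> nrm u + d" using nrm_diff[OF u w] l by (simp add: w_def)
      then show "nrm u + nrm w \<le> 2 * nrm u + 1" by (simp add: d_def)
    qed (use l u w d n in \<open>auto simp: w_def[symmetric]\<close>)
    also have "\<dots> \<le> e / (2 * nrm u + 2) * (2 * nrm u + 1)"
      using n by (intro mult_right_mono) (auto simp: d_def)
    also have "\<dots> < e" using e n by (simp add: pos_divide_less_eq add_nonneg_pos)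
    finally show ?thesis .
  qed
  moreover have "coef u x = coef w x" if "x \<notin> carrier G" for x using that by (simp add: coef_def)
  ultimately show ?thesis unfolding w_def using e by (intro exI[of _ l]) (metis diff_self norm_zero)
qed

end

context group
begin

text \<open>The coefficient of a unit vector \<open>v\<close> is pure, hence near a pure state that is 1 on some \<open>N\<close>
  (\<open>pure_adh\<close>), and the GNS representation of that state is irreducible and trivial on \<open>N\<close>. The
  coefficient of any other vector is nearly that of a combination of the orbit of \<open>v\<close>, and the same
  combination of the orbit of the GNS vector has nearly the same coefficient.\<close>
theorem dual_dense_if_states_dense:
  assumes \<N>: "\<And>N. N \<in> \<N> \<Longrightarrow> N \<lhd> G"
    and d: "\<And>\<phi>. \<phi> \<in> states G \<Longrightarrow> \<phi> \<in> adh (\<Union>N\<in>\<N>. states_on G N)"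
    and c: "c \<in> unitary_dual G"
  shows "c \<in> fell_topology G closure_of dual_on G \<N>"
proof -
  obtain V \<pi> where V: "(V, \<pi>) \<in> irreps G" and c: "c = rep_class G (V, \<pi>)"
    using c by (auto simp: unitary_dual_iff)
  interpret V: group_rep G V \<pi> by (rule irreps_group_rep[OF group_axioms V])
  have irr: "irreducible_rep G (V, \<pi>)" using V by (simp add: irreps_def)
  then obtain v0 where v0: "v0 \<in> carrier V" "v0 \<noteq> \<zero>\<^bsub>V\<^esub>"
    unfolding V.irreducible_iff using V.M.zero_closed by blast
  then have n0: "V.nrm v0 \<noteq> 0" using V.nrm_eq_zero by blast
  define v where "v = of_real (1 / V.nrm v0) \<odot>\<^bsub>V\<^esub> v0"
  have v: "v \<in> carrier V" "V.nrm v = 1"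
    using v0 n0 by (simp_all add: v_def V.cr V.nrm_smult norm_divide)
  define \<phi> where "\<phi> = V.coef v"
  have pure: "pure G \<phi>" unfolding \<phi>_def by (rule V.irreducible_coef_pure[OF irr v])
  have tot: "V.total (V.orb v)" using V.irreducible_total[OF irr v(1)] v(2) by simp
  show ?thesis
    unfolding c fell_closure_iff[OF group_axioms V]
  proof (intro allI impI)
    fix F Q and \<epsilon> :: real assume "fell_data G V F Q \<epsilon>"
    then have F: "finite F" "F \<subseteq> carrier V" and Q: "finite Q" "Q \<subseteq> carrier G" and \<epsilon>: "0 < \<epsilon>"
      by (auto simp: fell_data_def)
    have "\<forall>u\<in>F. \<exists>l. \<forall>x. cmod (V.coef u x - V.coef (V.comb (V.orb v) l) x) < \<epsilon> / 2"
    proof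
      fix u assume "u \<in> F"
      then show "\<exists>l. \<forall>x. cmod (V.coef u x - V.coef (V.comb (V.orb v) l) x) < \<epsilon> / 2"
        by (intro V.coef_approx[OF v(1) tot]) (use F \<epsilon> in auto)
    qed
    from bchoice[OF this] obtain L
      where L: "\<And>u x. u \<in> F \<Longrightarrow> cmod (V.coef u x - V.coef (V.comb (V.orb v) (L u)) x) < \<epsilon> / 2"
      by blast
    define Z where "Z = (\<Union>u\<in>F. snd ` set (L u)) \<inter> carrier G"
    have Z: "finite Z" using F by (simp add: Z_def)
    define R where "R = (\<lambda>(x, z, y). inv y \<otimes> (x \<otimes> z)) ` (Q \<times> Z \<times> Z)"
    have R: "finite R" using Q Z by (simp add: R_def)
    define M where "M = (\<Sum>u\<in>F. (\<Sum>p\<leftarrow>L u. cmod (fst p))\<^sup>2)"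
    have M: "M \<ge> 0" by (simp add: M_def sum_nonneg)
    define \<delta> where "\<delta> = (\<epsilon> / 2) / (M + 1)"
    have \<delta>: "\<delta> > 0" using \<epsilon> M by (simp add: \<delta>_def)
    have "\<phi> \<in> states G" using pure by (simp add: pure_def)
    then obtain \<psi> N where \<psi>: "N \<in> \<N>" "\<psi> \<in> states_on G N" "pure G \<psi>" "near R \<delta> \<phi> \<psi>"
      using adhD[OF pure_adh[OF pure d] R \<delta>] by blast
    obtain W \<sigma> where W: "gns G \<psi> = (W, \<sigma>)" by fastforce
    have pt: "positive_type G \<psi>" and \<psi>N: "\<And>n. n \<in> N \<Longrightarrow> \<psi> n = 1" "\<psi> \<one> = 1"
      using \<psi>(2) by (auto simp: states_on_def states_def)
    have Wirr: "(W, \<sigma>) \<in> irreps G" by (rule pure_gns_irreducible[OF \<psi>(3) W])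
    interpret W: group_rep G W \<sigma> by (rule irreps_group_rep[OF group_axioms Wirr])
    obtain \<zeta> where z: "\<zeta> \<in> carrier W" "W.coef \<zeta> = \<psi>" using gns_props(1)[OF pt W] by blast
    interpret N: normal N G by (rule \<N>[OF \<psi>(1)])
    have triv: "\<sigma> n w = w" if n: "n \<in> N" and w: "w \<in> carrier W" for n w
    proof (rule gns_trivial[OF pt W _ _ w])
      show "n \<in> carrier G" using n N.subset by blast
      show "\<psi> (inv x \<otimes> n \<otimes> x) = \<psi> \<one>" if "x \<in> carrier G" for x
        using N.inv_op_closed1[OF that n] \<psi>N by simp
    qed
    have "irrep_on G N (W, \<sigma>)" using Wirr triv by (simp add: irrep_on_def)
    then have "rep_class G (W, \<sigma>) \<in> dual_on G \<N>" unfolding dual_on_def using \<psi>(1) by blast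
    moreover have "rep_class G (W, \<sigma>) \<in> fell_nbhd G (V, \<pi>) F Q \<epsilon>"
    proof -
      have "\<exists>ws. set ws \<subseteq> carrier W \<and> (\<forall>x\<in>Q. cmod (ip V (\<pi> x u) u - (\<Sum>w\<leftarrow>ws. ip W (\<sigma> x w) w)) < \<epsilon>)"
        if u: "u \<in> F" for u
      proof (intro exI conjI ballI)
        define w where "w = W.comb (W.orb \<zeta>) (L u)"
        have w: "w \<in> carrier W" unfolding w_def by (rule W.comb_closed) (simp add: z)
        show "set [w] \<subseteq> carrier W" using w by simp
        fix x assume x: "x \<in> Q"
        have xG: "x \<in> carrier G" using x Q by blast
        have "cmod (V.coef (V.comb (V.orb v) (L u)) x - W.coef w x) \<le> \<delta> * (\<Sum>p\<leftarrow>L u. cmod (fst p))\<^sup>2"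
          unfolding power2_eq_square w_def V.coef_comb[OF v(1) xG] W.coef_comb[OF z(1) xG] z(2) \<phi>_def[symmetric]
        proof (rule bil_kernel_diff)
          fix a b assume ab: "a \<in> snd ` set (L u)" "b \<in> snd ` set (L u)"
          show "cmod (kernel_of G \<phi> (shift G x a) b - kernel_of G \<psi> (shift G x a) b) \<le> \<delta>"
          proof (cases "a \<in> carrier G \<and> b \<in> carrier G")
            case True
            then have "a \<in> Z" "b \<in> Z" using ab u by (auto simp: Z_def)
            then have "inv b \<otimes> (x \<otimes> a) \<in> R" using x unfolding R_def by force
            then have "cmod (\<phi> (inv b \<otimes> (x \<otimes> a)) - \<psi> (inv b \<otimes> (x \<otimes> a))) < \<delta>"
              using \<psi>(4) by (simp add: near_def)
            then show ?thesis using True xG by (simp add: kernel_of_def shift_def)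
          next
            case False
            then show ?thesis using \<delta> xG by (auto simp: kernel_of_def)
          qed
        qed (use \<delta> in simp)
        also have "\<dots> \<le> \<delta> * M"
          using \<delta> u F unfolding M_def by (intro mult_left_mono member_le_sum) auto
        also have "\<dots> < \<epsilon> / 2" using \<epsilon> M by (simp add: \<delta>_def field_simps)
        finally have "cmod (V.coef (V.comb (V.orb v) (L u)) x - W.coef w x) < \<epsilon> / 2" .
        then have "cmod (V.coef u x - W.coef w x) < \<epsilon>"
          by (rule norm_diff_triangle_less[OF L[OF u], THEN less_le_trans]) simp
        then show "cmod (ip V (\<pi> x u) u - (\<Sum>w\<leftarrow>[w]. ip W (\<sigma> x w) w)) < \<epsilon>"
          using xG by (simp add: V.coef_def W.coef_def)
      qed
      then show ?thesis using Wirr by (auto simp: fell_nbhd_def)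
    qed
    ultimately show "dual_on G \<N> \<inter> fell_nbhd G (V, \<pi>) F Q \<epsilon> \<noteq> {}" by blast
  qed
qed

lemma normalize_near:
  assumes pt: "positive_type G \<psi>" and N: "\<And>n. n \<in> N \<Longrightarrow> \<psi> n = \<psi> \<one>"
    and \<phi>: "\<phi> \<one> = 1" and \<epsilon>: "0 < \<epsilon>" and Q: "\<one> \<in> Q" and near: "near Q (min (1/2) (\<epsilon>/2)) \<phi> \<psi>"
  shows "\<exists>\<psi>'\<in>states_on G N. near Q \<epsilon> \<phi> \<psi>'"
proof -
  define r where "r = Re (\<psi> \<one>)"
  have r1: "\<psi> \<one> = of_real r" unfolding r_def by (rule pt_one(1)[OF pt])
  have "cmod (\<phi> \<one> - \<psi> \<one>) < min (1/2) (\<epsilon>/2)" using near Q by (simp add: near_def)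
  then have "cmod (of_real (1 - r)) < min (1/2) (\<epsilon>/2)" using \<phi> r1 by simp
  then have r: "\<bar>1 - r\<bar> < 1/2" "\<bar>1 - r\<bar> < \<epsilon>/2" by (simp_all only: norm_of_real min_less_iff_conj)
  then have r0: "r > 0" by linarith
  define \<psi>' where "\<psi>' x = of_real (1 / r) * \<psi> x" for x
  have "kernel_of G \<psi>' = (\<lambda>x y. of_real (1 / r) * kernel_of G \<psi> x y)"
    by (auto simp: kernel_of_def \<psi>'_def fun_eq_iff)
  then have "pd (kernel_of G \<psi>')" using pd_mult[OF _ pt_pd[OF pt], of "1 / r"] r0 by simp
  then have "positive_type G \<psi>'" using pt_outside[OF pt] by (simp add: positive_type_def \<psi>'_def)
  then have "\<psi>' \<in> states_on G N" using r0 r1 N by (simp add: states_on_def states_def \<psi>'_def)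
  moreover have "near Q \<epsilon> \<phi> \<psi>'"
    unfolding near_def
  proof
    fix x assume x: "x \<in> Q"
    have "cmod (\<phi> x - \<psi> x) < \<epsilon> / 2" using near x by (simp add: near_def)
    moreover have "cmod (\<psi> x - \<psi>' x) \<le> \<bar>1 - r\<bar>"
    proof -
      have "\<psi> x - \<psi>' x = of_real (1 - 1 / r) * \<psi> x" by (simp add: \<psi>'_def algebra_simps)
      then have "cmod (\<psi> x - \<psi>' x) = \<bar>1 - 1 / r\<bar> * cmod (\<psi> x)" by (simp only: norm_mult norm_of_real)
      also have "\<dots> \<le> \<bar>1 - 1 / r\<bar> * r" using pt_bound[OF pt, of x] by (intro mult_left_mono) (simp_all add: r_def)
      also have "\<dots> = \<bar>(1 - 1 / r) * r\<bar>" using r0 by (simp add: abs_mult)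
      also have "(1 - 1 / r) * r = - (1 - r)" using r0 by (simp add: algebra_simps)
      finally show ?thesis by simp
    qed
    moreover have "cmod (\<phi> x - \<psi>' x) \<le> cmod (\<phi> x - \<psi> x) + cmod (\<psi> x - \<psi>' x)"
      using norm_triangle_ineq[of "\<phi> x - \<psi> x" "\<psi> x - \<psi>' x"] by simp
    ultimately show "cmod (\<phi> x - \<psi>' x) < \<epsilon>" using r by linarith
  qed
  ultimately show ?thesis by blast
qed

text \<open>A pure state is a coefficient of an irreducible representation, which is near one that is trivial
  on some \<open>N\<close>; this yields functions of positive type near the state, and they only need to be
  normalized. The limits in question form a convex set, as the family is closed under
  intersection, so by \<open>states_on_approx_pure\<close> they include all states.\<close>
theorem states_dense_if_dual_dense:
  assumes \<N>: "\<And>N. N \<in> \<N> \<Longrightarrow> N \<lhd> G" and inter: "\<And>N M. N \<in> \<N> \<Longrightarrow> M \<in> \<N> \<Longrightarrow> N \<inter> M \<in> \<N>"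
    and d: "\<And>c. c \<in> unitary_dual G \<Longrightarrow> c \<in> fell_topology G closure_of dual_on G \<N>"
    and \<phi>: "\<phi> \<in> states G"
  shows "\<phi> \<in> adh (\<Union>N\<in>\<N>. states_on G N)" (is "_ \<in> adh ?U")
proof -
  have "convexf ?U"
    unfolding convexf_def
  proof (intro ballI allI impI)
    fix a b t assume a: "a \<in> ?U" and b: "b \<in> ?U" and t: "0 \<le> t \<and> t \<le> (1 :: real)"
    obtain N where N: "N \<in> \<N>" "a \<in> states_on G N" using a by blast
    obtain M where M: "M \<in> \<N>" "b \<in> states_on G M" using b by blast
    have "a \<in> states_on G (N \<inter> M)" "b \<in> states_on G (N \<inter> M)"
      using N(2) M(2) states_on_mono[of "N \<inter> M"] by blast+
    then have "mix t a b \<in> states_on G (N \<inter> M)" using convexfD[OF convexf_states_on] t by blast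
    then show "mix t a b \<in> ?U" using inter[OF N(1) M(1)] by blast
  qed
  then have cv: "convexf (adh ?U)" by (rule convexf_adh)
  have "e \<in> adh ?U" if pure: "pure G e" for e
  proof (rule adhI)
    fix Q0 :: "'a set" and \<epsilon> :: real assume Q0: "finite Q0" and \<epsilon>: "0 < \<epsilon>"
    define Q where "Q = insert \<one> (Q0 \<inter> carrier G)"
    have Q: "finite Q" "Q \<subseteq> carrier G" "\<one> \<in> Q" using Q0 by (auto simp: Q_def)
    define \<delta> where "\<delta> = min (1/2) (\<epsilon>/2)"
    have \<delta>: "\<delta> > 0" using \<epsilon> by (simp add: \<delta>_def)
    have pt: "positive_type G e" and e1: "e \<one> = 1" using pure by (auto simp: pure_def states_def)
    obtain V \<pi> where V: "gns G e = (V, \<pi>)" by fastforce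
    have Virr: "(V, \<pi>) \<in> irreps G" by (rule pure_gns_irreducible[OF pure V])
    interpret V: group_rep G V \<pi> by (rule irreps_group_rep[OF group_axioms Virr])
    obtain \<zeta> where z: "\<zeta> \<in> carrier V" "V.coef \<zeta> = e" using gns_props(1)[OF pt V] by blast
    have "rep_class G (V, \<pi>) \<in> fell_topology G closure_of dual_on G \<N>"
      using Virr by (intro d) (auto simp: unitary_dual_iff)
    moreover have "fell_data G V {\<zeta>} Q \<delta>" using z Q \<delta> by (simp add: fell_data_def)
    ultimately have "dual_on G \<N> \<inter> fell_nbhd G (V, \<pi>) {\<zeta>} Q \<delta> \<noteq> {}"
      unfolding fell_closure_iff[OF group_axioms Virr] by blast
    then obtain c where c: "c \<in> dual_on G \<N>" "c \<in> fell_nbhd G (V, \<pi>) {\<zeta>} Q \<delta>" by blast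
    obtain W \<sigma> ws where W: "c = rep_class G (W, \<sigma>)" "(W, \<sigma>) \<in> irreps G" and ws: "set ws \<subseteq> carrier W"
      "\<And>x. x \<in> Q \<Longrightarrow> cmod (ip V (\<pi> x \<zeta>) \<zeta> - (\<Sum>w\<leftarrow>ws. ip W (\<sigma> x w) w)) < \<delta>"
      using c(2) by (auto simp: fell_nbhd_def)
    obtain W' \<sigma>' N where W': "c = rep_class G (W', \<sigma>')" "N \<in> \<N>" "(W', \<sigma>') \<in> irreps G"
      and triv': "\<And>n w. n \<in> N \<Longrightarrow> w \<in> carrier W' \<Longrightarrow> \<sigma>' n w = w"
      using c(1) by (auto simp: dual_on_def irrep_on_def)
    interpret W: group_rep G W \<sigma> by (rule irreps_group_rep[OF group_axioms W(2)])
    interpret N: normal N G by (rule \<N>[OF W'(2)])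
    obtain U where U: "U \<in> unitary_maps W' W"
      and UI: "\<And>g w. g \<in> carrier G \<Longrightarrow> w \<in> carrier W' \<Longrightarrow> U (\<sigma>' g w) = \<sigma> g (U w)"
      using rep_class_eqD[OF W(2), of W' \<sigma>'] W(1) W'(1) by auto
    have triv: "\<sigma> n w = w" if n: "n \<in> N" and w: "w \<in> carrier W" for n w
    proof -
      have "w \<in> U ` carrier W'" using U w by (auto simp: unitary_maps_def bij_betw_def)
      then obtain w' where w': "w' \<in> carrier W'" "w = U w'" by blast
      have "n \<in> carrier G" using n N.subset by blast
      then show ?thesis using UI[of n w'] w' triv'[OF n w'(1)] by simp
    qed
    define \<psi> where "\<psi> x = (\<Sum>w\<leftarrow>ws. W.coef w x)" for x
    have \<psi>pt: "positive_type G \<psi>"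
      unfolding \<psi>_def by (rule positive_type_sum) (use ws(1) W.coef_positive_type in blast)
    have \<psi>N: "\<psi> n = \<psi> \<one>" if n: "n \<in> N" for n
    proof -
      have nG: "n \<in> carrier G" using n N.subset by blast
      have "W.coef w n = W.coef w \<one>" if "w \<in> set ws" for w
      proof -
        have "w \<in> carrier W" using that ws(1) by blast
        then show ?thesis using nG triv[OF n, of w] by (simp add: W.coef_def W.rep_one)
      qed
      then show ?thesis unfolding \<psi>_def by (intro arg_cong[where f = sum_list] map_cong) auto
    qed
    have "near Q \<delta> e \<psi>"
      unfolding near_def
    proof
      fix x assume x: "x \<in> Q"
      have xG: "x \<in> carrier G" using x Q by blast
      have "e x = ip V (\<pi> x \<zeta>) \<zeta>" using z(2) xG by (auto simp: V.coef_def)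
      moreover have "\<psi> x = (\<Sum>w\<leftarrow>ws. ip W (\<sigma> x w) w)" using xG by (simp add: \<psi>_def W.coef_def)
      ultimately show "cmod (e x - \<psi> x) < \<delta>" using ws(2)[OF x] by simp
    qed
    then have "\<exists>\<psi>'\<in>states_on G N. near Q \<epsilon> e \<psi>'"
      using normalize_near[of \<psi> N e \<epsilon> Q] \<psi>pt \<psi>N e1 \<epsilon> Q(3) unfolding \<delta>_def by blast
    then obtain \<psi>' where \<psi>': "\<psi>' \<in> states_on G N" "near Q \<epsilon> e \<psi>'" by blast
    have "near Q0 \<epsilon> e \<psi>'"
      unfolding near_def
    proof
      fix x assume x: "x \<in> Q0"
      have "positive_type G \<psi>'" using \<psi>'(1) by (simp add: states_on_def states_def)
      then show "cmod (e x - \<psi>' x) < \<epsilon>"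
        using \<psi>'(2) x \<epsilon> pt_outside[OF pt, of x] pt_outside[of \<psi>' x]
        by (cases "x \<in> carrier G") (auto simp: near_def Q_def)
    qed
    then show "\<exists>b\<in>?U. near Q0 \<epsilon> e b" using \<psi>'(1) W'(2) by blast
  qed
  then have "{e \<in> states_on G {}. pure G e} \<subseteq> adh ?U" by blast
  then have "chull {e \<in> states_on G {}. pure G e} \<subseteq> adh ?U" by (rule chull_least[OF cv])
  from adh_mono[OF this] have "states_on G {} \<subseteq> adh ?U"
    using states_on_approx_pure[of "{}"] adh_adh[of ?U] by blast
  then show ?thesis using \<phi> by (auto simp: states_on_empty)
qed

end

section \<open>Amenability and almost invariant vectors\<close>

lemma compact_real_cube: "compact {f :: 'x \<Rightarrow> real. \<forall>x. \<bar>f x\<bar> \<le> 1}"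
proof -
  have "compactin (product_topology (\<lambda>i. euclidean) UNIV) (\<Pi>\<^sub>E x\<in>(UNIV :: 'x set). cball (0 :: real) 1)"
    by (subst compactin_PiE) (auto simp: compactin_euclidean_iff)
  then have "compact (\<Pi>\<^sub>E x\<in>(UNIV :: 'x set). cball (0 :: real) 1)"
    unfolding euclidean_product_topology by (simp add: compactin_euclidean_iff)
  also have "(\<Pi>\<^sub>E x\<in>(UNIV :: 'x set). cball (0 :: real) 1) = {f. \<forall>x. \<bar>f x\<bar> \<le> 1}"
    by (auto simp: PiE_def Pi_def)
  finally show ?thesis .
qed

lemma continuous_real_coordinate: "continuous_on S (\<lambda>a :: 'x \<Rightarrow> real. a x)"
  by (rule continuous_on_subset[OF continuous_on_product_coordinates]) simp

lemma max_sq_le: "(max 0 (z - s :: real))\<^sup>2 \<le> (max 0 z - s)\<^sup>2"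
proof (cases "z \<le> 0")
  case True
  then have "max 0 (z - s) \<le> \<bar>max 0 z - s\<bar>" by auto
  then have "(max 0 (z - s))\<^sup>2 \<le> \<bar>max 0 z - s\<bar>\<^sup>2" by (intro power_mono) auto
  then show ?thesis by simp
next
  case False
  then have "max 0 (z - s) \<le> \<bar>max 0 z - s\<bar>" by auto
  then have "(max 0 (z - s))\<^sup>2 \<le> \<bar>max 0 z - s\<bar>\<^sup>2" by (intro power_mono) auto
  then show ?thesis by simp
qed

context group
begin

lemma bounded_functionsI: "(\<And>x. x \<in> carrier G \<Longrightarrow> \<bar>f x\<bar> \<le> c) \<Longrightarrow> f \<in> bounded_functions G"
  unfolding bounded_functions_def by (auto intro!: boundedI[of _ c])

text \<open>An invariant mean annihilates this sum as a function of \<open>x\<close>, which is impossible if the function is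
  bounded below by \<open>\<delta>\<close>.\<close>
lemma amenable_coboundary:
  fixes f :: "'a \<times> 'a \<Rightarrow> real"
  assumes am: "amenable G" and E: "finite E" "E \<subseteq> carrier G" and f: "\<And>i. \<bar>f i\<bar> \<le> 1" and \<delta>: "0 < \<delta>"
  shows "\<exists>x\<in>carrier G. (\<Sum>g\<in>E. f (g, inv g \<otimes> x) - f (g, x)) < \<delta>"
proof (rule ccontr)
  assume "\<not> ?thesis"
  then have ge: "\<And>x. x \<in> carrier G \<Longrightarrow> \<delta> \<le> (\<Sum>g\<in>E. f (g, inv g \<otimes> x) - f (g, x))" by force
  obtain m :: "('a \<Rightarrow> real) \<Rightarrow> real" where
    add: "\<And>f h. f \<in> bounded_functions G \<Longrightarrow> h \<in> bounded_functions G \<Longrightarrow> m (\<lambda>x. f x + h x) = m f + m h"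
    and scale: "\<And>c f. f \<in> bounded_functions G \<Longrightarrow> m (\<lambda>x. c * f x) = c * m f"
    and pos: "\<And>f. f \<in> bounded_functions G \<Longrightarrow> (\<forall>x\<in>carrier G. 0 \<le> f x) \<Longrightarrow> 0 \<le> m f"
    and one: "m (\<lambda>x. 1) = 1"
    and inv: "\<And>g f. g \<in> carrier G \<Longrightarrow> f \<in> bounded_functions G \<Longrightarrow> m (\<lambda>x. f (inv g \<otimes> x)) = m f"
    using am unfolding amenable_def by blast
  have c1: "(\<lambda>x. 1) \<in> bounded_functions G" by (rule bounded_functionsI[of _ 1]) simp
  have m0: "m (\<lambda>x. 0) = 0" using scale[OF c1, of 0] by simp
  have "m (\<lambda>x. \<Sum>g\<in>E'. f (g, inv g \<otimes> x) - f (g, x)) = 0 \<and>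
      (\<lambda>x. \<Sum>g\<in>E'. f (g, inv g \<otimes> x) - f (g, x)) \<in> bounded_functions G" if "finite E'" "E' \<subseteq> E" for E'
    using that
  proof (induction E' rule: finite_induct)
    case empty
    have "(\<lambda>x. 0) \<in> bounded_functions G" by (rule bounded_functionsI[of _ 0]) simp
    then show ?case using m0 by simp
  next
    case (insert g E')
    let ?S = "\<lambda>x. \<Sum>g\<in>E'. f (g, inv g \<otimes> x) - f (g, x)"
    have g: "g \<in> carrier G" using insert.prems E by blast
    have b1: "(\<lambda>x. f (g, x)) \<in> bounded_functions G" by (rule bounded_functionsI) (rule f)
    have b2: "(\<lambda>x. f (g, inv g \<otimes> x)) \<in> bounded_functions G" by (rule bounded_functionsI) (rule f)
    have b3: "(\<lambda>x. (-1) * f (g, x)) \<in> bounded_functions G" by (rule bounded_functionsI[of _ 1]) (use f in simp)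
    have b4: "(\<lambda>x. f (g, inv g \<otimes> x) + (-1) * f (g, x)) \<in> bounded_functions G"
    proof (rule bounded_functionsI)
      show "\<bar>f (g, inv g \<otimes> x) + (-1) * f (g, x)\<bar> \<le> 2" for x
        using f[of "(g, inv g \<otimes> x)"] f[of "(g, x)"] by linarith
    qed
    have z: "m (\<lambda>x. f (g, inv g \<otimes> x) + (-1) * f (g, x)) = 0"
      using add[OF b2 b3] scale[OF b1, of "-1"] inv[OF g b1] by simp
    have IH: "m ?S = 0" "?S \<in> bounded_functions G" using insert by auto
    have eq: "(\<lambda>x. \<Sum>g\<in>insert g E'. f (g, inv g \<otimes> x) - f (g, x)) =
        (\<lambda>x. (f (g, inv g \<otimes> x) + (-1) * f (g, x)) + ?S x)"
      using insert.hyps by (simp add: fun_eq_iff)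
    have "(\<lambda>x. (f (g, inv g \<otimes> x) + (-1) * f (g, x)) + ?S x) \<in> bounded_functions G"
    proof -
      have "bounded ((\<lambda>x. f (g, inv g \<otimes> x) + (-1) * f (g, x)) ` carrier G)" "bounded (?S ` carrier G)"
        using b4 IH(2) unfolding bounded_functions_def by blast+
      from bounded_plus_comp[OF this] show ?thesis unfolding bounded_functions_def by blast
    qed
    then show ?case unfolding eq using add[OF b4 IH(2)] z IH(1) by simp
  qed
  from this[OF E(1) order_refl]
  have h: "m (\<lambda>x. \<Sum>g\<in>E. f (g, inv g \<otimes> x) - f (g, x)) = 0"
    "(\<lambda>x. \<Sum>g\<in>E. f (g, inv g \<otimes> x) - f (g, x)) \<in> bounded_functions G" by auto
  have cd: "(\<lambda>x. (- \<delta>) * 1) \<in> bounded_functions G" by (rule bounded_functionsI[of _ \<delta>]) (use \<delta> in simp)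
  have "0 \<le> m (\<lambda>x. (\<Sum>g\<in>E. f (g, inv g \<otimes> x) - f (g, x)) + (- \<delta>) * 1)"
  proof (rule pos)
    have "bounded ((\<lambda>x. \<Sum>g\<in>E. f (g, inv g \<otimes> x) - f (g, x)) ` carrier G)" "bounded ((\<lambda>x. (- \<delta>) * 1) ` carrier G)"
      using h(2) cd unfolding bounded_functions_def by blast+
    from bounded_plus_comp[OF this]
    show "(\<lambda>x. (\<Sum>g\<in>E. f (g, inv g \<otimes> x) - f (g, x)) + (- \<delta>) * 1) \<in> bounded_functions G"
      unfolding bounded_functions_def by blast
    show "\<forall>x\<in>carrier G. 0 \<le> (\<Sum>g\<in>E. f (g, inv g \<otimes> x) - f (g, x)) + (- \<delta>) * 1" using ge by simp
  qed
  also have "\<dots> = - \<delta>" using add[OF h(2) cd] h(1) scale[OF c1, of "- \<delta>"] one by simp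
  finally show False using \<delta> by simp
qed

lemma translate_image: "g \<in> carrier G \<Longrightarrow> T \<subseteq> carrier G \<Longrightarrow> t \<in> carrier G \<Longrightarrow>
    t \<in> (\<lambda>x. inv g \<otimes> x) ` T \<longleftrightarrow> g \<otimes> t \<in> T"
proof
  assume g: "g \<in> carrier G" and T: "T \<subseteq> carrier G" and t: "t \<in> carrier G"
  show "g \<otimes> t \<in> T" if m: "t \<in> (\<lambda>x. inv g \<otimes> x) ` T"
  proof -
    obtain x where "x \<in> T" "t = inv g \<otimes> x" using m by blast
    moreover then have "x \<in> carrier G" using T by blast
    ultimately show ?thesis using g by (simp add: m_assoc[symmetric])
  qed
  show "t \<in> (\<lambda>x. inv g \<otimes> x) ` T" if "g \<otimes> t \<in> T"
    by (rule image_eqI[OF _ that]) (use g t in \<open>simp add: m_assoc[symmetric]\<close>)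
qed

lemma sum_translate:
  fixes F :: "'a \<Rightarrow> 'a \<Rightarrow> real"
  assumes g: "g \<in> carrier G" and T: "finite T" "T \<subseteq> carrier G" and z: "\<And>x y. x \<notin> T \<Longrightarrow> F x y = 0"
  shows "(\<Sum>x\<in>T. F x (inv g \<otimes> x)) = (\<Sum>t\<in>T \<union> (\<lambda>x. inv g \<otimes> x) ` T. F (g \<otimes> t) t)"
proof -
  have inj: "inj_on (\<lambda>x. inv g \<otimes> x) T"
  proof (rule inj_onI)
    fix x y assume xy: "x \<in> T" "y \<in> T" "inv g \<otimes> x = inv g \<otimes> y"
    have "g \<otimes> (inv g \<otimes> x) = x" "g \<otimes> (inv g \<otimes> y) = y"
      using g subsetD[OF T(2) xy(1)] subsetD[OF T(2) xy(2)] by (simp_all add: m_assoc[symmetric])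
    then show "x = y" unfolding xy(3) by simp
  qed
  have "(\<Sum>t\<in>T \<union> (\<lambda>x. inv g \<otimes> x) ` T. F (g \<otimes> t) t) = (\<Sum>t\<in>(\<lambda>x. inv g \<otimes> x) ` T. F (g \<otimes> t) t)"
  proof (rule sum.mono_neutral_right)
    show "\<forall>t\<in>(T \<union> (\<lambda>x. inv g \<otimes> x) ` T) - (\<lambda>x. inv g \<otimes> x) ` T. F (g \<otimes> t) t = 0"
      using z translate_image[OF g T(2)] T(2) by blast
  qed (use T in auto)
  also have "\<dots> = (\<Sum>x\<in>T. F (g \<otimes> (inv g \<otimes> x)) (inv g \<otimes> x))" by (simp add: sum.reindex[OF inj])
  also have "\<dots> = (\<Sum>x\<in>T. F x (inv g \<otimes> x))"
  proof (rule sum.cong[OF refl])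
    fix x assume "x \<in> T"
    then have "x \<in> carrier G" using T by blast
    then show "F (g \<otimes> (inv g \<otimes> x)) (inv g \<otimes> x) = F x (inv g \<otimes> x)" using g by (simp add: m_assoc[symmetric])
  qed
  finally show ?thesis by simp
qed

text \<open>A finitely supported probability that \<open>E\<close> almost preserves. By \<open>amenable_coboundary\<close> and
  compactness of the cube of all \<open>f\<close>, some finite set \<open>P\<close> has for each \<open>f\<close> a point \<open>x\<close> with
  \<open>h x f < \<delta>\<close>. A minimax argument turns \<open>x\<close> into a probability on \<open>P\<close> that does not depend on \<open>f\<close>: minimize
  the sum of the squares of \<open>max 0 (\<delta> - h x f)\<close>; the values of these maxima at the
  minimizer \<open>f0\<close>, divided by their sum, are the weights. Taking for \<open>f\<close> the sign of
  \<open>p (g t) - p t\<close> gives the claim.\<close>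
theorem reiter:
  assumes am: "amenable G" and E: "finite E" "E \<subseteq> carrier G" and \<epsilon>: "0 < \<epsilon>"
  shows "\<exists>T p. finite T \<and> T \<subseteq> carrier G \<and> (\<forall>x. 0 \<le> p x) \<and> (\<forall>x. x \<notin> T \<longrightarrow> p x = 0) \<and> (\<Sum>x\<in>T. p x) = 1 \<and>
    (\<forall>g\<in>E. (\<Sum>t\<in>T \<union> (\<lambda>x. inv g \<otimes> x) ` T. \<bar>p (g \<otimes> t) - p t\<bar>) < (\<epsilon> :: real))"
proof -
  define \<delta> where "\<delta> = \<epsilon> / 2"
  have \<delta>: "\<delta> > 0" "\<delta> < \<epsilon>" using \<epsilon> by (simp_all add: \<delta>_def)
  define B where "B = {f :: 'a \<times> 'a \<Rightarrow> real. \<forall>i. \<bar>f i\<bar> \<le> 1}"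
  define h where "h x f = (\<Sum>g\<in>E. f (g, inv g \<otimes> x) - f (g, x))" for x and f :: "'a \<times> 'a \<Rightarrow> real"
  have ch: "continuous_on S (h x)" for S x
    unfolding h_def by (intro continuous_on_sum continuous_on_diff continuous_real_coordinate)
  have cB: "compact B" unfolding B_def by (rule compact_real_cube)
  obtain P where P: "P \<subseteq> carrier G" "finite P" "B \<subseteq> (\<Union>x\<in>P. {f. h x f < \<delta>})"
  proof (rule compactE_image[OF cB, of "carrier G" "\<lambda>x. {f. h x f < \<delta>}"])
    show "open {f. h x f < \<delta>}" for x by (intro open_Collect_less ch continuous_on_const)
    show "B \<subseteq> (\<Union>x\<in>carrier G. {f. h x f < \<delta>})"
    proof
      fix f assume "f \<in> B"
      then have "\<And>i. \<bar>f i\<bar> \<le> 1" unfolding B_def by blast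
      from amenable_coboundary[OF am E this \<delta>(1)]
      show "f \<in> (\<Union>x\<in>carrier G. {f. h x f < \<delta>})" by (simp add: h_def)
    qed
  qed
  define J where "J f = (\<Sum>x\<in>P. (max 0 (\<delta> - h x f))\<^sup>2)" for f
  have "continuous_on B J"
    unfolding J_def by (intro continuous_on_sum continuous_on_power continuous_on_max continuous_on_const continuous_on_diff ch)
  moreover have "B \<noteq> {}" by (auto simp: B_def intro: exI[of _ "\<lambda>_. 0"])
  ultimately have "\<exists>f\<in>B. \<forall>f'\<in>B. J f \<le> J f'" by (intro continuous_attains_inf cB)
  then obtain f0 where f0: "f0 \<in> B" "\<And>f. f \<in> B \<Longrightarrow> J f0 \<le> J f" by blast
  define r where "r x = (if x \<in> P then max 0 (\<delta> - h x f0) else 0)" for x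
  have r0: "0 \<le> r x" for x by (simp add: r_def)
  obtain x0 where x0: "x0 \<in> P" "h x0 f0 < \<delta>" using f0(1) P(3) by blast
  define R where "R = (\<Sum>x\<in>P. r x)"
  have "r x0 \<le> R" unfolding R_def by (rule member_le_sum[OF x0(1)]) (use r0 P in auto)
  moreover have "0 < r x0" using x0 by (simp add: r_def)
  ultimately have R: "R > 0" by simp
  have opt: "(\<Sum>x\<in>P. r x * h x f) \<le> R * \<delta>" if f: "f \<in> B" for f
  proof -
    define d where "d x = h x f - h x f0" for x
    define A where "A = (\<Sum>x\<in>P. r x * d x)"
    define N where "N = (\<Sum>x\<in>P. (d x)\<^sup>2)"
    have N: "N \<ge> 0" by (simp add: N_def sum_nonneg)
    have step: "2 * A \<le> t * N" if t: "0 < t" "t \<le> 1" for t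
    proof -
      define ft where "ft i = (1 - t) * f0 i + t * f i" for i
      have "\<bar>ft i\<bar> \<le> 1" for i
      proof -
        have "\<bar>f0 i\<bar> \<le> 1" "\<bar>f i\<bar> \<le> 1" using f f0(1) unfolding B_def by blast+
        then have "(1 - t) * \<bar>f0 i\<bar> + t * \<bar>f i\<bar> \<le> 1" using t by (intro convex_bound_le) auto
        moreover have "\<bar>ft i\<bar> \<le> (1 - t) * \<bar>f0 i\<bar> + t * \<bar>f i\<bar>"
          using abs_triangle_ineq[of "(1 - t) * f0 i" "t * f i"] t by (simp add: ft_def abs_mult)
        ultimately show ?thesis by linarith
      qed
      then have "ft \<in> B" by (simp add: B_def)
      have hft: "h x ft = h x f0 + t * d x" for x
      proof -
        have "h x ft = (1 - t) * h x f0 + t * h x f"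
          unfolding h_def ft_def sum_distrib_left sum.distrib[symmetric]
          by (rule sum.cong) (simp_all add: algebra_simps)
        then show ?thesis by (simp add: d_def algebra_simps)
      qed
      have "J f0 \<le> J ft" by (rule f0(2)[OF \<open>ft \<in> B\<close>])
      also have "\<dots> \<le> (\<Sum>x\<in>P. (r x - t * d x)\<^sup>2)"
        unfolding J_def
      proof (rule sum_mono)
        fix x assume x: "x \<in> P"
        show "(max 0 (\<delta> - h x ft))\<^sup>2 \<le> (r x - t * d x)\<^sup>2"
          using max_sq_le[of "\<delta> - h x f0" "t * d x"] x by (simp add: hft r_def algebra_simps)
      qed
      also have "\<dots> = (\<Sum>x\<in>P. (r x)\<^sup>2) - 2 * t * A + t\<^sup>2 * N"
        unfolding A_def N_def sum_distrib_left sum_subtractf[symmetric] sum.distrib[symmetric]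
        by (rule sum.cong) (simp_all add: power2_eq_square algebra_simps)
      also have "(\<Sum>x\<in>P. (r x)\<^sup>2) = J f0" unfolding J_def by (rule sum.cong) (simp_all add: r_def)
      finally have "t * (2 * A) \<le> t * (t * N)" by (simp add: power2_eq_square algebra_simps)
      then show ?thesis using t(1) by simp
    qed
    have "A \<le> 0"
    proof (rule ccontr)
      assume "\<not> A \<le> 0"
      then have A: "A > 0" by simp
      define t where "t = min 1 (A / (N + 1))"
      have t: "0 < t" "t \<le> 1" using A N by (simp_all add: t_def)
      have "t \<le> A / (N + 1)" by (simp add: t_def)
      then have "t * (N + 1) \<le> A" using N by (simp add: pos_le_divide_eq add_nonneg_pos)
      then have "t * N + t \<le> A" by (simp add: algebra_simps)
      then show False using step[OF t] t(1) A by linarith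
    qed
    then have "(\<Sum>x\<in>P. r x * h x f) \<le> (\<Sum>x\<in>P. r x * h x f0)"
      by (simp add: A_def d_def right_diff_distrib sum_subtractf)
    also have "\<dots> \<le> (\<Sum>x\<in>P. r x * \<delta>)"
    proof (rule sum_mono)
      fix x assume "x \<in> P"
      show "r x * h x f0 \<le> r x * \<delta>"
      proof (cases "h x f0 \<le> \<delta>")
        case True
        then show ?thesis by (intro mult_left_mono r0)
      qed (simp add: r_def)
    qed
    also have "\<dots> = R * \<delta>" by (simp add: R_def sum_distrib_right)
    finally show ?thesis .
  qed
  define p where "p x = r x / R" for x
  have p0: "0 \<le> p x" for x using r0 R by (simp add: p_def)
  have pP: "p x = 0" if "x \<notin> P" for x using that by (simp add: p_def r_def)
  have p1: "(\<Sum>x\<in>P. p x) = 1" using R by (simp add: p_def R_def sum_divide_distrib[symmetric])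
  define f where "f = (\<lambda>(g, t). sgn (p (g \<otimes> t) - p t))"
  have "f \<in> B" by (auto simp: B_def f_def sgn_if)
  have term_eq: "(\<Sum>x\<in>P. p x * (f (g, inv g \<otimes> x) - f (g, x))) =
      (\<Sum>t\<in>P \<union> (\<lambda>x. inv g \<otimes> x) ` P. \<bar>p (g \<otimes> t) - p t\<bar>)" if g: "g \<in> carrier G" for g
  proof -
    have "(\<Sum>x\<in>P. p x * f (g, inv g \<otimes> x)) = (\<Sum>t\<in>P \<union> (\<lambda>x. inv g \<otimes> x) ` P. p (g \<otimes> t) * f (g, t))"
      using sum_translate[OF g P(2,1), of "\<lambda>x y. p x * f (g, y)"] pP by simp
    moreover have "(\<Sum>x\<in>P. p x * f (g, x)) = (\<Sum>t\<in>P \<union> (\<lambda>x. inv g \<otimes> x) ` P. p t * f (g, t))"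
      by (rule sum.mono_neutral_left) (use P pP in auto)
    ultimately have "(\<Sum>x\<in>P. p x * (f (g, inv g \<otimes> x) - f (g, x))) =
        (\<Sum>t\<in>P \<union> (\<lambda>x. inv g \<otimes> x) ` P. (p (g \<otimes> t) - p t) * f (g, t))"
      by (simp add: right_diff_distrib left_diff_distrib sum_subtractf)
    also have "\<dots> = (\<Sum>t\<in>P \<union> (\<lambda>x. inv g \<otimes> x) ` P. \<bar>p (g \<otimes> t) - p t\<bar>)"
      by (rule sum.cong) (auto simp: f_def mult_sgn_abs abs_sgn)
    finally show ?thesis .
  qed
  have total: "(\<Sum>g\<in>E. \<Sum>t\<in>P \<union> (\<lambda>x. inv g \<otimes> x) ` P. \<bar>p (g \<otimes> t) - p t\<bar>) \<le> \<delta>"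
  proof -
    have "(\<Sum>g\<in>E. \<Sum>t\<in>P \<union> (\<lambda>x. inv g \<otimes> x) ` P. \<bar>p (g \<otimes> t) - p t\<bar>) =
        (\<Sum>g\<in>E. \<Sum>x\<in>P. p x * (f (g, inv g \<otimes> x) - f (g, x)))"
      by (rule sum.cong) (use term_eq E in auto)
    also have "\<dots> = (\<Sum>x\<in>P. p x * h x f)"
      unfolding h_def sum_distrib_left by (rule sum.swap)
    also have "\<dots> = (\<Sum>x\<in>P. r x * h x f) / R" by (simp add: p_def sum_divide_distrib)
    also have "\<dots> \<le> \<delta>" using opt[OF \<open>f \<in> B\<close>] R by (simp add: pos_divide_le_eq mult.commute)
    finally show ?thesis .
  qed
  have "(\<Sum>t\<in>P \<union> (\<lambda>x. inv g \<otimes> x) ` P. \<bar>p (g \<otimes> t) - p t\<bar>) < \<epsilon>" if g: "g \<in> E" for g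
  proof -
    have "(\<Sum>t\<in>P \<union> (\<lambda>x. inv g \<otimes> x) ` P. \<bar>p (g \<otimes> t) - p t\<bar>) \<le>
      (\<Sum>g\<in>E. \<Sum>t\<in>P \<union> (\<lambda>x. inv g \<otimes> x) ` P. \<bar>p (g \<otimes> t) - p t\<bar>)"
      by (rule member_le_sum[OF g, of "\<lambda>g. \<Sum>t\<in>P \<union> (\<lambda>x. inv g \<otimes> x) ` P. \<bar>p (g \<otimes> t) - p t\<bar>"])
         (use E in \<open>auto intro: sum_nonneg\<close>)
    then show ?thesis using total \<delta>(2) by linarith
  qed
  then show ?thesis using P p0 pP p1 by blast
qed

text \<open>The square root of an almost invariant probability, as \<open>(a - b)\<^sup>2 \<le> \<bar>a\<^sup>2 - b\<^sup>2\<bar>\<close> for nonnegative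
  \<open>a\<close> and \<open>b\<close>.\<close>
theorem almost_invariant_vector:
  assumes am: "amenable G" and E: "finite E" "E \<subseteq> carrier G" and \<epsilon>: "0 < \<epsilon>"
  shows "\<exists>T \<xi>. finite T \<and> T \<subseteq> carrier G \<and> (\<forall>x. 0 \<le> \<xi> x) \<and> (\<forall>x. x \<notin> T \<longrightarrow> \<xi> x = 0) \<and>
    (\<Sum>x\<in>T. (\<xi> x)\<^sup>2) = 1 \<and> (\<forall>g\<in>E. \<bar>1 - (\<Sum>t\<in>T. \<xi> (g \<otimes> t) * \<xi> t)\<bar> < (\<epsilon> :: real))"
proof -
  obtain T p where T: "finite T" "T \<subseteq> carrier G" and p: "\<And>x. 0 \<le> p x" "\<And>x. x \<notin> T \<Longrightarrow> p x = 0" "(\<Sum>x\<in>T. p x) = 1"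
    and inv: "\<And>g. g \<in> E \<Longrightarrow> (\<Sum>t\<in>T \<union> (\<lambda>x. inv g \<otimes> x) ` T. \<bar>p (g \<otimes> t) - p t\<bar>) < \<epsilon>"
    using reiter[OF am E \<epsilon>] by blast
  define \<xi> where "\<xi> x = sqrt (p x)" for x
  have sq: "(\<xi> x)\<^sup>2 = p x" "0 \<le> \<xi> x" for x using p(1) by (simp_all add: \<xi>_def)
  have z: "\<xi> x = 0" if "x \<notin> T" for x using p(2)[OF that] by (simp add: \<xi>_def)
  have "\<bar>1 - (\<Sum>t\<in>T. \<xi> (g \<otimes> t) * \<xi> t)\<bar> < \<epsilon>" if g: "g \<in> E" for g
  proof -
    have gG: "g \<in> carrier G" using g E by blast
    let ?Y = "T \<union> (\<lambda>x. inv g \<otimes> x) ` T"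
    have "(\<Sum>t\<in>?Y. p (g \<otimes> t)) = 1" using sum_translate[OF gG T, of "\<lambda>x y. p x"] p(2,3) by simp
    moreover have "(\<Sum>t\<in>?Y. p t) = 1"
      unfolding p(3)[symmetric] by (rule sum.mono_neutral_right) (use T p(2) in auto)
    moreover have "(\<Sum>t\<in>?Y. \<xi> (g \<otimes> t) * \<xi> t) = (\<Sum>t\<in>T. \<xi> (g \<otimes> t) * \<xi> t)"
      by (rule sum.mono_neutral_right) (use T z in auto)
    moreover have "(\<xi> (g \<otimes> t) - \<xi> t)\<^sup>2 = p (g \<otimes> t) + p t - 2 * (\<xi> (g \<otimes> t) * \<xi> t)" for t
      by (simp add: power2_diff sq)
    then have "(\<Sum>t\<in>?Y. (\<xi> (g \<otimes> t) - \<xi> t)\<^sup>2) =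
        (\<Sum>t\<in>?Y. p (g \<otimes> t)) + (\<Sum>t\<in>?Y. p t) - 2 * (\<Sum>t\<in>?Y. \<xi> (g \<otimes> t) * \<xi> t)"
      by (simp add: sum.distrib sum_subtractf sum_distrib_left)
    ultimately have e: "(\<Sum>t\<in>?Y. (\<xi> (g \<otimes> t) - \<xi> t)\<^sup>2) = 2 * (1 - (\<Sum>t\<in>T. \<xi> (g \<otimes> t) * \<xi> t))" by simp
    have "(\<Sum>t\<in>?Y. (\<xi> (g \<otimes> t) - \<xi> t)\<^sup>2) \<le> (\<Sum>t\<in>?Y. \<bar>p (g \<otimes> t) - p t\<bar>)"
    proof (rule sum_mono)
      fix t
      have "(a - b)\<^sup>2 \<le> \<bar>a\<^sup>2 - b\<^sup>2\<bar>" if "0 \<le> a" "0 \<le> b" for a b :: real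
      proof -
        have "\<bar>a\<^sup>2 - b\<^sup>2\<bar> = \<bar>a - b\<bar> * (a + b)"
          using that by (simp add: power2_eq_square square_diff_square_factored abs_mult mult.commute)
        moreover have "(a - b)\<^sup>2 = \<bar>a - b\<bar> * \<bar>a - b\<bar>" by (simp add: power2_eq_square)
        moreover have "\<bar>a - b\<bar> \<le> a + b" using that by linarith
        ultimately show ?thesis by (simp only: mult_left_mono abs_ge_zero)
      qed
      from this[of "\<xi> (g \<otimes> t)" "\<xi> t"] show "(\<xi> (g \<otimes> t) - \<xi> t)\<^sup>2 \<le> \<bar>p (g \<otimes> t) - p t\<bar>" by (simp add: sq)
    qed
    then have "2 * (1 - (\<Sum>t\<in>T. \<xi> (g \<otimes> t) * \<xi> t)) < \<epsilon>" using inv[OF g] e by linarith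
    moreover have "0 \<le> (\<Sum>t\<in>?Y. (\<xi> (g \<otimes> t) - \<xi> t)\<^sup>2)" by (rule sum_nonneg) simp
    moreover have "\<bar>z\<bar> < \<epsilon>" if "2 * z < \<epsilon>" "0 \<le> s" "s = 2 * z" for z s
      using that by linarith
    ultimately show ?thesis using e by blast
  qed
  then show ?thesis using T sq z p(3) by (intro exI[of _ T] exI[of _ \<xi>]) auto
qed

end

section \<open>Simultaneous approximation of finitely many coefficients\<close>

text \<open>If \<open>\<Psi> s t x\<close> is the inner product of \<open>\<pi> x (v t)\<close> with \<open>v s\<close>, this kernel is the matrix of inner products
  of the vectors \<open>\<pi> x (v t)\<close>. So its semidefiniteness says that \<open>\<Psi>\<close> is a matrix of positive type.\<close>
definition mkernel :: "('a, 'b) monoid_scheme \<Rightarrow> ('t \<Rightarrow> 't \<Rightarrow> 'a \<Rightarrow> complex) \<Rightarrow> 'a \<times> 't \<Rightarrow> 'a \<times> 't \<Rightarrow> complex"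
  where "mkernel G \<Psi> i j = (if fst i \<in> carrier G \<and> fst j \<in> carrier G
    then \<Psi> (snd j) (snd i) (inv\<^bsub>G\<^esub> (fst j) \<otimes>\<^bsub>G\<^esub> fst i) else 0)"

lemma pd_mkernel_zero:
  fixes G :: "('a, 'b) monoid_scheme"
  shows "pd (mkernel G (\<lambda>(s :: 't) t x. 0))"
proof -
  have "mkernel G (\<lambda>s t x. 0) = (\<lambda>i j :: 'a \<times> 't. 0)" by (simp add: mkernel_def fun_eq_iff)
  then show "pd (mkernel G (\<lambda>(s :: 't) t x. 0))" by (simp add: pd_zero)
qed

context group
begin

lemma conj_cancel:
  assumes "x \<in> carrier G" "y \<in> carrier G" "z \<in> carrier G" "n \<in> carrier G"
  shows "(inv y \<otimes> (x \<otimes> z)) \<otimes> (inv z \<otimes> n \<otimes> z) = inv y \<otimes> (x \<otimes> n \<otimes> z)"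
proof -
  have "z \<otimes> (inv z \<otimes> (n \<otimes> z)) = n \<otimes> z"
    using m_assoc[of z "inv z" "n \<otimes> z"] assms by simp
  then show ?thesis using assms by (simp add: m_assoc)
qed

lemma cone_approx:
  assumes ne: "\<N> \<noteq> {}" and d: "\<And>\<phi>. \<phi> \<in> states G \<Longrightarrow> \<phi> \<in> adh (\<Union>N\<in>\<N>. states_on G N)"
    and pt: "positive_type G \<phi>" and Q: "finite Q" and \<epsilon>: "0 < \<epsilon>"
  shows "\<exists>N\<in>\<N>. \<exists>\<psi>. positive_type G \<psi> \<and> (\<forall>n\<in>N. \<psi> n = \<psi> \<one>) \<and> near Q \<epsilon> \<phi> \<psi>"
proof -
  define r where "r = Re (\<phi> \<one>)"
  have r1: "\<phi> \<one> = of_real r" and r0: "0 \<le> r" unfolding r_def by (rule pt_one[OF pt])+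
  show ?thesis
  proof (cases "r = 0")
    case True
    then have "\<phi> x = 0" for x using pt_bound[OF pt, of x] by (simp add: r_def)
    then have "\<forall>n\<in>N. \<phi> n = \<phi> \<one>" for N by simp
    moreover obtain N where "N \<in> \<N>" using ne by blast
    ultimately show ?thesis using pt near_refl[OF \<epsilon>] by blast
  next
    case False
    then have r: "r > 0" using r0 by simp
    have sc: "positive_type G (\<lambda>x. of_real c * f x)" if "positive_type G f" "0 \<le> c" for c f
    proof -
      have "kernel_of G (\<lambda>x. of_real c * f x) = (\<lambda>x y. of_real c * kernel_of G f x y)"
        by (auto simp: kernel_of_def fun_eq_iff)
      then show ?thesis using that pd_mult[OF that(2), of "kernel_of G f"] by (simp add: positive_type_def)
    qed
    have "(\<lambda>x. of_real (1 / r) * \<phi> x) \<in> states G"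
      using sc[OF pt, of "1 / r"] r r1 by (simp add: states_def)
    from adhD[OF d[OF this] Q, of "\<epsilon> / r"] obtain N \<psi>
      where N: "N \<in> \<N>" "\<psi> \<in> states_on G N" "near Q (\<epsilon> / r) (\<lambda>x. of_real (1 / r) * \<phi> x) \<psi>"
      using \<epsilon> r by auto
    have "positive_type G (\<lambda>x. of_real r * \<psi> x)"
      using N(2) r by (intro sc) (auto simp: states_on_def states_def)
    moreover have "\<forall>n\<in>N. of_real r * \<psi> n = of_real r * \<psi> \<one>" using N(2) by (simp add: states_on_def states_def)
    moreover have "near Q \<epsilon> \<phi> (\<lambda>x. of_real r * \<psi> x)"
      unfolding near_def
    proof
      fix x assume "x \<in> Q"
      then have "cmod (of_real (1 / r) * \<phi> x - \<psi> x) < \<epsilon> / r" using N(3) by (simp add: near_def)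
      moreover have "\<phi> x - of_real r * \<psi> x = of_real r * (of_real (1 / r) * \<phi> x - \<psi> x)"
        using r by (simp add: algebra_simps)
      then have "cmod (\<phi> x - of_real r * \<psi> x) = r * cmod (of_real (1 / r) * \<phi> x - \<psi> x)"
        using r by (simp only: norm_mult norm_of_real abs_of_pos)
      ultimately show "cmod (\<phi> x - of_real r * \<psi> x) < \<epsilon>" using r by (simp add: pos_less_divide_eq mult.commute)
    qed
    ultimately show ?thesis using N(1) by blast
  qed
qed

end

context group_rep
begin

text \<open>A state controls one cyclic vector, but several vectors have to be treated at once and with
  one matrix of positive type. The induction splits every \<open>v t\<close> into its component in the cyclic
  subspace \<open>W\<close> of \<open>v t0\<close> and the orthogonal rest. Both are invariant, so there are no mixed terms,
  and the matrices for the two parts may be added.\<close>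
theorem matrix_approx:
  assumes \<N>: "\<And>N. N \<in> \<N> \<Longrightarrow> N \<lhd> G" and inter: "\<And>N M. N \<in> \<N> \<Longrightarrow> M \<in> \<N> \<Longrightarrow> N \<inter> M \<in> \<N>"
    and ne: "\<N> \<noteq> {}"
    and d: "\<And>\<phi>. \<phi> \<in> states G \<Longrightarrow> \<phi> \<in> adh (\<Union>N\<in>\<N>. states_on G N)"
    and Q: "finite Q" "Q \<subseteq> carrier G" and T: "finite T" and \<epsilon>: "0 < \<epsilon>" and v: "\<And>t. v t \<in> carrier V"
  shows "\<exists>N\<in>\<N>. \<exists>\<Psi>. pd (mkernel G \<Psi>) \<and>
    (\<forall>s t. \<forall>n\<in>N. \<forall>x\<in>carrier G. \<Psi> s t (x \<otimes>\<^bsub>G\<^esub> n) = \<Psi> s t x) \<and>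
    (\<forall>s\<in>T. \<forall>t\<in>T. \<forall>x\<in>Q. cmod (ip V (\<pi> x (v t)) (v s) - \<Psi> s t x) < \<epsilon>)"
  using T \<epsilon> v
proof (induction T arbitrary: v \<epsilon> rule: finite_induct)
  case empty
  obtain N where "N \<in> \<N>" using ne by blast
  then show ?case by (intro bexI[of _ N] exI[of _ "\<lambda>s t x. 0"]) (simp_all add: pd_mkernel_zero)
next
  case (insert t0 T)
  define v0 where "v0 = v t0"
  have v0: "v0 \<in> carrier V" using insert.prems(2) by (simp add: v0_def)
  have vc: "v t \<in> carrier V" for t by (rule insert.prems(2))
  define W where "W = cspan (orb v0)"
  have W: "closed_subspace W V" unfolding W_def by (rule closed_subspace_cspan) (simp add: v0)
  have Winv: "\<pi> g u \<in> W" if "g \<in> carrier G" "u \<in> W" for g u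
    using cspan_invariant[OF v0 that(1)] that(2) unfolding W_def by blast
  have v0W: "v0 \<in> W" using cspan_base[of "orb v0" "\<one>\<^bsub>G\<^esub>"] v0 by (simp add: W_def orb_one)
  have "\<exists>w\<in>W. \<forall>u\<in>W. ip V u (v t \<ominus>\<^bsub>V\<^esub> w) = 0" for t by (rule projection[OF W vc])
  then obtain w where w: "\<And>t. w t \<in> W" "\<And>t u. u \<in> W \<Longrightarrow> ip V u (v t \<ominus>\<^bsub>V\<^esub> w t) = 0" by metis
  define w' where "w' t = v t \<ominus>\<^bsub>V\<^esub> w t" for t
  have wc: "w t \<in> carrier V" for t using w(1) closed_subspaceD(1)[OF W] by blast
  have w'c: "w' t \<in> carrier V" for t using wc vc by (simp add: w'_def)
  have vw: "v t = w t \<oplus>\<^bsub>V\<^esub> w' t" for t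
    unfolding w'_def by (rule ip_eqI) (use wc vc in \<open>auto simp: ip_simps\<close>)
  have orth: "ip V u (w' t) = 0" if "u \<in> W" for u t using w(2)[OF that] by (simp add: w'_def)
  have w't0: "w' t0 = \<zero>\<^bsub>V\<^esub>"
  proof -
    have "w' t0 \<in> W" unfolding w'_def v0_def[symmetric] by (rule closed_subspaceD(5)[OF W v0W w(1)])
    from orth[OF this, of t0] show ?thesis using ip_definite w'c by blast
  qed
  have split: "ip V (\<pi> x (v t)) (v s) = ip V (\<pi> x (w t)) (w s) + ip V (\<pi> x (w' t)) (w' s)"
    if x: "x \<in> carrier G" for x s t
  proof -
    have "ip V (\<pi> x (w t)) (w' s) = 0" by (rule orth[OF Winv[OF x w(1)]])
    moreover have "ip V (\<pi> x (w' t)) (w s) = 0"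
      using orth[OF Winv[of "inv\<^bsub>G\<^esub> x", OF _ w(1)], of s t] x rep_adj[OF x w'c wc]
        ip_cnj[OF w'c rep_closed[of "inv\<^bsub>G\<^esub> x", OF _ wc], of t s] by simp
    ultimately show ?thesis
      unfolding vw[of t] vw[of s] using x wc w'c by (simp add: bddlinD[OF rep_linear] ip_add ip_add2)
  qed
  \<comment> \<open>The components in \<open>W\<close> are close to combinations of the orbit of \<open>v0\<close>, so
    they are governed by the single function \<open>coef v0\<close>.\<close>
  define T' where "T' = insert t0 T"
  have T': "finite T'" using insert.hyps by (simp add: T'_def)
  define B where "B = (\<Sum>t\<in>T'. nrm (w t))"
  have B: "nrm (w t) \<le> B" if "t \<in> T'" for t unfolding B_def by (rule member_le_sum[OF that]) (use T' wc in auto)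
  have B0: "0 \<le> B" unfolding B_def by (rule sum_nonneg) (simp add: wc)
  define e where "e = \<epsilon> / 4"
  have e: "0 < e" using insert.prems(1) by (simp add: e_def)
  define \<eta> where "\<eta> = min 1 (e / (2 * B + 2))"
  have \<eta>: "0 < \<eta>" "\<eta> \<le> 1" using e B0 by (simp_all add: \<eta>_def)
  have \<eta>B: "\<eta> * (2 * B + 1) < e"
  proof -
    have "\<eta> * (2 * B + 1) \<le> e / (2 * B + 2) * (2 * B + 1)"
      using B0 by (intro mult_right_mono) (auto simp: \<eta>_def)
    also have "\<dots> < e" using e B0 by (simp add: pos_divide_less_eq add_nonneg_pos)
    finally show ?thesis .
  qed
  have "\<exists>l. nrm (w t \<ominus>\<^bsub>V\<^esub> comb (orb v0) l) < \<eta>" for t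
    using w(1)[of t] \<eta>(1) unfolding W_def cspan_def by blast
  then obtain l where l: "\<And>t. nrm (w t \<ominus>\<^bsub>V\<^esub> comb (orb v0) (l t)) < \<eta>" by metis
  define c where "c t = comb (orb v0) (l t)" for t
  have cc: "c t \<in> carrier V" for t unfolding c_def by (rule comb_closed) (simp add: v0)
  have err1: "cmod (ip V (\<pi> x (w t)) (w s) - ip V (\<pi> x (c t)) (c s)) < e"
    if x: "x \<in> carrier G" and t: "t \<in> T'" and s: "s \<in> T'" for x s t
  proof -
    have "ip V (\<pi> x (w t)) (w s) - ip V (\<pi> x (c t)) (c s) =
      ip V (\<pi> x (w t \<ominus>\<^bsub>V\<^esub> c t)) (w s) + ip V (\<pi> x (c t)) (w s \<ominus>\<^bsub>V\<^esub> c s)"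
      using x wc cc by (simp add: bddlinD[OF rep_linear] ip_minus)
    also have "cmod \<dots> \<le> cmod (ip V (\<pi> x (w t \<ominus>\<^bsub>V\<^esub> c t)) (w s)) + cmod (ip V (\<pi> x (c t)) (w s \<ominus>\<^bsub>V\<^esub> c s))"
      by (rule norm_triangle_ineq)
    also have "\<dots> \<le> nrm (w t \<ominus>\<^bsub>V\<^esub> c t) * nrm (w s) + nrm (c t) * nrm (w s \<ominus>\<^bsub>V\<^esub> c s)"
      using x wc cc nrm_cs[of "\<pi> x (w t \<ominus>\<^bsub>V\<^esub> c t)" "w s"] nrm_cs[of "\<pi> x (c t)" "w s \<ominus>\<^bsub>V\<^esub> c s"]
      by (simp add: rep_nrm)
    also have "\<dots> \<le> \<eta> * B + (B + 1) * \<eta>"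
    proof (intro add_mono mult_mono)
      have "nrm (c t) \<le> nrm (w t) + nrm (w t \<ominus>\<^bsub>V\<^esub> c t)" using nrm_diff[OF wc cc, of t t] by linarith
      then show "nrm (c t) \<le> B + 1" using l[of t] B[OF t] \<eta>(2) by (simp add: c_def)
    qed (use l B[OF s] \<eta> B0 wc cc in \<open>auto simp: c_def intro: less_imp_le\<close>)
    also have "\<dots> = \<eta> * (2 * B + 1)" by (simp add: algebra_simps)
    finally show ?thesis using \<eta>B by linarith
  qed
  define \<phi> where "\<phi> = coef v0"
  have \<phi>: "positive_type G \<phi>" unfolding \<phi>_def by (rule coef_positive_type[OF v0])
  define Z where "Z = (\<Union>t\<in>T'. snd ` set (l t)) \<inter> carrier G"
  define R where "R = (\<lambda>(x, z, y). inv\<^bsub>G\<^esub> y \<otimes>\<^bsub>G\<^esub> (x \<otimes>\<^bsub>G\<^esub> z)) ` (Q \<times> Z \<times> Z)"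
  have R: "finite R" using Q T' by (simp add: R_def Z_def)
  define A where "A t = (\<Sum>p\<leftarrow>l t. cmod (fst p))" for t
  have A0: "0 \<le> A t" for t unfolding A_def by (rule sum_list_nonneg) auto
  define M where "M = (\<Sum>t\<in>T'. A t)"
  have M: "A t \<le> M" if "t \<in> T'" for t unfolding M_def by (rule member_le_sum[OF that]) (use T' A0 in auto)
  have M0: "0 \<le> M" unfolding M_def by (rule sum_nonneg) (simp add: A0)
  define \<delta> where "\<delta> = e / (M * M + 1)"
  have \<delta>: "0 < \<delta>" using e M0 by (simp add: \<delta>_def add_nonneg_pos)
  have \<delta>M: "\<delta> * (M * M) < e" using e M0 by (simp add: \<delta>_def pos_divide_less_eq add_nonneg_pos)
  obtain N1 \<psi> where N1: "N1 \<in> \<N>" and \<psi>: "positive_type G \<psi>" "\<And>n. n \<in> N1 \<Longrightarrow> \<psi> n = \<psi> \<one>\<^bsub>G\<^esub>" "near R \<delta> \<phi> \<psi>"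
    using cone_approx[OF ne d \<phi> R \<delta>] by blast
  define \<Psi>1 where "\<Psi>1 s t x = bil (\<lambda>z y. kernel_of G \<psi> (shift G x z) y) (l t) (l s)" for s t x
  have err2: "cmod (ip V (\<pi> x (c t)) (c s) - \<Psi>1 s t x) < e" if x: "x \<in> Q" and t: "t \<in> T'" and s: "s \<in> T'" for x s t
  proof -
    have xG: "x \<in> carrier G" using x Q by blast
    have "cmod (ip V (\<pi> x (c t)) (c s) - \<Psi>1 s t x) \<le> \<delta> * (A t * A s)"
      unfolding c_def \<Psi>1_def ip_rep_comb[OF v0 xG] \<phi>_def[symmetric] A_def
    proof (rule bil_kernel_diff)
      fix a b assume ab: "a \<in> snd ` set (l t)" "b \<in> snd ` set (l s)"
      show "cmod (kernel_of G \<phi> (shift G x a) b - kernel_of G \<psi> (shift G x a) b) \<le> \<delta>"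
      proof (cases "a \<in> carrier G \<and> b \<in> carrier G")
        case True
        then have "a \<in> Z" "b \<in> Z" using ab t s by (auto simp: Z_def)
        then have "inv\<^bsub>G\<^esub> b \<otimes>\<^bsub>G\<^esub> (x \<otimes>\<^bsub>G\<^esub> a) \<in> R" using x unfolding R_def by force
        then have "cmod (\<phi> (inv\<^bsub>G\<^esub> b \<otimes>\<^bsub>G\<^esub> (x \<otimes>\<^bsub>G\<^esub> a)) - \<psi> (inv\<^bsub>G\<^esub> b \<otimes>\<^bsub>G\<^esub> (x \<otimes>\<^bsub>G\<^esub> a))) < \<delta>"
          using \<psi>(3) by (simp add: near_def)
        then show ?thesis using True xG by (simp add: kernel_of_def shift_def)
      next
        case False
        then show ?thesis using \<delta> xG by (auto simp: kernel_of_def)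
      qed
    qed (use \<delta> in simp)
    also have "\<dots> \<le> \<delta> * (M * M)"
      using \<delta> M[OF t] M[OF s] A0 M0 by (intro mult_left_mono mult_mono) auto
    finally show ?thesis using \<delta>M by linarith
  qed
  have pd1: "pd (mkernel G \<Psi>1)"
  proof -
    define f where "f i = (if fst i \<in> carrier G then push (shift G (fst i)) (l (snd i)) else [])" for i
    have "mkernel G \<Psi>1 i j = bil (kernel_of G \<psi>) (f i) (f j)" for i j
    proof (cases "fst i \<in> carrier G \<and> fst j \<in> carrier G")
      case True
      have "kernel_of G \<psi> (shift G (inv\<^bsub>G\<^esub> (fst j) \<otimes>\<^bsub>G\<^esub> fst i) z) y =
          kernel_of G \<psi> (shift G (fst i) z) (shift G (fst j) y)" for z y
        using kernel_shift[of "fst j" \<psi> "shift G (inv\<^bsub>G\<^esub> (fst j) \<otimes>\<^bsub>G\<^esub> fst i) z" y] True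
        by (simp add: shift_mult shift_inv)
      then show ?thesis using True by (simp add: mkernel_def \<Psi>1_def f_def bil_push)
    qed (auto simp: mkernel_def f_def)
    then have "mkernel G \<Psi>1 = (\<lambda>i j. bil (kernel_of G \<psi>) (f i) (f j))" by (simp add: fun_eq_iff)
    then show ?thesis using pd_combination[OF pt_pd[OF \<psi>(1)], of f] by simp
  qed
  have inv1: "\<Psi>1 s t (x \<otimes>\<^bsub>G\<^esub> n) = \<Psi>1 s t x" if n: "n \<in> N1" and x: "x \<in> carrier G" for s t n x
  proof -
    interpret N1: normal N1 G by (rule \<N>[OF N1])
    have nG: "n \<in> carrier G" using n N1.subset by blast
    have "kernel_of G \<psi> (shift G (x \<otimes>\<^bsub>G\<^esub> n) z) y = kernel_of G \<psi> (shift G x z) y" for z y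
    proof (cases "z \<in> carrier G \<and> y \<in> carrier G")
      case True
      let ?m = "inv\<^bsub>G\<^esub> z \<otimes>\<^bsub>G\<^esub> n \<otimes>\<^bsub>G\<^esub> z"
      have m: "?m \<in> N1" using N1.inv_op_closed1[of z n] True n by blast
      have "(inv\<^bsub>G\<^esub> y \<otimes>\<^bsub>G\<^esub> (x \<otimes>\<^bsub>G\<^esub> z)) \<otimes>\<^bsub>G\<^esub> ?m = inv\<^bsub>G\<^esub> y \<otimes>\<^bsub>G\<^esub> (x \<otimes>\<^bsub>G\<^esub> n \<otimes>\<^bsub>G\<^esub> z)"
        using True nG x by (intro conj_cancel) auto
      then show ?thesis
        using pt_periodic[OF \<psi>(1) _ \<psi>(2)[OF m], of "inv\<^bsub>G\<^esub> y \<otimes>\<^bsub>G\<^esub> (x \<otimes>\<^bsub>G\<^esub> z)"] True nG x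
        by (simp add: kernel_of_def shift_def)
    qed (use nG x in \<open>auto simp: kernel_of_def\<close>)
    then show ?thesis by (simp add: \<Psi>1_def)
  qed
  \<comment> \<open>The orthogonal components vanish at \<open>t0\<close>; the induction hypothesis covers the others.\<close>
  have e2: "0 < \<epsilon> / 2" using insert.prems(1) by simp
  obtain N2 \<Psi>0 where N2: "N2 \<in> \<N>" and pd0: "pd (mkernel G \<Psi>0)"
    and inv0: "\<And>s t n x. n \<in> N2 \<Longrightarrow> x \<in> carrier G \<Longrightarrow> \<Psi>0 s t (x \<otimes>\<^bsub>G\<^esub> n) = \<Psi>0 s t x"
    and err0: "\<And>s t x. s \<in> T \<Longrightarrow> t \<in> T \<Longrightarrow> x \<in> Q \<Longrightarrow> cmod (ip V (\<pi> x (w' t)) (w' s) - \<Psi>0 s t x) < \<epsilon> / 2"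
    using insert.IH[OF e2, of w', OF w'c] by blast
  define \<Psi>2 where "\<Psi>2 s t x = (if t \<in> T \<and> s \<in> T then \<Psi>0 s t x else 0)" for s t x
  have pd2: "pd (mkernel G \<Psi>2)"
  proof -
    have "mkernel G \<Psi>2 = (\<lambda>i j. if snd i \<in> T \<and> snd j \<in> T then mkernel G \<Psi>0 i j else 0)"
      by (auto simp: mkernel_def \<Psi>2_def fun_eq_iff)
    then show ?thesis using pd_restrict[OF pd0, of "\<lambda>i. snd i \<in> T"] by simp
  qed
  have err3: "cmod (ip V (\<pi> x (w' t)) (w' s) - \<Psi>2 s t x) < \<epsilon> / 2" if x: "x \<in> Q" and t: "t \<in> T'" and s: "s \<in> T'" for x s t
  proof (cases "t \<in> T \<and> s \<in> T")
    case True
    then show ?thesis using err0 x by (simp add: \<Psi>2_def)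
  next
    case False
    then have "t = t0 \<or> s = t0" using t s by (auto simp: T'_def)
    moreover have "x \<in> carrier G" using x Q by blast
    ultimately have "ip V (\<pi> x (w' t)) (w' s) = 0" using w't0 w'c by (auto simp: rep_zero ip_zero)
    moreover have "\<Psi>2 s t x = 0" unfolding \<Psi>2_def using False by (rule if_not_P)
    ultimately show ?thesis using e2 by simp
  qed
  define \<Psi> where "\<Psi> s t x = \<Psi>1 s t x + \<Psi>2 s t x" for s t x
  have "mkernel G \<Psi> = (\<lambda>i j. mkernel G \<Psi>1 i j + mkernel G \<Psi>2 i j)"
  proof (intro ext)
    fix i j show "mkernel G \<Psi> i j = mkernel G \<Psi>1 i j + mkernel G \<Psi>2 i j"
      by (cases "fst i \<in> carrier G \<and> fst j \<in> carrier G") (simp_all only: mkernel_def \<Psi>_def if_True if_False simp_thms add_0)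
  qed
  then have "pd (mkernel G \<Psi>)" using pd_add[OF pd1 pd2] by simp
  moreover have "\<forall>s t. \<forall>n\<in>N1 \<inter> N2. \<forall>x\<in>carrier G. \<Psi> s t (x \<otimes>\<^bsub>G\<^esub> n) = \<Psi> s t x"
  proof (intro allI ballI)
    fix s t n x assume n: "n \<in> N1 \<inter> N2" and x: "x \<in> carrier G"
    have "\<Psi>2 s t (x \<otimes>\<^bsub>G\<^esub> n) = \<Psi>2 s t x"
      by (cases "t \<in> T \<and> s \<in> T") (use n x inv0 in \<open>simp_all only: \<Psi>2_def if_True if_False Int_iff\<close>)
    then show "\<Psi> s t (x \<otimes>\<^bsub>G\<^esub> n) = \<Psi> s t x" using n x inv1 by (simp add: \<Psi>_def)
  qed
  moreover have "cmod (ip V (\<pi> x (v t)) (v s) - \<Psi> s t x) < \<epsilon>" if x: "x \<in> Q" and t: "t \<in> T'" and s: "s \<in> T'" for x s t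
  proof -
    have xG: "x \<in> carrier G" using x Q by blast
    have "ip V (\<pi> x (v t)) (v s) - \<Psi> s t x = (ip V (\<pi> x (w t)) (w s) - ip V (\<pi> x (c t)) (c s)) +
      ((ip V (\<pi> x (c t)) (c s) - \<Psi>1 s t x) + (ip V (\<pi> x (w' t)) (w' s) - \<Psi>2 s t x))"
      by (simp add: split[OF xG] \<Psi>_def)
    also have "cmod \<dots> \<le> cmod (ip V (\<pi> x (w t)) (w s) - ip V (\<pi> x (c t)) (c s)) +
      (cmod (ip V (\<pi> x (c t)) (c s) - \<Psi>1 s t x) + cmod (ip V (\<pi> x (w' t)) (w' s) - \<Psi>2 s t x))"
      by (rule order_trans[OF norm_triangle_ineq add_left_mono[OF norm_triangle_ineq]])
    also have "\<dots> < e + (e + \<epsilon> / 2)"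
      by (intro add_strict_mono err1[OF xG t s] err2[OF x t s] err3[OF x t s])
    finally show ?thesis by (simp add: e_def)
  qed
  ultimately show ?case using inter[OF N1 N2] unfolding T'_def by blast
qed

end

section \<open>Normal subgroups of finite index and property FD\<close>

text \<open>A colouring with finitely many colours that separates the left cosets. The colours are numbers so
  that no type of colours has to be chosen.\<close>
definition fin_index :: "('a, 'b) monoid_scheme \<Rightarrow> 'a set \<Rightarrow> bool"
  where "fin_index G N \<longleftrightarrow> (\<exists>\<kappa> :: 'a \<Rightarrow> nat. finite (\<kappa> ` carrier G) \<and>
    (\<forall>x\<in>carrier G. \<forall>y\<in>carrier G. \<kappa> x = \<kappa> y \<longrightarrow> inv\<^bsub>G\<^esub> x \<otimes>\<^bsub>G\<^esub> y \<in> N))"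

definition fin_normal :: "('a, 'b) monoid_scheme \<Rightarrow> 'a set set"
  where "fin_normal G = {N. N \<lhd> G \<and> fin_index G N}"

lemma fin_indexI:
  assumes "finite (f ` carrier G)"
    "\<And>x y. x \<in> carrier G \<Longrightarrow> y \<in> carrier G \<Longrightarrow> f x = f y \<Longrightarrow> inv\<^bsub>G\<^esub> x \<otimes>\<^bsub>G\<^esub> y \<in> N"
  shows "fin_index G N"
proof -
  obtain i :: "_ \<Rightarrow> nat" where i: "inj_on i (f ` carrier G)"
    using finite_imp_inj_to_nat_seg[OF assms(1)] by blast
  have "finite ((i \<circ> f) ` carrier G)" unfolding image_comp[symmetric] by (rule finite_imageI[OF assms(1)])
  moreover have "inv\<^bsub>G\<^esub> x \<otimes>\<^bsub>G\<^esub> y \<in> N" if "x \<in> carrier G" "y \<in> carrier G" "(i \<circ> f) x = (i \<circ> f) y" for x y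
    using that inj_onD[OF i, of "f x" "f y"] assms(2) by auto
  ultimately show ?thesis unfolding fin_index_def by blast
qed

lemma finite_image_factor:
  assumes "finite (\<kappa> ` A)" "\<And>x y. x \<in> A \<Longrightarrow> y \<in> A \<Longrightarrow> \<kappa> x = \<kappa> y \<Longrightarrow> f x = f y"
  shows "finite (f ` A)"
proof -
  have "f x = (f \<circ> inv_into A \<kappa>) (\<kappa> x)" if "x \<in> A" for x
    using assms(2)[OF that inv_into_into[of "\<kappa> x" \<kappa> A]] that by (simp add: f_inv_into_f)
  then have "f ` A \<subseteq> (f \<circ> inv_into A \<kappa>) ` (\<kappa> ` A)" by blast
  then show ?thesis using assms(1) finite_subset by blast
qed

lemma fin_index_Int: "fin_index G N \<Longrightarrow> fin_index G M \<Longrightarrow> fin_index G (N \<inter> M)"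
proof -
  assume "fin_index G N" "fin_index G M"
  then obtain \<kappa> \<mu> :: "_ \<Rightarrow> nat" where
    k: "finite (\<kappa> ` carrier G)" "\<And>x y. x \<in> carrier G \<Longrightarrow> y \<in> carrier G \<Longrightarrow> \<kappa> x = \<kappa> y \<Longrightarrow> inv\<^bsub>G\<^esub> x \<otimes>\<^bsub>G\<^esub> y \<in> N"
    and m: "finite (\<mu> ` carrier G)" "\<And>x y. x \<in> carrier G \<Longrightarrow> y \<in> carrier G \<Longrightarrow> \<mu> x = \<mu> y \<Longrightarrow> inv\<^bsub>G\<^esub> x \<otimes>\<^bsub>G\<^esub> y \<in> M"
    unfolding fin_index_def by blast
  show ?thesis
  proof (rule fin_indexI)
    show "finite ((\<lambda>x. (\<kappa> x, \<mu> x)) ` carrier G)"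
      by (rule finite_subset[OF _ finite_cartesian_product[OF k(1) m(1)]]) auto
    show "inv\<^bsub>G\<^esub> x \<otimes>\<^bsub>G\<^esub> y \<in> N \<inter> M" if "x \<in> carrier G" "y \<in> carrier G" "(\<kappa> x, \<mu> x) = (\<kappa> y, \<mu> y)" for x y
      using that k(2) m(2) by blast
  qed
qed

context group
begin

lemma fin_normalD: "N \<in> fin_normal G \<Longrightarrow> N \<lhd> G" "N \<in> fin_normal G \<Longrightarrow> fin_index G N"
  by (simp_all add: fin_normal_def)

lemma fin_normal_Int: "N \<in> fin_normal G \<Longrightarrow> M \<in> fin_normal G \<Longrightarrow> N \<inter> M \<in> fin_normal G"
  by (simp add: fin_normal_def normal_subgroup_intersect fin_index_Int)

lemma carrier_fin_normal: "carrier G \<in> fin_normal G"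
proof -
  have "carrier G \<lhd> G" by (rule normal_invI) (auto simp: subgroup_self)
  moreover have "fin_index G (carrier G)" by (rule fin_indexI[of "\<lambda>_. 0 :: nat"]) (auto intro: finite_subset[of _ "{0}"])
  ultimately show ?thesis by (simp add: fin_normal_def)
qed

end

context group_rep
begin

definition rker :: "'a set"
  where "rker = {g \<in> carrier G. \<forall>v\<in>carrier V. \<pi> g v = v}"

lemma rker_normal: "rker \<lhd> G"
proof (rule normal_invI)
  have i: "inv\<^bsub>G\<^esub> g \<in> rker" if "g \<in> rker" for g
  proof -
    have g: "g \<in> carrier G" using that by (simp add: rker_def)
    have "\<pi> (inv\<^bsub>G\<^esub> g) v = v" if v: "v \<in> carrier V" for v
    proof -
      have "\<pi> (inv\<^bsub>G\<^esub> g) (\<pi> g v) = v" using rep_mult[of "inv\<^bsub>G\<^esub> g" g v] g v by (simp add: rep_one)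
      then show ?thesis using \<open>g \<in> rker\<close> v by (simp add: rker_def)
    qed
    then show ?thesis using g by (simp add: rker_def)
  qed
  show "subgroup rker G"
    by (rule subgroupI) (use i in \<open>auto simp: rker_def rep_mult rep_one intro!: exI[of _ "\<one>\<^bsub>G\<^esub>"]\<close>)
  show "x \<otimes>\<^bsub>G\<^esub> h \<otimes>\<^bsub>G\<^esub> inv\<^bsub>G\<^esub> x \<in> rker" if x: "x \<in> carrier G" and h: "h \<in> rker" for x h
  proof -
    have hG: "h \<in> carrier G" using h by (simp add: rker_def)
    have "\<pi> (x \<otimes>\<^bsub>G\<^esub> h \<otimes>\<^bsub>G\<^esub> inv\<^bsub>G\<^esub> x) v = v" if v: "v \<in> carrier V" for v
    proof -
      have "\<pi> (x \<otimes>\<^bsub>G\<^esub> h \<otimes>\<^bsub>G\<^esub> inv\<^bsub>G\<^esub> x) v = \<pi> x (\<pi> h (\<pi> (inv\<^bsub>G\<^esub> x) v))"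
        using x hG v by (simp add: rep_mult)
      also have "\<pi> h (\<pi> (inv\<^bsub>G\<^esub> x) v) = \<pi> (inv\<^bsub>G\<^esub> x) v" using h x v by (simp add: rker_def)
      also have "\<pi> x \<dots> = v" using rep_mult[of x "inv\<^bsub>G\<^esub> x" v] x v by (simp add: rep_one)
      finally show ?thesis .
    qed
    then show ?thesis using x hG by (simp add: rker_def)
  qed
qed

lemma rker_fin_index:
  assumes "finite (\<pi> ` carrier G)"
  shows "fin_index G rker"
proof (rule fin_indexI[OF assms])
  fix x y assume xy: "x \<in> carrier G" "y \<in> carrier G" "\<pi> x = \<pi> y"
  have "\<pi> (inv\<^bsub>G\<^esub> x \<otimes>\<^bsub>G\<^esub> y) v = v" if v: "v \<in> carrier V" for v
  proof -
    have "\<pi> (inv\<^bsub>G\<^esub> x \<otimes>\<^bsub>G\<^esub> y) v = \<pi> (inv\<^bsub>G\<^esub> x) (\<pi> x v)" using xy v by (simp add: rep_mult)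
    also have "\<dots> = v" using rep_mult[of "inv\<^bsub>G\<^esub> x" x v] xy v by (simp add: rep_one)
    finally show ?thesis .
  qed
  then show "inv\<^bsub>G\<^esub> x \<otimes>\<^bsub>G\<^esub> y \<in> rker" using xy by (simp add: rker_def)
qed

lemma rep_eqI:
  assumes "x \<in> carrier G" "y \<in> carrier G" "inv\<^bsub>G\<^esub> x \<otimes>\<^bsub>G\<^esub> y \<in> rker"
  shows "\<pi> x = \<pi> y"
proof
  fix v
  show "\<pi> x v = \<pi> y v"
  proof (cases "v \<in> carrier V")
    case True
    have "\<pi> x (\<pi> (inv\<^bsub>G\<^esub> x \<otimes>\<^bsub>G\<^esub> y) v) = \<pi> y v"
      using rep_mult[of x "inv\<^bsub>G\<^esub> x" "\<pi> y v"] assms True by (simp add: rep_mult rep_one)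
    then show ?thesis using assms(3) True by (simp add: rker_def)
  next
    case False
    then show ?thesis using rep_extensional assms(1,2) by (simp add: extensional_def)
  qed
qed

lemma finite_image_if_trivial:
  assumes "fin_index G N" "N \<subseteq> rker"
  shows "finite (\<pi> ` carrier G)"
proof -
  obtain \<kappa> :: "_ \<Rightarrow> nat" where k: "finite (\<kappa> ` carrier G)"
    "\<And>x y. x \<in> carrier G \<Longrightarrow> y \<in> carrier G \<Longrightarrow> \<kappa> x = \<kappa> y \<Longrightarrow> inv\<^bsub>G\<^esub> x \<otimes>\<^bsub>G\<^esub> y \<in> N"
    using assms(1) unfolding fin_index_def by blast
  show ?thesis
    by (rule finite_image_factor[OF k(1)]) (use rep_eqI k(2) assms(2) in blast)
qed

end

context group
begin

lemma irrep_onD: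
  assumes "irrep_on G N (V, \<pi>)" "N \<subseteq> carrier G"
  shows "(V, \<pi>) \<in> irreps G" "group_rep G V \<pi>" "N \<subseteq> group_rep.rker G V \<pi>"
proof -
  show 1: "(V, \<pi>) \<in> irreps G" using assms by (simp add: irrep_on_def)
  show 2: "group_rep G V \<pi>" by (rule irreps_group_rep[OF group_axioms 1])
  show "N \<subseteq> group_rep.rker G V \<pi>"
    using assms by (auto simp: irrep_on_def group_rep.rker_def[OF 2])
qed

lemma finite_image_dual_eq: "finite_image_dual G = dual_on G (fin_normal G)"
proof (intro equalityI subsetI)
  fix c assume "c \<in> finite_image_dual G"
  then obtain V \<pi> where c: "c = rep_class G (V, \<pi>)" "(V, \<pi>) \<in> irreps G" "finite (\<pi> ` carrier G)"
    by (auto simp: finite_image_dual_def finite_image_def)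
  interpret V: group_rep G V \<pi> by (rule irreps_group_rep[OF group_axioms c(2)])
  have "V.rker \<in> fin_normal G"
    using V.rker_normal V.rker_fin_index[OF c(3)] by (simp add: fin_normal_def)
  moreover have "irrep_on G V.rker (V, \<pi>)" using c(2) by (simp add: irrep_on_def V.rker_def)
  ultimately show "c \<in> dual_on G (fin_normal G)" unfolding dual_on_def c(1) by blast
next
  fix c assume "c \<in> dual_on G (fin_normal G)"
  then obtain \<rho> N where N: "c = rep_class G \<rho>" "N \<in> fin_normal G" "irrep_on G N \<rho>"
    by (auto simp: dual_on_def)
  obtain V \<pi> where \<rho>: "\<rho> = (V, \<pi>)" by fastforce
  have "N \<subseteq> carrier G" using fin_normalD(1)[OF N(2)] normal_imp_subgroup subgroup.subset by blast
  note D = irrep_onD[OF N(3)[unfolded \<rho>] this]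
  have "finite (\<pi> ` carrier G)"
    by (rule group_rep.finite_image_if_trivial[OF D(2) fin_normalD(2)[OF N(2)] D(3)])
  then show "c \<in> finite_image_dual G" unfolding finite_image_dual_def N(1) \<rho>
    using D(1) by (auto simp: finite_image_def)
qed

text \<open>The irreducible representations with finite image are those that are trivial on a normal subgroup of
  finite index, so both density theorems apply.\<close>
theorem property_FD_iff:
  "property_FD G \<longleftrightarrow> (\<forall>\<phi>\<in>states G. \<phi> \<in> adh (\<Union>N\<in>fin_normal G. states_on G N))"
proof
  assume "property_FD G"
  then have d: "fell_topology G closure_of dual_on G (fin_normal G) = unitary_dual G"
    by (simp add: property_FD_def finite_image_dual_eq)
  show "\<forall>\<phi>\<in>states G. \<phi> \<in> adh (\<Union>N\<in>fin_normal G. states_on G N)"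
  proof
    fix \<phi> assume \<phi>: "\<phi> \<in> states G"
    show "\<phi> \<in> adh (\<Union>N\<in>fin_normal G. states_on G N)"
      by (rule states_dense_if_dual_dense[OF fin_normalD(1) fin_normal_Int _ \<phi>]) (simp_all add: d)
  qed
next
  assume s: "\<forall>\<phi>\<in>states G. \<phi> \<in> adh (\<Union>N\<in>fin_normal G. states_on G N)"
  have "c \<in> fell_topology G closure_of dual_on G (fin_normal G)" if "c \<in> unitary_dual G" for c
    by (rule dual_dense_if_states_dense[OF fin_normalD(1) _ that]) (use s in blast)+
  then show "property_FD G"
    unfolding property_FD_def finite_image_dual_eq using fell_closure_subset by blast
qed

text \<open>The quotient by \<open>N\<close>, with its elements renamed to numbers.\<close>
lemma finite_transport:
  assumes N: "N \<in> fin_normal G" and z: "z \<in> carrier G" "y \<in> carrier G" "z \<otimes> inv y \<notin> N"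
  shows "\<exists>(K :: nat monoid) f. group K \<and> finite (carrier K) \<and> f \<in> hom G K \<and> f z \<noteq> f y"
proof -
  interpret N: normal N G by (rule fin_normalD(1)[OF N])
  obtain \<kappa> :: "_ \<Rightarrow> nat" where k: "finite (\<kappa> ` carrier G)"
    "\<And>x y. x \<in> carrier G \<Longrightarrow> y \<in> carrier G \<Longrightarrow> \<kappa> x = \<kappa> y \<Longrightarrow> inv x \<otimes> y \<in> N"
    using fin_normalD(2)[OF N] unfolding fin_index_def by blast
  have "finite ((\<lambda>x. N #> x) ` carrier G)"
  proof (rule finite_image_factor[OF k(1)])
    fix x y assume xy: "x \<in> carrier G" "y \<in> carrier G" "\<kappa> x = \<kappa> y"
    have "x \<otimes> (inv x \<otimes> y) \<otimes> inv x \<in> N" using N.inv_op_closed2[OF xy(1) k(2)[OF xy]] .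
    then have n: "y \<otimes> inv x \<in> N" using xy by (simp add: m_assoc[symmetric])
    have "y = (y \<otimes> inv x) \<otimes> x" using xy by (simp add: m_assoc)
    then have "y \<in> N #> x" using n unfolding r_coset_def by blast
    then show "N #> x = N #> y" using repr_independence xy N.subgroup_axioms by blast
  qed
  moreover have "carrier (G Mod N) = (\<lambda>x. N #> x) ` carrier G" by (auto simp: FactGroup_def RCOSETS_def)
  ultimately have fin: "finite (carrier (G Mod N))" by simp
  obtain i :: "_ \<Rightarrow> nat" where i: "inj_on i (carrier (G Mod N))"
    using finite_imp_inj_to_nat_seg[OF fin] by blast
  interpret Q: group "G Mod N" by (rule N.factorgroup_is_group)
  define K where "K = image_group i (G Mod N)"
  have K: "group K" unfolding K_def by (rule Q.inj_imp_image_group_is_group[OF i])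
  have "i \<in> hom (G Mod N) K"
    using inj_imp_image_group_iso[OF i] unfolding K_def iso_def by blast
  then have "i \<circ> (\<lambda>x. N #> x) \<in> hom G K" by (rule Group.hom_compose[OF N.r_coset_hom_Mod])
  moreover have "finite (carrier K)" unfolding K_def image_group_carrier using fin by simp
  moreover have "(i \<circ> (\<lambda>x. N #> x)) z \<noteq> (i \<circ> (\<lambda>x. N #> x)) y"
  proof
    assume "(i \<circ> (\<lambda>x. N #> x)) z = (i \<circ> (\<lambda>x. N #> x)) y"
    then have "N #> z = N #> y"
      using inj_onD[OF i, of "N #> z" "N #> y"] z by (auto simp: FactGroup_def RCOSETS_def)
    then have "z \<in> N #> y" using rcos_self[OF z(1) N.subgroup_axioms] by simp
    then obtain n where "n \<in> N" "z = n \<otimes> y" unfolding r_coset_def by blast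
    moreover then have "n \<in> carrier G" using N.subset by blast
    ultimately have "z \<otimes> inv y \<in> N" using z(2) by (simp add: m_assoc)
    then show False using z(3) by simp
  qed
  ultimately show ?thesis using K by blast
qed

lemma residually_finite_avoid:
  assumes rf: "residually_finite G" and A: "finite A" "A \<subseteq> carrier G" "\<one> \<notin> A"
  shows "\<exists>L\<in>fin_normal G. L \<inter> A = {}"
  using A
proof (induction A rule: finite_induct)
  case empty
  then show ?case using carrier_fin_normal by blast
next
  case (insert a A)
  then obtain L where L: "L \<in> fin_normal G" "L \<inter> A = {}" by auto
  have a: "a \<in> carrier G" "a \<noteq> \<one>" using insert.prems by auto
  then obtain K :: "nat monoid" and f where K: "group K" "finite (carrier K)" "f \<in> hom G K" "f a \<noteq> f \<one>"
    using rf unfolding residually_finite_def by blast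
  interpret f: group_hom G K f
    using K group_axioms by (simp add: group_hom_def group_hom_axioms_def)
  have "kernel G K f \<in> fin_normal G"
    unfolding fin_normal_def
  proof (intro CollectI conjI)
    show "kernel G K f \<lhd> G" by (rule f.normal_kernel)
    show "fin_index G (kernel G K f)"
    proof (rule fin_indexI[of f])
      show "finite (f ` carrier G)" by (rule finite_subset[OF _ K(2)]) auto
      show "inv x \<otimes> y \<in> kernel G K f" if "x \<in> carrier G" "y \<in> carrier G" "f x = f y" for x y
        using that by (simp add: kernel_def)
    qed
  qed
  then have "L \<inter> kernel G K f \<in> fin_normal G" by (rule fin_normal_Int[OF L(1)])
  moreover have "a \<notin> kernel G K f" using K(4) by (simp add: kernel_def)
  then have "(L \<inter> kernel G K f) \<inter> insert a A = {}" using L(2) by fast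
  ultimately show ?case by (rule bexI[rotated])
qed

end

lemma fin_normal_vimage:
  assumes f: "group_hom A B f" and N: "N \<in> fin_normal B"
  shows "{a \<in> carrier A. f a \<in> N} \<in> fin_normal A"
proof -
  interpret f: group_hom A B f by (rule f)
  interpret N: normal N B by (rule f.H.fin_normalD(1)[OF N])
  obtain \<kappa> :: "_ \<Rightarrow> nat" where k: "finite (\<kappa> ` carrier B)"
    "\<And>x y. x \<in> carrier B \<Longrightarrow> y \<in> carrier B \<Longrightarrow> \<kappa> x = \<kappa> y \<Longrightarrow> inv\<^bsub>B\<^esub> x \<otimes>\<^bsub>B\<^esub> y \<in> N"
    using f.H.fin_normalD(2)[OF N] unfolding fin_index_def by blast
  have "{a \<in> carrier A. f a \<in> N} \<lhd> A"
  proof (rule f.G.normal_invI)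
    show "subgroup {a \<in> carrier A. f a \<in> N} A"
      by (rule f.G.subgroupI) (auto intro!: exI[of _ "\<one>\<^bsub>A\<^esub>"])
    show "x \<otimes>\<^bsub>A\<^esub> a \<otimes>\<^bsub>A\<^esub> inv\<^bsub>A\<^esub> x \<in> {a \<in> carrier A. f a \<in> N}"
      if "x \<in> carrier A" "a \<in> {a \<in> carrier A. f a \<in> N}" for x a
      using that N.inv_op_closed2[of "f x" "f a"] by simp
  qed
  moreover have "fin_index A {a \<in> carrier A. f a \<in> N}"
  proof (rule fin_indexI[of "\<lambda>a. \<kappa> (f a)"])
    show "finite ((\<lambda>a. \<kappa> (f a)) ` carrier A)" by (rule finite_subset[OF _ k(1)]) auto
    show "inv\<^bsub>A\<^esub> x \<otimes>\<^bsub>A\<^esub> y \<in> {a \<in> carrier A. f a \<in> N}"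
      if "x \<in> carrier A" "y \<in> carrier A" "\<kappa> (f x) = \<kappa> (f y)" for x y
      using that k(2)[of "f x" "f y"] by simp
  qed
  ultimately show ?thesis by (simp add: fin_normal_def)
qed

section \<open>Actions by automorphisms and finite orbits\<close>

locale automorphism_action = G: group G + H: group H
  for G :: "('g, 'c) monoid_scheme" and H :: "('h, 'b) monoid_scheme" +
  fixes \<alpha> :: "'g \<Rightarrow> 'h \<Rightarrow> 'h"
  assumes action_hom: "\<alpha> \<in> hom G (AutoGroup H)"
begin

lemma act_auto: "g \<in> carrier G \<Longrightarrow> \<alpha> g \<in> hom H H" "g \<in> carrier G \<Longrightarrow> \<alpha> g \<in> Bij (carrier H)"
  using hom_in_carrier[OF action_hom] by (simp_all add: AutoGroup_def auto_def)

lemma act_closed [simp]: "g \<in> carrier G \<Longrightarrow> h \<in> carrier H \<Longrightarrow> \<alpha> g h \<in> carrier H"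
  using hom_in_carrier[OF act_auto(1)] by simp

lemma act_mult: "g \<in> carrier G \<Longrightarrow> h \<in> carrier H \<Longrightarrow> k \<in> carrier H \<Longrightarrow>
    \<alpha> g (h \<otimes>\<^bsub>H\<^esub> k) = \<alpha> g h \<otimes>\<^bsub>H\<^esub> \<alpha> g k"
  using hom_mult[OF act_auto(1)] by simp

lemma act_comp: "g \<in> carrier G \<Longrightarrow> g' \<in> carrier G \<Longrightarrow> h \<in> carrier H \<Longrightarrow>
    \<alpha> (g \<otimes>\<^bsub>G\<^esub> g') h = \<alpha> g (\<alpha> g' h)"
  using hom_mult[OF action_hom, of g g'] act_auto(2)[of g] act_auto(2)[of g']
  by (simp add: AutoGroup_def BijGroup_def compose_def)

lemma act_outside: "g \<in> carrier G \<Longrightarrow> h \<notin> carrier H \<Longrightarrow> \<alpha> g h = undefined"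
  using act_auto(2)[of g] by (simp add: Bij_def extensional_def)

lemma act_one [simp]: "h \<in> carrier H \<Longrightarrow> \<alpha> \<one>\<^bsub>G\<^esub> h = h"
proof -
  assume h: "h \<in> carrier H"
  have "\<alpha> \<one>\<^bsub>G\<^esub> (\<alpha> \<one>\<^bsub>G\<^esub> h) = \<alpha> \<one>\<^bsub>G\<^esub> h" using act_comp[of "\<one>\<^bsub>G\<^esub>" "\<one>\<^bsub>G\<^esub>" h] h by simp
  moreover have "inj_on (\<alpha> \<one>\<^bsub>G\<^esub>) (carrier H)" using act_auto(2)[of "\<one>\<^bsub>G\<^esub>"] by (simp add: Bij_def bij_betw_def)
  ultimately show ?thesis using h by (simp add: inj_on_eq_iff)
qed

lemma act_group_hom: "g \<in> carrier G \<Longrightarrow> group_hom H H (\<alpha> g)"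
  using act_auto(1) H.group_axioms by (simp add: group_hom_def group_hom_axioms_def)

lemma act_unit [simp]: "g \<in> carrier G \<Longrightarrow> \<alpha> g \<one>\<^bsub>H\<^esub> = \<one>\<^bsub>H\<^esub>"
  by (rule group_hom.hom_one[OF act_group_hom])

lemma act_inv: "g \<in> carrier G \<Longrightarrow> h \<in> carrier H \<Longrightarrow> \<alpha> g (inv\<^bsub>H\<^esub> h) = inv\<^bsub>H\<^esub> \<alpha> g h"
  by (rule group_hom.hom_inv[OF act_group_hom])

lemma act_cancel [simp]: "g \<in> carrier G \<Longrightarrow> h \<in> carrier H \<Longrightarrow> \<alpha> (inv\<^bsub>G\<^esub> g) (\<alpha> g h) = h"
  "g \<in> carrier G \<Longrightarrow> h \<in> carrier H \<Longrightarrow> \<alpha> g (\<alpha> (inv\<^bsub>G\<^esub> g) h) = h"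
  by (simp_all add: act_comp[symmetric])

definition invariant_normal :: "'h set set"
  where "invariant_normal = {M \<in> fin_normal H. \<forall>g\<in>carrier G. \<alpha> g ` M \<subseteq> M}"

text \<open>The elements of \<open>G\<close> that act trivially on \<open>H / M\<close>.\<close>
definition act_trivial :: "'h set \<Rightarrow> 'g set"
  where "act_trivial M = {l \<in> carrier G. \<forall>h\<in>carrier H. inv\<^bsub>H\<^esub> h \<otimes>\<^bsub>H\<^esub> \<alpha> l h \<in> M}"

lemma invariant_normalD:
  assumes "M \<in> invariant_normal"
  shows "M \<in> fin_normal H" "M \<lhd> H" "subgroup M H" "M \<subseteq> carrier H"
    "g \<in> carrier G \<Longrightarrow> m \<in> M \<Longrightarrow> \<alpha> g m \<in> M"
proof -
  show 1: "M \<in> fin_normal H" using assms by (simp add: invariant_normal_def)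
  show 2: "M \<lhd> H" by (rule H.fin_normalD(1)[OF 1])
  show 3: "subgroup M H" by (rule normal_imp_subgroup[OF 2])
  show "M \<subseteq> carrier H" by (rule subgroup.subset[OF 3])
  show "\<alpha> g m \<in> M" if "g \<in> carrier G" "m \<in> M" using assms that by (auto simp: invariant_normal_def)
qed

lemma invariant_normal_Int:
  "M \<in> invariant_normal \<Longrightarrow> M' \<in> invariant_normal \<Longrightarrow> M \<inter> M' \<in> invariant_normal"
  unfolding invariant_normal_def using H.fin_normal_Int by fast

lemma carrier_invariant_normal: "carrier H \<in> invariant_normal"
  by (auto simp: invariant_normal_def H.carrier_fin_normal)

lemma act_trivial_normal:
  assumes M: "M \<in> invariant_normal"
  shows "act_trivial M \<lhd> G"
proof (rule G.normal_invI)
  note D = invariant_normalD[OF M]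
  note cl = subgroup.m_closed[OF D(3)] subgroup.m_inv_closed[OF D(3)] subgroup.one_closed[OF D(3)]
  show "subgroup (act_trivial M) G"
  proof (rule G.subgroupI)
    show "act_trivial M \<subseteq> carrier G" by (auto simp: act_trivial_def)
    have "\<one>\<^bsub>G\<^esub> \<in> act_trivial M" using cl by (simp add: act_trivial_def)
    then show "act_trivial M \<noteq> {}" by blast
    fix l assume l: "l \<in> act_trivial M"
    then have lG: "l \<in> carrier G" by (simp add: act_trivial_def)
    show "inv\<^bsub>G\<^esub> l \<in> act_trivial M"
      unfolding act_trivial_def
    proof (intro CollectI conjI ballI)
      show "inv\<^bsub>G\<^esub> l \<in> carrier G" using lG by simp
      fix h assume h: "h \<in> carrier H"
      define k where "k = \<alpha> (inv\<^bsub>G\<^esub> l) h"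
      have k: "k \<in> carrier H" "\<alpha> l k = h" using lG h by (simp_all add: k_def)
      have "inv\<^bsub>H\<^esub> k \<otimes>\<^bsub>H\<^esub> \<alpha> l k \<in> M" using l k(1) by (simp add: act_trivial_def)
      then have "inv\<^bsub>H\<^esub> (inv\<^bsub>H\<^esub> k \<otimes>\<^bsub>H\<^esub> h) \<in> M" using k(2) cl by simp
      then show "inv\<^bsub>H\<^esub> h \<otimes>\<^bsub>H\<^esub> \<alpha> (inv\<^bsub>G\<^esub> l) h \<in> M" using h k(1) by (simp add: H.inv_mult_group k_def[symmetric])
    qed
    fix l' assume l': "l' \<in> act_trivial M"
    then have l'G: "l' \<in> carrier G" by (simp add: act_trivial_def)
    show "l \<otimes>\<^bsub>G\<^esub> l' \<in> act_trivial M"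
      unfolding act_trivial_def
    proof (intro CollectI conjI ballI)
      show "l \<otimes>\<^bsub>G\<^esub> l' \<in> carrier G" using lG l'G by simp
      fix h assume h: "h \<in> carrier H"
      define k where "k = \<alpha> l' h"
      have k: "k \<in> carrier H" using l'G h by (simp add: k_def)
      have "inv\<^bsub>H\<^esub> h \<otimes>\<^bsub>H\<^esub> k \<in> M" "inv\<^bsub>H\<^esub> k \<otimes>\<^bsub>H\<^esub> \<alpha> l k \<in> M"
        using l l' h k by (simp_all add: act_trivial_def k_def)
      then have "(inv\<^bsub>H\<^esub> h \<otimes>\<^bsub>H\<^esub> k) \<otimes>\<^bsub>H\<^esub> (inv\<^bsub>H\<^esub> k \<otimes>\<^bsub>H\<^esub> \<alpha> l k) \<in> M" by (rule cl)
      moreover have "k \<otimes>\<^bsub>H\<^esub> (inv\<^bsub>H\<^esub> k \<otimes>\<^bsub>H\<^esub> \<alpha> l k) = \<alpha> l k"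
        using lG k by (simp add: H.m_assoc[symmetric])
      ultimately show "inv\<^bsub>H\<^esub> h \<otimes>\<^bsub>H\<^esub> \<alpha> (l \<otimes>\<^bsub>G\<^esub> l') h \<in> M"
        using h k lG l'G by (simp add: H.m_assoc act_comp k_def[symmetric])
    qed
  qed
  fix x l assume x: "x \<in> carrier G" and l: "l \<in> act_trivial M"
  then have lG: "l \<in> carrier G" by (simp add: act_trivial_def)
  show "x \<otimes>\<^bsub>G\<^esub> l \<otimes>\<^bsub>G\<^esub> inv\<^bsub>G\<^esub> x \<in> act_trivial M"
    unfolding act_trivial_def
  proof (intro CollectI conjI ballI)
    show "x \<otimes>\<^bsub>G\<^esub> l \<otimes>\<^bsub>G\<^esub> inv\<^bsub>G\<^esub> x \<in> carrier G" using x lG by simp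
    fix h assume h: "h \<in> carrier H"
    define k where "k = \<alpha> (inv\<^bsub>G\<^esub> x) h"
    have k: "k \<in> carrier H" "h = \<alpha> x k" using x h by (simp_all add: k_def)
    have "inv\<^bsub>H\<^esub> k \<otimes>\<^bsub>H\<^esub> \<alpha> l k \<in> M" using l k(1) by (simp add: act_trivial_def)
    then have "\<alpha> x (inv\<^bsub>H\<^esub> k \<otimes>\<^bsub>H\<^esub> \<alpha> l k) \<in> M" by (rule D(5)[OF x])
    moreover have "\<alpha> (x \<otimes>\<^bsub>G\<^esub> l \<otimes>\<^bsub>G\<^esub> inv\<^bsub>G\<^esub> x) h = \<alpha> x (\<alpha> l k)"
      using x lG h by (simp add: act_comp k_def)
    ultimately show "inv\<^bsub>H\<^esub> h \<otimes>\<^bsub>H\<^esub> \<alpha> (x \<otimes>\<^bsub>G\<^esub> l \<otimes>\<^bsub>G\<^esub> inv\<^bsub>G\<^esub> x) h \<in> M"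
      using x lG k(1) by (simp add: act_mult act_inv k(2)[symmetric])
  qed
qed

text \<open>The action of \<open>g\<close> on \<open>H / M\<close> is determined by the cosets of \<open>\<alpha> g (r n)\<close> for the finitely many coset
  representatives \<open>r n\<close>.\<close>
lemma act_trivial_fin_index:
  assumes M: "M \<in> invariant_normal"
  shows "fin_index G (act_trivial M)"
proof -
  note D = invariant_normalD[OF M]
  obtain \<kappa> :: "'h \<Rightarrow> nat" where k: "finite (\<kappa> ` carrier H)"
    "\<And>x y. x \<in> carrier H \<Longrightarrow> y \<in> carrier H \<Longrightarrow> \<kappa> x = \<kappa> y \<Longrightarrow> inv\<^bsub>H\<^esub> x \<otimes>\<^bsub>H\<^esub> y \<in> M"
    using H.fin_normalD(2)[OF D(1)] unfolding fin_index_def by blast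
  define r where "r n = inv_into (carrier H) \<kappa> n" for n
  define f where "f g = (\<lambda>n\<in>\<kappa> ` carrier H. \<kappa> (\<alpha> g (r n)))" for g
  have rc: "r (\<kappa> h) \<in> carrier H" "\<kappa> (r (\<kappa> h)) = \<kappa> h" if "h \<in> carrier H" for h
    using that by (simp_all add: r_def inv_into_into f_inv_into_f)
  show ?thesis
  proof (rule fin_indexI[of f])
    have "f ` carrier G \<subseteq> \<kappa> ` carrier H \<rightarrow>\<^sub>E \<kappa> ` carrier H" using rc(1) by (auto simp: f_def)
    then show "finite (f ` carrier G)" using finite_PiE[of "\<kappa> ` carrier H" "\<lambda>_. \<kappa> ` carrier H"] k(1) finite_subset by blast
    fix g g' assume g: "g \<in> carrier G" "g' \<in> carrier G" and fg: "f g = f g'"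
    show "inv\<^bsub>G\<^esub> g \<otimes>\<^bsub>G\<^esub> g' \<in> act_trivial M"
      unfolding act_trivial_def
    proof (intro CollectI conjI ballI)
      show "inv\<^bsub>G\<^esub> g \<otimes>\<^bsub>G\<^esub> g' \<in> carrier G" using g by simp
      fix h assume h: "h \<in> carrier H"
      define q where "q = r (\<kappa> h)"
      define m where "m = inv\<^bsub>H\<^esub> q \<otimes>\<^bsub>H\<^esub> h"
      have q: "q \<in> carrier H" "\<kappa> q = \<kappa> h" using rc[OF h] by (simp_all add: q_def)
      have m: "m \<in> M" unfolding m_def by (rule k(2)[OF q(1) h q(2)])
      have mH: "m \<in> carrier H" using m D(4) by blast
      have hq: "h = q \<otimes>\<^bsub>H\<^esub> m" using q(1) h by (simp add: m_def H.m_assoc[symmetric])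
      have "\<kappa> (\<alpha> g q) = \<kappa> (\<alpha> g' q)" using fun_cong[OF fg, of "\<kappa> h"] h by (simp add: f_def q_def)
      then have a: "inv\<^bsub>H\<^esub> (\<alpha> g q) \<otimes>\<^bsub>H\<^esub> \<alpha> g' q \<in> M" using g q(1) k(2) by simp
      have "inv\<^bsub>H\<^esub> (\<alpha> g m) \<otimes>\<^bsub>H\<^esub> (inv\<^bsub>H\<^esub> (\<alpha> g q) \<otimes>\<^bsub>H\<^esub> \<alpha> g' q) \<otimes>\<^bsub>H\<^esub> \<alpha> g' m \<in> M"
        using subgroup.m_closed[OF D(3) subgroup.m_closed[OF D(3)
          subgroup.m_inv_closed[OF D(3) D(5)[OF g(1) m]] a] D(5)[OF g(2) m]] .
      moreover have "inv\<^bsub>H\<^esub> (\<alpha> g h) \<otimes>\<^bsub>H\<^esub> \<alpha> g' h =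
          inv\<^bsub>H\<^esub> (\<alpha> g m) \<otimes>\<^bsub>H\<^esub> (inv\<^bsub>H\<^esub> (\<alpha> g q) \<otimes>\<^bsub>H\<^esub> \<alpha> g' q) \<otimes>\<^bsub>H\<^esub> \<alpha> g' m"
        unfolding hq using g q(1) mH by (simp add: act_mult H.inv_mult_group H.m_assoc)
      ultimately have "\<alpha> (inv\<^bsub>G\<^esub> g) (inv\<^bsub>H\<^esub> (\<alpha> g h) \<otimes>\<^bsub>H\<^esub> \<alpha> g' h) \<in> M" using D(5) g by simp
      then show "inv\<^bsub>H\<^esub> h \<otimes>\<^bsub>H\<^esub> \<alpha> (inv\<^bsub>G\<^esub> g \<otimes>\<^bsub>G\<^esub> g') h \<in> M"
        using g h by (simp add: act_mult act_inv act_comp)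
    qed
  qed
qed

lemma act_trivial_fin_normal: "M \<in> invariant_normal \<Longrightarrow> act_trivial M \<in> fin_normal G"
  by (simp add: fin_normal_def act_trivial_normal act_trivial_fin_index)

definition rep_kernel :: "('h, 'h \<Rightarrow> complex) rep \<Rightarrow> 'h set"
  where "rep_kernel \<rho> = {h \<in> carrier H. \<forall>v\<in>carrier (fst \<rho>). snd \<rho> h v = v}"

lemma rep_kernel_class:
  assumes "\<sigma> \<in> rep_class H \<rho>"
  shows "rep_kernel \<sigma> = rep_kernel \<rho>"
proof -
  obtain V \<pi> W \<tau> where \<rho>: "\<rho> = (V, \<pi>)" and \<sigma>: "\<sigma> = (W, \<tau>)" by fastforce
  have "unitarily_equivalent H (V, \<pi>) (W, \<tau>)" and ir: "(V, \<pi>) \<in> irreps H"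
    using assms unfolding rep_class_def equiv_rel_def \<rho> \<sigma> by blast+
  then obtain U where U: "U \<in> unitary_maps V W" "\<And>h v. h \<in> carrier H \<Longrightarrow> v \<in> carrier V \<Longrightarrow> U (\<pi> h v) = \<tau> h (U v)"
    unfolding unitarily_equivalent_def by blast
  interpret V: group_rep H V \<pi> by (rule irreps_group_rep[OF H.group_axioms ir])
  have b: "inj_on U (carrier V)" "carrier W = U ` carrier V"
    using U(1) by (simp_all add: unitary_maps_def bij_betw_def)
  have "(\<forall>w\<in>carrier W. \<tau> h w = w) \<longleftrightarrow> (\<forall>v\<in>carrier V. \<pi> h v = v)" if h: "h \<in> carrier H" for h
  proof -
    have "(\<forall>w\<in>carrier W. \<tau> h w = w) \<longleftrightarrow> (\<forall>v\<in>carrier V. U (\<pi> h v) = U v)"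
      unfolding b(2) using U(2)[OF h] by auto
    also have "\<dots> \<longleftrightarrow> (\<forall>v\<in>carrier V. \<pi> h v = v)"
      by (rule ball_cong) (use h in \<open>simp_all add: inj_on_eq_iff[OF b(1)]\<close>)
    finally show ?thesis .
  qed
  then show ?thesis unfolding rep_kernel_def \<rho> \<sigma> by auto
qed

lemma rep_action_irreps:
  assumes "\<rho> \<in> irreps H" and g: "g \<in> carrier G"
  shows "rep_action G \<alpha> g \<rho> \<in> irreps H"
proof -
  obtain V \<pi> where \<rho>: "\<rho> = (V, \<pi>)" by fastforce
  have ir: "irreducible_rep H (V, \<pi>)" using assms(1) by (simp add: irreps_def \<rho>)
  then have h: "hilbert_space V" "\<pi> \<in> hom H (unitary_group V)" "carrier V \<noteq> {\<zero>\<^bsub>V\<^esub>}"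
    by (simp_all add: irreducible_rep_def unitary_rep_def)
  have "\<pi> \<circ> \<alpha> (inv\<^bsub>G\<^esub> g) \<in> hom H (unitary_group V)"
    by (rule Group.hom_compose[OF act_auto(1) h(2)]) (simp add: g)
  moreover have "W = {\<zero>\<^bsub>V\<^esub>} \<or> W = carrier V"
    if W: "closed_subspace W V" and inv: "\<forall>h\<in>carrier H. \<pi> (\<alpha> (inv\<^bsub>G\<^esub> g) h) ` W \<subseteq> W" for W
  proof -
    have "\<forall>h\<in>carrier H. \<pi> h ` W \<subseteq> W"
    proof
      fix k assume k: "k \<in> carrier H"
      show "\<pi> k ` W \<subseteq> W" using bspec[OF inv, of "\<alpha> g k"] g k by simp
    qed
    then show ?thesis using ir W unfolding irreducible_rep_def by blast
  qed
  ultimately show ?thesis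
    unfolding irreps_def irreducible_rep_def unitary_rep_def rep_action_def \<rho>
    using h by (simp add: comp_def)
qed

lemma rep_kernel_action:
  "g \<in> carrier G \<Longrightarrow> rep_kernel (rep_action G \<alpha> g \<rho>) = {h \<in> carrier H. \<alpha> (inv\<^bsub>G\<^esub> g) h \<in> rep_kernel \<rho>}"
  by (cases \<rho>) (auto simp: rep_kernel_def rep_action_def)

text \<open>Equality holds as functions, also outside of \<open>H\<close>, because all \<open>\<alpha> g\<close> take the same default value
  there. So no equivalence of representations has to be invoked.\<close>
lemma rep_action_eqI:
  assumes M: "M \<in> invariant_normal" and \<rho>: "\<rho> \<in> irreps H" "M \<subseteq> rep_kernel \<rho>"
    and g: "g \<in> carrier G" "g' \<in> carrier G" "inv\<^bsub>G\<^esub> g \<otimes>\<^bsub>G\<^esub> g' \<in> act_trivial M"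
  shows "rep_action G \<alpha> g \<rho> = rep_action G \<alpha> g' \<rho>"
proof -
  obtain V \<pi> where r: "\<rho> = (V, \<pi>)" by fastforce
  interpret V: group_rep H V \<pi> by (rule irreps_group_rep[OF H.group_axioms]) (use \<rho>(1) r in simp)
  have ker: "M \<subseteq> V.rker" using \<rho>(2) by (simp add: rep_kernel_def V.rker_def r)
  have "\<pi> (\<alpha> (inv\<^bsub>G\<^esub> g) h) = \<pi> (\<alpha> (inv\<^bsub>G\<^esub> g') h)" for h
  proof (cases "h \<in> carrier H")
    case True
    define k where "k = \<alpha> (inv\<^bsub>G\<^esub> g') h"
    have k: "k \<in> carrier H" using True g by (simp add: k_def)
    have "inv\<^bsub>G\<^esub> g = (inv\<^bsub>G\<^esub> g \<otimes>\<^bsub>G\<^esub> g') \<otimes>\<^bsub>G\<^esub> inv\<^bsub>G\<^esub> g'" using g by (simp add: G.m_assoc)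
    then have a: "\<alpha> (inv\<^bsub>G\<^esub> g) h = \<alpha> (inv\<^bsub>G\<^esub> g \<otimes>\<^bsub>G\<^esub> g') k"
      using act_comp[of "inv\<^bsub>G\<^esub> g \<otimes>\<^bsub>G\<^esub> g'" "inv\<^bsub>G\<^esub> g'" h] g True by (simp add: k_def)
    have "inv\<^bsub>H\<^esub> k \<otimes>\<^bsub>H\<^esub> \<alpha> (inv\<^bsub>G\<^esub> g \<otimes>\<^bsub>G\<^esub> g') k \<in> V.rker"
      using g(3) k ker by (auto simp: act_trivial_def)
    then have "\<pi> k = \<pi> (\<alpha> (inv\<^bsub>G\<^esub> g \<otimes>\<^bsub>G\<^esub> g') k)" by (rule V.rep_eqI[OF k, rotated]) (use g k in simp)
    then show ?thesis by (simp only: a k_def)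
  qed (use g in \<open>simp add: act_outside\<close>)
  then show ?thesis by (simp add: rep_action_def r)
qed

lemma fin_normal_Inter: "finite A \<Longrightarrow> A \<noteq> {} \<Longrightarrow> A \<subseteq> fin_normal H \<Longrightarrow> \<Inter>A \<in> fin_normal H"
  by (induction A rule: finite_ne_induct) (simp_all add: H.fin_normal_Int)

text \<open>The kernel of a translate \<open>g\<cdot>\<rho>\<close> depends on its class only. If the orbit is finite, there are
  finitely many such kernels; their intersection is invariant and of finite index, and \<open>\<rho>\<close> is
  trivial on it. Conversely, if \<open>\<rho>\<close> is trivial on an invariant \<open>M\<close> of finite index, \<open>g\<cdot>\<rho>\<close> depends only on
  \<open>g\<close> modulo \<open>act_trivial M\<close>.\<close>
theorem finite_orbit_dual_eq:
  "{d \<in> finite_image_dual H. finite (orbit G (dual_action G H \<alpha>) d)} = dual_on H invariant_normal"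
proof (intro equalityI subsetI)
  have orb: "orbit G (dual_action G H \<alpha>) d = (\<lambda>g. dual_action G H \<alpha> g d) ` carrier G" for d
    by (auto simp: orbit_def)
  {
    fix d assume "d \<in> {d \<in> finite_image_dual H. finite (orbit G (dual_action G H \<alpha>) d)}"
    then have "d \<in> finite_image_dual H" and fin: "finite ((\<lambda>g. dual_action G H \<alpha> g d) ` carrier G)"
      by (simp_all add: orb)
    then obtain \<rho> where \<rho>: "d = rep_class H \<rho>" "\<rho> \<in> irreps H" "finite_image H \<rho>"
      by (auto simp: finite_image_dual_def)
    define K where "K g = rep_kernel (rep_action G \<alpha> g \<rho>)" for g
    have "finite (K ` carrier G)"
    proof (rule finite_image_factor[OF fin])
      fix g g' assume g: "g \<in> carrier G" "g' \<in> carrier G" and eq: "dual_action G H \<alpha> g d = dual_action G H \<alpha> g' d"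
      have "rep_action G \<alpha> g \<rho> \<in> dual_action G H \<alpha> g d"
        unfolding dual_action_def \<rho>(1)
        by (rule UN_I[of \<rho>]) (rule rep_class_self \<rho>(2) rep_action_irreps g(1))+
      then have "rep_action G \<alpha> g \<rho> \<in> dual_action G H \<alpha> g' d" using eq by simp
      then obtain \<rho>' where \<rho>': "\<rho>' \<in> rep_class H \<rho>" "rep_action G \<alpha> g \<rho> \<in> rep_class H (rep_action G \<alpha> g' \<rho>')"
        unfolding dual_action_def \<rho>(1) by (rule UN_E)
      have "K g = rep_kernel (rep_action G \<alpha> g' \<rho>')" unfolding K_def by (rule rep_kernel_class[OF \<rho>'(2)])
      then show "K g = K g'" unfolding K_def
        by (simp only: rep_kernel_action[OF g(2)] rep_kernel_class[OF \<rho>'(1)])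
    qed
    moreover have K0: "rep_kernel \<rho> \<in> fin_normal H"
    proof -
      obtain V \<pi> where r: "\<rho> = (V, \<pi>)" by fastforce
      interpret V: group_rep H V \<pi> by (rule irreps_group_rep[OF H.group_axioms]) (use \<rho>(2) r in simp)
      have "finite (\<pi> ` carrier H)" using \<rho>(3) by (simp add: finite_image_def r)
      then have "V.rker \<in> fin_normal H" using V.rker_normal V.rker_fin_index by (simp add: fin_normal_def)
      then show ?thesis by (simp add: rep_kernel_def V.rker_def r)
    qed
    have Kg: "K g = {h \<in> carrier H. \<alpha> (inv\<^bsub>G\<^esub> g) h \<in> rep_kernel \<rho>}" if "g \<in> carrier G" for g
      unfolding K_def by (rule rep_kernel_action[OF that])
    have "K ` carrier G \<subseteq> fin_normal H"
      using fin_normal_vimage[OF act_group_hom K0] by (auto simp: Kg)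
    ultimately have M: "\<Inter>(K ` carrier G) \<in> fin_normal H"
      using fin_normal_Inter[of "K ` carrier G"] G.one_closed by blast
    have "\<alpha> x h \<in> K g" if x: "x \<in> carrier G" and h: "h \<in> \<Inter>(K ` carrier G)" and g: "g \<in> carrier G" for x h g
    proof -
      have "h \<in> K (inv\<^bsub>G\<^esub> x \<otimes>\<^bsub>G\<^esub> g)" using h x g by blast
      then have "h \<in> carrier H" "\<alpha> (inv\<^bsub>G\<^esub> (inv\<^bsub>G\<^esub> x \<otimes>\<^bsub>G\<^esub> g)) h \<in> rep_kernel \<rho>"
        using x g by (simp_all add: Kg)
      then show ?thesis using x g by (simp add: Kg G.inv_mult_group act_comp)
    qed
    then have "\<Inter>(K ` carrier G) \<in> invariant_normal" using M by (auto simp: invariant_normal_def)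
    moreover have "irrep_on H (\<Inter>(K ` carrier G)) \<rho>"
    proof -
      have "\<Inter>(K ` carrier G) \<subseteq> K \<one>\<^bsub>G\<^esub>" by (rule INF_lower) simp
      also have "K \<one>\<^bsub>G\<^esub> \<subseteq> rep_kernel \<rho>" by (auto simp: Kg)
      finally show ?thesis using \<rho>(2) by (cases \<rho>) (auto simp: irrep_on_def rep_kernel_def)
    qed
    ultimately show "d \<in> dual_on H invariant_normal" unfolding dual_on_def \<rho>(1) by blast
  }
  fix d assume d: "d \<in> dual_on H invariant_normal"
  then obtain \<rho> M where \<rho>: "d = rep_class H \<rho>" "irrep_on H M \<rho>" and M: "M \<in> invariant_normal"
    unfolding dual_on_def by blast
  have ir: "\<rho> \<in> irreps H" "M \<subseteq> rep_kernel \<rho>"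
    using \<rho>(2) invariant_normalD(4)[OF M] by (cases \<rho>; auto simp: irrep_on_def rep_kernel_def)+
  obtain \<kappa> :: "'g \<Rightarrow> nat" where k: "finite (\<kappa> ` carrier G)"
    "\<And>x y. x \<in> carrier G \<Longrightarrow> y \<in> carrier G \<Longrightarrow> \<kappa> x = \<kappa> y \<Longrightarrow> inv\<^bsub>G\<^esub> x \<otimes>\<^bsub>G\<^esub> y \<in> act_trivial M"
    using act_trivial_fin_index[OF M] unfolding fin_index_def by blast
  have "finite ((\<lambda>g. dual_action G H \<alpha> g d) ` carrier G)"
  proof (rule finite_image_factor[OF k(1)])
    fix g g' assume g: "g \<in> carrier G" "g' \<in> carrier G" "\<kappa> g = \<kappa> g'"
    have "rep_action G \<alpha> g \<sigma> = rep_action G \<alpha> g' \<sigma>" if "\<sigma> \<in> d" for \<sigma>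
    proof (rule rep_action_eqI[OF M _ _ g(1,2) k(2)[OF g]])
      show "\<sigma> \<in> irreps H" using that by (auto simp: \<rho>(1) rep_class_def equiv_rel_def)
      show "M \<subseteq> rep_kernel \<sigma>" using ir(2) rep_kernel_class[of \<sigma> \<rho>] that by (simp add: \<rho>(1))
    qed
    then show "dual_action G H \<alpha> g d = dual_action G H \<alpha> g' d" by (simp add: dual_action_def)
  qed
  moreover have "d \<in> finite_image_dual H"
    using d unfolding H.finite_image_dual_eq dual_on_def invariant_normal_def by blast
  ultimately show "d \<in> {d \<in> finite_image_dual H. finite (orbit G (dual_action G H \<alpha>) d)}" by (simp add: orb)
qed

end

section \<open>From the semidirect product to the factors\<close>

context automorphism_action
begin

abbreviation S :: "('h \<times> 'g) monoid"
  where "S \<equiv> semidirect_product H G \<alpha>"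

lemma S_simps [simp]:
  "carrier S = carrier H \<times> carrier G"
  "(h, g) \<otimes>\<^bsub>S\<^esub> (h', g') = (h \<otimes>\<^bsub>H\<^esub> \<alpha> g h', g \<otimes>\<^bsub>G\<^esub> g')"
  "\<one>\<^bsub>S\<^esub> = (\<one>\<^bsub>H\<^esub>, \<one>\<^bsub>G\<^esub>)"
  by (simp_all add: semidirect_product_def)

lemma S_group: "group S"
proof (rule groupI)
  fix x assume "x \<in> carrier S"
  then obtain h g where x: "x = (h, g)" "h \<in> carrier H" "g \<in> carrier G" by auto
  show "\<exists>y\<in>carrier S. y \<otimes>\<^bsub>S\<^esub> x = \<one>\<^bsub>S\<^esub>"
    by (rule bexI[of _ "(\<alpha> (inv\<^bsub>G\<^esub> g) (inv\<^bsub>H\<^esub> h), inv\<^bsub>G\<^esub> g)"]) (simp_all add: x act_inv)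
qed (auto simp: act_mult act_comp H.m_assoc G.m_assoc)

sublocale S: group S
  by (rule S_group)

lemma S_inv:
  assumes "h \<in> carrier H" "g \<in> carrier G"
  shows "inv\<^bsub>S\<^esub> (h, g) = (\<alpha> (inv\<^bsub>G\<^esub> g) (inv\<^bsub>H\<^esub> h), inv\<^bsub>G\<^esub> g)"
  by (rule S.inv_equality) (use assms in \<open>simp_all add: act_inv\<close>)

lemma S_div:
  assumes "h \<in> carrier H" "g \<in> carrier G" "h' \<in> carrier H" "g' \<in> carrier G"
  shows "inv\<^bsub>S\<^esub> (h', g') \<otimes>\<^bsub>S\<^esub> (h, g) =
    (\<alpha> (inv\<^bsub>G\<^esub> g') (inv\<^bsub>H\<^esub> h' \<otimes>\<^bsub>H\<^esub> h), inv\<^bsub>G\<^esub> g' \<otimes>\<^bsub>G\<^esub> g)"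
  using assms by (simp add: S_inv act_mult)

lemma incl_H: "group_hom H S (\<lambda>h. (h, \<one>\<^bsub>G\<^esub>))"
  by (auto simp: group_hom_def group_hom_axioms_def H.group_axioms S_group intro!: homI)

lemma incl_G: "group_hom G S (\<lambda>g. (\<one>\<^bsub>H\<^esub>, g))"
  by (auto simp: group_hom_def group_hom_axioms_def G.group_axioms S_group intro!: homI)

text \<open>The kernel of the extension vanishes unless the components in \<open>G\<close> agree, and on each of these
  blocks it is the kernel of \<open>\<phi>\<close> transported by an automorphism.\<close>
lemma state_extension:
  assumes \<phi>: "\<phi> \<in> states H"
  shows "(\<lambda>x. if snd x = \<one>\<^bsub>G\<^esub> then \<phi> (fst x) else 0) \<in> states S" (is "?\<psi> \<in> _")
proof -
  have pt: "positive_type H \<phi>" and one: "\<phi> \<one>\<^bsub>H\<^esub> = 1" using \<phi> by (simp_all add: states_def)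
  define F where "F x = \<alpha> (inv\<^bsub>G\<^esub> (snd x)) (fst x)" for x
  have "kernel_of S ?\<psi> x y = (if x \<in> carrier S \<and> y \<in> carrier S
      then if snd x = snd y then kernel_of H \<phi> (F x) (F y) else 0 else 0)" for x y
  proof (cases "x \<in> carrier S \<and> y \<in> carrier S")
    case True
    obtain h g h' g' where xy: "x = (h, g)" "y = (h', g')" by fastforce
    have c: "h \<in> carrier H" "g \<in> carrier G" "h' \<in> carrier H" "g' \<in> carrier G" using True by (simp_all add: xy)
    have "inv\<^bsub>G\<^esub> g' \<otimes>\<^bsub>G\<^esub> g = \<one>\<^bsub>G\<^esub> \<longleftrightarrow> g = g'"
      using c by (metis G.inv_equality G.inv_inv G.inv_closed G.l_inv)
    then show ?thesis using c
      by (auto simp: kernel_of_def xy S_div F_def act_mult act_inv)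
  qed (auto simp: kernel_of_def)
  then have "kernel_of S ?\<psi> = (\<lambda>x y. if x \<in> carrier S \<and> y \<in> carrier S
      then if snd x = snd y then kernel_of H \<phi> (F x) (F y) else 0 else 0)" by (intro ext)
  moreover have "pd \<dots>"
    by (intro pd_restrict pd_block pd_pullback[of "kernel_of H \<phi>" F] H.pt_pd[OF pt])
  ultimately have "pd (kernel_of S ?\<psi>)" by (simp only:)
  moreover have "?\<psi> x = 0" if "x \<notin> carrier S" for x
    using that H.pt_outside[OF pt, of "fst x"] by (cases x) auto
  ultimately show ?thesis using one H.pt_outside[OF pt] by (simp add: states_def positive_type_def)
qed

lemma state_restriction:
  assumes \<psi>: "\<psi> \<in> states_on S N"
  shows "(\<lambda>h. \<psi> (h, \<one>\<^bsub>G\<^esub>)) \<in> states_on H {h \<in> carrier H. (h, \<one>\<^bsub>G\<^esub>) \<in> N}"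
proof -
  have pt: "positive_type S \<psi>" and one: "\<psi> (\<one>\<^bsub>H\<^esub>, \<one>\<^bsub>G\<^esub>) = 1" and N: "\<And>n. n \<in> N \<Longrightarrow> \<psi> n = 1"
    using \<psi> by (simp_all add: states_on_def states_def)
  have "kernel_of H (\<lambda>h. \<psi> (h, \<one>\<^bsub>G\<^esub>)) = (\<lambda>x y. kernel_of S \<psi> (x, \<one>\<^bsub>G\<^esub>) (y, \<one>\<^bsub>G\<^esub>))"
    by (intro ext) (simp add: kernel_of_def S_div)
  then have "pd (kernel_of H (\<lambda>h. \<psi> (h, \<one>\<^bsub>G\<^esub>)))"
    using pd_pullback[OF S.pt_pd[OF pt], of "\<lambda>x. (x, \<one>\<^bsub>G\<^esub>)"] by simp
  moreover have "\<psi> (h, \<one>\<^bsub>G\<^esub>) = 0" if "h \<notin> carrier H" for h using S.pt_outside[OF pt] that by simp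
  ultimately show ?thesis using one N by (simp add: states_on_def states_def positive_type_def)
qed

lemma restriction_invariant:
  assumes N: "N \<in> fin_normal S"
  shows "{h \<in> carrier H. (h, \<one>\<^bsub>G\<^esub>) \<in> N} \<in> invariant_normal"
proof -
  interpret N: normal N S by (rule S.fin_normalD(1)[OF N])
  have "(\<alpha> g h, \<one>\<^bsub>G\<^esub>) \<in> N" if g: "g \<in> carrier G" and h: "h \<in> carrier H" "(h, \<one>\<^bsub>G\<^esub>) \<in> N" for g h
    using N.inv_op_closed2[of "(\<one>\<^bsub>H\<^esub>, g)" "(h, \<one>\<^bsub>G\<^esub>)"] g h by (simp add: S_inv)
  then show ?thesis using fin_normal_vimage[OF incl_H N] by (auto simp: invariant_normal_def)
qed

lemma FD_states_dense:
  assumes fd: "property_FD S" and \<phi>: "\<phi> \<in> states H"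
  shows "\<phi> \<in> adh (\<Union>M\<in>invariant_normal. states_on H M)"
proof (rule adhI)
  fix Q :: "'h set" and \<epsilon> :: real assume Q: "finite Q" and \<epsilon>: "0 < \<epsilon>"
  let ?\<psi> = "\<lambda>x. if snd x = \<one>\<^bsub>G\<^esub> then \<phi> (fst x) else 0"
  have "?\<psi> \<in> adh (\<Union>N\<in>fin_normal S. states_on S N)"
    using fd state_extension[OF \<phi>] by (simp only: S.property_FD_iff)
  from adhD[OF this finite_imageI[OF Q, of "\<lambda>h. (h, \<one>\<^bsub>G\<^esub>)"] \<epsilon>]
  obtain N \<psi> where N: "N \<in> fin_normal S" "\<psi> \<in> states_on S N" "near ((\<lambda>h. (h, \<one>\<^bsub>G\<^esub>)) ` Q) \<epsilon> ?\<psi> \<psi>" by blast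
  have "near Q \<epsilon> \<phi> (\<lambda>h. \<psi> (h, \<one>\<^bsub>G\<^esub>))" using N(3) by (simp add: near_def)
  then show "\<exists>b\<in>\<Union>M\<in>invariant_normal. states_on H M. near Q \<epsilon> \<phi> b"
    using state_restriction[OF N(2)] restriction_invariant[OF N(1)] by blast
qed

theorem FD_dual_dense:
  assumes fd: "property_FD S" and c: "c \<in> unitary_dual H"
  shows "c \<in> fell_topology H closure_of dual_on H invariant_normal"
  by (rule H.dual_dense_if_states_dense[OF invariant_normalD(2) FD_states_dense[OF fd] c])

text \<open>The indicator function of \<open>H\<close> is a state. A state near it at \<open>(1, z)\<close> that is 1 on \<open>N\<close> shows that
  \<open>(1, z)\<close> is not in \<open>N\<close>, so the subgroup that \<open>N\<close> cuts out of \<open>G\<close> does not contain \<open>z\<close>.\<close>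
theorem FD_residually_finite:
  assumes fd: "property_FD S"
  shows "residually_finite G"
  unfolding residually_finite_def
proof (intro ballI impI)
  fix x y assume xy: "x \<in> carrier G" "y \<in> carrier G" "x \<noteq> y"
  define z where "z = x \<otimes>\<^bsub>G\<^esub> inv\<^bsub>G\<^esub> y"
  have z: "z \<in> carrier G" "z \<noteq> \<one>\<^bsub>G\<^esub>"
    using xy G.inv_equality[of x "inv\<^bsub>G\<^esub> y"] by (auto simp: z_def)
  have k: "kernel_of H (\<lambda>h. if h \<in> carrier H then 1 else 0) =
      (\<lambda>x y. if x \<in> carrier H \<and> y \<in> carrier H then 1 else 0)"
    by (intro ext) (simp add: kernel_of_def)
  have "pd (kernel_of H (\<lambda>h. if h \<in> carrier H then 1 else 0))" unfolding k by (rule pd_restrict[OF pd_one])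
  then have "(\<lambda>h. if h \<in> carrier H then 1 else 0) \<in> states H"
    by (simp add: states_def positive_type_def)
  from state_extension[OF this] fd
  have "(\<lambda>x. if snd x = \<one>\<^bsub>G\<^esub> then if fst x \<in> carrier H then 1 else 0 else 0)
      \<in> adh (\<Union>N\<in>fin_normal S. states_on S N)" by (simp only: S.property_FD_iff)
  from adhD[OF this, of "{(\<one>\<^bsub>H\<^esub>, z)}" 1]
  obtain N \<psi> where N: "N \<in> fin_normal S" "\<psi> \<in> states_on S N" "cmod (\<psi> (\<one>\<^bsub>H\<^esub>, z)) < 1"
    using z(2) by (auto simp: near_def)
  then have "(\<one>\<^bsub>H\<^esub>, z) \<notin> N" by (auto simp: states_on_def)
  then have "z \<notin> {g \<in> carrier G. (\<one>\<^bsub>H\<^esub>, g) \<in> N}" by simp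
  then show "\<exists>(K :: nat monoid) f. group K \<and> finite (carrier K) \<and> f \<in> hom G K \<and> f x \<noteq> f y"
    unfolding z_def by (rule G.finite_transport[OF fin_normal_vimage[OF incl_G N(1)] xy(1,2)])
qed

end

section \<open>From the factors to the semidirect product\<close>

context automorphism_action
begin

text \<open>Conjugation of \<open>M \<times> L\<close> by elements of \<open>H\<close> produces the factors \<open>h (\<alpha> l h\<^sup>-\<^sup>1)\<close>, which lie in \<open>M\<close> because
  \<open>L\<close> acts trivially on \<open>H / M\<close>.\<close>
lemma product_fin_normal:
  assumes M: "M \<in> invariant_normal" and L: "L \<in> fin_normal G" "L \<subseteq> act_trivial M"
  shows "M \<times> L \<in> fin_normal S"
proof -
  note D = invariant_normalD[OF M]
  interpret M: normal M H by (rule D(2))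
  interpret L: normal L G by (rule G.fin_normalD(1)[OF L(1)])
  have tr: "inv\<^bsub>H\<^esub> h \<otimes>\<^bsub>H\<^esub> \<alpha> l h \<in> M" if "l \<in> L" "h \<in> carrier H" for l h
    using L(2) that by (auto simp: act_trivial_def)
  have "M \<times> L \<lhd> S"
  proof (rule S.normal_invI)
    show "subgroup (M \<times> L) S"
    proof (rule S.subgroupI)
      show "M \<times> L \<subseteq> carrier S" using M.subset L.subset by auto
      show "M \<times> L \<noteq> {}" using M.one_closed L.one_closed by blast
      show "inv\<^bsub>S\<^esub> a \<in> M \<times> L" if "a \<in> M \<times> L" for a
        using that D(5) M.subset L.subset by (auto simp: S_inv)
      show "a \<otimes>\<^bsub>S\<^esub> b \<in> M \<times> L" if "a \<in> M \<times> L" "b \<in> M \<times> L" for a b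
        using that D(5) L.subset by (auto simp: subset_iff)
    qed
    fix x n assume x: "x \<in> carrier S" and n: "n \<in> M \<times> L"
    obtain h g m l where xn: "x = (h, g)" "n = (m, l)" by fastforce
    have c: "h \<in> carrier H" "g \<in> carrier G" "m \<in> M" "l \<in> L" using x n by (simp_all add: xn)
    have mH: "m \<in> carrier H" "l \<in> carrier G" using c M.subset L.subset by blast+
    define l' where "l' = g \<otimes>\<^bsub>G\<^esub> l \<otimes>\<^bsub>G\<^esub> inv\<^bsub>G\<^esub> g"
    define m' where "m' = \<alpha> g m"
    define k where "k = inv\<^bsub>H\<^esub> h"
    have l': "l' \<in> L" "l' \<in> carrier G" unfolding l'_def using L.inv_op_closed2[OF c(2,4)] L.subset by blast+
    have m': "m' \<in> M" "m' \<in> carrier H" unfolding m'_def using D(5)[OF c(2,3)] M.subset by blast+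
    have k: "k \<in> carrier H" "h = inv\<^bsub>H\<^esub> k" using c(1) by (simp_all add: k_def)
    have "x \<otimes>\<^bsub>S\<^esub> n \<otimes>\<^bsub>S\<^esub> inv\<^bsub>S\<^esub> x = (h \<otimes>\<^bsub>H\<^esub> m' \<otimes>\<^bsub>H\<^esub> \<alpha> l' k, l')"
      using c mH by (simp add: xn S_inv act_comp l'_def m'_def k_def)
    also have "h \<otimes>\<^bsub>H\<^esub> m' \<otimes>\<^bsub>H\<^esub> \<alpha> l' k = (inv\<^bsub>H\<^esub> k \<otimes>\<^bsub>H\<^esub> m' \<otimes>\<^bsub>H\<^esub> k) \<otimes>\<^bsub>H\<^esub> (inv\<^bsub>H\<^esub> k \<otimes>\<^bsub>H\<^esub> \<alpha> l' k)"
    proof -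
      have "k \<otimes>\<^bsub>H\<^esub> (inv\<^bsub>H\<^esub> k \<otimes>\<^bsub>H\<^esub> \<alpha> l' k) = \<alpha> l' k" using k(1) l'(2) by (simp add: H.m_assoc[symmetric])
      then show ?thesis using k m'(2) l'(2) by (simp add: H.m_assoc)
    qed
    finally show "x \<otimes>\<^bsub>S\<^esub> n \<otimes>\<^bsub>S\<^esub> inv\<^bsub>S\<^esub> x \<in> M \<times> L"
      using l'(1) tr[OF l'(1) k(1)] M.inv_op_closed1[OF k(1) m'(1)] by simp
  qed
  moreover have "fin_index S (M \<times> L)"
  proof -
    obtain \<kappa> :: "'h \<Rightarrow> nat" where k: "finite (\<kappa> ` carrier H)"
      "\<And>x y. x \<in> carrier H \<Longrightarrow> y \<in> carrier H \<Longrightarrow> \<kappa> x = \<kappa> y \<Longrightarrow> inv\<^bsub>H\<^esub> x \<otimes>\<^bsub>H\<^esub> y \<in> M"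
      using H.fin_normalD(2)[OF D(1)] unfolding fin_index_def by blast
    obtain \<mu> :: "'g \<Rightarrow> nat" where m: "finite (\<mu> ` carrier G)"
      "\<And>x y. x \<in> carrier G \<Longrightarrow> y \<in> carrier G \<Longrightarrow> \<mu> x = \<mu> y \<Longrightarrow> inv\<^bsub>G\<^esub> x \<otimes>\<^bsub>G\<^esub> y \<in> L"
      using G.fin_normalD(2)[OF L(1)] unfolding fin_index_def by blast
    show ?thesis
    proof (rule fin_indexI[of "\<lambda>x. (\<kappa> (fst x), \<mu> (snd x))"])
      show "finite ((\<lambda>x. (\<kappa> (fst x), \<mu> (snd x))) ` carrier S)"
        by (rule finite_subset[OF _ finite_cartesian_product[OF k(1) m(1)]]) auto
      fix x y assume x: "x \<in> carrier S" and y: "y \<in> carrier S"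
        and eq: "(\<kappa> (fst x), \<mu> (snd x)) = (\<kappa> (fst y), \<mu> (snd y))"
      obtain h g h' g' where xy: "x = (h, g)" "y = (h', g')" by fastforce
      have c: "h \<in> carrier H" "g \<in> carrier G" "h' \<in> carrier H" "g' \<in> carrier G" using x y by (simp_all add: xy)
      show "inv\<^bsub>S\<^esub> x \<otimes>\<^bsub>S\<^esub> y \<in> M \<times> L"
        using c eq D(5) k(2) m(2) by (simp add: xy S_div del: S_simps(2))
    qed
  qed
  ultimately show ?thesis by (simp add: fin_normal_def)
qed

text \<open>For \<open>L = {1}\<close> and a matrix \<open>\<Psi>\<close> of coefficients of a representation \<open>\<pi>\<close> of \<open>H\<close> at vectors \<open>v t\<close>, this is
  the coefficient of the representation induced from \<open>\<pi>\<close> at the vector with components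
  \<open>\<xi> t v t\<close>. A larger \<open>L\<close> folds the regular representation of \<open>G\<close> to that of \<open>G / L\<close>.\<close>
definition folded :: "'g set \<Rightarrow> ('g \<Rightarrow> 'g \<Rightarrow> 'h \<Rightarrow> complex) \<Rightarrow> 'g set \<Rightarrow> ('g \<Rightarrow> real) \<Rightarrow> 'h \<times> 'g \<Rightarrow> complex"
  where "folded L \<Psi> T \<xi> x = (if x \<in> carrier S then \<Sum>t\<in>T. \<Sum>s\<in>T. of_real (\<xi> t * \<xi> s) *
    (if inv\<^bsub>G\<^esub> s \<otimes>\<^bsub>G\<^esub> snd x \<otimes>\<^bsub>G\<^esub> t \<in> L then \<Psi> s t (\<alpha> (inv\<^bsub>G\<^esub> s) (fst x)) else 0) else 0)"

context
  fixes M :: "'h set" and L :: "'g set" and \<Psi> :: "'g \<Rightarrow> 'g \<Rightarrow> 'h \<Rightarrow> complex" and T :: "'g set" and \<xi> :: "'g \<Rightarrow> real"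
  assumes M: "M \<in> invariant_normal" and L: "L \<in> fin_normal G" "L \<subseteq> act_trivial M"
    and \<Psi>: "pd (mkernel H \<Psi>)" "\<And>s t n x. n \<in> M \<Longrightarrow> x \<in> carrier H \<Longrightarrow> \<Psi> s t (x \<otimes>\<^bsub>H\<^esub> n) = \<Psi> s t x"
    and T: "finite T" "T \<subseteq> carrier G"
begin

lemma folded_periodic:
  assumes n: "n \<in> M \<times> L"
  shows "folded L \<Psi> T \<xi> n = folded L \<Psi> T \<xi> \<one>\<^bsub>S\<^esub>"
proof -
  note D = invariant_normalD[OF M]
  interpret L: normal L G by (rule G.fin_normalD(1)[OF L(1)])
  obtain m l where ml: "n = (m, l)" "m \<in> M" "l \<in> L" using n by blast
  have c: "m \<in> carrier H" "l \<in> carrier G" using ml D(4) L.subset by blast+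
  have iff: "inv\<^bsub>G\<^esub> s \<otimes>\<^bsub>G\<^esub> l \<otimes>\<^bsub>G\<^esub> t \<in> L \<longleftrightarrow> inv\<^bsub>G\<^esub> s \<otimes>\<^bsub>G\<^esub> t \<in> L" if st: "s \<in> carrier G" "t \<in> carrier G" for s t
  proof -
    define l' where "l' = inv\<^bsub>G\<^esub> s \<otimes>\<^bsub>G\<^esub> l \<otimes>\<^bsub>G\<^esub> s"
    define u where "u = inv\<^bsub>G\<^esub> s \<otimes>\<^bsub>G\<^esub> t"
    have l': "l' \<in> L" "l' \<in> carrier G" unfolding l'_def using L.inv_op_closed1[OF st(1) ml(3)] L.subset by blast+
    have u: "u \<in> carrier G" using st by (simp add: u_def)
    have "s \<otimes>\<^bsub>G\<^esub> (inv\<^bsub>G\<^esub> s \<otimes>\<^bsub>G\<^esub> t) = t" using st by (simp add: G.m_assoc[symmetric])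
    then have e: "inv\<^bsub>G\<^esub> s \<otimes>\<^bsub>G\<^esub> l \<otimes>\<^bsub>G\<^esub> t = l' \<otimes>\<^bsub>G\<^esub> u"
      using st c(2) by (simp add: l'_def u_def G.m_assoc)
    have "u \<in> L" if "l' \<otimes>\<^bsub>G\<^esub> u \<in> L"
    proof -
      have "inv\<^bsub>G\<^esub> l' \<otimes>\<^bsub>G\<^esub> (l' \<otimes>\<^bsub>G\<^esub> u) \<in> L" using that l'(1) by simp
      then show ?thesis using l'(2) u by (simp add: G.m_assoc[symmetric])
    qed
    then show ?thesis using l'(1) unfolding e u_def[symmetric] by auto
  qed
  have val: "\<Psi> s t (\<alpha> (inv\<^bsub>G\<^esub> s) m) = \<Psi> s t \<one>\<^bsub>H\<^esub>" if "s \<in> carrier G" for s t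
    using \<Psi>(2)[of "\<alpha> (inv\<^bsub>G\<^esub> s) m" "\<one>\<^bsub>H\<^esub>" s t] D(5)[of "inv\<^bsub>G\<^esub> s" m] ml(2) that c by simp
  have "(if inv\<^bsub>G\<^esub> s \<otimes>\<^bsub>G\<^esub> l \<otimes>\<^bsub>G\<^esub> t \<in> L then \<Psi> s t (\<alpha> (inv\<^bsub>G\<^esub> s) m) else 0) =
      (if inv\<^bsub>G\<^esub> s \<otimes>\<^bsub>G\<^esub> \<one>\<^bsub>G\<^esub> \<otimes>\<^bsub>G\<^esub> t \<in> L then \<Psi> s t (\<alpha> (inv\<^bsub>G\<^esub> s) \<one>\<^bsub>H\<^esub>) else 0)"
    if "s \<in> T" "t \<in> T" for s t
  proof -
    have st: "s \<in> carrier G" "t \<in> carrier G" using that T(2) by blast+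
    show ?thesis by (simp add: iff[OF st] val[OF st(1)] st)
  qed
  moreover have "(m, l) \<in> carrier S" "(\<one>\<^bsub>H\<^esub>, \<one>\<^bsub>G\<^esub>) \<in> carrier S" using c by simp_all
  ultimately show ?thesis unfolding ml(1) S_simps(3)
    by (simp only: folded_def if_True fst_conv snd_conv cong: sum.cong)
qed

text \<open>The kernel of the function is made of the entries at pairs \<open>i = ((h, g), t)\<close>, and only pairs
  with the same coset of \<open>g t\<close> modulo \<open>L\<close> interact. Within such a block all \<open>h\<close> can be transported by
  the inverse of one representative \<open>p\<close> of the coset, and \<open>mkernel H \<Psi>\<close> becomes applicable. Choosing
  \<open>p\<close> instead of \<open>g t\<close> does not matter, since \<open>L\<close> moves the argument of \<open>\<Psi>\<close> only within its coset
  of \<open>M\<close>.\<close>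
lemma folded_positive_type: "positive_type S (folded L \<Psi> T \<xi>)"
proof -
  note D = invariant_normalD[OF M]
  interpret L: normal L G by (rule G.fin_normalD(1)[OF L(1)])
  define cl where "cl a = {x \<in> carrier G. inv\<^bsub>G\<^esub> x \<otimes>\<^bsub>G\<^esub> a \<in> L}" for a
  define p where "p a = (SOME x. x \<in> cl a)" for a
  have div: "inv\<^bsub>G\<^esub> b \<otimes>\<^bsub>G\<^esub> a \<in> L" if "inv\<^bsub>G\<^esub> a \<otimes>\<^bsub>G\<^esub> b \<in> L" "a \<in> carrier G" "b \<in> carrier G" for a b
    using L.m_inv_closed[OF that(1)] that(2,3) by (simp add: G.inv_mult_group)
  have trans: "inv\<^bsub>G\<^esub> x \<otimes>\<^bsub>G\<^esub> b \<in> L" if "inv\<^bsub>G\<^esub> x \<otimes>\<^bsub>G\<^esub> a \<in> L" "inv\<^bsub>G\<^esub> a \<otimes>\<^bsub>G\<^esub> b \<in> L"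
    "x \<in> carrier G" "a \<in> carrier G" "b \<in> carrier G" for x a b
  proof -
    have "a \<otimes>\<^bsub>G\<^esub> (inv\<^bsub>G\<^esub> a \<otimes>\<^bsub>G\<^esub> b) = b" using that by (simp add: G.m_assoc[symmetric])
    then show ?thesis using L.m_closed[OF that(1,2)] that(3-5) by (simp add: G.m_assoc)
  qed
  have cl_self: "a \<in> cl a" if "a \<in> carrier G" for a using that by (simp add: cl_def)
  have cl_eq: "cl a = cl b \<longleftrightarrow> inv\<^bsub>G\<^esub> b \<otimes>\<^bsub>G\<^esub> a \<in> L" if a: "a \<in> carrier G" and b: "b \<in> carrier G" for a b
  proof
    assume "cl a = cl b"
    then have "a \<in> cl b" using cl_self[OF a] by simp
    then show "inv\<^bsub>G\<^esub> b \<otimes>\<^bsub>G\<^esub> a \<in> L" using div[of a b] a b by (simp add: cl_def)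
  next
    assume L1: "inv\<^bsub>G\<^esub> b \<otimes>\<^bsub>G\<^esub> a \<in> L"
    have L2: "inv\<^bsub>G\<^esub> a \<otimes>\<^bsub>G\<^esub> b \<in> L" by (rule div[OF L1 b a])
    show "cl a = cl b"
      unfolding cl_def using trans[OF _ L1 _ b a] trans[OF _ L2 _ a b] by fast
  qed
  have p: "p a \<in> carrier G" "inv\<^bsub>G\<^esub> p a \<otimes>\<^bsub>G\<^esub> a \<in> L" if a: "a \<in> carrier G" for a
  proof -
    have "p a \<in> cl a" unfolding p_def by (rule someI[of _ a]) (rule cl_self[OF a])
    then show "p a \<in> carrier G" "inv\<^bsub>G\<^esub> p a \<otimes>\<^bsub>G\<^esub> a \<in> L" by (simp_all add: cl_def)
  qed
  define pos where "pos i = snd (fst i) \<otimes>\<^bsub>G\<^esub> snd i" for i :: "('h \<times> 'g) \<times> 'g"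
  define F where "F i = (\<alpha> (inv\<^bsub>G\<^esub> p (pos i)) (fst (fst i)), snd i)" for i
  define K0 where "K0 i j = (if cl (pos i) = cl (pos j) then mkernel H \<Psi> (F i) (F j) else 0)" for i j
  have K0: "pd K0" unfolding K0_def by (rule pd_block[OF pd_pullback[OF \<Psi>(1)]])
  obtain ts where ts: "set ts = T" "distinct ts" using finite_distinct_list[OF T(1)] by blast
  define f where "f x = map (\<lambda>t. (complex_of_real (\<xi> t), (x, t))) ts" for x :: "'h \<times> 'g"
  have bil: "bil K0 (f x) (f y) = (\<Sum>t\<in>T. \<Sum>s\<in>T. of_real (\<xi> t * \<xi> s) * K0 (x, t) (y, s))" for x y
    by (simp add: bil_def f_def comp_def sum_list_distinct_conv_sum_set[OF ts(2)] ts(1))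
  have "kernel_of S (folded L \<Psi> T \<xi>) x y = (if x \<in> carrier S \<and> y \<in> carrier S then bil K0 (f x) (f y) else 0)" for x y
  proof (cases "x \<in> carrier S \<and> y \<in> carrier S")
    case True
    obtain h g h' g' where xy: "x = (h, g)" "y = (h', g')" by fastforce
    have c: "h \<in> carrier H" "g \<in> carrier G" "h' \<in> carrier H" "g' \<in> carrier G" using True by (simp_all add: xy)
    define k where "k = inv\<^bsub>H\<^esub> h' \<otimes>\<^bsub>H\<^esub> h"
    have kH: "k \<in> carrier H" using c by (simp add: k_def)
    have K0eq: "K0 (x, t) (y, s) = (if inv\<^bsub>G\<^esub> s \<otimes>\<^bsub>G\<^esub> (inv\<^bsub>G\<^esub> g' \<otimes>\<^bsub>G\<^esub> g) \<otimes>\<^bsub>G\<^esub> t \<in> L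
        then \<Psi> s t (\<alpha> (inv\<^bsub>G\<^esub> s) (\<alpha> (inv\<^bsub>G\<^esub> g') k)) else 0)" if "s \<in> T" "t \<in> T" for s t
    proof -
      have st: "s \<in> carrier G" "t \<in> carrier G" using that T(2) by blast+
      define a where "a = g \<otimes>\<^bsub>G\<^esub> t"
      define b where "b = g' \<otimes>\<^bsub>G\<^esub> s"
      have ab: "a \<in> carrier G" "b \<in> carrier G" using c st by (simp_all add: a_def b_def)
      have ata: "pos (x, t) = a" "pos (y, s) = b" by (simp_all add: pos_def xy a_def b_def)
      have e: "inv\<^bsub>G\<^esub> s \<otimes>\<^bsub>G\<^esub> (inv\<^bsub>G\<^esub> g' \<otimes>\<^bsub>G\<^esub> g) \<otimes>\<^bsub>G\<^esub> t = inv\<^bsub>G\<^esub> b \<otimes>\<^bsub>G\<^esub> a"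
        using c st by (simp add: a_def b_def G.inv_mult_group G.m_assoc)
      show ?thesis
      proof (cases "inv\<^bsub>G\<^esub> b \<otimes>\<^bsub>G\<^esub> a \<in> L")
        case True
        then have cle: "cl a = cl b" using cl_eq[OF ab] by blast
        then have pe: "p a = p b" by (simp add: p_def)
        define l where "l = inv\<^bsub>G\<^esub> p b \<otimes>\<^bsub>G\<^esub> b"
        define k' where "k' = \<alpha> (inv\<^bsub>G\<^esub> b) k"
        have l: "l \<in> L" "l \<in> carrier G" unfolding l_def using p[OF ab(2)] ab by simp_all
        have k': "k' \<in> carrier H" using kH ab by (simp add: k'_def)
        have pl: "inv\<^bsub>G\<^esub> p b = l \<otimes>\<^bsub>G\<^esub> inv\<^bsub>G\<^esub> b" using p(1)[OF ab(2)] ab by (simp add: l_def G.m_assoc)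
        have pk: "\<alpha> (inv\<^bsub>G\<^esub> p b) k = \<alpha> l k'" unfolding pl k'_def using act_comp[OF l(2) _ kH] ab by simp
        have Fx: "F (x, t) = (\<alpha> (inv\<^bsub>G\<^esub> p b) (fst x), t)"
          by (simp only: F_def ata pe fst_conv snd_conv)
        have Fy: "F (y, s) = (\<alpha> (inv\<^bsub>G\<^esub> p b) (fst y), s)"
          by (simp only: F_def ata fst_conv snd_conv)
        have "inv\<^bsub>H\<^esub> k' \<otimes>\<^bsub>H\<^esub> \<alpha> l k' \<in> M" using L(2) l(1) k' by (auto simp: act_trivial_def)
        from \<Psi>(2)[OF this k']
        have "\<Psi> s t (\<alpha> l k') = \<Psi> s t k'" using k' l(2) by (simp add: H.m_assoc[symmetric])
        moreover have "k' = \<alpha> (inv\<^bsub>G\<^esub> s) (\<alpha> (inv\<^bsub>G\<^esub> g') k)"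
          using c st kH by (simp add: k'_def b_def G.inv_mult_group act_comp)
        moreover have "mkernel H \<Psi> (F (x, t)) (F (y, s)) = \<Psi> s t (\<alpha> (inv\<^bsub>G\<^esub> p b) k)"
          unfolding Fx Fy using c p(1)[OF ab(2)] by (simp add: mkernel_def xy k_def act_mult act_inv)
        ultimately show ?thesis using True by (simp add: K0_def ata cle e pk)
      next
        case False
        then have "cl a \<noteq> cl b" using cl_eq[OF ab] by blast
        then show ?thesis using False by (simp add: K0_def ata e)
      qed
    qed
    have d: "inv\<^bsub>S\<^esub> y \<otimes>\<^bsub>S\<^esub> x = (\<alpha> (inv\<^bsub>G\<^esub> g') k, inv\<^bsub>G\<^esub> g' \<otimes>\<^bsub>G\<^esub> g)"
      using c by (simp only: xy S_div k_def)
    have m: "(\<alpha> (inv\<^bsub>G\<^esub> g') k, inv\<^bsub>G\<^esub> g' \<otimes>\<^bsub>G\<^esub> g) \<in> carrier S" using c kH by simp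
    have "kernel_of S (folded L \<Psi> T \<xi>) x y = folded L \<Psi> T \<xi> (\<alpha> (inv\<^bsub>G\<^esub> g') k, inv\<^bsub>G\<^esub> g' \<otimes>\<^bsub>G\<^esub> g)"
      unfolding kernel_of_def d using True by (rule if_P)
    also have "\<dots> = bil K0 (f x) (f y)"
      unfolding bil folded_def if_P[OF m] fst_conv snd_conv
      by (intro sum.cong refl arg_cong2[where f = "(*)"]) (rule K0eq[symmetric])
    finally show ?thesis using True by simp
  qed (auto simp: kernel_of_def)
  then have "kernel_of S (folded L \<Psi> T \<xi>) = (\<lambda>x y. if x \<in> carrier S \<and> y \<in> carrier S then bil K0 (f x) (f y) else 0)"
    by (intro ext)
  then have "pd (kernel_of S (folded L \<Psi> T \<xi>))" using pd_restrict[OF pd_combination[OF K0]] by (simp only:)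
  then show ?thesis by (auto simp: positive_type_def folded_def)
qed

end

end

context automorphism_action
begin

lemma restrict_rep:
  assumes "group_rep S V \<pi>"
  shows "group_rep H V (\<lambda>h. \<pi> (h, \<one>\<^bsub>G\<^esub>))"
proof -
  interpret V: group_rep S V \<pi> by (rule assms)
  interpret i: group_hom H S "\<lambda>h. (h, \<one>\<^bsub>G\<^esub>)" by (rule incl_H)
  have "(\<lambda>h. \<pi> (h, \<one>\<^bsub>G\<^esub>)) \<in> hom H (unitary_group V)"
    using Group.hom_compose[OF i.homh V.hom] by (simp add: comp_def)
  then show ?thesis
    by (intro group_rep.intro group_rep_axioms.intro H.group_axioms V.hilbert_space_axioms)
qed

text \<open>Move \<open>(1, s)\<close> to the other side and multiply out.\<close>
lemma translated_coef:
  assumes V: "group_rep S V \<pi>" and z: "\<zeta> \<in> carrier V" and c: "h \<in> carrier H" "s \<in> carrier G" "t \<in> carrier G"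
  shows "ip V (\<pi> (\<alpha> (inv\<^bsub>G\<^esub> s) h, \<one>\<^bsub>G\<^esub>) (\<pi> (\<one>\<^bsub>H\<^esub>, inv\<^bsub>G\<^esub> t) \<zeta>)) (\<pi> (\<one>\<^bsub>H\<^esub>, inv\<^bsub>G\<^esub> s) \<zeta>) =
    ip V (\<pi> (h, s \<otimes>\<^bsub>G\<^esub> inv\<^bsub>G\<^esub> t) \<zeta>) \<zeta>"
proof -
  interpret V: group_rep S V \<pi> by (rule V)
  let ?a = "\<pi> (\<alpha> (inv\<^bsub>G\<^esub> s) h, \<one>\<^bsub>G\<^esub>) (\<pi> (\<one>\<^bsub>H\<^esub>, inv\<^bsub>G\<^esub> t) \<zeta>)"
  have a: "?a \<in> carrier V" using c z by simp
  have "ip V ?a (\<pi> (\<one>\<^bsub>H\<^esub>, inv\<^bsub>G\<^esub> s) \<zeta>) = ip V (\<pi> (\<one>\<^bsub>H\<^esub>, s) ?a) (\<pi> (\<one>\<^bsub>H\<^esub>, s) (\<pi> (\<one>\<^bsub>H\<^esub>, inv\<^bsub>G\<^esub> s) \<zeta>))"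
    by (rule V.rep_ip[symmetric]) (use c z in simp_all)
  also have "\<pi> (\<one>\<^bsub>H\<^esub>, s) (\<pi> (\<one>\<^bsub>H\<^esub>, inv\<^bsub>G\<^esub> s) \<zeta>) = \<zeta>"
    using V.rep_mult[of "(\<one>\<^bsub>H\<^esub>, s)" "(\<one>\<^bsub>H\<^esub>, inv\<^bsub>G\<^esub> s)" \<zeta>] V.rep_one[OF z] c z by simp
  also have "\<pi> (\<one>\<^bsub>H\<^esub>, s) ?a = \<pi> (h, s \<otimes>\<^bsub>G\<^esub> inv\<^bsub>G\<^esub> t) \<zeta>"
    using V.rep_mult[of "(\<one>\<^bsub>H\<^esub>, s)" "(\<alpha> (inv\<^bsub>G\<^esub> s) h, \<one>\<^bsub>G\<^esub>)" "\<pi> (\<one>\<^bsub>H\<^esub>, inv\<^bsub>G\<^esub> t) \<zeta>"]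
      V.rep_mult[of "(h, s)" "(\<one>\<^bsub>H\<^esub>, inv\<^bsub>G\<^esub> t)" \<zeta>] c z by simp
  finally show ?thesis .
qed

text \<open>If \<open>L\<close> meets the relevant elements in the identity only, then the congruence modulo \<open>L\<close> singles out
  \<open>s = g t\<close>. No term is lost when \<open>g t\<close> is outside of \<open>T\<close>, for \<open>\<xi>\<close> vanishes there.\<close>
lemma folded_value:
  assumes x: "x \<in> carrier S" and T: "finite T" "T \<subseteq> carrier G" and \<xi>: "\<And>t. t \<notin> T \<Longrightarrow> \<xi> t = 0"
    and L: "L \<in> fin_normal G"
    and avoid: "\<And>s t. s \<in> T \<Longrightarrow> t \<in> T \<Longrightarrow> inv\<^bsub>G\<^esub> s \<otimes>\<^bsub>G\<^esub> snd x \<otimes>\<^bsub>G\<^esub> t \<in> L \<Longrightarrow> inv\<^bsub>G\<^esub> s \<otimes>\<^bsub>G\<^esub> snd x \<otimes>\<^bsub>G\<^esub> t = \<one>\<^bsub>G\<^esub>"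
  shows "folded L \<Psi> T \<xi> x = (\<Sum>t\<in>T. of_real (\<xi> (snd x \<otimes>\<^bsub>G\<^esub> t) * \<xi> t) *
    \<Psi> (snd x \<otimes>\<^bsub>G\<^esub> t) t (\<alpha> (inv\<^bsub>G\<^esub> (snd x \<otimes>\<^bsub>G\<^esub> t)) (fst x)))"
proof -
  interpret L: normal L G by (rule G.fin_normalD(1)[OF L])
  define g where "g = snd x"
  define h where "h = fst x"
  have c: "g \<in> carrier G" using x by (auto simp: g_def)
  have "(\<Sum>s\<in>T. of_real (\<xi> t * \<xi> s) * (if inv\<^bsub>G\<^esub> s \<otimes>\<^bsub>G\<^esub> g \<otimes>\<^bsub>G\<^esub> t \<in> L then \<Psi> s t (\<alpha> (inv\<^bsub>G\<^esub> s) h) else 0)) =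
      of_real (\<xi> (g \<otimes>\<^bsub>G\<^esub> t) * \<xi> t) * \<Psi> (g \<otimes>\<^bsub>G\<^esub> t) t (\<alpha> (inv\<^bsub>G\<^esub> (g \<otimes>\<^bsub>G\<^esub> t)) h)" (is "?l = ?r") if t: "t \<in> T" for t
  proof -
    have tG: "t \<in> carrier G" using t T(2) by blast
    have iff: "inv\<^bsub>G\<^esub> s \<otimes>\<^bsub>G\<^esub> g \<otimes>\<^bsub>G\<^esub> t \<in> L \<longleftrightarrow> s = g \<otimes>\<^bsub>G\<^esub> t" if s: "s \<in> T" for s
    proof
      have sG: "s \<in> carrier G" using s T(2) by blast
      show "s = g \<otimes>\<^bsub>G\<^esub> t" if "inv\<^bsub>G\<^esub> s \<otimes>\<^bsub>G\<^esub> g \<otimes>\<^bsub>G\<^esub> t \<in> L"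
      proof -
        have "inv\<^bsub>G\<^esub> s \<otimes>\<^bsub>G\<^esub> (g \<otimes>\<^bsub>G\<^esub> t) = \<one>\<^bsub>G\<^esub>"
          using avoid[OF s t] that sG c tG by (simp add: g_def[symmetric] G.m_assoc)
        moreover have "g \<otimes>\<^bsub>G\<^esub> t = s \<otimes>\<^bsub>G\<^esub> (inv\<^bsub>G\<^esub> s \<otimes>\<^bsub>G\<^esub> (g \<otimes>\<^bsub>G\<^esub> t))"
          using sG c tG by (simp add: G.m_assoc[symmetric])
        ultimately show ?thesis using sG by simp
      qed
      show "inv\<^bsub>G\<^esub> s \<otimes>\<^bsub>G\<^esub> g \<otimes>\<^bsub>G\<^esub> t \<in> L" if "s = g \<otimes>\<^bsub>G\<^esub> t"
        using G.l_inv[OF G.m_closed[OF c tG]] L.one_closed c tG by (simp add: that G.m_assoc)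
    qed
    have "?l = (\<Sum>s\<in>T. if g \<otimes>\<^bsub>G\<^esub> t = s then ?r else 0)"
      by (intro sum.cong refl) (auto simp: iff)
    also have "\<dots> = (if g \<otimes>\<^bsub>G\<^esub> t \<in> T then ?r else 0)" by (simp only: sum.delta'[OF T(1)])
    also have "\<dots> = ?r" using \<xi>[of "g \<otimes>\<^bsub>G\<^esub> t"] by simp
    finally show ?thesis .
  qed
  then show ?thesis using x unfolding folded_def g_def h_def by simp
qed

text \<open>The function \<open>folded L \<Psi> T \<xi>\<close> is compared with \<open>\<phi>\<close> on a finite set. Replacing \<open>\<phi>(h, g)\<close> by the sum over \<open>t\<close>
  of \<open>\<xi>(g t) \<xi>(t) \<phi>(h, g)\<close> costs the deviation of the weights from 1, which amenability
  controls, and replacing \<open>\<phi>(h, g)\<close> in each term by an entry of \<open>\<Psi>\<close> costs the error of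
  \<open>matrix_approx\<close>. Normalization at the identity makes the function a state.\<close>
theorem FD_if_dual_dense:
  assumes am: "amenable G" and rf: "residually_finite G"
    and dense: "\<And>c. c \<in> unitary_dual H \<Longrightarrow> c \<in> fell_topology H closure_of dual_on H invariant_normal"
  shows "property_FD S"
  unfolding S.property_FD_iff
proof
  fix \<phi> assume \<phi>: "\<phi> \<in> states S"
  have pt: "positive_type S \<phi>" and one: "\<phi> \<one>\<^bsub>S\<^esub> = 1" using \<phi> by (simp_all only: states_def mem_Collect_eq)
  obtain V \<pi> where V: "gns S \<phi> = (V, \<pi>)" by fastforce
  interpret V: group_rep S V \<pi> using S.gns_rep[OF pt] V by simp
  obtain \<zeta> where z: "\<zeta> \<in> carrier V" "V.coef \<zeta> = \<phi>" using S.gns_props(1)[OF pt V] by blast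
  have dH: "\<psi> \<in> adh (\<Union>M\<in>invariant_normal. states_on H M)" if "\<psi> \<in> states H" for \<psi>
    by (rule H.states_dense_if_dual_dense[OF invariant_normalD(2) invariant_normal_Int dense that])
  show "\<phi> \<in> adh (\<Union>N\<in>fin_normal S. states_on S N)"
  proof (rule adhI)
    fix Q0 :: "('h \<times> 'g) set" and \<epsilon> :: real assume Q0: "finite Q0" and \<epsilon>: "0 < \<epsilon>"
    define Q where "Q = insert \<one>\<^bsub>S\<^esub> (Q0 \<inter> carrier S)"
    have Q: "finite Q" "Q \<subseteq> carrier S" "\<one>\<^bsub>S\<^esub> \<in> Q"
      using Q0 S.one_closed by (simp_all add: Q_def del: S_simps)
    \<comment> \<open>The tolerance that \<open>normalize_near\<close> needs.\<close>
    define \<delta> where "\<delta> = min (1 / 2) (\<epsilon> / 2)"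
    have \<delta>: "0 < \<delta>" using \<epsilon> by (simp add: \<delta>_def)
    have sQ: "snd ` Q \<subseteq> carrier G" using Q(2) by auto
    have "0 < min 1 (\<delta> / 2)" using \<delta> by simp
    from G.almost_invariant_vector[OF am finite_imageI[OF Q(1)] sQ this]
    obtain T \<xi> where T: "finite T" "T \<subseteq> carrier G" and \<xi>: "\<And>x. 0 \<le> \<xi> x" "\<And>x. x \<notin> T \<Longrightarrow> \<xi> x = 0"
      and inv: "\<And>g. g \<in> snd ` Q \<Longrightarrow> \<bar>1 - (\<Sum>t\<in>T. \<xi> (g \<otimes>\<^bsub>G\<^esub> t) * \<xi> t)\<bar> < min 1 (\<delta> / 2)" by blast
    define v where "v t = (if t \<in> carrier G then \<pi> (\<one>\<^bsub>H\<^esub>, inv\<^bsub>G\<^esub> t) \<zeta> else \<zeta>)" for t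
    have v: "v t \<in> carrier V" for t using z(1) by (simp add: v_def)
    \<comment> \<open>The elements of \<open>H\<close> at which the entries of \<open>\<Psi>\<close> are evaluated for arguments in \<open>Q\<close>.\<close>
    define QH where "QH = (\<lambda>(s, x). \<alpha> (inv\<^bsub>G\<^esub> s) (fst x)) ` (T \<times> Q)"
    have QH: "finite QH" "QH \<subseteq> carrier H"
      using T(1) Q(1) subsetD[OF T(2)] subsetD[OF Q(2)] by (fastforce simp: QH_def)+
    have ne: "invariant_normal \<noteq> {}" using carrier_invariant_normal by blast
    have \<delta>4: "0 < \<delta> / 4" using \<delta> by simp
    have "\<exists>M\<in>invariant_normal. \<exists>\<Psi>. pd (mkernel H \<Psi>) \<and>
      (\<forall>s t. \<forall>n\<in>M. \<forall>x\<in>carrier H. \<Psi> s t (x \<otimes>\<^bsub>H\<^esub> n) = \<Psi> s t x) \<and>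
      (\<forall>s\<in>T. \<forall>t\<in>T. \<forall>x\<in>QH. cmod (ip V (\<pi> (x, \<one>\<^bsub>G\<^esub>) (v t)) (v s) - \<Psi> s t x) < \<delta> / 4)"
      by (rule group_rep.matrix_approx[OF restrict_rep[OF V.group_rep_axioms]])
         (assumption | rule invariant_normalD(2) invariant_normal_Int ne dH QH T(1) \<delta>4 v)+
    then obtain M \<Psi> where M: "M \<in> invariant_normal" and \<Psi>: "pd (mkernel H \<Psi>)"
      "\<And>s t n x. n \<in> M \<Longrightarrow> x \<in> carrier H \<Longrightarrow> \<Psi> s t (x \<otimes>\<^bsub>H\<^esub> n) = \<Psi> s t x"
      and near\<Psi>: "\<And>s t x. s \<in> T \<Longrightarrow> t \<in> T \<Longrightarrow> x \<in> QH \<Longrightarrow>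
        cmod (ip V (\<pi> (x, \<one>\<^bsub>G\<^esub>) (v t)) (v s) - \<Psi> s t x) < \<delta> / 4"
      by blast
    \<comment> \<open>The elements of \<open>G\<close> that must not become trivial modulo \<open>L\<close>.\<close>
    define A where "A = (\<lambda>(s, x, t). inv\<^bsub>G\<^esub> s \<otimes>\<^bsub>G\<^esub> snd x \<otimes>\<^bsub>G\<^esub> t) ` (T \<times> Q \<times> T) - {\<one>\<^bsub>G\<^esub>}"
    have "finite A" using T Q by (simp add: A_def)
    moreover have "A \<subseteq> carrier G"
    proof
      fix a assume "a \<in> A"
      then obtain s x t where "a = inv\<^bsub>G\<^esub> s \<otimes>\<^bsub>G\<^esub> snd x \<otimes>\<^bsub>G\<^esub> t" "s \<in> T" "x \<in> Q" "t \<in> T" unfolding A_def by auto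
      moreover then have "s \<in> carrier G" "t \<in> carrier G" "x \<in> carrier S" using T Q by blast+
      ultimately show "a \<in> carrier G" by auto
    qed
    moreover have "\<one>\<^bsub>G\<^esub> \<notin> A" by (simp add: A_def)
    ultimately obtain L0 where L0: "L0 \<in> fin_normal G" "L0 \<inter> A = {}"
      using G.residually_finite_avoid[OF rf] by blast
    define L where "L = L0 \<inter> act_trivial M"
    have L: "L \<in> fin_normal G" "L \<subseteq> act_trivial M"
      using G.fin_normal_Int[OF L0(1) act_trivial_fin_normal[OF M]] by (simp_all add: L_def)
    define \<psi> where "\<psi> = folded L \<Psi> T \<xi>"
    have pt\<psi>: "positive_type S \<psi>" unfolding \<psi>_def by (rule folded_positive_type[OF M L \<Psi> T])
    have per: "\<psi> n = \<psi> \<one>\<^bsub>S\<^esub>" if "n \<in> M \<times> L" for n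
      unfolding \<psi>_def by (rule folded_periodic[OF M L \<Psi> T that])
    have "near Q \<delta> \<phi> \<psi>"
      unfolding near_def
    proof
      fix x assume x: "x \<in> Q"
      have xS: "x \<in> carrier S" using x Q(2) by blast
      define h g where "h = fst x" and "g = snd x"
      have xhg: "x = (h, g)" by (simp add: h_def g_def)
      have c: "h \<in> carrier H" "g \<in> carrier G" using xS by (simp_all add: xhg)
      define w where "w t = \<xi> (g \<otimes>\<^bsub>G\<^esub> t) * \<xi> t" for t
      define k where "k t = \<alpha> (inv\<^bsub>G\<^esub> (g \<otimes>\<^bsub>G\<^esub> t)) h" for t
      have w0: "0 \<le> w t" for t using \<xi>(1) by (simp add: w_def)
      have "snd x \<in> snd ` Q" using x by blast
      then have wsum: "\<bar>1 - (\<Sum>t\<in>T. w t)\<bar> < min 1 (\<delta> / 2)" using inv[of g] by (simp add: w_def g_def)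
      have avoid: "inv\<^bsub>G\<^esub> s \<otimes>\<^bsub>G\<^esub> snd x \<otimes>\<^bsub>G\<^esub> t = \<one>\<^bsub>G\<^esub>"
        if "s \<in> T" "t \<in> T" "inv\<^bsub>G\<^esub> s \<otimes>\<^bsub>G\<^esub> snd x \<otimes>\<^bsub>G\<^esub> t \<in> L" for s t
      proof (rule ccontr)
        assume "inv\<^bsub>G\<^esub> s \<otimes>\<^bsub>G\<^esub> snd x \<otimes>\<^bsub>G\<^esub> t \<noteq> \<one>\<^bsub>G\<^esub>"
        moreover have "inv\<^bsub>G\<^esub> s \<otimes>\<^bsub>G\<^esub> snd x \<otimes>\<^bsub>G\<^esub> t \<in> (\<lambda>(s, x, t). inv\<^bsub>G\<^esub> s \<otimes>\<^bsub>G\<^esub> snd x \<otimes>\<^bsub>G\<^esub> t) ` (T \<times> Q \<times> T)"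
          by (rule image_eqI[of _ _ "(s, x, t)"]) (use that x in simp_all)
        ultimately have "inv\<^bsub>G\<^esub> s \<otimes>\<^bsub>G\<^esub> snd x \<otimes>\<^bsub>G\<^esub> t \<in> L0 \<inter> A" using that(3) by (simp add: A_def L_def)
        then show False using L0(2) by simp
      qed
      have \<psi>x: "\<psi> x = (\<Sum>t\<in>T. of_real (w t) * \<Psi> (g \<otimes>\<^bsub>G\<^esub> t) t (k t))"
        unfolding \<psi>_def using folded_value[OF xS T \<xi>(2) L(1) avoid, where \<Psi> = \<Psi>] by (simp add: w_def k_def xhg)
      have term_near: "cmod (of_real (w t) * (\<phi> x - \<Psi> (g \<otimes>\<^bsub>G\<^esub> t) t (k t))) \<le> w t * (\<delta> / 4)" if t: "t \<in> T" for t
      proof (cases "g \<otimes>\<^bsub>G\<^esub> t \<in> T")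
        case True
        have tG: "t \<in> carrier G" using t T(2) by blast
        have "k t \<in> QH" unfolding QH_def k_def
          by (rule image_eqI[of _ _ "(g \<otimes>\<^bsub>G\<^esub> t, x)"]) (use True x in \<open>simp_all add: xhg\<close>)
        from near\<Psi>[OF True t this]
        have "cmod (ip V (\<pi> (k t, \<one>\<^bsub>G\<^esub>) (v t)) (v (g \<otimes>\<^bsub>G\<^esub> t)) - \<Psi> (g \<otimes>\<^bsub>G\<^esub> t) t (k t)) < \<delta> / 4" .
        moreover have "ip V (\<pi> (k t, \<one>\<^bsub>G\<^esub>) (v t)) (v (g \<otimes>\<^bsub>G\<^esub> t)) = \<phi> x"
          using translated_coef[OF V.group_rep_axioms z(1) c(1) G.m_closed[OF c(2) tG] tG] tG c
            fun_cong[OF z(2), of x]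
          by (simp add: k_def v_def V.coef_def xhg G.m_assoc)
        ultimately have "cmod (\<phi> x - \<Psi> (g \<otimes>\<^bsub>G\<^esub> t) t (k t)) \<le> \<delta> / 4" by (simp only: less_imp_le)
        from mult_left_mono[OF this w0[of t]] show ?thesis
          by (simp only: norm_mult norm_of_real abs_of_nonneg[OF w0[of t]])
      qed (use \<xi>(2) in \<open>simp add: w_def\<close>)
      have split: "a - b = a * (1 - c) + (c * a - b)" for a b c :: complex by (simp add: algebra_simps)
      have "(\<Sum>t\<in>T. of_real (w t) * (\<phi> x - \<Psi> (g \<otimes>\<^bsub>G\<^esub> t) t (k t))) = of_real (\<Sum>t\<in>T. w t) * \<phi> x - \<psi> x"
        unfolding \<psi>x by (simp only: right_diff_distrib sum_subtractf sum_distrib_right of_real_sum)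
      then have "\<phi> x - \<psi> x = \<phi> x * of_real (1 - (\<Sum>t\<in>T. w t)) +
          (\<Sum>t\<in>T. of_real (w t) * (\<phi> x - \<Psi> (g \<otimes>\<^bsub>G\<^esub> t) t (k t)))"
        using split[of "\<phi> x" "\<psi> x" "of_real (\<Sum>t\<in>T. w t)"] by (simp only: of_real_diff of_real_1)
      then have "cmod (\<phi> x - \<psi> x) \<le> cmod (\<phi> x * of_real (1 - (\<Sum>t\<in>T. w t))) +
          cmod (\<Sum>t\<in>T. of_real (w t) * (\<phi> x - \<Psi> (g \<otimes>\<^bsub>G\<^esub> t) t (k t)))"
        by (simp only: norm_triangle_ineq)
      moreover have "cmod (\<phi> x * of_real (1 - (\<Sum>t\<in>T. w t))) \<le> 1 * \<bar>1 - (\<Sum>t\<in>T. w t)\<bar>"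
        unfolding norm_mult norm_of_real using S.pt_bound[OF pt, of x] one by (intro mult_right_mono) simp_all
      moreover have "cmod (\<Sum>t\<in>T. of_real (w t) * (\<phi> x - \<Psi> (g \<otimes>\<^bsub>G\<^esub> t) t (k t))) \<le> (\<Sum>t\<in>T. w t * (\<delta> / 4))"
        by (rule sum_norm_le) (rule term_near)
      moreover have "(\<Sum>t\<in>T. w t * (\<delta> / 4)) \<le> 2 * (\<delta> / 4)"
        unfolding sum_distrib_right[symmetric] by (rule mult_right_mono) (use wsum \<delta> in linarith)+
      moreover have "\<bar>1 - (\<Sum>t\<in>T. w t)\<bar> < \<delta> / 2" using wsum by simp
      moreover have "d < \<delta>" if "d \<le> a + b" "a \<le> 1 * e" "b \<le> c" "c \<le> 2 * (\<delta> / 4)" "e < \<delta> / 2"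
        for a b c d e :: real using that by linarith
      ultimately show "cmod (\<phi> x - \<psi> x) < \<delta>" by blast
    qed
    from S.normalize_near[of \<psi> "M \<times> L" \<phi> \<epsilon> Q, OF pt\<psi> per one \<epsilon> Q(3) this[unfolded \<delta>_def]]
    obtain \<psi>' where \<psi>': "\<psi>' \<in> states_on S (M \<times> L)" "near Q \<epsilon> \<phi> \<psi>'" by blast
    have pt': "positive_type S \<psi>'" using \<psi>'(1) by (simp only: states_on_def states_def mem_Collect_eq)
    have "near Q0 \<epsilon> \<phi> \<psi>'"
      unfolding near_def
    proof
      fix x assume x: "x \<in> Q0"
      show "cmod (\<phi> x - \<psi>' x) < \<epsilon>"
      proof (cases "x \<in> carrier S")
        case True
        then have "x \<in> Q" using x by (simp add: Q_def del: S_simps)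
        then show ?thesis using \<psi>'(2) by (simp add: near_def)
      next
        case False
        then show ?thesis using \<epsilon> S.pt_outside[OF pt False] S.pt_outside[OF pt' False] by simp
      qed
    qed
    then show "\<exists>b\<in>\<Union>N\<in>fin_normal S. states_on S N. near Q0 \<epsilon> \<phi> b"
      using \<psi>'(1) product_fin_normal[OF M L] by blast
  qed
qed

end

section \<open>Property FD of semidirect products\<close>

theorem proposition4p5:
  fixes G :: "('g, 'c) monoid_scheme"
    and H :: "('h, 'b) monoid_scheme"
    and \<alpha> :: "'g \<Rightarrow> 'h \<Rightarrow> 'h"
  assumes "group G" and "amenable G" and "group H"
    and "\<alpha> \<in> hom G (AutoGroup H)"
  shows "property_FD (semidirect_product H G \<alpha>) \<longleftrightarrow>
    residually_finite G \<and>
    (\<forall>c\<in>unitary_dual H. c \<in> fell_topology H closure_of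
      {d \<in> finite_image_dual H. finite (orbit G (dual_action G H \<alpha>) d)})"
proof -
  interpret automorphism_action G H \<alpha>
    using assms by (intro automorphism_action.intro automorphism_action_axioms.intro)
  show ?thesis
    unfolding finite_orbit_dual_eq
    using FD_residually_finite FD_dual_dense FD_if_dual_dense[OF assms(2)] by blast
qed

end
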